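(* Let $k$ be a field, let $U\subset\mathbb{A}^1_k$ be an open subset and let $i\colon V\to U$ be the inclusion of a non-empty open subset. Then there is a morphism $r\in\mathbb{Z}F_1(U,V)$ such that $[i]\circ[r]=[\sigma_U]\in\overline{\mathbb{Z}F}_1(U,U)$.
   Context: Framed correspondences. For smooth $k$-schemes $X,Y$, an explicit framed correspondence of level $n$ from $X$ to $Y$ is a tuple $(Z,\mathcal V,\varphi,g)$: $Z\subset \mathbb{A}^n_X$ a closed subset finite over $X$; $v\colon\mathcal V\to\mathbb{A}^n_X$ an étale neighbourhood of $Z$ (étale, and an isomorphism over $Z$ with reduced structures); $\varphi=(\varphi_1,\dots,\varphi_n)$ regular functions on $\mathcal V$ whose common zero set is $v^{-1}(Z)$; $g\colon \mathcal V\to Y$ a morphism; two such are equivalent if they have the same $Z$ and agree after refining $\mathcal V$. $Fr_n(X,Y)$ is the set of classes; $\mathbb{Z}F_n(X,Y)$ is the free abelian group on it modulo $(Z\amalg Z',\mathcal V,\varphi,g)=(Z,\mathcal V- v^{-1}(Z'),\varphi,g)+(Z',\mathcal V- v^{-1}(Z),\varphi,g)$. Morphisms of schemes give elements of level $0$. Composition: $(Z',\mathcal V',\varphi',g')\circ(Z,\mathcal V,\varphi,g)=(Z\times_Y Z',\mathcal V\times_Y\mathcal V',(\varphi,\varphi'),g'\circ \mathrm{pr})$. $\overline{\mathbb{Z}F}_n(X,Y)=\operatorname{Coker}(\mathbb{Z}F_n(X\times\mathbb{A}^1,Y)\xrightarrow{i_0^*-i_1^*}\mathbb{Z}F_n(X,Y))$;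 $[a]$ is the class of $a$. $\sigma_X=(0\times X,\mathbb{A}^1_X,t,\mathrm{pr}_X)\in Fr_1(X,X)$. *)

theory Defs
  imports
    "HOL-Algebra.QuotRing"
    "HOL-Algebra.Generated_Groups"
    "HOL-Algebra.Free_Abelian_Groups"
    "HOL-Library.Poly_Mapping"
    "HOL-Analysis.Abstract_Topology"
begin

section \<open>Algebras over a field\<close>

text \<open>The base field is a type of class \<^class>\<open>field\<close>; a commutative algebra over it is a commutative
  ring together with a ring homomorphism from the field, the field \<open>scal\<close> of the record.\<close>

record ('a, 'k) kalg = "'a ring" +
  scal :: "'k \<Rightarrow> 'a"

definition kalgebra :: "('a, 'k::field) kalg \<Rightarrow> bool" where
  "kalgebra A \<longleftrightarrow> cring A \<and> range (scal A) \<subseteq> carrier A \<and> scal A 1 = \<one>\<^bsub>A\<^esub> \<and>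
     (\<forall>x y. scal A (x + y) = scal A x \<oplus>\<^bsub>A\<^esub> scal A y \<and> scal A (x * y) = scal A x \<otimes>\<^bsub>A\<^esub> scal A y)"

definition alg_hom :: "('a, 'k) kalg \<Rightarrow> ('b, 'k) kalg \<Rightarrow> ('a \<Rightarrow> 'b) set" where
  "alg_hom A B = {h \<in> ring_hom A B. \<forall>c. h (scal A c) = scal B c}"

definition quot :: "('a, 'k) kalg \<Rightarrow> 'a set \<Rightarrow> ('a set, 'k) kalg" where
  "quot A I = \<lparr>carrier = carrier (A Quot I), mult = mult (A Quot I), one = one (A Quot I),
     ring.zero = ring.zero (A Quot I), add = add (A Quot I), scal = (\<lambda>c. I +>\<^bsub>A\<^esub> scal A c)\<rparr>"

text \<open>\<open>frac A S a s\<close> is the fraction \<open>a/s\<close> in the localization of \<open>A\<close> at the multiplicative set \<open>S\<close>,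
  as an equivalence class of pairs.\<close>

definition frac :: "('a, 'k) kalg \<Rightarrow> 'a set \<Rightarrow> 'a \<Rightarrow> 'a \<Rightarrow> ('a \<times> 'a) set" where
  "frac A S a s =
     {(b, t). b \<in> carrier A \<and> t \<in> S \<and> (\<exists>u\<in>S. u \<otimes>\<^bsub>A\<^esub> (a \<otimes>\<^bsub>A\<^esub> t) = u \<otimes>\<^bsub>A\<^esub> (b \<otimes>\<^bsub>A\<^esub> s))}"

definition localization :: "('a, 'k) kalg \<Rightarrow> 'a set \<Rightarrow> (('a \<times> 'a) set, 'k) kalg" where
  "localization A S =
    \<lparr>carrier = {frac A S a s | a s. a \<in> carrier A \<and> s \<in> S},
     mult = (\<lambda>x y. \<Union>(a, s)\<in>x. \<Union>(b, t)\<in>y. frac A S (a \<otimes>\<^bsub>A\<^esub> b) (s \<otimes>\<^bsub>A\<^esub> t)),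
     one = frac A S \<one>\<^bsub>A\<^esub> \<one>\<^bsub>A\<^esub>,
     ring.zero = frac A S \<zero>\<^bsub>A\<^esub> \<one>\<^bsub>A\<^esub>,
     add = (\<lambda>x y. \<Union>(a, s)\<in>x. \<Union>(b, t)\<in>y.
              frac A S ((a \<otimes>\<^bsub>A\<^esub> t) \<oplus>\<^bsub>A\<^esub> (b \<otimes>\<^bsub>A\<^esub> s)) (s \<otimes>\<^bsub>A\<^esub> t)),
     scal = (\<lambda>c. frac A S (scal A c) \<one>\<^bsub>A\<^esub>)\<rparr>"

text \<open>Polynomials in the variables \<open>x\<^sub>0, x\<^sub>1, \<dots>\<close>: a monomial is a finitely supported exponent
  function.  \<open>polyring n\<close> is the polynomial ring in \<open>x\<^sub>0, \<dots>, x\<^sub>n\<^sub>-\<^sub>1\<close>.\<close>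

type_synonym 'k mpoly = "(nat \<Rightarrow>\<^sub>0 nat) \<Rightarrow>\<^sub>0 'k"

definition polyring :: "nat \<Rightarrow> ('k::field mpoly, 'k) kalg" where
  "polyring n = \<lparr>carrier = {p. \<forall>m \<in> Poly_Mapping.keys p. Poly_Mapping.keys m \<subseteq> {..<n}},
     mult = (*), one = 1, ring.zero = 0, add = (+), scal = Poly_Mapping.single 0\<rparr>"

definition fin_gen_alg :: "('a, 'k::field) kalg \<Rightarrow> bool" where
  "fin_gen_alg A \<longleftrightarrow> kalgebra A \<and>
     (\<exists>n. \<exists>h \<in> alg_hom (polyring n) A. h ` carrier (polyring n) = carrier A)"

definition finite_hom :: "('b, 'k) kalg \<Rightarrow> ('a, 'k) kalg \<Rightarrow> ('b \<Rightarrow> 'a) \<Rightarrow> bool" where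
  "finite_hom B A h \<longleftrightarrow> h \<in> alg_hom B A \<and>
     (\<exists>S. finite S \<and> S \<subseteq> carrier A \<and>
       (\<forall>a \<in> carrier A. \<exists>c \<in> S \<rightarrow> carrier B. a = (\<Oplus>\<^bsub>A\<^esub>s\<in>S. h (c s) \<otimes>\<^bsub>A\<^esub> s)))"


section \<open>Locally ringed spaces over a field\<close>

text \<open>A sheaf of algebras is given through its stalks: a section over an open set \<open>W\<close> is an extensional
  function assigning to each point of \<open>W\<close> an element of the stalk (its germ) at that point.  The axioms
  in \<open>locally_ringed\<close> say that these functions form a sheaf of algebras whose stalks are the given
  ones (every stalk element is a germ, and sections with equal germs agree nearby).  Any sheaf is of
  this form up to isomorphism.\<close>

record ('p, 'a, 'k) lrs =
  tspace :: "'p topology"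
  stalk :: "'p \<Rightarrow> ('a, 'k) kalg"
  sections :: "'p set \<Rightarrow> ('p \<Rightarrow> 'a) set"

abbreviation pts :: "('p, 'a, 'k) lrs \<Rightarrow> 'p set" where
  "pts X \<equiv> topspace (tspace X)"

abbreviation global :: "('p, 'a, 'k) lrs \<Rightarrow> ('p \<Rightarrow> 'a) set" where
  "global X \<equiv> sections X (pts X)"

definition local_ring :: "('a, 'k) kalg \<Rightarrow> bool" where
  "local_ring A \<longleftrightarrow> cring A \<and> (\<exists>!M. maximalideal M A)"

definition locally_ringed :: "('p, 'a, 'k::field) lrs \<Rightarrow> bool" where
  "locally_ringed X \<longleftrightarrow>
    (\<forall>p \<in> pts X. kalgebra (stalk X p) \<and> local_ring (stalk X p)) \<and>
    (\<forall>W. openin (tspace X) W \<longrightarrow>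
       sections X W \<subseteq> (\<Pi>\<^sub>E p\<in>W. carrier (stalk X p)) \<and>
       (\<forall>c. (\<lambda>p\<in>W. scal (stalk X p) c) \<in> sections X W) \<and>
       (\<forall>s \<in> sections X W. \<forall>t \<in> sections X W.
          (\<lambda>p\<in>W. s p \<ominus>\<^bsub>stalk X p\<^esub> t p) \<in> sections X W \<and>
          (\<lambda>p\<in>W. s p \<otimes>\<^bsub>stalk X p\<^esub> t p) \<in> sections X W) \<and>
       (\<forall>s \<in> sections X W. \<forall>W'. openin (tspace X) W' \<and> W' \<subseteq> W \<longrightarrow> restrict s W' \<in> sections X W') \<and>
       (\<forall>s \<in> (\<Pi>\<^sub>E p\<in>W. carrier (stalk X p)).
          (\<forall>p\<in>W. \<exists>W'. openin (tspace X) W' \<and> p \<in> W' \<and> W' \<subseteq> W \<and> restrict s W' \<in> sections X W')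
          \<longrightarrow> s \<in> sections X W) \<and>
       (\<forall>s \<in> sections X W. \<forall>t \<in> sections X W. \<forall>p\<in>W. s p = t p \<longrightarrow>
          (\<exists>W'. openin (tspace X) W' \<and> p \<in> W' \<and> W' \<subseteq> W \<and> restrict s W' = restrict t W'))) \<and>
    (\<forall>p \<in> pts X. \<forall>a \<in> carrier (stalk X p).
       \<exists>W s. openin (tspace X) W \<and> p \<in> W \<and> s \<in> sections X W \<and> s p = a)"

definition open_sub :: "('p, 'a, 'k) lrs \<Rightarrow> 'p set \<Rightarrow> ('p, 'a, 'k) lrs" where
  "open_sub X W = X\<lparr>tspace := subtopology (tspace X) W\<rparr>"

text \<open>A morphism is a map of points together with the maps induced on stalks, both extensional, so that
  equality of morphisms is HOL equality.  \<open>pull X f W s\<close> is the pullback of the section \<open>s\<close> over \<open>W\<close>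
  along \<open>f\<close>, a section over the preimage of \<open>W\<close>.\<close>

type_synonym ('p, 'a, 'q, 'b) mor = "('p \<Rightarrow> 'q) \<times> ('p \<Rightarrow> 'b \<Rightarrow> 'a)"

definition preim :: "('p, 'a, 'k) lrs \<Rightarrow> ('p, 'a, 'q, 'b) mor \<Rightarrow> 'q set \<Rightarrow> 'p set" where
  "preim X f W = {p \<in> pts X. fst f p \<in> W}"

definition pull :: "('p, 'a, 'k) lrs \<Rightarrow> ('p, 'a, 'q, 'b) mor \<Rightarrow> 'q set \<Rightarrow> ('q \<Rightarrow> 'b) \<Rightarrow> 'p \<Rightarrow> 'a" where
  "pull X f W s = (\<lambda>p \<in> preim X f W. snd f p (s (fst f p)))"

definition morphism :: "('p, 'a, 'k::field) lrs \<Rightarrow> ('q, 'b, 'k) lrs \<Rightarrow> ('p, 'a, 'q, 'b) mor \<Rightarrow> bool" where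
  "morphism X Y f \<longleftrightarrow>
     fst f \<in> extensional (pts X) \<and> snd f \<in> extensional (pts X) \<and>
     continuous_map (tspace X) (tspace Y) (fst f) \<and>
     (\<forall>p \<in> pts X. snd f p \<in> extensional (carrier (stalk Y (fst f p))) \<and>
        snd f p \<in> alg_hom (stalk Y (fst f p)) (stalk X p) \<and>
        (\<forall>a \<in> carrier (stalk Y (fst f p)).
           snd f p a \<in> Units (stalk X p) \<longrightarrow> a \<in> Units (stalk Y (fst f p)))) \<and>
     (\<forall>W. openin (tspace Y) W \<longrightarrow> (\<forall>s \<in> sections Y W. pull X f W s \<in> sections X (preim X f W)))"

definition id_mor :: "('p, 'a, 'k) lrs \<Rightarrow> ('p, 'a, 'p, 'a) mor" where
  "id_mor X = (\<lambda>p \<in> pts X. p, \<lambda>p \<in> pts X. \<lambda>a \<in> carrier (stalk X p). a)"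

text \<open>\<open>mcomp X Z g f\<close> is \<open>g\<close> after \<open>f\<close> with source \<open>X\<close> and target \<open>Z\<close>; as \<open>X\<close> may also be an open
  subspace of the source of \<open>f\<close>, it subsumes restriction.\<close>

definition mcomp :: "('p, 'a, 'k) lrs \<Rightarrow> ('r, 'c, 'k) lrs \<Rightarrow> ('q, 'b, 'r, 'c) mor \<Rightarrow> ('p, 'a, 'q, 'b) mor
    \<Rightarrow> ('p, 'a, 'r, 'c) mor" where
  "mcomp X Z g f =
     (\<lambda>p \<in> pts X. fst g (fst f p),
      \<lambda>p \<in> pts X. \<lambda>a \<in> carrier (stalk Z (fst g (fst f p))). snd f p (snd g (fst f p) a))"

definition isomorphism :: "('p, 'a, 'k::field) lrs \<Rightarrow> ('q, 'b, 'k) lrs \<Rightarrow> ('p, 'a, 'q, 'b) mor \<Rightarrow> bool" where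
  "isomorphism X Y f \<longleftrightarrow> morphism X Y f \<and>
     (\<exists>g. morphism Y X g \<and> mcomp X X g f = id_mor X \<and> mcomp Y Y f g = id_mor Y)"

text \<open>Vanishing of a section at \<open>p\<close> (zero value in the residue field) means that its germ is a
  non-unit of the local ring at \<open>p\<close>.\<close>

definition vanishes :: "('p, 'a, 'k) lrs \<Rightarrow> ('p \<Rightarrow> 'a) \<Rightarrow> 'p \<Rightarrow> bool" where
  "vanishes X s p \<longleftrightarrow> s p \<notin> Units (stalk X p)"

definition const_fun :: "('p, 'a, 'k) lrs \<Rightarrow> 'k \<Rightarrow> 'p \<Rightarrow> 'a" where
  "const_fun X c = (\<lambda>p \<in> pts X. scal (stalk X p) c)"

text \<open>The reduced closed subspace on a closed set \<open>Z\<close>: the stalks are divided by the ideal of germs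
  vanishing on \<open>Z\<close> near the point, and sections are locally induced by sections of \<open>X\<close>.\<close>

definition van_ideal :: "('p, 'a, 'k) lrs \<Rightarrow> 'p set \<Rightarrow> 'p \<Rightarrow> 'a set" where
  "van_ideal X Z p = {a \<in> carrier (stalk X p). \<exists>W s. openin (tspace X) W \<and> p \<in> W \<and>
      s \<in> sections X W \<and> s p = a \<and> (\<forall>q \<in> W \<inter> Z. vanishes X s q)}"

definition reduced_sub :: "('p, 'a, 'k) lrs \<Rightarrow> 'p set \<Rightarrow> ('p, 'a set, 'k) lrs" where
  "reduced_sub X Z =
    \<lparr>tspace = subtopology (tspace X) Z,
     stalk = (\<lambda>p. quot (stalk X p) (van_ideal X Z p)),
     sections = (\<lambda>W. {s \<in> (\<Pi>\<^sub>E p\<in>W. carrier (quot (stalk X p) (van_ideal X Z p))).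
        \<forall>p\<in>W. \<exists>W' t. openin (tspace X) W' \<and> p \<in> W' \<and> W' \<inter> Z \<subseteq> W \<and> t \<in> sections X W' \<and>
          (\<forall>q \<in> W' \<inter> Z. s q = van_ideal X Z q +>\<^bsub>stalk X q\<^esub> t q)})\<rparr>"

definition reduced_incl :: "('p, 'a, 'k) lrs \<Rightarrow> 'p set \<Rightarrow> ('p, 'a set, 'p, 'a) mor" where
  "reduced_incl X Z =
     (\<lambda>p\<in>Z. p, \<lambda>p\<in>Z. \<lambda>a \<in> carrier (stalk X p). van_ideal X Z p +>\<^bsub>stalk X p\<^esub> a)"


section \<open>Schemes\<close>

definition zariski :: "('a, 'k) kalg \<Rightarrow> 'a set topology" where
  "zariski A = topology (\<lambda>W. \<exists>E \<subseteq> carrier A. W = {P. primeideal P A \<and> \<not> E \<subseteq> P})"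

definition stalk_at :: "('a, 'k) kalg \<Rightarrow> 'a set \<Rightarrow> (('a \<times> 'a) set, 'k) kalg" where
  "stalk_at A P = localization A (carrier A - P)"

definition Spec :: "('a, 'k) kalg \<Rightarrow> ('a set, ('a \<times> 'a) set, 'k) lrs" where
  "Spec A =
    \<lparr>tspace = zariski A,
     stalk = stalk_at A,
     sections = (\<lambda>W. {s \<in> (\<Pi>\<^sub>E P\<in>W. carrier (stalk_at A P)).
        \<forall>P\<in>W. \<exists>D a f. openin (zariski A) D \<and> P \<in> D \<and> D \<subseteq> W \<and> a \<in> carrier A \<and> f \<in> carrier A \<and>
          (\<forall>Q\<in>D. f \<notin> Q \<and> s Q = frac A (carrier A - Q) a f)})\<rparr>"

text \<open>\<open>Spec_map A B h : Spec B \<rightarrow> Spec A\<close>, for \<open>h : A \<rightarrow> B\<close>.\<close>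

definition Spec_map :: "('a, 'k) kalg \<Rightarrow> ('b, 'k) kalg \<Rightarrow> ('a \<Rightarrow> 'b)
    \<Rightarrow> ('b set, ('b \<times> 'b) set, 'a set, ('a \<times> 'a) set) mor" where
  "Spec_map A B h =
     (\<lambda>Q \<in> pts (Spec B). {a \<in> carrier A. h a \<in> Q},
      \<lambda>Q \<in> pts (Spec B). \<lambda>x \<in> carrier (stalk_at A {a \<in> carrier A. h a \<in> Q}).
         \<Union>(a, s)\<in>x. frac B (carrier B - Q) (h a) (h s))"

text \<open>All schemes are locally of finite type over the base field.  The finitely generated algebras
  describing affine charts may be taken on the type \<^typ>\<open>'k mpoly set\<close>, since every such algebra is
  isomorphic to a quotient \<open>polyring n Quot J\<close>.\<close>

definition kscheme :: "('p, 'a, 'k::field) lrs \<Rightarrow> bool" where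
  "kscheme X \<longleftrightarrow> locally_ringed X \<and>
     (\<forall>p \<in> pts X. \<exists>W (A :: ('k mpoly set, 'k) kalg) f.
        openin (tspace X) W \<and> p \<in> W \<and> fin_gen_alg A \<and> isomorphism (open_sub X W) (Spec A) f)"

text \<open>The types of \<^term>\<open>Spec (polyring n)\<close>.  By cardinality, every scheme of finite type over the field
  is isomorphic to one of type \<open>'k sch\<close>; as etale neighbourhoods of a support can be refined to
  quasi-compact ones, classes of framed correspondences lose nothing by this restriction.\<close>

type_synonym 'k sch = "('k mpoly set, ('k mpoly \<times> 'k mpoly) set, 'k) lrs"
type_synonym 'k smor =
  "('k mpoly set, ('k mpoly \<times> 'k mpoly) set, 'k mpoly set, ('k mpoly \<times> 'k mpoly) set) mor"
type_synonym 'k sfun = "'k mpoly set \<Rightarrow> ('k mpoly \<times> 'k mpoly) set"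

definition affine_line :: "'k::field sch" where
  "affine_line = Spec (polyring 1)"

definition finite_mor :: "('p, 'a, 'k::field) lrs \<Rightarrow> ('q, 'b, 'k) lrs \<Rightarrow> ('p, 'a, 'q, 'b) mor \<Rightarrow> bool" where
  "finite_mor X Y f \<longleftrightarrow> morphism X Y f \<and>
     (\<forall>q \<in> pts Y. \<exists>W (A :: ('k mpoly set, 'k) kalg) (B :: ('k mpoly set, 'k) kalg) h \<alpha> \<beta>.
        openin (tspace Y) W \<and> q \<in> W \<and> kalgebra A \<and> kalgebra B \<and> finite_hom B A h \<and>
        isomorphism (open_sub X (preim X f W)) (Spec A) \<alpha> \<and>
        isomorphism (open_sub Y W) (Spec B) \<beta> \<and>
        mcomp (open_sub X (preim X f W)) (Spec B) \<beta> f =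
        mcomp (open_sub X (preim X f W)) (Spec B) (Spec_map B A h) \<alpha>)"

text \<open>Etale morphisms, following EGA IV 17.3.1: formally etale (unique lifting along square-zero
  thickenings of affine schemes) and locally of finite presentation; the latter is automatic between
  schemes locally of finite type over a field.  For such schemes it is enough to test on thickenings
  of affine schemes of finite type, so the fixed type of test algebras is no restriction.\<close>

definition etale :: "('p, 'a, 'k::field) lrs \<Rightarrow> ('q, 'b, 'k) lrs \<Rightarrow> ('p, 'a, 'q, 'b) mor \<Rightarrow> bool" where
  "etale X Y f \<longleftrightarrow> kscheme X \<and> kscheme Y \<and> morphism X Y f \<and>
     (\<forall>(A :: ('k mpoly set, 'k) kalg) I u0 w.
        kalgebra A \<and> ideal I A \<and> (\<forall>a\<in>I. \<forall>b\<in>I. a \<otimes>\<^bsub>A\<^esub> b = \<zero>\<^bsub>A\<^esub>) \<and>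
        morphism (Spec (quot A I)) X u0 \<and> morphism (Spec A) Y w \<and>
        mcomp (Spec (quot A I)) Y f u0 =
        mcomp (Spec (quot A I)) Y w (Spec_map A (quot A I) (\<lambda>a. I +>\<^bsub>A\<^esub> a)) \<longrightarrow>
        (\<exists>!u. morphism (Spec A) X u \<and>
           mcomp (Spec (quot A I)) X u (Spec_map A (quot A I) (\<lambda>a. I +>\<^bsub>A\<^esub> a)) = u0 \<and>
           mcomp (Spec A) Y f u = w))"

definition is_pullback :: "'k::field sch \<Rightarrow> 'k sch \<Rightarrow> 'k sch \<Rightarrow> 'k smor \<Rightarrow> 'k smor
    \<Rightarrow> 'k sch \<Rightarrow> 'k smor \<Rightarrow> 'k smor \<Rightarrow> bool" where
  "is_pullback A B Y f g W p1 p2 \<longleftrightarrow>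
     kscheme W \<and> morphism W A p1 \<and> morphism W B p2 \<and> mcomp W Y f p1 = mcomp W Y g p2 \<and>
     (\<forall>(T :: 'k sch) a b. kscheme T \<and> morphism T A a \<and> morphism T B b \<and> mcomp T Y f a = mcomp T Y g b \<longrightarrow>
        (\<exists>!m. morphism T W m \<and> mcomp T A p1 m = a \<and> mcomp T B p2 m = b))"

text \<open>\<open>P\<close>, with projection \<open>\<pi>\<close> to \<open>X\<close> and coordinate functions \<open>c\<close>, is the affine space over \<open>X\<close> of
  relative dimension \<open>length c\<close>: it represents pairs of a morphism to \<open>X\<close> and a list of functions.\<close>

definition is_affine_space :: "'k::field sch \<Rightarrow> 'k sch \<Rightarrow> 'k smor \<Rightarrow> 'k sfun list \<Rightarrow> bool" where
  "is_affine_space X P \<pi> c \<longleftrightarrow>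
     kscheme P \<and> morphism P X \<pi> \<and> set c \<subseteq> global P \<and>
     (\<forall>(T :: 'k sch) h s. kscheme T \<and> morphism T X h \<and> set s \<subseteq> global T \<and> length s = length c \<longrightarrow>
        (\<exists>!m. morphism T P m \<and> mcomp T X \<pi> m = h \<and> map (pull T m (pts P)) c = s))"

text \<open>\<open>j\<close> is the section \<open>X \<rightarrow> X \<times> \<A>\<^sup>1\<close> with constant coordinate \<open>a\<close>.\<close>

definition is_const_section ::
    "'k::field sch \<Rightarrow> 'k sch \<Rightarrow> 'k smor \<Rightarrow> 'k sfun \<Rightarrow> 'k \<Rightarrow> 'k smor \<Rightarrow> bool" where
  "is_const_section X P \<pi> c a j \<longleftrightarrow>
     morphism X P j \<and> mcomp X X \<pi> j = id_mor X \<and> pull X j (pts P) c = const_fun X a"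


section \<open>Framed correspondences\<close>

text \<open>An explicit framed correspondence carries its own model of the affine space over the source
  (\<open>aff\<close>, \<open>aproj\<close>, \<open>acoord\<close>); then \<open>supp\<close> is \<open>Z\<close>, \<open>nbhd\<close> and \<open>emap\<close> are the etale neighbourhood and its
  map to the affine space, \<open>fram\<close> is the list \<open>\<phi>\<close> and \<open>targ\<close> is \<open>g\<close>.\<close>

record (overloaded) ('k::field) fcorr =
  aff :: "'k sch"
  aproj :: "'k smor"
  acoord :: "'k sfun list"
  supp :: "'k mpoly set set"
  nbhd :: "'k sch"
  emap :: "'k smor"
  fram :: "'k sfun list"
  targ :: "'k smor"

definition etale_nbhd :: "'k::field sch \<Rightarrow> 'k smor \<Rightarrow> 'k sch \<Rightarrow> 'k mpoly set set \<Rightarrow> bool" where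
  "etale_nbhd V v P Z \<longleftrightarrow> etale V P v \<and>
     (\<exists>u. isomorphism (reduced_sub V (preim V v Z)) (reduced_sub P Z) u \<and>
        mcomp (reduced_sub V (preim V v Z)) P (reduced_incl P Z) u =
        mcomp (reduced_sub V (preim V v Z)) P v (reduced_incl V (preim V v Z)))"

definition explicit_corr :: "nat \<Rightarrow> 'k::field sch \<Rightarrow> 'k sch \<Rightarrow> 'k fcorr \<Rightarrow> bool" where
  "explicit_corr n X Y t \<longleftrightarrow>
     length (acoord t) = n \<and> is_affine_space X (aff t) (aproj t) (acoord t) \<and>
     closedin (tspace (aff t)) (supp t) \<and>
     finite_mor (reduced_sub (aff t) (supp t)) X
       (mcomp (reduced_sub (aff t) (supp t)) X (aproj t) (reduced_incl (aff t) (supp t))) \<and>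
     etale_nbhd (nbhd t) (emap t) (aff t) (supp t) \<and>
     length (fram t) = n \<and> set (fram t) \<subseteq> global (nbhd t) \<and>
     {w \<in> pts (nbhd t). \<forall>\<phi> \<in> set (fram t). vanishes (nbhd t) \<phi> w} = preim (nbhd t) (emap t) (supp t) \<and>
     morphism (nbhd t) Y (targ t)"

text \<open>\<open>t'\<close> is obtained from \<open>t\<close> by refining the etale neighbourhood along \<open>f\<close>; \<open>\<theta>\<close> is the canonical
  isomorphism between the two models of the affine space.  Refinements generate the equivalence of
  explicit correspondences.\<close>

definition refines :: "'k::field sch \<Rightarrow> 'k sch \<Rightarrow> 'k fcorr \<Rightarrow> 'k fcorr \<Rightarrow> bool" where
  "refines X Y t' t \<longleftrightarrow> (\<exists>\<theta> f.
     isomorphism (aff t') (aff t) \<theta> \<and> mcomp (aff t') X (aproj t) \<theta> = aproj t' \<and>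
     map (pull (aff t') \<theta> (pts (aff t))) (acoord t) = acoord t' \<and>
     fst \<theta> ` supp t' = supp t \<and>
     morphism (nbhd t') (nbhd t) f \<and>
     mcomp (nbhd t') (aff t) (emap t) f = mcomp (nbhd t') (aff t) \<theta> (emap t') \<and>
     fram t' = map (pull (nbhd t') f (pts (nbhd t))) (fram t) \<and>
     targ t' = mcomp (nbhd t') Y (targ t) f)"

definition fr_equiv :: "nat \<Rightarrow> 'k::field sch \<Rightarrow> 'k sch \<Rightarrow> ('k fcorr \<times> 'k fcorr) set" where
  "fr_equiv n X Y =
     (let R = {(t', t). explicit_corr n X Y t' \<and> explicit_corr n X Y t \<and> refines X Y t' t}
      in (R \<union> R\<inverse>)\<^sup>*)"

definition fr_class :: "nat \<Rightarrow> 'k::field sch \<Rightarrow> 'k sch \<Rightarrow> 'k fcorr \<Rightarrow> 'k fcorr set" where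
  "fr_class n X Y t = fr_equiv n X Y `` {t}"

definition Fr :: "nat \<Rightarrow> 'k::field sch \<Rightarrow> 'k sch \<Rightarrow> 'k fcorr set set" where
  "Fr n X Y = fr_class n X Y ` {t. explicit_corr n X Y t}"

text \<open>A morphism of schemes as an element of level 0 (with \<open>X\<close> as affine space of dimension 0 over
  itself), and \<open>\<sigma>\<close>; the set \<open>0 \<times> X\<close> is the image of the zero section.\<close>

definition graph_corr :: "'k::field sch \<Rightarrow> 'k smor \<Rightarrow> 'k fcorr" where
  "graph_corr X f = \<lparr>aff = X, aproj = id_mor X, acoord = [], supp = pts X,
     nbhd = X, emap = id_mor X, fram = [], targ = f\<rparr>"

definition is_sigma :: "'k::field sch \<Rightarrow> 'k fcorr \<Rightarrow> bool" where
  "is_sigma X s \<longleftrightarrow> (\<exists>P \<pi> c z. is_affine_space X P \<pi> [c] \<and> is_const_section X P \<pi> c 0 z \<and>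
     s = \<lparr>aff = P, aproj = \<pi>, acoord = [c], supp = fst z ` pts X,
          nbhd = P, emap = id_mor P, fram = [c], targ = \<pi>\<rparr>)"

definition sigma :: "'k::field sch \<Rightarrow> 'k fcorr set" where
  "sigma X = fr_class 1 X X (SOME s. is_sigma X s)"

text \<open>\<open>t''\<close> is a composite of \<open>t : X \<rightarrow> Y\<close> followed by \<open>t' : Y \<rightarrow> W\<close>.  Its neighbourhood is the fibre
  product over \<open>Y\<close> of the two neighbourhoods, and its support is \<open>Z \<times>\<^sub>Y Z'\<close>, embedded in the affine space
  over \<open>X\<close> through this fibre product.\<close>

definition is_composite :: "'k::field sch \<Rightarrow> 'k sch \<Rightarrow> 'k sch
    \<Rightarrow> 'k fcorr \<Rightarrow> 'k fcorr \<Rightarrow> 'k fcorr \<Rightarrow> bool" where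
  "is_composite X Y W t' t t'' \<longleftrightarrow> (\<exists>p1 p2.
     (let V = nbhd t; V' = nbhd t'; N = nbhd t'' in
       is_pullback V V' Y (targ t) (mcomp V' Y (aproj t') (emap t')) N p1 p2 \<and>
       mcomp N X (aproj t'') (emap t'') = mcomp N X (mcomp V X (aproj t) (emap t)) p1 \<and>
       map (pull N (emap t'') (pts (aff t''))) (acoord t'') =
         map (pull N p1 (pts V) \<circ> pull V (emap t) (pts (aff t))) (acoord t) @
         map (pull N p2 (pts V') \<circ> pull V' (emap t') (pts (aff t'))) (acoord t') \<and>
       supp t'' = fst (emap t'') `
         (preim N p1 (preim V (emap t) (supp t)) \<inter> preim N p2 (preim V' (emap t') (supp t'))) \<and>
       fram t'' = map (pull N p1 (pts V)) (fram t) @ map (pull N p2 (pts V')) (fram t') \<and>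
       targ t'' = mcomp N W (targ t') p2))"

text \<open>Composition of classes, as a relation: \<open>e = b \<circ> a\<close>.  The composite does not depend on the choice
  of representatives, of the fibre product and of the affine space, so the relation is functional.\<close>

definition fr_comp :: "nat \<Rightarrow> nat \<Rightarrow> 'k::field sch \<Rightarrow> 'k sch \<Rightarrow> 'k sch
    \<Rightarrow> 'k fcorr set \<Rightarrow> 'k fcorr set \<Rightarrow> 'k fcorr set \<Rightarrow> bool" where
  "fr_comp m n X Y W b a e \<longleftrightarrow>
     (\<exists>t' t t''. explicit_corr m Y W t' \<and> explicit_corr n X Y t \<and> explicit_corr (n + m) X W t'' \<and>
        b = fr_class m Y W t' \<and> a = fr_class n X Y t \<and> e = fr_class (n + m) X W t'' \<and>
        is_composite X Y W t' t t'')"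


section \<open>Linear framed correspondences\<close>

definition cut_support :: "'k::field sch \<Rightarrow> 'k fcorr \<Rightarrow> 'k mpoly set set \<Rightarrow> 'k mpoly set set \<Rightarrow> 'k fcorr" where
  "cut_support Y t Z Z' =
     (let V = open_sub (nbhd t) (pts (nbhd t) - preim (nbhd t) (emap t) Z')
      in t\<lparr>supp := Z, nbhd := V, emap := mcomp V (aff t) (emap t) (id_mor V),
           fram := map (\<lambda>\<phi>. restrict \<phi> (pts V)) (fram t), targ := mcomp V Y (targ t) (id_mor V)\<rparr>)"

definition additivity_rel :: "nat \<Rightarrow> 'k::field sch \<Rightarrow> 'k sch \<Rightarrow> ('k fcorr set \<Rightarrow>\<^sub>0 int) set" where
  "additivity_rel n X Y =
     {frag_of (fr_class n X Y t) - frag_of (fr_class n X Y (cut_support Y t Z Z'))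
        - frag_of (fr_class n X Y (cut_support Y t Z' Z)) | t Z Z'.
      explicit_corr n X Y t \<and> explicit_corr n X Y (cut_support Y t Z Z') \<and>
      explicit_corr n X Y (cut_support Y t Z' Z) \<and>
      closedin (tspace (aff t)) Z \<and> closedin (tspace (aff t)) Z' \<and> Z \<inter> Z' = {} \<and> supp t = Z \<union> Z'}"

definition ZF_rel :: "nat \<Rightarrow> 'k::field sch \<Rightarrow> 'k sch \<Rightarrow> ('k fcorr set \<Rightarrow>\<^sub>0 int) set" where
  "ZF_rel n X Y = generate (free_Abelian_group (Fr n X Y)) (additivity_rel n X Y)"

definition ZF :: "nat \<Rightarrow> 'k::field sch \<Rightarrow> 'k sch \<Rightarrow> ('k fcorr set \<Rightarrow>\<^sub>0 int) set monoid" where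
  "ZF n X Y = free_Abelian_group (Fr n X Y) Mod ZF_rel n X Y"

definition zf_class :: "nat \<Rightarrow> 'k::field sch \<Rightarrow> 'k sch \<Rightarrow> ('k fcorr set \<Rightarrow>\<^sub>0 int)
    \<Rightarrow> ('k fcorr set \<Rightarrow>\<^sub>0 int) set" where
  "zf_class n X Y x = ZF_rel n X Y #>\<^bsub>free_Abelian_group (Fr n X Y)\<^esub> x"

definition zf_morphism :: "'k::field sch \<Rightarrow> 'k sch \<Rightarrow> 'k smor \<Rightarrow> ('k fcorr set \<Rightarrow>\<^sub>0 int) set" where
  "zf_morphism X Y f = zf_class 0 X Y (frag_of (fr_class 0 X Y (graph_corr X f)))"

definition zf_sigma :: "'k::field sch \<Rightarrow> ('k fcorr set \<Rightarrow>\<^sub>0 int) set" where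
  "zf_sigma X = zf_class 1 X X (frag_of (sigma X))"

text \<open>The bilinear extension of composition, as a relation \<open>\<epsilon> = \<beta> \<circ> \<alpha>\<close>: if \<open>\<beta>\<close> is represented by
  \<open>\<Sum> y\<^sub>b b\<close> and \<open>\<alpha>\<close> by \<open>\<Sum> x\<^sub>a a\<close>, then \<open>\<epsilon>\<close> is represented by \<open>\<Sum> y\<^sub>b x\<^sub>a (b \<circ> a)\<close>.\<close>

definition zf_comp :: "nat \<Rightarrow> nat \<Rightarrow> 'k::field sch \<Rightarrow> 'k sch \<Rightarrow> 'k sch
    \<Rightarrow> ('k fcorr set \<Rightarrow>\<^sub>0 int) set \<Rightarrow> ('k fcorr set \<Rightarrow>\<^sub>0 int) set
    \<Rightarrow> ('k fcorr set \<Rightarrow>\<^sub>0 int) set \<Rightarrow> bool" where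
  "zf_comp m n X Y W \<beta> \<alpha> \<epsilon> \<longleftrightarrow> (\<exists>y x E.
     y \<in> carrier (free_Abelian_group (Fr m Y W)) \<and> \<beta> = zf_class m Y W y \<and>
     x \<in> carrier (free_Abelian_group (Fr n X Y)) \<and> \<alpha> = zf_class n X Y x \<and>
     (\<forall>b \<in> Poly_Mapping.keys y. \<forall>a \<in> Poly_Mapping.keys x. fr_comp m n X Y W b a (E b a)) \<and>
     \<epsilon> = zf_class (n + m) X W (frag_extend (\<lambda>b. frag_extend (\<lambda>a. frag_of (E b a)) x) y))"

text \<open>The image of \<open>i\<^sub>0\<^sup>* - i\<^sub>1\<^sup>*\<close>, where pullback along \<open>i\<^sub>0\<close> and \<open>i\<^sub>1\<close> is composition with these morphisms;
  \<open>Q\<close> runs over the (canonically isomorphic) models of \<open>X \<times> \<A>\<^sup>1\<close>.\<close>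

definition homotopy_rel :: "nat \<Rightarrow> 'k::field sch \<Rightarrow> 'k sch \<Rightarrow> ('k fcorr set \<Rightarrow>\<^sub>0 int) set set" where
  "homotopy_rel n X Y = generate (ZF n X Y)
     {d0 \<otimes>\<^bsub>ZF n X Y\<^esub> inv\<^bsub>ZF n X Y\<^esub> d1 | d0 d1. \<exists>Q \<pi> c i0 i1 e.
        is_affine_space X Q \<pi> [c] \<and>
        is_const_section X Q \<pi> c 0 i0 \<and> is_const_section X Q \<pi> c 1 i1 \<and>
        e \<in> carrier (ZF n Q Y) \<and>
        zf_comp n 0 X Q Y e (zf_morphism X Q i0) d0 \<and>
        zf_comp n 0 X Q Y e (zf_morphism X Q i1) d1}"

definition ZFbar :: "nat \<Rightarrow> 'k::field sch \<Rightarrow> 'k sch \<Rightarrow> ('k fcorr set \<Rightarrow>\<^sub>0 int) set set monoid" where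
  "ZFbar n X Y = ZF n X Y Mod homotopy_rel n X Y"

definition zfbar_class :: "nat \<Rightarrow> 'k::field sch \<Rightarrow> 'k sch \<Rightarrow> ('k fcorr set \<Rightarrow>\<^sub>0 int) set
    \<Rightarrow> ('k fcorr set \<Rightarrow>\<^sub>0 int) set set" where
  "zfbar_class n X Y \<alpha> = homotopy_rel n X Y #>\<^bsub>ZF n X Y\<^esub> \<alpha>"

end

theory Submission
  imports Defs "HOL-Algebra.Ring_Divisibility" "HOL-Computational_Algebra.Polynomial"
begin

text \<open>Write \<open>U = D(f)\<close>, choose \<open>g\<close> coprime to \<open>f\<close> with \<open>D(f) \<inter> D(g) \<subseteq> V\<close>, and put \<open>y = x + t\<close>, where \<open>t\<close> is the
  coordinate of the relative affine line over \<open>U\<close>, and \<open>L = g (1 + y f)\<close>.  The function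
  \<open>h\<^sub>\<theta> = t\<^sup>2 L(y) + (t (1 - \<theta>) + \<theta>) f(y)\<close> has constant leading coefficient in \<open>t\<close>, so its zero set is finite over
  \<open>U \<times> \<A>\<^sup>1\<close>, and with target \<open>y\<close> it is a framed homotopy of correspondences from \<open>U\<close> to \<open>U\<close>.  The zeros of \<open>h\<^sub>1\<close> are
  mapped to \<open>V\<close>, whereas \<open>h\<^sub>0 = t (f(y) + t L(y))\<close> has two disjoint zero sets: that of the second factor is
  mapped to \<open>V\<close>, and near \<open>t = 0\<close> a linear homotopy connects \<open>(h\<^sub>0, y)\<close> with \<open>(t f(x), x)\<close>.  Framings are divided by
  the unit \<open>f(x)\<close>, which turns the last one into \<open>\<sigma>\<^sub>U\<close>.  Hence \<open>r\<close> is the difference of the class of \<open>h\<^sub>1\<close> and the class of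
  \<open>h\<^sub>0\<close> at the second zero set.\<close>

section \<open>Rings\<close>

text \<open>The shape of h_\<theta> answers several constraints at once. A zero of h_\<theta> with
  f(y) = 0 would have t = 0 or L(y) = 0; t = 0 means y = x, where f is invertible, and L is prime to
  f, so y maps all zeros into U. A zero of h_1, or of the cofactor K = f(y) + t L(y) of t in h_0,
  with g(y) = 0 would have L(y) = 0 and hence f(y) = 0, which has just been excluded; so these zeros
  are mapped into V. The square in t^2 L(y) makes K equal to the unit f(x) along t = 0: this
  separates the two zero sets of h_0 and lets t K be deformed linearly into t f(x) without further
  zeros near t = 0. The factor 1 + y f forces deg L > deg f, so that the terms containing \<theta>
  stay away from the leading coefficient. All spaces that carry correspondences are open subsets of
  affine spaces over the field; a correspondence is then a tuple of polynomials, and its restriction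
  to an end of a homotopy is a substitution for one variable.\<close>

lemma kalg_cring: "kalgebra A \<Longrightarrow> cring A"
  by (simp add: kalgebra_def)

lemma kalg_scal_closed: "kalgebra A \<Longrightarrow> scal A c \<in> carrier A"
  by (auto simp: kalgebra_def)

lemma kalg_scal_one: "kalgebra A \<Longrightarrow> scal A 1 = \<one>\<^bsub>A\<^esub>"
  and kalg_scal_add: "kalgebra A \<Longrightarrow> scal A (x + y) = scal A x \<oplus>\<^bsub>A\<^esub> scal A y"
  and kalg_scal_mult: "kalgebra A \<Longrightarrow> scal A (x * y) = scal A x \<otimes>\<^bsub>A\<^esub> scal A y"
  by (auto simp: kalgebra_def)

lemma kalg_scal_zero:
  assumes "kalgebra A" shows "scal A 0 = \<zero>\<^bsub>A\<^esub>"
proof -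
  interpret cring A by (rule kalg_cring[OF assms])
  have "scal A 0 \<oplus>\<^bsub>A\<^esub> scal A 0 = scal A 0"
    using kalg_scal_add[OF assms, of 0 0] by simp
  then show ?thesis
    using kalg_scal_closed[OF assms, of 0] by (metis add.r_cancel_one)
qed

lemma kalgebraI:
  assumes "cring A" "\<And>c. scal A c \<in> carrier A" "scal A 1 = \<one>\<^bsub>A\<^esub>"
    "\<And>x y. scal A (x + y) = scal A x \<oplus>\<^bsub>A\<^esub> scal A y" "\<And>x y. scal A (x * y) = scal A x \<otimes>\<^bsub>A\<^esub> scal A y"
  shows "kalgebra A"
  using assms by (auto simp: kalgebra_def)

lemma alg_homI:
  assumes "\<And>x. x \<in> carrier A \<Longrightarrow> h x \<in> carrier B"
    "\<And>x y. x \<in> carrier A \<Longrightarrow> y \<in> carrier A \<Longrightarrow> h (x \<otimes>\<^bsub>A\<^esub> y) = h x \<otimes>\<^bsub>B\<^esub> h y"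
    "\<And>x y. x \<in> carrier A \<Longrightarrow> y \<in> carrier A \<Longrightarrow> h (x \<oplus>\<^bsub>A\<^esub> y) = h x \<oplus>\<^bsub>B\<^esub> h y"
    "\<And>c. h (scal A c) = scal B c" "h \<one>\<^bsub>A\<^esub> = \<one>\<^bsub>B\<^esub>"
  shows "h \<in> alg_hom A B"
  using assms by (auto simp: alg_hom_def intro!: ring_hom_memI)

lemma alg_hom_closed: "h \<in> alg_hom A B \<Longrightarrow> x \<in> carrier A \<Longrightarrow> h x \<in> carrier B"
  and alg_hom_mult: "h \<in> alg_hom A B \<Longrightarrow> x \<in> carrier A \<Longrightarrow> y \<in> carrier A \<Longrightarrow> h (x \<otimes>\<^bsub>A\<^esub> y) = h x \<otimes>\<^bsub>B\<^esub> h y"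
  and alg_hom_add: "h \<in> alg_hom A B \<Longrightarrow> x \<in> carrier A \<Longrightarrow> y \<in> carrier A \<Longrightarrow> h (x \<oplus>\<^bsub>A\<^esub> y) = h x \<oplus>\<^bsub>B\<^esub> h y"
  and alg_hom_one: "h \<in> alg_hom A B \<Longrightarrow> h \<one>\<^bsub>A\<^esub> = \<one>\<^bsub>B\<^esub>"
  and alg_hom_scal: "h \<in> alg_hom A B \<Longrightarrow> h (scal A c) = scal B c"
  by (auto simp: alg_hom_def ring_hom_closed ring_hom_mult ring_hom_add ring_hom_one)

lemma alg_hom_ring_hom_cring:
  assumes "h \<in> alg_hom A B" "cring A" "cring B" shows "ring_hom_cring A B h"
  using assms by (simp add: alg_hom_def ring_hom_cring_def ring_hom_cring_axioms_def)

lemma alg_hom_zero: "h \<in> alg_hom A B \<Longrightarrow> cring A \<Longrightarrow> cring B \<Longrightarrow> h \<zero>\<^bsub>A\<^esub> = \<zero>\<^bsub>B\<^esub>"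
  using ring_hom_cring.hom_zero[OF alg_hom_ring_hom_cring] .

lemma alg_hom_minus:
  assumes "h \<in> alg_hom A B" "cring A" "cring B" "x \<in> carrier A" "y \<in> carrier A"
  shows "h (x \<ominus>\<^bsub>A\<^esub> y) = h x \<ominus>\<^bsub>B\<^esub> h y"
proof -
  interpret ring_hom_cring A B h by (rule alg_hom_ring_hom_cring[OF assms(1-3)])
  show ?thesis using assms by (simp add: a_minus_def)
qed

lemma alg_hom_Units:
  assumes "h \<in> alg_hom A B" "x \<in> Units A" shows "h x \<in> Units B"
proof -
  obtain y where y: "x \<in> carrier A" "y \<in> carrier A" "y \<otimes>\<^bsub>A\<^esub> x = \<one>\<^bsub>A\<^esub>" "x \<otimes>\<^bsub>A\<^esub> y = \<one>\<^bsub>A\<^esub>"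
    using assms(2) by (auto simp: Units_def)
  then have "h y \<otimes>\<^bsub>B\<^esub> h x = \<one>\<^bsub>B\<^esub>" "h x \<otimes>\<^bsub>B\<^esub> h y = \<one>\<^bsub>B\<^esub>"
    using alg_hom_mult[OF assms(1)] alg_hom_one[OF assms(1)] by metis+
  then show ?thesis
    using y alg_hom_closed[OF assms(1)] unfolding Units_def by blast
qed

lemma alg_hom_inv:
  assumes "h \<in> alg_hom A B" "cring A" "cring B" "x \<in> Units A"
  shows "h (inv\<^bsub>A\<^esub> x) = inv\<^bsub>B\<^esub> (h x)"
proof -
  interpret A: cring A by fact
  interpret B: cring B by fact
  have x: "x \<in> carrier A" "inv\<^bsub>A\<^esub> x \<in> carrier A" using assms by auto
  have "h x \<otimes>\<^bsub>B\<^esub> h (inv\<^bsub>A\<^esub> x) = \<one>\<^bsub>B\<^esub>"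
    using alg_hom_mult[OF assms(1) x] alg_hom_one[OF assms(1)] assms(4) by simp
  then show ?thesis
    using B.comm_inv_char alg_hom_closed[OF assms(1)] x by (metis)
qed

lemma alg_hom_comp: "g \<in> alg_hom B C \<Longrightarrow> f \<in> alg_hom A B \<Longrightarrow> (\<lambda>x. g (f x)) \<in> alg_hom A C"
  by (auto intro!: alg_homI simp: alg_hom_closed alg_hom_mult alg_hom_add alg_hom_one alg_hom_scal)

lemma alg_hom_cong:
  assumes "h \<in> alg_hom A B" "kalgebra A" "\<And>x. x \<in> carrier A \<Longrightarrow> h' x = h x" shows "h' \<in> alg_hom A B"
proof -
  interpret cring A using assms(2) by (rule kalg_cring)
  show ?thesis
    using assms(1) kalg_scal_closed[OF assms(2)]
    by (intro alg_homI) (simp_all add: assms(3) alg_hom_closed alg_hom_mult alg_hom_add alg_hom_one alg_hom_scal)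
qed

lemma (in cring) Units_mult_iff:
  assumes "a \<in> carrier R" "b \<in> carrier R"
  shows "a \<otimes> b \<in> Units R \<longleftrightarrow> a \<in> Units R \<and> b \<in> Units R"
proof
  assume u: "a \<otimes> b \<in> Units R"
  let ?c = "inv (a \<otimes> b)"
  have c: "?c \<in> carrier R" "(a \<otimes> b) \<otimes> ?c = \<one>" using u by auto
  have "a \<otimes> (b \<otimes> ?c) = \<one>" "b \<otimes> (a \<otimes> ?c) = \<one>"
    using c assms by (simp_all add: m_assoc m_lcomm)
  moreover have "(b \<otimes> ?c) \<otimes> a = \<one>" "(a \<otimes> ?c) \<otimes> b = \<one>"
    using calculation c assms by (simp_all add: m_comm)
  ultimately show "a \<in> Units R \<and> b \<in> Units R"
    using assms c unfolding Units_def by blast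
qed auto

text \<open>Both prime ideals avoiding a multiplicative set and maximal ideals arise from this by Zorn's lemma.\<close>

lemma (in cring) ideal_maximal_disjoint:
  assumes "ideal I R" "I \<inter> S = {}"
  shows "\<exists>M. ideal M R \<and> I \<subseteq> M \<and> M \<inter> S = {} \<and> (\<forall>J. ideal J R \<longrightarrow> M \<subseteq> J \<longrightarrow> J \<inter> S = {} \<longrightarrow> J = M)"
proof -
  let ?A = "{J. ideal J R \<and> I \<subseteq> J \<and> J \<inter> S = {}}"
  have "\<exists>M\<in>?A. \<forall>X\<in>?A. M \<subseteq> X \<longrightarrow> X = M"
  proof (rule subset_Zorn_nonempty)
    show "?A \<noteq> {}" using assms by blast
    fix C assume C: "C \<noteq> {}" "subset.chain ?A C"
    then have "subset.chain {J. ideal J R} C" by (auto simp: subset.chain_def)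
    from chain_Union_is_ideal[OF this] C show "\<Union>C \<in> ?A"
      by (auto simp: subset.chain_def)
  qed
  then obtain M where "M \<in> ?A" "\<forall>X\<in>?A. M \<subseteq> X \<longrightarrow> X = M" by auto
  then show ?thesis by (intro exI[of _ M]) auto
qed

lemma (in cring) ideal_insert:
  assumes "ideal M R" "a \<in> carrier R"
  obtains J where "ideal J R" "M \<subseteq> J" "a \<in> J" "\<And>x. x \<in> J \<Longrightarrow> \<exists>m\<in>M. \<exists>r\<in>carrier R. x = m \<oplus> r \<otimes> a"
proof
  interpret M: ideal M R by fact
  let ?J = "M <+>\<^bsub>R\<^esub> PIdl a"
  show "ideal ?J R" by (rule add_ideals[OF assms(1) cgenideal_ideal[OF assms(2)]])
  show "M \<subseteq> ?J"
  proof
    fix x assume "x \<in> M"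
    then have "x = x \<oplus> \<zero>" "x \<in> M" "\<zero> \<in> PIdl a"
      using M.Icarr assms by (auto simp: cgenideal_def intro!: exI[of _ \<zero>])
    then show "x \<in> ?J" unfolding set_add_def' by blast
  qed
  have "a = \<zero> \<oplus> a" "\<zero> \<in> M" "a \<in> PIdl a"
    using assms cgenideal_self M.zero_closed by auto
  then show "a \<in> ?J" unfolding set_add_def' by blast
  show "\<exists>m\<in>M. \<exists>r\<in>carrier R. x = m \<oplus> r \<otimes> a" if "x \<in> ?J" for x
    using that unfolding set_add_def' cgenideal_def by blast
qed

text \<open>An ideal \<open>M\<close> maximal among those disjoint from \<open>S\<close> is prime:
  for \<open>a\<close> and \<open>b\<close> outside \<open>M\<close> the set \<open>S\<close>
  contains some m + r a and m' + r' b, and their product lies in \<open>S\<close>, but also in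
  \<open>M\<close> if a b does. Applied to the powers of one element, this shows that an element of
  all prime ideals is nilpotent.\<close>

lemma (in cring) prime_avoiding:
  assumes "ideal I R" "I \<inter> S = {}" "S \<subseteq> carrier R" "\<one> \<in> S" "\<And>x y. x \<in> S \<Longrightarrow> y \<in> S \<Longrightarrow> x \<otimes> y \<in> S"
  shows "\<exists>P. primeideal P R \<and> I \<subseteq> P \<and> P \<inter> S = {}"
proof -
  obtain M where M: "ideal M R" "I \<subseteq> M" "M \<inter> S = {}"
    "\<And>J. ideal J R \<Longrightarrow> M \<subseteq> J \<Longrightarrow> J \<inter> S = {} \<Longrightarrow> J = M"
    using ideal_maximal_disjoint[OF assms(1,2)] by blast
  interpret M: ideal M R by fact
  have meet: "\<exists>m\<in>M. \<exists>r\<in>carrier R. m \<oplus> r \<otimes> a \<in> S" if "a \<in> carrier R" "a \<notin> M" for a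
    using ideal_insert[OF M(1) that(1)] M(4) that(2) by (metis disjoint_iff)
  have "primeideal M R"
  proof (rule primeidealI[OF M(1) is_cring])
    show "carrier R \<noteq> M" using M(3) assms(3,4) by auto
    fix a b assume ab: "a \<in> carrier R" "b \<in> carrier R" "a \<otimes> b \<in> M"
    show "a \<in> M \<or> b \<in> M"
    proof (rule ccontr)
      assume n: "\<not> (a \<in> M \<or> b \<in> M)"
      obtain m r where 1: "m \<in> M" "r \<in> carrier R" "m \<oplus> r \<otimes> a \<in> S" using meet[of a] ab n by blast
      obtain m' r' where 2: "m' \<in> M" "r' \<in> carrier R" "m' \<oplus> r' \<otimes> b \<in> S" using meet[of b] ab n by blast
      note c = 1(2) 2(2) ab(1,2) M.Icarr[OF 1(1)] M.Icarr[OF 2(1)]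
      have "(m \<oplus> r \<otimes> a) \<otimes> (m' \<oplus> r' \<otimes> b) = m \<otimes> (m' \<oplus> r' \<otimes> b) \<oplus> (r \<otimes> a) \<otimes> m' \<oplus> (r \<otimes> r') \<otimes> (a \<otimes> b)"
        using c by algebra
      also have "\<dots> \<in> M"
        using 1 2 c ab(3) M.I_r_closed M.I_l_closed by (intro M.a_closed) auto
      finally show False using assms(5)[OF 1(3) 2(3)] M(3) by auto
    qed
  qed
  then show ?thesis using M by blast
qed

lemma (in cring) nonunit_in_maximal:
  assumes "a \<in> carrier R" "a \<notin> Units R"
  shows "\<exists>M. maximalideal M R \<and> a \<in> M"
proof -
  have one: "\<one> \<notin> PIdl a"
  proof
    assume "\<one> \<in> PIdl a"
    then obtain x where "x \<in> carrier R" "\<one> = x \<otimes> a" by (auto simp: cgenideal_def)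
    then show False using assms m_comm unfolding Units_def by auto
  qed
  obtain M where M: "ideal M R" "PIdl a \<subseteq> M" "M \<inter> {\<one>} = {}"
    "\<And>J. ideal J R \<Longrightarrow> M \<subseteq> J \<Longrightarrow> J \<inter> {\<one>} = {} \<Longrightarrow> J = M"
    using ideal_maximal_disjoint[OF cgenideal_ideal[OF assms(1)], of "{\<one>}"] one by auto
  have "maximalideal M R"
  proof (rule maximalidealI[OF M(1)])
    show "carrier R \<noteq> M" using M(3) one_closed by blast
    fix J assume "ideal J R" "M \<subseteq> J" "J \<subseteq> carrier R"
    then show "J = M \<or> J = carrier R"
      using M(4)[of J] ideal.one_imp_carrier[of J] by blast
  qed
  then show ?thesis using M(2) cgenideal_self[OF assms(1)] by blast
qed

lemma (in cring) maximalideal_nonunit: "maximalideal M R \<Longrightarrow> a \<in> M \<Longrightarrow> a \<notin> Units R"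
proof
  assume M: "maximalideal M R" "a \<in> M" "a \<in> Units R"
  interpret M: maximalideal M R by fact
  have "inv a \<otimes> a \<in> M" using M(2,3) by (intro M.I_l_closed) auto
  then show False using M(3) M.one_imp_carrier M.I_notcarr by simp
qed

text \<open>Every non-unit lies in some maximal ideal, so a unique maximal ideal must consist of all
  non-units; conversely, once the non-units are closed under addition they form an ideal containing
  every proper ideal. In this form, locality of localizations and quotients is checked on
  elements.\<close>

lemma (in cring) unique_maximalideal_iff:
  "(\<exists>!M. maximalideal M R) \<longleftrightarrow> \<one> \<noteq> \<zero> \<and>
     (\<forall>a \<in> carrier R. \<forall>b \<in> carrier R. a \<notin> Units R \<longrightarrow> b \<notin> Units R \<longrightarrow> a \<oplus> b \<notin> Units R)"
  (is "?L \<longleftrightarrow> ?R")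
proof
  assume ?L
  then obtain M where M: "maximalideal M R" "\<And>M'. maximalideal M' R \<Longrightarrow> M' = M"
    by auto
  interpret M: maximalideal M R by fact
  have eq: "a \<in> M" if "a \<in> carrier R" "a \<notin> Units R" for a
    using nonunit_in_maximal[OF that] M(2) by blast
  show ?R
  proof (intro conjI ballI impI)
    show "\<one> \<noteq> \<zero>" using M.one_imp_carrier M.I_notcarr M.zero_closed by metis
    show "a \<oplus> b \<notin> Units R" if "a \<in> carrier R" "b \<in> carrier R" "a \<notin> Units R" "b \<notin> Units R" for a b
      using eq that M.a_closed maximalideal_nonunit[OF M(1)] by blast
  qed
next
  assume R: ?R
  let ?M = "carrier R - Units R"
  have z: "\<zero> \<notin> Units R"
  proof
    assume "\<zero> \<in> Units R"
    then have "\<zero> \<otimes> inv \<zero> = \<one>" "inv \<zero> \<in> carrier R" by auto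
    then show False using R by simp
  qed
  have neg: "\<ominus> a \<notin> Units R" if "a \<in> carrier R" "a \<notin> Units R" for a
  proof
    assume "\<ominus> a \<in> Units R"
    then have "\<ominus> a \<otimes> inv (\<ominus> a) = \<one>" "inv (\<ominus> a) \<in> carrier R" by auto
    then have "a \<otimes> (\<ominus> (inv (\<ominus> a))) = \<one>" using that by (simp add: l_minus r_minus)
    then show False using that \<open>inv (\<ominus> a) \<in> carrier R\<close> unfolding Units_def
      by (metis (mono_tags, lifting) a_inv_closed m_comm mem_Collect_eq)
  qed
  have M: "ideal ?M R"
  proof (rule idealI[OF ring_axioms])
    show "subgroup ?M (add_monoid R)"
      using R z neg by (intro group.subgroupI[OF add.is_group]) (auto simp: a_inv_def[symmetric])
    show "x \<otimes> a \<in> ?M" "a \<otimes> x \<in> ?M" if "a \<in> ?M" "x \<in> carrier R" for a x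
      using that by (auto simp: Units_mult_iff)
  qed
  have sub: "I \<subseteq> ?M" if "ideal I R" "I \<noteq> carrier R" for I
  proof
    fix x assume x: "x \<in> I"
    interpret I: ideal I R by fact
    have "x \<notin> Units R"
    proof
      assume "x \<in> Units R"
      then have "inv x \<otimes> x \<in> I" using x by (intro I.I_l_closed) auto
      then show False using \<open>x \<in> Units R\<close> I.one_imp_carrier that by simp
    qed
    then show "x \<in> ?M" using I.Icarr x by simp
  qed
  have max: "maximalideal ?M R"
    using M sub by (intro maximalidealI) auto
  have "M' = ?M" if "maximalideal M' R" for M'
  proof -
    interpret M': maximalideal M' R by fact
    show ?thesis
      using M'.I_maximal[OF M sub] M'.is_ideal M'.I_notcarr max by auto
  qed
  with max show ?L by blast
qed

lemma local_ring_iff: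
  "local_ring A \<longleftrightarrow> cring A \<and> \<one>\<^bsub>A\<^esub> \<noteq> \<zero>\<^bsub>A\<^esub> \<and>
     (\<forall>a \<in> carrier A. \<forall>b \<in> carrier A. a \<notin> Units A \<longrightarrow> b \<notin> Units A \<longrightarrow> a \<oplus>\<^bsub>A\<^esub> b \<notin> Units A)"
  using cring.unique_maximalideal_iff[of A] unfolding local_ring_def by blast

lemma local_ring_one: "local_ring A \<Longrightarrow> \<one>\<^bsub>A\<^esub> \<noteq> \<zero>\<^bsub>A\<^esub>"
  by (simp add: local_ring_iff)

lemma local_ring_nonunit_add:
  "local_ring A \<Longrightarrow> a \<in> carrier A \<Longrightarrow> b \<in> carrier A \<Longrightarrow> a \<notin> Units A \<Longrightarrow> b \<notin> Units A \<Longrightarrow> a \<oplus>\<^bsub>A\<^esub> b \<notin> Units A"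
  by (simp add: local_ring_iff)

lemma local_ring_zero_nonunit:
  assumes "local_ring A" shows "\<zero>\<^bsub>A\<^esub> \<notin> Units A"
proof
  interpret cring A using assms by (simp add: local_ring_def)
  assume "\<zero>\<^bsub>A\<^esub> \<in> Units A"
  then have "\<zero>\<^bsub>A\<^esub> \<otimes>\<^bsub>A\<^esub> inv\<^bsub>A\<^esub> \<zero>\<^bsub>A\<^esub> = \<one>\<^bsub>A\<^esub>" "inv\<^bsub>A\<^esub> \<zero>\<^bsub>A\<^esub> \<in> carrier A" by auto
  then show False using local_ring_one[OF assms] by simp
qed

section \<open>Quotient algebras\<close>

lemma quot_simps:
  "carrier (quot A I) = a_rcosets\<^bsub>A\<^esub> I" "monoid.mult (quot A I) = rcoset_mult A I" "one (quot A I) = I +>\<^bsub>A\<^esub> \<one>\<^bsub>A\<^esub>"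
  "ring.zero (quot A I) = I" "add (quot A I) = set_add A" "scal (quot A I) c = I +>\<^bsub>A\<^esub> scal A c"
  by (simp_all add: quot_def FactRing_def)

lemma quot_carrier: "x \<in> carrier (quot A I) \<longleftrightarrow> (\<exists>a\<in>carrier A. x = I +>\<^bsub>A\<^esub> a)"
  by (auto simp: quot_simps A_RCOSETS_def')

lemma quot_kalgebra:
  assumes "kalgebra A" "ideal I A" shows "kalgebra (quot A I)"
proof -
  interpret ideal I A by fact
  interpret Q: cring "A Quot I" by (rule quotient_is_cring[OF kalg_cring[OF assms(1)]])
  have c: "cring (quot A I)"
    by (intro cringI abelian_groupI comm_monoidI; (simp add: quot_def Q.a_assoc Q.m_assoc Q.l_distr)?)
      (use Q.a_comm Q.m_comm Q.l_neg Q.a_inv_closed in \<open>auto simp: quot_def\<close>)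
  show ?thesis
    by (rule kalgebraI[OF c]) (use kalg_scal_closed[OF assms(1)] in
      \<open>auto simp: quot_carrier quot_simps(2-) kalg_scal_add[OF assms(1)] kalg_scal_mult[OF assms(1)]
        kalg_scal_one[OF assms(1)] rcoset_mult_add a_rcos_sum\<close>)
qed

lemma quot_hom:
  assumes "ideal I A" shows "(\<lambda>a. I +>\<^bsub>A\<^esub> a) \<in> alg_hom A (quot A I)"
proof -
  interpret ideal I A by fact
  show ?thesis by (rule alg_homI) (auto simp: quot_carrier quot_simps(2-) rcoset_mult_add a_rcos_sum)
qed

lemma quot_eq_iff:
  assumes "ideal I A" "a \<in> carrier A" "b \<in> carrier A"
  shows "I +>\<^bsub>A\<^esub> a = I +>\<^bsub>A\<^esub> b \<longleftrightarrow> a \<ominus>\<^bsub>A\<^esub> b \<in> I"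
  using ring.quotient_eq_iff_same_a_r_cos[of A I a b] assms ideal.axioms(2) by blast

text \<open>Evaluation of \<open>h\<close> on an arbitrary representative of the class;
  \<open>qlift_eq\<close> removes the choice when \<open>h\<close> kills \<open>I\<close>.\<close>

definition qlift :: "('a, 'k) kalg \<Rightarrow> 'a set \<Rightarrow> ('a \<Rightarrow> 'b) \<Rightarrow> 'a set \<Rightarrow> 'b" where
  "qlift A I h x = h (SOME a. a \<in> carrier A \<and> x = I +>\<^bsub>A\<^esub> a)"

lemma qlift_eq:
  assumes "ideal I A" "h \<in> alg_hom A B" "cring A" "cring B" "\<And>a. a \<in> I \<Longrightarrow> h a = \<zero>\<^bsub>B\<^esub>" "a \<in> carrier A"
  shows "qlift A I h (I +>\<^bsub>A\<^esub> a) = h a"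
proof -
  interpret B: cring B by fact
  let ?b = "SOME b. b \<in> carrier A \<and> I +>\<^bsub>A\<^esub> a = I +>\<^bsub>A\<^esub> b"
  have b: "?b \<in> carrier A \<and> I +>\<^bsub>A\<^esub> a = I +>\<^bsub>A\<^esub> ?b" by (rule someI[of _ a]) (simp add: assms)
  then have "a \<ominus>\<^bsub>A\<^esub> ?b \<in> I" using quot_eq_iff[OF assms(1,6)] by blast
  then have "h a \<ominus>\<^bsub>B\<^esub> h ?b = \<zero>\<^bsub>B\<^esub>"
    using alg_hom_minus[OF assms(2,3,4,6), of ?b] b assms(5) by simp
  then have "h a = h ?b"
    using B.r_right_minus_eq[of "h a" "h ?b"] alg_hom_closed[OF assms(2)] assms(6) b by blast
  then show ?thesis by (simp add: qlift_def)
qed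

lemma qlift_hom:
  assumes "ideal I A" "h \<in> alg_hom A B" "kalgebra A" "cring B" "\<And>a. a \<in> I \<Longrightarrow> h a = \<zero>\<^bsub>B\<^esub>"
  shows "qlift A I h \<in> alg_hom (quot A I) B"
proof -
  interpret I: ideal I A by fact
  note q = qlift_eq[OF assms(1,2) kalg_cring[OF assms(3)] assms(4,5)]
  show ?thesis
  proof (rule alg_homI)
    fix x y assume "x \<in> carrier (quot A I)" "y \<in> carrier (quot A I)"
    then obtain a b where ab: "a \<in> carrier A" "b \<in> carrier A" "x = I +>\<^bsub>A\<^esub> a" "y = I +>\<^bsub>A\<^esub> b"
      by (auto simp: quot_carrier)
    show "qlift A I h (x \<otimes>\<^bsub>quot A I\<^esub> y) = qlift A I h x \<otimes>\<^bsub>B\<^esub> qlift A I h y"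
      "qlift A I h (x \<oplus>\<^bsub>quot A I\<^esub> y) = qlift A I h x \<oplus>\<^bsub>B\<^esub> qlift A I h y"
      using ab by (simp_all add: quot_simps I.rcoset_mult_add I.a_rcos_sum q
         alg_hom_mult[OF assms(2)] alg_hom_add[OF assms(2)])
  qed (auto simp: quot_carrier quot_simps(2-) q alg_hom_closed[OF assms(2)] alg_hom_one[OF assms(2)]
      alg_hom_scal[OF assms(2)] kalg_scal_closed[OF assms(3)])
qed

lemma kernel_ideal:
  assumes "h \<in> alg_hom A B" "cring A" "cring B" shows "ideal {a \<in> carrier A. h a = \<zero>\<^bsub>B\<^esub>} A"
proof -
  interpret ring_hom_cring A B h by (rule alg_hom_ring_hom_cring[OF assms])
  show ?thesis using ring.kernel_is_ideal unfolding a_kernel_def' .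
qed

section \<open>Locally ringed spaces\<close>

locale lr_space =
  fixes X :: "('p, 'a, 'k::field) lrs"
  assumes lr: "locally_ringed X"
begin

lemma stalk_kalg: "p \<in> pts X \<Longrightarrow> kalgebra (stalk X p)"
  and stalk_local: "p \<in> pts X \<Longrightarrow> local_ring (stalk X p)"
  and stalk_cring: "p \<in> pts X \<Longrightarrow> cring (stalk X p)"
  using lr by (auto simp: locally_ringed_def kalg_cring)

lemmas sec_axioms = lr[unfolded locally_ringed_def, THEN conjunct2, THEN conjunct1, THEN spec, THEN mp]

lemmas sec_ext = sec_axioms[THEN conjunct1, THEN subsetD]

lemma sec_carrier: "openin (tspace X) W \<Longrightarrow> s \<in> sections X W \<Longrightarrow> p \<in> W \<Longrightarrow> s p \<in> carrier (stalk X p)"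
  by (rule PiE_mem[OF sec_ext])

lemmas sec_scal = sec_axioms[THEN conjunct2, THEN conjunct1, THEN spec]

lemmas sec_diff = sec_axioms[THEN conjunct2, THEN conjunct2, THEN conjunct1, THEN bspec, THEN bspec, THEN conjunct1]

lemmas sec_mult = sec_axioms[THEN conjunct2, THEN conjunct2, THEN conjunct1, THEN bspec, THEN bspec, THEN conjunct2]

lemma sec_restrict: "openin (tspace X) W \<Longrightarrow> s \<in> sections X W \<Longrightarrow> openin (tspace X) W' \<Longrightarrow> W' \<subseteq> W \<Longrightarrow>
    restrict s W' \<in> sections X W'"
  by (drule sec_axioms) simp

lemma sec_glue:
  assumes "openin (tspace X) W" "s \<in> (\<Pi>\<^sub>E p\<in>W. carrier (stalk X p))"
    "\<And>p. p \<in> W \<Longrightarrow> \<exists>W'. openin (tspace X) W' \<and> p \<in> W' \<and> W' \<subseteq> W \<and> restrict s W' \<in> sections X W'"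
  shows "s \<in> sections X W"
  using sec_axioms[OF assms(1), THEN conjunct2, THEN conjunct2, THEN conjunct2, THEN conjunct2, THEN conjunct1,
      THEN bspec, OF assms(2)] assms(3) by simp

lemma sec_germ_eq: "openin (tspace X) W \<Longrightarrow> s \<in> sections X W \<Longrightarrow> t \<in> sections X W \<Longrightarrow> p \<in> W \<Longrightarrow> s p = t p \<Longrightarrow>
    \<exists>W'. openin (tspace X) W' \<and> p \<in> W' \<and> W' \<subseteq> W \<and> restrict s W' = restrict t W'"
  by (drule sec_axioms[THEN conjunct2, THEN conjunct2, THEN conjunct2, THEN conjunct2, THEN conjunct2]) simp

lemma germ_ex: "p \<in> pts X \<Longrightarrow> a \<in> carrier (stalk X p) \<Longrightarrow> \<exists>W s. openin (tspace X) W \<and> p \<in> W \<and> s \<in> sections X W \<and> s p = a"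
  using lr[unfolded locally_ringed_def, THEN conjunct2, THEN conjunct2] by simp

lemma openin_pts: "openin (tspace X) W \<Longrightarrow> p \<in> W \<Longrightarrow> p \<in> pts X"
  using openin_subset by blast

lemma sec_one: "openin (tspace X) W \<Longrightarrow> (\<lambda>p\<in>W. \<one>\<^bsub>stalk X p\<^esub>) \<in> sections X W"
  using sec_scal[of W 1] by (rule back_subst[of "\<lambda>s. s \<in> sections X W"])
    (auto simp: restrict_def fun_eq_iff kalg_scal_one stalk_kalg openin_pts)

lemma sec_zero: "openin (tspace X) W \<Longrightarrow> (\<lambda>p\<in>W. \<zero>\<^bsub>stalk X p\<^esub>) \<in> sections X W"
  using sec_scal[of W 0] by (rule back_subst[of "\<lambda>s. s \<in> sections X W"])
    (auto simp: restrict_def fun_eq_iff kalg_scal_zero stalk_kalg openin_pts)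

text \<open>The sheaf axioms provide differences and scalars only, so the sum is obtained as s - (0
  - t).\<close>

lemma sec_add:
  assumes "openin (tspace X) W" "s \<in> sections X W" "t \<in> sections X W"
  shows "(\<lambda>p\<in>W. s p \<oplus>\<^bsub>stalk X p\<^esub> t p) \<in> sections X W"
proof -
  have "(\<lambda>p\<in>W. s p \<ominus>\<^bsub>stalk X p\<^esub> (\<lambda>p\<in>W. (\<lambda>p\<in>W. \<zero>\<^bsub>stalk X p\<^esub>) p \<ominus>\<^bsub>stalk X p\<^esub> t p) p) \<in> sections X W"
    by (intro sec_diff sec_zero assms)
  moreover have "s p \<ominus>\<^bsub>stalk X p\<^esub> (\<zero>\<^bsub>stalk X p\<^esub> \<ominus>\<^bsub>stalk X p\<^esub> t p) = s p \<oplus>\<^bsub>stalk X p\<^esub> t p" if "p \<in> W" for p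
  proof -
    interpret cring "stalk X p" using that assms by (intro stalk_cring openin_pts)
    show ?thesis using sec_carrier[OF assms(1) assms(2) that] sec_carrier[OF assms(1) assms(3) that]
      by (simp add: a_minus_def)
  qed
  ultimately show ?thesis by (simp cong: restrict_cong)
qed

text \<open>Gluing in a more convenient form than \<open>sec_glue\<close>: the witness
  \<open>t\<close> may be any section over any neighbourhood \<open>W'\<close>, also one that leaves
  \<open>W\<close>, because restricting it to the intersection of \<open>W'\<close> and
  \<open>W\<close> gives the required local section.\<close>

lemma sec_local:
  assumes "openin (tspace X) W" "s \<in> extensional W"
    "\<And>p. p \<in> W \<Longrightarrow> \<exists>W' t. openin (tspace X) W' \<and> p \<in> W' \<and> t \<in> sections X W' \<and> (\<forall>q\<in>W' \<inter> W. s q = t q)"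
  shows "s \<in> sections X W"
proof (rule sec_glue[OF assms(1)])
  show "s \<in> (\<Pi>\<^sub>E p\<in>W. carrier (stalk X p))"
  proof (rule PiE_I)
    fix p assume p: "p \<in> W"
    obtain W' t where "openin (tspace X) W'" "p \<in> W'" "t \<in> sections X W'" "\<forall>q\<in>W' \<inter> W. s q = t q"
      using assms(3)[OF p] by blast
    then show "s p \<in> carrier (stalk X p)" using sec_carrier[of W' t p] p by simp
  qed (use assms(2) in \<open>auto simp: extensional_def\<close>)
  fix p assume p: "p \<in> W"
  then obtain W' t where W': "openin (tspace X) W'" "p \<in> W'" "t \<in> sections X W'" "\<forall>q\<in>W' \<inter> W. s q = t q"
    using assms(3) by blast
  have "restrict s (W' \<inter> W) = restrict t (W' \<inter> W)" using W'(4) by (intro restrict_ext) auto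
  moreover have "restrict t (W' \<inter> W) \<in> sections X (W' \<inter> W)"
    using W' assms(1) by (intro sec_restrict[OF W'(1,3)]) auto
  ultimately show "\<exists>W'. openin (tspace X) W' \<and> p \<in> W' \<and> W' \<subseteq> W \<and> restrict s W' \<in> sections X W'"
    using W' p assms(1) by (intro exI[of _ "W' \<inter> W"]) auto
qed

text \<open>Choose a section \<open>t\<close> whose germ at \<open>p\<close> is the inverse. The
  product of \<open>s\<close> and \<open>t\<close> has the same germ at \<open>p\<close> as the
  section 1, hence equals it on a neighbourhood, where \<open>t\<close> is then the inverse of
  \<open>s\<close>.\<close>

lemma sec_inv_local:
  assumes "openin (tspace X) W" "s \<in> sections X W" "p \<in> W" "s p \<in> Units (stalk X p)"
  shows "\<exists>W' t. openin (tspace X) W' \<and> p \<in> W' \<and> W' \<subseteq> W \<and> t \<in> sections X W' \<and>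
           (\<forall>q\<in>W'. s q \<in> Units (stalk X q) \<and> t q = inv\<^bsub>stalk X q\<^esub> (s q))"
proof -
  interpret R: cring "stalk X p" using assms by (intro stalk_cring openin_pts)
  obtain W1 t where t: "openin (tspace X) W1" "p \<in> W1" "t \<in> sections X W1" "t p = inv\<^bsub>stalk X p\<^esub> (s p)"
    using germ_ex[OF openin_pts[OF assms(1,3)], of "inv\<^bsub>stalk X p\<^esub> (s p)"] assms(4) by blast
  let ?V = "W \<inter> W1"
  have V: "openin (tspace X) ?V" using assms(1) t(1) by blast
  have rs: "restrict s ?V \<in> sections X ?V" "restrict t ?V \<in> sections X ?V"
    using sec_restrict[OF assms(1,2) V] sec_restrict[OF t(1,3) V] by auto
  have "\<exists>W'. openin (tspace X) W' \<and> p \<in> W' \<and> W' \<subseteq> ?V \<and>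
     restrict (\<lambda>q\<in>?V. restrict s ?V q \<otimes>\<^bsub>stalk X q\<^esub> restrict t ?V q) W' = restrict (\<lambda>q\<in>?V. \<one>\<^bsub>stalk X q\<^esub>) W'"
    using assms(3,4) t(2,4) by (intro sec_germ_eq[OF V sec_mult[OF V rs] sec_one[OF V]]) auto
  then obtain W' where W': "openin (tspace X) W'" "p \<in> W'" "W' \<subseteq> ?V"
    "\<And>q. q \<in> W' \<Longrightarrow> s q \<otimes>\<^bsub>stalk X q\<^esub> t q = \<one>\<^bsub>stalk X q\<^esub>"
    by (auto simp: fun_eq_iff restrict_def Ball_def split: if_splits) (metis IntD1 IntD2 subsetD)
  have "s q \<in> Units (stalk X q) \<and> t q = inv\<^bsub>stalk X q\<^esub> (s q)" if q: "q \<in> W'" for q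
  proof -
    interpret Q: cring "stalk X q" using q W' by (intro stalk_cring openin_pts)
    have c: "s q \<in> carrier (stalk X q)" "t q \<in> carrier (stalk X q)"
      using sec_carrier[OF assms(1,2)] sec_carrier[OF t(1,3)] q W'(3) by auto
    then have "s q \<in> Units (stalk X q)" using W'(4)[OF q] Q.m_comm unfolding Units_def by fastforce
    then show ?thesis using Q.comm_inv_char[OF c W'(4)[OF q]] by simp
  qed
  then show ?thesis using W' sec_restrict[OF t(1,3) W'(1)]
    by (intro exI[of _ W'] exI[of _ "restrict t W'"]) auto
qed

lemma unit_open:
  assumes "openin (tspace X) W" "s \<in> sections X W"
  shows "openin (tspace X) {p \<in> W. s p \<in> Units (stalk X p)}"
proof (subst openin_subopen, intro ballI)
  fix p assume "p \<in> {p \<in> W. s p \<in> Units (stalk X p)}"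
  then show "\<exists>T. openin (tspace X) T \<and> p \<in> T \<and> T \<subseteq> {p \<in> W. s p \<in> Units (stalk X p)}"
    using sec_inv_local[OF assms, of p] by blast
qed

end

text \<open>The functions on a space as an algebra of the same record type as all others, so that
  polynomial evaluation, quotients and localizations apply to them directly.\<close>

definition gam :: "('p, 'a, 'k::field) lrs \<Rightarrow> ('p \<Rightarrow> 'a, 'k) kalg" where
  "gam X = \<lparr>carrier = global X, monoid.mult = (\<lambda>s t. \<lambda>p\<in>pts X. s p \<otimes>\<^bsub>stalk X p\<^esub> t p), one = (\<lambda>p\<in>pts X. \<one>\<^bsub>stalk X p\<^esub>),
     ring.zero = (\<lambda>p\<in>pts X. \<zero>\<^bsub>stalk X p\<^esub>), add = (\<lambda>s t. \<lambda>p\<in>pts X. s p \<oplus>\<^bsub>stalk X p\<^esub> t p), scal = const_fun X\<rparr>"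

lemma gam_simps [simp]:
  "carrier (gam X) = global X" "s \<otimes>\<^bsub>gam X\<^esub> t = (\<lambda>p\<in>pts X. s p \<otimes>\<^bsub>stalk X p\<^esub> t p)"
  "\<one>\<^bsub>gam X\<^esub> = (\<lambda>p\<in>pts X. \<one>\<^bsub>stalk X p\<^esub>)" "\<zero>\<^bsub>gam X\<^esub> = (\<lambda>p\<in>pts X. \<zero>\<^bsub>stalk X p\<^esub>)"
  "s \<oplus>\<^bsub>gam X\<^esub> t = (\<lambda>p\<in>pts X. s p \<oplus>\<^bsub>stalk X p\<^esub> t p)" "scal (gam X) = const_fun X"
  by (simp_all add: gam_def)

context lr_space begin

lemma global_carrier: "s \<in> global X \<Longrightarrow> p \<in> pts X \<Longrightarrow> s p \<in> carrier (stalk X p)"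
  by (rule sec_carrier[OF openin_topspace])

lemma global_ext: "s \<in> global X \<Longrightarrow> s \<in> extensional (pts X)"
  using sec_ext[OF openin_topspace] by (simp add: PiE_def)

lemma global_eqI: "s \<in> global X \<Longrightarrow> t \<in> global X \<Longrightarrow> (\<And>p. p \<in> pts X \<Longrightarrow> s p = t p) \<Longrightarrow> s = t"
  using global_ext by (metis extensionalityI)

lemma gam_kalgebra: "kalgebra (gam X)"
proof (rule kalgebraI)
  note ri = stalk_cring[THEN cring.axioms(1)]
  note ax = ri[THEN ring.is_abelian_group, THEN abelian_group.axioms(1)]
  note mx = stalk_cring[THEN cring.axioms(2)]
  note ax' = ax[THEN abelian_monoid.a_assoc] ax[THEN abelian_monoid.a_comm] ax[THEN abelian_monoid.l_zero]
    mx[THEN comm_monoid.axioms(1), THEN monoid.m_assoc] mx[THEN comm_monoid.m_comm]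
    mx[THEN comm_monoid.axioms(1), THEN monoid.l_one]
    ri[THEN ring.ring_simprules(13)]
  show "cring (gam X)"
  proof (intro cringI abelian_groupI comm_monoidI; (simp add: sec_add sec_mult sec_one sec_zero; fail)?)
    fix x assume x: "x \<in> carrier (gam X)"
    show "\<exists>y\<in>carrier (gam X). y \<oplus>\<^bsub>gam X\<^esub> x = \<zero>\<^bsub>gam X\<^esub>"
    proof (intro bexI)
      show "(\<lambda>p\<in>pts X. (\<lambda>p\<in>pts X. \<zero>\<^bsub>stalk X p\<^esub>) p \<ominus>\<^bsub>stalk X p\<^esub> x p) \<in> carrier (gam X)"
        using x unfolding gam_simps by (intro sec_diff sec_zero openin_topspace)
      show "(\<lambda>p\<in>pts X. (\<lambda>p\<in>pts X. \<zero>\<^bsub>stalk X p\<^esub>) p \<ominus>\<^bsub>stalk X p\<^esub> x p) \<oplus>\<^bsub>gam X\<^esub> x = \<zero>\<^bsub>gam X\<^esub>"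
        unfolding gam_simps
      proof (rule restrict_ext)
        fix p assume p: "p \<in> pts X"
        interpret cring "stalk X p" using p by (rule stalk_cring)
        show "(\<lambda>p\<in>pts X. (\<lambda>p\<in>pts X. \<zero>\<^bsub>stalk X p\<^esub>) p \<ominus>\<^bsub>stalk X p\<^esub> x p) p \<oplus>\<^bsub>stalk X p\<^esub> x p = \<zero>\<^bsub>stalk X p\<^esub>"
          using p global_carrier[of x p] x by (simp add: a_minus_def l_neg)
      qed
    qed
  qed (auto simp: fun_eq_iff restrict_def extensional_arb[OF global_ext]
      global_carrier ax' cong: if_cong)
qed (auto simp: const_fun_def sec_scal stalk_kalg kalg_scal_one kalg_scal_add kalg_scal_mult intro!: restrict_ext)

lemma gam_eval: "p \<in> pts X \<Longrightarrow> (\<lambda>s. s p) \<in> alg_hom (gam X) (stalk X p)"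
  by (rule alg_homI) (auto simp: global_carrier const_fun_def)

end

section \<open>Morphisms\<close>

lemma mor_pt: "morphism X Y f \<Longrightarrow> p \<in> pts X \<Longrightarrow> fst f p \<in> pts Y"
  unfolding morphism_def by (blast dest: continuous_map_image_subset_topspace)

lemma mor_ext: "morphism X Y f \<Longrightarrow> fst f \<in> extensional (pts X) \<and> snd f \<in> extensional (pts X)"
  by (simp add: morphism_def)

lemma mor_stalk_ext: "morphism X Y f \<Longrightarrow> p \<in> pts X \<Longrightarrow> snd f p \<in> extensional (carrier (stalk Y (fst f p)))"
  by (simp add: morphism_def)

lemma mor_hom: "morphism X Y f \<Longrightarrow> p \<in> pts X \<Longrightarrow> snd f p \<in> alg_hom (stalk Y (fst f p)) (stalk X p)"
  by (simp add: morphism_def)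

lemma mor_closed: "morphism X Y f \<Longrightarrow> p \<in> pts X \<Longrightarrow> a \<in> carrier (stalk Y (fst f p)) \<Longrightarrow> snd f p a \<in> carrier (stalk X p)"
  by (rule alg_hom_closed[OF mor_hom])

lemma mor_Units_iff: "morphism X Y f \<Longrightarrow> p \<in> pts X \<Longrightarrow> a \<in> carrier (stalk Y (fst f p)) \<Longrightarrow>
    snd f p a \<in> Units (stalk X p) \<longleftrightarrow> a \<in> Units (stalk Y (fst f p))"
  by (rule iffI, simp add: morphism_def, rule alg_hom_Units[OF mor_hom])

lemma mor_preim_open: "morphism X Y f \<Longrightarrow> openin (tspace Y) W \<Longrightarrow> openin (tspace X) (preim X f W)"
  unfolding morphism_def preim_def by (blast intro: openin_continuous_map_preimage)

lemma mor_pull: "morphism X Y f \<Longrightarrow> openin (tspace Y) W \<Longrightarrow> s \<in> sections Y W \<Longrightarrow> pull X f W s \<in> sections X (preim X f W)"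
  by (simp add: morphism_def)

lemma preim_pts: "morphism X Y f \<Longrightarrow> preim X f (pts Y) = pts X"
  by (auto simp: preim_def mor_pt)

lemma mor_pull_global: "morphism X Y f \<Longrightarrow> s \<in> global Y \<Longrightarrow> pull X f (pts Y) s \<in> global X"
  using mor_pull[of X Y f "pts Y" s] by (simp add: preim_pts)

lemma morphismI:
  assumes "fst f \<in> extensional (pts X)" "snd f \<in> extensional (pts X)"
    "\<And>p. p \<in> pts X \<Longrightarrow> fst f p \<in> pts Y"
    "\<And>W. openin (tspace Y) W \<Longrightarrow> openin (tspace X) (preim X f W)"
    "\<And>p. p \<in> pts X \<Longrightarrow> snd f p \<in> extensional (carrier (stalk Y (fst f p)))"
    "\<And>p. p \<in> pts X \<Longrightarrow> snd f p \<in> alg_hom (stalk Y (fst f p)) (stalk X p)"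
    "\<And>p a. p \<in> pts X \<Longrightarrow> a \<in> carrier (stalk Y (fst f p)) \<Longrightarrow> snd f p a \<in> Units (stalk X p) \<Longrightarrow> a \<in> Units (stalk Y (fst f p))"
    "\<And>W s. openin (tspace Y) W \<Longrightarrow> s \<in> sections Y W \<Longrightarrow> pull X f W s \<in> sections X (preim X f W)"
  shows "morphism X Y f"
  using assms by (auto simp: morphism_def continuous_map_def preim_def)

text \<open>Both components of a morphism are extensional, so points and germs decide equality.
  Equality of the image points may be assumed when germs are compared, since only then do both stalk
  maps start from the same ring.\<close>

lemma mor_fst_eqI:
  assumes "morphism X Y f" "morphism X Y g" "\<And>p. p \<in> pts X \<Longrightarrow> fst f p = fst g p"
    "\<And>p a. p \<in> pts X \<Longrightarrow> fst f p = fst g p \<Longrightarrow> a \<in> carrier (stalk Y (fst f p)) \<Longrightarrow> snd f p a = snd g p a"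
  shows "f = g"
proof (rule prod_eqI)
  show 1: "fst f = fst g"
    using mor_ext[OF assms(1)] mor_ext[OF assms(2)] assms(3) by (intro extensionalityI) auto
  show "snd f = snd g"
  proof (rule extensionalityI[of _ "pts X"])
    fix p assume p: "p \<in> pts X"
    show "snd f p = snd g p"
      using mor_stalk_ext[OF assms(1) p] mor_stalk_ext[OF assms(2) p] assms(4)[OF p] 1
      by (intro extensionalityI[of _ "carrier (stalk Y (fst f p))"]) auto
  qed (use mor_ext[OF assms(1)] mor_ext[OF assms(2)] in auto)
qed

lemma mcomp_fst [simp]: "p \<in> pts X \<Longrightarrow> fst (mcomp X Z g f) p = fst g (fst f p)"
  by (simp add: mcomp_def)

lemma mcomp_snd [simp]: "p \<in> pts X \<Longrightarrow> a \<in> carrier (stalk Z (fst g (fst f p))) \<Longrightarrow>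
    snd (mcomp X Z g f) p a = snd f p (snd g (fst f p) a)"
  by (simp add: mcomp_def)

lemma preim_mcomp: "morphism X Y f \<Longrightarrow> preim X (mcomp X Z g f) W = preim X f (preim Y g W)"
  by (auto simp: preim_def mor_pt)

lemma pull_mcomp:
  assumes "morphism X Y f" "locally_ringed Z" "openin (tspace Z) W" "s \<in> sections Z W"
  shows "pull X (mcomp X Z g f) W s = pull X f (preim Y g W) (pull Y g W s)"
proof -
  interpret Z: lr_space Z by (rule lr_space.intro) fact
  show ?thesis
    unfolding pull_def preim_mcomp[OF assms(1)]
    by (intro restrict_ext) (auto simp: preim_def Z.sec_carrier[OF assms(3,4)])
qed

lemma morphism_mcomp:
  assumes "morphism X Y f" "morphism Y Z g" "locally_ringed Z"
  shows "morphism X Z (mcomp X Z g f)"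
proof (rule morphismI)
  fix p assume p: "p \<in> pts X"
  note q = mor_pt[OF assms(1) p]
  interpret lr_space Z by (rule lr_space.intro) fact
  show "fst (mcomp X Z g f) p \<in> pts Z" using mor_pt[OF assms(2) q] p by simp
  show "snd (mcomp X Z g f) p \<in> extensional (carrier (stalk Z (fst (mcomp X Z g f) p)))"
    using p by (simp add: mcomp_def)
  have "snd (mcomp X Z g f) p \<in> alg_hom (stalk Z (fst g (fst f p))) (stalk X p)"
    by (rule alg_hom_cong[OF alg_hom_comp[OF mor_hom[OF assms(1) p] mor_hom[OF assms(2) q]]])
      (use p stalk_kalg mor_pt[OF assms(2) q] in auto)
  then show "snd (mcomp X Z g f) p \<in> alg_hom (stalk Z (fst (mcomp X Z g f) p)) (stalk X p)"
    using p by simp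
  show "a \<in> Units (stalk Z (fst (mcomp X Z g f) p))"
    if "a \<in> carrier (stalk Z (fst (mcomp X Z g f) p))" "snd (mcomp X Z g f) p a \<in> Units (stalk X p)" for a
    using that p mor_Units_iff[OF assms(1) p] mor_Units_iff[OF assms(2) q] mor_closed[OF assms(2) q] by simp
next
  fix W assume W: "openin (tspace Z) W"
  show "openin (tspace X) (preim X (mcomp X Z g f) W)"
    by (simp add: preim_mcomp[OF assms(1)] mor_preim_open[OF assms(1)] mor_preim_open[OF assms(2)] W)
  fix s assume s: "s \<in> sections Z W"
  show "pull X (mcomp X Z g f) W s \<in> sections X (preim X (mcomp X Z g f) W)"
    by (simp add: pull_mcomp[OF assms(1,3) W s] preim_mcomp[OF assms(1)] mor_pull[OF assms(1)] mor_pull[OF assms(2)]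
        mor_preim_open[OF assms(2)] W s)
qed (simp_all add: mcomp_def)

lemma mcomp_assoc:
  assumes "morphism X Y f" "morphism Y Z g" "morphism Z T h"
  shows "mcomp X T h (mcomp X Z g f) = mcomp X T (mcomp Y T h g) f"
  by (auto simp: mcomp_def fun_eq_iff restrict_def mor_pt[OF assms(1)] mor_pt[OF assms(2)] mor_closed[OF assms(3)])

lemma id_mor_fst [simp]: "p \<in> pts X \<Longrightarrow> fst (id_mor X) p = p"
  and id_mor_snd [simp]: "p \<in> pts X \<Longrightarrow> a \<in> carrier (stalk X p) \<Longrightarrow> snd (id_mor X) p a = a"
  by (simp_all add: id_mor_def)

lemma mor_arb:
  assumes "morphism X Y f"
  shows "p \<notin> pts X \<Longrightarrow> fst f p = undefined" "p \<notin> pts X \<Longrightarrow> snd f p = undefined"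
    "p \<in> pts X \<Longrightarrow> a \<notin> carrier (stalk Y (fst f p)) \<Longrightarrow> snd f p a = undefined"
  using mor_ext[OF assms] mor_stalk_ext[OF assms, of p] by (auto simp: extensional_def)

lemma mcomp_id_left: "morphism X Y f \<Longrightarrow> mcomp X Y (id_mor Y) f = f"
  by (intro prod_eqI) (simp_all add: mcomp_def fun_eq_iff mor_pt restrict_def mor_arb)

lemma mcomp_id_right: "morphism X Y f \<Longrightarrow> mcomp X Y f (id_mor X) = f"
  by (intro prod_eqI) (simp_all add: mcomp_def fun_eq_iff mor_closed restrict_def mor_arb)

context lr_space begin

lemma alg_hom_restrict_id: "p \<in> pts X \<Longrightarrow> snd (id_mor X) p \<in> alg_hom (stalk X p) (stalk X p)"
  by (rule alg_hom_cong[of "\<lambda>x. x"]) (auto intro: alg_homI stalk_kalg)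

lemma morphism_id: "morphism X X (id_mor X)"
proof (rule morphismI)
  fix W assume W: "openin (tspace X) W"
  then have eq: "preim X (id_mor X) W = W" using openin_subset[OF W] by (auto simp: preim_def id_mor_def)
  show "openin (tspace X) (preim X (id_mor X) W)" using eq W by simp
  fix s assume s: "s \<in> sections X W"
  have "pull X (id_mor X) W s = s"
    unfolding pull_def eq using sec_ext[OF W s] sec_carrier[OF W s] openin_pts[OF W]
    by (intro extensionalityI[of _ W]) (auto simp: PiE_def)
  then show "pull X (id_mor X) W s \<in> sections X (preim X (id_mor X) W)" using eq s by simp
qed (use alg_hom_restrict_id in \<open>auto simp: id_mor_def\<close>)

end

lemma pull_hom:
  assumes "morphism X Y f" "locally_ringed X" "locally_ringed Y"
  shows "pull X f (pts Y) \<in> alg_hom (gam Y) (gam X)"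
proof -
  interpret X: lr_space X by (rule lr_space.intro) fact
  interpret Y: lr_space Y by (rule lr_space.intro) fact
  note h = mor_hom[OF assms(1)] and pt = mor_pt[OF assms(1)]
  show ?thesis
    by (rule alg_homI; (simp add: mor_pull_global[OF assms(1)]; fail)?)
      (auto simp: pull_def preim_pts[OF assms(1)] fun_eq_iff restrict_def const_fun_def
         pt alg_hom_mult[OF h] alg_hom_add[OF h] alg_hom_one[OF h] alg_hom_scal[OF h] Y.global_carrier)
qed

lemma pull_at: "morphism X Y f \<Longrightarrow> p \<in> pts X \<Longrightarrow> pull X f (pts Y) s p = snd f p (s (fst f p))"
  by (simp add: pull_def preim_pts)

section \<open>Open subspaces\<close>

lemma open_sub_simps [simp]:
  "stalk (open_sub X W) = stalk X" "sections (open_sub X W) = sections X"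
  "tspace (open_sub X W) = subtopology (tspace X) W"
  by (simp_all add: open_sub_def)

lemma open_sub_pts [simp]: "openin (tspace X) W \<Longrightarrow> pts X \<inter> W = W"
  using openin_subset by blast

lemma openin_open_sub [simp]:
  "openin (tspace X) W \<Longrightarrow> openin (subtopology (tspace X) W) S \<longleftrightarrow> openin (tspace X) S \<and> S \<subseteq> W"
  by (rule openin_open_subtopology)

lemma open_sub_open_sub: "V \<subseteq> W \<Longrightarrow> open_sub (open_sub X W) V = open_sub X V"
  by (simp add: open_sub_def subtopology_subtopology Int_absorb1)

lemma open_sub_all: "open_sub X (pts X) = X"
  by (simp add: open_sub_def)

lemma locally_ringedI:
  assumes "\<And>p. p \<in> pts X \<Longrightarrow> kalgebra (stalk X p)" "\<And>p. p \<in> pts X \<Longrightarrow> local_ring (stalk X p)"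
    and ext: "\<And>W s. openin (tspace X) W \<Longrightarrow> s \<in> sections X W \<Longrightarrow> s \<in> (\<Pi>\<^sub>E p\<in>W. carrier (stalk X p))"
    and scal: "\<And>W c. openin (tspace X) W \<Longrightarrow> (\<lambda>p\<in>W. scal (stalk X p) c) \<in> sections X W"
    and diff: "\<And>W s t. openin (tspace X) W \<Longrightarrow> s \<in> sections X W \<Longrightarrow> t \<in> sections X W \<Longrightarrow>
      (\<lambda>p\<in>W. s p \<ominus>\<^bsub>stalk X p\<^esub> t p) \<in> sections X W"
    and mult: "\<And>W s t. openin (tspace X) W \<Longrightarrow> s \<in> sections X W \<Longrightarrow> t \<in> sections X W \<Longrightarrow>
      (\<lambda>p\<in>W. s p \<otimes>\<^bsub>stalk X p\<^esub> t p) \<in> sections X W"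
    and restrict: "\<And>W W' s. openin (tspace X) W \<Longrightarrow> s \<in> sections X W \<Longrightarrow> openin (tspace X) W' \<Longrightarrow> W' \<subseteq> W \<Longrightarrow>
      restrict s W' \<in> sections X W'"
    and glue: "\<And>W s. openin (tspace X) W \<Longrightarrow> s \<in> (\<Pi>\<^sub>E p\<in>W. carrier (stalk X p)) \<Longrightarrow>
      \<forall>p\<in>W. \<exists>W'. openin (tspace X) W' \<and> p \<in> W' \<and> W' \<subseteq> W \<and> restrict s W' \<in> sections X W' \<Longrightarrow> s \<in> sections X W"
    and germ_eq: "\<And>W s t p. openin (tspace X) W \<Longrightarrow> s \<in> sections X W \<Longrightarrow> t \<in> sections X W \<Longrightarrow> p \<in> W \<Longrightarrow>
      s p = t p \<Longrightarrow> \<exists>W'. openin (tspace X) W' \<and> p \<in> W' \<and> W' \<subseteq> W \<and> restrict s W' = restrict t W'"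
    and germ: "\<And>p a. p \<in> pts X \<Longrightarrow> a \<in> carrier (stalk X p) \<Longrightarrow>
      \<exists>W s. openin (tspace X) W \<and> p \<in> W \<and> s \<in> sections X W \<and> s p = a"
  shows "locally_ringed X"
  unfolding locally_ringed_def
proof (intro conjI allI impI ballI subsetI)
  show "s \<in> (\<Pi>\<^sub>E p\<in>W. carrier (stalk X p))" if "openin (tspace X) W" "s \<in> sections X W" for W s
    by (rule ext[OF that])
  show "restrict s W' \<in> sections X W'"
    if "openin (tspace X) W" "s \<in> sections X W" "openin (tspace X) W' \<and> W' \<subseteq> W" for W W' s
    using restrict[OF that(1,2)] that(3) by blast
qed (rule assms; assumption)+

lemma (in lr_space) open_sub_lr:
  assumes W: "openin (tspace X) W" shows "locally_ringed (open_sub X W)"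
proof (rule locally_ringedI; (unfold open_sub_simps openin_open_sub[OF W])?)
  fix p a assume "p \<in> topspace (subtopology (tspace X) W)" and a: "a \<in> carrier (stalk X p)"
  then have p: "p \<in> W" "p \<in> pts X" by auto
  obtain W1 s where s: "openin (tspace X) W1" "p \<in> W1" "s \<in> sections X W1" "s p = a"
    using germ_ex[OF p(2) a] by blast
  have o: "openin (tspace X) (W1 \<inter> W)" using s(1) W by (rule openin_Int)
  have "restrict s (W1 \<inter> W) \<in> sections X (W1 \<inter> W)" using sec_restrict[OF s(1,3) o] by simp
  moreover have "p \<in> W1 \<inter> W" "restrict s (W1 \<inter> W) p = a" using p s(2,4) by simp_all
  moreover have "W1 \<inter> W \<subseteq> W" by simp
  ultimately show "\<exists>S s. (openin (tspace X) S \<and> S \<subseteq> W) \<and> p \<in> S \<and> s \<in> sections X S \<and> s p = a"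
    using o by blast
next
  fix p assume "p \<in> topspace (subtopology (tspace X) W)"
  then show "kalgebra (stalk X p)" "local_ring (stalk X p)" using stalk_kalg stalk_local by auto
next
  fix S s assume S: "openin (tspace X) S \<and> S \<subseteq> W"
  { assume s: "s \<in> (\<Pi>\<^sub>E p\<in>S. carrier (stalk X p))"
      "\<forall>p\<in>S. \<exists>W'. (openin (tspace X) W' \<and> W' \<subseteq> W) \<and> p \<in> W' \<and> W' \<subseteq> S \<and> restrict s W' \<in> sections X W'"
    show "s \<in> sections X S"
    proof (rule sec_glue[OF conjunct1[OF S] s(1)])
      fix p assume "p \<in> S"
      from bspec[OF s(2) this] show "\<exists>W'. openin (tspace X) W' \<and> p \<in> W' \<and> W' \<subseteq> S \<and> restrict s W' \<in> sections X W'"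
        by (elim exE conjE) (intro exI conjI)
    qed }
  { fix p t assume s: "s \<in> sections X S" "t \<in> sections X S" "p \<in> S" "s p = t p"
    show "\<exists>W'. (openin (tspace X) W' \<and> W' \<subseteq> W) \<and> p \<in> W' \<and> W' \<subseteq> S \<and> restrict s W' = restrict t W'"
    proof -
      obtain W' where "openin (tspace X) W'" "p \<in> W'" "W' \<subseteq> S" "restrict s W' = restrict t W'"
        using sec_germ_eq[OF conjunct1[OF S] s] by (elim exE conjE)
      moreover have "W' \<subseteq> W" using calculation(3) S by (elim conjE) (rule subset_trans)
      ultimately show ?thesis by (intro exI conjI)
    qed }
qed (elim conjE, (rule sec_ext sec_scal sec_diff sec_mult sec_restrict; assumption))+

text \<open>A composite depends on its target only through the stalks, and these are shared with
  open subspaces. Many later equations between morphisms with different targets are therefore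
  literal equalities.\<close>

lemma mcomp_open_sub [simp]: "mcomp X (open_sub Y W) g f = mcomp X Y g f"
  by (simp add: mcomp_def)

text \<open>A morphism into an open subspace is the same pair of maps as a morphism into the whole
  space. Replacing a section over \<open>S\<close> by its restriction to the intersection of
  \<open>S\<close> and \<open>W\<close> changes neither the preimage nor the pullback when all image
  points lie in \<open>W\<close>.\<close>

lemma morphism_open_sub_iff:
  assumes "openin (tspace Y) W" "locally_ringed Y"
  shows "morphism X (open_sub Y W) f \<longleftrightarrow> morphism X Y f \<and> fst f ` pts X \<subseteq> W"
proof
  assume L: "morphism X (open_sub Y W) f"
  have i: "fst f p \<in> W" if "p \<in> pts X" for p using mor_pt[OF L that] by simp
  have eq: "preim X f S = preim X f (S \<inter> W)" "pull X f S s = pull X f (S \<inter> W) (restrict s (S \<inter> W))" for S s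
    using i by (auto simp: preim_def pull_def fun_eq_iff)
  have "morphism X Y f"
  proof (rule morphismI)
    fix S assume S: "openin (tspace Y) S"
    then have SW: "openin (tspace Y) (S \<inter> W)" using assms by blast
    show "openin (tspace X) (preim X f S)"
      using mor_preim_open[OF L, of "S \<inter> W"] SW assms eq(1)[of S] by simp
    fix s assume "s \<in> sections Y S"
    then have "restrict s (S \<inter> W) \<in> sections Y (S \<inter> W)"
      using lr_space.sec_restrict[OF lr_space.intro[OF assms(2)] S _ SW] by simp
    then show "pull X f S s \<in> sections X (preim X f S)"
      using mor_pull[OF L, of "S \<inter> W"] SW assms eq[of S] by simp
  qed (use L mor_ext[OF L] mor_stalk_ext[OF L] mor_hom[OF L] mor_Units_iff[OF L] mor_pt[OF L] in auto)
  then show "morphism X Y f \<and> fst f ` pts X \<subseteq> W" using i by blast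
next
  assume R: "morphism X Y f \<and> fst f ` pts X \<subseteq> W"
  then have m: "morphism X Y f" and i: "\<And>p. p \<in> pts X \<Longrightarrow> fst f p \<in> W" by auto
  show "morphism X (open_sub Y W) f"
    by (rule morphismI)
      (use assms mor_ext[OF m] mor_stalk_ext[OF m] mor_hom[OF m] mor_Units_iff[OF m] mor_pt[OF m] i
        mor_pull[OF m] mor_preim_open[OF m] in auto)
qed


lemma open_incl_morphism:
  assumes "locally_ringed X" "openin (tspace X) W"
  shows "morphism (open_sub X W) X (id_mor (open_sub X W))"
  using lr_space.morphism_id[OF lr_space.intro[OF lr_space.open_sub_lr[OF lr_space.intro[OF assms(1)] assms(2)]]]
  by (simp add: morphism_open_sub_iff[OF assms(2,1)])

lemma mor_restrict:
  assumes "locally_ringed X" "locally_ringed Y" "openin (tspace X) W" "morphism X Y f"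
  shows "morphism (open_sub X W) Y (mcomp (open_sub X W) Y f (id_mor (open_sub X W)))"
  by (rule morphism_mcomp[OF open_incl_morphism assms(4,2)]) (use assms in auto)

section \<open>Isomorphisms\<close>

lemma isomorphismI:
  "morphism X Y f \<Longrightarrow> morphism Y X g \<Longrightarrow> mcomp X X g f = id_mor X \<Longrightarrow> mcomp Y Y f g = id_mor Y \<Longrightarrow> isomorphism X Y f"
  unfolding isomorphism_def by blast

lemma isomorphism_comp:
  assumes "isomorphism X Y f" "isomorphism Y Z h" "locally_ringed X" "locally_ringed Z"
  shows "isomorphism X Z (mcomp X Z h f)"
proof -
  obtain g k where g: "morphism X Y f" "morphism Y X g" "mcomp X X g f = id_mor X" "mcomp Y Y f g = id_mor Y"
    and k: "morphism Y Z h" "morphism Z Y k" "mcomp Y Y k h = id_mor Y" "mcomp Z Z h k = id_mor Z"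
    using assms(1,2) unfolding isomorphism_def by blast
  show ?thesis
  proof (rule isomorphismI)
    show fh: "morphism X Z (mcomp X Z h f)" by (rule morphism_mcomp[OF g(1) k(1) assms(4)])
    show kg: "morphism Z X (mcomp Z X g k)" by (rule morphism_mcomp[OF k(2) g(2) assms(3)])
    have "mcomp X X (mcomp Z X g k) (mcomp X Z h f) = mcomp X X g (mcomp X Y k (mcomp X Z h f))"
      by (rule mcomp_assoc[OF fh k(2) g(2), symmetric])
    also have "mcomp X Y k (mcomp X Z h f) = mcomp X Y (mcomp Y Y k h) f"
      by (rule mcomp_assoc[OF g(1) k(1,2)])
    also have "\<dots> = f" using k(3) mcomp_id_left[OF g(1)] by simp
    finally show "mcomp X X (mcomp Z X g k) (mcomp X Z h f) = id_mor X" using g(3) by simp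
    have "mcomp Z Z (mcomp X Z h f) (mcomp Z X g k) = mcomp Z Z h (mcomp Z Y f (mcomp Z X g k))"
      by (rule mcomp_assoc[OF kg g(1) k(1), symmetric])
    also have "mcomp Z Y f (mcomp Z X g k) = mcomp Z Y (mcomp Y Y f g) k"
      by (rule mcomp_assoc[OF k(2) g(2,1)])
    also have "\<dots> = k" using g(4) mcomp_id_left[OF k(2)] by simp
    finally show "mcomp Z Z (mcomp X Z h f) (mcomp Z X g k) = id_mor Z" using k(4) by simp
  qed
qed

lemma isomorphism_restrict:
  assumes "isomorphism X Y f" "locally_ringed X" "locally_ringed Y" "openin (tspace Y) W"
  defines "X' \<equiv> open_sub X (preim X f W)" and "Y' \<equiv> open_sub Y W"
  shows "isomorphism X' Y' (mcomp X' Y f (id_mor X'))"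
proof -
  obtain g where g: "morphism X Y f" "morphism Y X g" "mcomp X X g f = id_mor X" "mcomp Y Y f g = id_mor Y"
    using assms(1) unfolding isomorphism_def by blast
  have o: "openin (tspace X) (preim X f W)" by (rule mor_preim_open[OF g(1) assms(4)])
  have pX: "pts X' = preim X f W" "pts Y' = W" using o assms(4) by (auto simp: X'_def Y'_def)
  have sub: "p \<in> pts X'" if "p \<in> pts X'" for p using that .
  have gf: "fst g (fst f p) = p" "a \<in> carrier (stalk X p) \<Longrightarrow> snd f p (snd g (fst f p) a) = a"
    if "p \<in> pts X" for p a
    using arg_cong[OF g(3), of "\<lambda>h. fst h p"] arg_cong[OF g(3), of "\<lambda>h. snd h p a"] that by auto
  have fg: "fst f (fst g q) = q" "a \<in> carrier (stalk Y q) \<Longrightarrow> snd g q (snd f (fst g q) a) = a"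
    if "q \<in> pts Y" for q a
    using arg_cong[OF g(4), of "\<lambda>h. fst h q"] arg_cong[OF g(4), of "\<lambda>h. snd h q a"] that by auto
  have pY: "q \<in> W \<Longrightarrow> q \<in> pts Y" for q using assms(4) openin_subset by blast
  have pp: "p \<in> preim X f W \<longleftrightarrow> p \<in> pts X \<and> fst f p \<in> W" for p by (auto simp: preim_def)
  have img: "fst g q \<in> preim X f W" if "q \<in> W" for q
    using that pp fg(1)[OF pY[OF that]] mor_pt[OF g(2) pY[OF that]] by simp
  show ?thesis
  proof (rule isomorphismI)
    show "morphism X' Y' (mcomp X' Y f (id_mor X'))"
      unfolding Y'_def morphism_open_sub_iff[OF assms(4,3)]
      using mor_restrict[OF assms(2,3) o g(1)] pX(1) by (auto simp: X'_def[symmetric] pp)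
    show "morphism Y' X' (mcomp Y' X g (id_mor Y'))"
      unfolding X'_def morphism_open_sub_iff[OF o assms(2)]
      using mor_restrict[OF assms(3,2,4) g(2)] by (simp add: Y'_def[symmetric] pX(2) image_subset_iff img)
    have st: "stalk X' = stalk X" "stalk Y' = stalk Y" by (simp_all add: X'_def Y'_def)
    show "mcomp X' X' (mcomp Y' X g (id_mor Y')) (mcomp X' Y f (id_mor X')) = id_mor X'"
      using pX by (auto simp: mcomp_def id_mor_def fun_eq_iff restrict_def pp gf st mor_closed[OF g(1)] mor_closed[OF g(2)] mor_pt[OF g(1)])
    show "mcomp Y' Y' (mcomp X' Y f (id_mor X')) (mcomp Y' X g (id_mor Y')) = id_mor Y'"
      using pX by (auto simp: mcomp_def id_mor_def fun_eq_iff restrict_def pp fg st pY mor_closed[OF g(1)] mor_closed[OF g(2)] mor_pt[OF g(2)])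
  qed
qed

section \<open>Localization\<close>

lemma UN_const_eq: "x \<in> X \<Longrightarrow> (\<And>y. y \<in> X \<Longrightarrow> f y = c) \<Longrightarrow> (\<Union>y\<in>X. f y) = c"
  by auto

locale mult_loc =
  fixes A :: "('a, 'k::field) kalg" (structure) and S :: "'a set"
  assumes kalg: "kalgebra A" and sub: "S \<subseteq> carrier A" and one_S: "\<one> \<in> S"
    and mult_S: "s \<in> S \<Longrightarrow> t \<in> S \<Longrightarrow> s \<otimes> t \<in> S"

sublocale mult_loc \<subseteq> cring A
  using kalg by (rule kalg_cring)

context mult_loc
begin

abbreviation "fr \<equiv> frac A S"
abbreviation "L \<equiv> localization A S"

lemma S_carrier: "s \<in> S \<Longrightarrow> s \<in> carrier A"
  using sub by blast

lemma frac_mem_iff: "(b, t) \<in> fr a s \<longleftrightarrow> b \<in> carrier A \<and> t \<in> S \<and> (\<exists>u\<in>S. u \<otimes> (a \<otimes> t) = u \<otimes> (b \<otimes> s))"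
  by (simp add: frac_def)

lemma frac_rel_trans:
  assumes "a \<in> carrier A" "b \<in> carrier A" "c \<in> carrier A" "s \<in> S" "t \<in> S" "r \<in> S"
    "\<exists>u\<in>S. u \<otimes> (a \<otimes> t) = u \<otimes> (b \<otimes> s)" "\<exists>u\<in>S. u \<otimes> (b \<otimes> r) = u \<otimes> (c \<otimes> t)"
  shows "\<exists>u\<in>S. u \<otimes> (a \<otimes> r) = u \<otimes> (c \<otimes> s)"
proof -
  obtain u v where uv: "u \<in> S" "v \<in> S" "u \<otimes> (a \<otimes> t) = u \<otimes> (b \<otimes> s)" "v \<otimes> (b \<otimes> r) = v \<otimes> (c \<otimes> t)"
    using assms by blast
  note c = assms(1-3) S_carrier[OF assms(4)] S_carrier[OF assms(5)] S_carrier[OF assms(6)] S_carrier[OF uv(1)] S_carrier[OF uv(2)]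
  have "(u \<otimes> v \<otimes> t) \<otimes> (a \<otimes> r) = (u \<otimes> (a \<otimes> t)) \<otimes> (v \<otimes> r)" using c by (simp add: m_ac)
  also have "\<dots> = (u \<otimes> (b \<otimes> s)) \<otimes> (v \<otimes> r)" using uv by simp
  also have "\<dots> = (v \<otimes> (b \<otimes> r)) \<otimes> (u \<otimes> s)" using c by (simp add: m_ac)
  also have "\<dots> = (v \<otimes> (c \<otimes> t)) \<otimes> (u \<otimes> s)" using uv by simp
  also have "\<dots> = (u \<otimes> v \<otimes> t) \<otimes> (c \<otimes> s)" using c by (simp add: m_ac)
  finally show ?thesis using mult_S uv assms(5) by (intro bexI[of _ "u \<otimes> v \<otimes> t"]) auto
qed

lemma frac_eq_iff:
  assumes "a \<in> carrier A" "b \<in> carrier A" "s \<in> S" "t \<in> S"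
  shows "fr a s = fr b t \<longleftrightarrow> (\<exists>u\<in>S. u \<otimes> (a \<otimes> t) = u \<otimes> (b \<otimes> s))"
proof
  assume e: "fr a s = fr b t"
  have "(b, t) \<in> fr b t" using assms one_S by (auto simp: frac_mem_iff)
  then show "\<exists>u\<in>S. u \<otimes> (a \<otimes> t) = u \<otimes> (b \<otimes> s)" unfolding e[symmetric] by (simp add: frac_mem_iff)
next
  assume r: "\<exists>u\<in>S. u \<otimes> (a \<otimes> t) = u \<otimes> (b \<otimes> s)"
  then have r': "\<exists>u\<in>S. u \<otimes> (b \<otimes> s) = u \<otimes> (a \<otimes> t)" by metis
  have "(c, q) \<in> fr a s \<longleftrightarrow> (c, q) \<in> fr b t" for c q
    unfolding frac_mem_iff using frac_rel_trans[OF assms(2,1) _ assms(4,3) _ r'] frac_rel_trans[OF assms(1,2) _ assms(3,4) _ r]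
    by metis
  note eq = this
  show "fr a s = fr b t"
  proof (rule Set.set_eqI)
    fix z show "z \<in> fr a s \<longleftrightarrow> z \<in> fr b t" by (cases z) (simp only: eq)
  qed
qed

lemma frac_memD: "(b, t) \<in> fr a s \<Longrightarrow> a \<in> carrier A \<Longrightarrow> s \<in> S \<Longrightarrow> b \<in> carrier A \<and> t \<in> S \<and> fr b t = fr a s"
  using frac_eq_iff[of a b s t] by (auto simp: frac_mem_iff)

lemma frac_self: "a \<in> carrier A \<Longrightarrow> s \<in> S \<Longrightarrow> (a, s) \<in> fr a s"
  using one_S by (auto simp: frac_mem_iff)

lemma frac_cancel:
  assumes "a \<in> carrier A" "s \<in> S" "u \<in> S" shows "fr (a \<otimes> u) (s \<otimes> u) = fr a s"
  using assms S_carrier one_S mult_S by (subst frac_eq_iff) (auto simp: m_ac intro!: bexI[of _ \<one>])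

text \<open>Independence of the representative of the first operand. The second operand is treated
  in \<open>loc_mult\<close> and \<open>loc_add\<close> by exchanging the two operands.\<close>

lemma frac_mult_cong:
  assumes "a \<in> carrier A" "s \<in> S" "b \<in> carrier A" "t \<in> S" "a' \<in> carrier A" "s' \<in> S" "fr a s = fr a' s'"
  shows "fr (a \<otimes> b) (s \<otimes> t) = fr (a' \<otimes> b) (s' \<otimes> t)"
    "fr ((a \<otimes> t) \<oplus> (b \<otimes> s)) (s \<otimes> t) = fr ((a' \<otimes> t) \<oplus> (b \<otimes> s')) (s' \<otimes> t)"
proof -
  obtain u where u: "u \<in> S" "u \<otimes> (a \<otimes> s') = u \<otimes> (a' \<otimes> s)" using frac_eq_iff assms by metis
  note c = assms(1,3,5) S_carrier[OF assms(2)] S_carrier[OF assms(4)] S_carrier[OF assms(6)] S_carrier[OF u(1)]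
  have "u \<otimes> ((a \<otimes> b) \<otimes> (s' \<otimes> t)) = (u \<otimes> (a \<otimes> s')) \<otimes> (b \<otimes> t)" using c by (simp add: m_ac)
  also have "\<dots> = u \<otimes> ((a' \<otimes> b) \<otimes> (s \<otimes> t))" unfolding u(2) using c by (simp add: m_ac)
  finally show "fr (a \<otimes> b) (s \<otimes> t) = fr (a' \<otimes> b) (s' \<otimes> t)"
    using u c mult_S assms by (subst frac_eq_iff) auto
  have "u \<otimes> (((a \<otimes> t) \<oplus> (b \<otimes> s)) \<otimes> (s' \<otimes> t)) = (u \<otimes> (a \<otimes> s')) \<otimes> (t \<otimes> t) \<oplus> u \<otimes> b \<otimes> s \<otimes> s' \<otimes> t"
    using c by (simp add: m_ac l_distr r_distr)
  also have "\<dots> = u \<otimes> (((a' \<otimes> t) \<oplus> (b \<otimes> s')) \<otimes> (s \<otimes> t))" unfolding u(2) using c by (simp add: m_ac l_distr r_distr)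
  finally show "fr ((a \<otimes> t) \<oplus> (b \<otimes> s)) (s \<otimes> t) = fr ((a' \<otimes> t) \<oplus> (b \<otimes> s')) (s' \<otimes> t)"
    using u c mult_S assms by (subst frac_eq_iff) auto
qed

lemma loc_carrier: "x \<in> carrier L \<longleftrightarrow> (\<exists>a\<in>carrier A. \<exists>s\<in>S. x = fr a s)"
  by (auto simp: localization_def)

lemma loc_one: "\<one>\<^bsub>L\<^esub> = fr \<one> \<one>" and loc_zero: "\<zero>\<^bsub>L\<^esub> = fr \<zero> \<one>" and loc_scal: "scal L c = fr (scal A c) \<one>"
  by (simp_all add: localization_def)

lemma loc_mult:
  assumes "a \<in> carrier A" "b \<in> carrier A" "s \<in> S" "t \<in> S"
  shows "fr a s \<otimes>\<^bsub>L\<^esub> fr b t = fr (a \<otimes> b) (s \<otimes> t)"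
proof -
  have 1: "(\<Union>(b', t')\<in>fr b t. fr (a' \<otimes> b') (s' \<otimes> t')) = fr (a \<otimes> b) (s \<otimes> t)" if "(a', s') \<in> fr a s" for a' s'
  proof (rule UN_const_eq[OF frac_self[OF assms(2,4)]], clarify)
    fix b' t' assume "(b', t') \<in> fr b t"
    note b = frac_memD[OF this assms(2,4)] and a = frac_memD[OF that assms(1,3)]
    have "fr (a' \<otimes> b') (s' \<otimes> t') = fr (a \<otimes> b') (s \<otimes> t')" using a b assms by (intro frac_mult_cong) auto
    also have "\<dots> = fr (b' \<otimes> a) (t' \<otimes> s)" using a b assms S_carrier by (simp add: m_comm)
    also have "\<dots> = fr (b \<otimes> a) (t \<otimes> s)" using a b assms by (intro frac_mult_cong) auto
    also have "\<dots> = fr (a \<otimes> b) (s \<otimes> t)" using a b assms S_carrier by (simp add: m_comm)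
    finally show "fr (a' \<otimes> b') (s' \<otimes> t') = fr (a \<otimes> b) (s \<otimes> t)" .
  qed
  show ?thesis unfolding localization_def monoid.simps
    by (rule UN_const_eq[OF frac_self[OF assms(1,3)]]) (use 1 in blast)
qed

lemma loc_add:
  assumes "a \<in> carrier A" "b \<in> carrier A" "s \<in> S" "t \<in> S"
  shows "fr a s \<oplus>\<^bsub>L\<^esub> fr b t = fr ((a \<otimes> t) \<oplus> (b \<otimes> s)) (s \<otimes> t)"
proof -
  have 1: "(\<Union>(b', t')\<in>fr b t. fr ((a' \<otimes> t') \<oplus> (b' \<otimes> s')) (s' \<otimes> t')) = fr ((a \<otimes> t) \<oplus> (b \<otimes> s)) (s \<otimes> t)"
    if "(a', s') \<in> fr a s" for a' s'
  proof (rule UN_const_eq[OF frac_self[OF assms(2,4)]], clarify)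
    fix b' t' assume "(b', t') \<in> fr b t"
    note b = frac_memD[OF this assms(2,4)] and a = frac_memD[OF that assms(1,3)]
    have "fr ((a' \<otimes> t') \<oplus> (b' \<otimes> s')) (s' \<otimes> t') = fr ((a \<otimes> t') \<oplus> (b' \<otimes> s)) (s \<otimes> t')"
      using a b assms by (intro frac_mult_cong) auto
    also have "\<dots> = fr ((b' \<otimes> s) \<oplus> (a \<otimes> t')) (t' \<otimes> s)" using a b assms S_carrier by (simp add: m_comm a_comm)
    also have "\<dots> = fr ((b \<otimes> s) \<oplus> (a \<otimes> t)) (t \<otimes> s)" using a b assms by (intro frac_mult_cong) auto
    also have "\<dots> = fr ((a \<otimes> t) \<oplus> (b \<otimes> s)) (s \<otimes> t)" using a b assms S_carrier by (simp add: m_comm a_comm)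
    finally show "fr ((a' \<otimes> t') \<oplus> (b' \<otimes> s')) (s' \<otimes> t') = fr ((a \<otimes> t) \<oplus> (b \<otimes> s)) (s \<otimes> t)" .
  qed
  show ?thesis unfolding localization_def ring.simps
    by (rule UN_const_eq[OF frac_self[OF assms(1,3)]]) (use 1 in blast)
qed

lemma frac_zero: "s \<in> S \<Longrightarrow> fr \<zero> s = fr \<zero> \<one>"
  using one_S S_carrier by (subst frac_eq_iff) (auto intro!: bexI[of _ \<one>])

lemma loc_kalgebra: "kalgebra L"
proof (rule kalgebraI)
  show "cring L"
  proof (intro cringI abelian_groupI comm_monoidI)
    fix x y assume "x \<in> carrier L" "y \<in> carrier L"
    then obtain a s b t where x: "x = fr a s" "y = fr b t" "a \<in> carrier A" "s \<in> S" "b \<in> carrier A" "t \<in> S"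
      unfolding loc_carrier by blast
    then have c: "s \<in> carrier A" "t \<in> carrier A" "s \<otimes> t \<in> S" using S_carrier mult_S by auto
    show "x \<oplus>\<^bsub>L\<^esub> y \<in> carrier L" "x \<otimes>\<^bsub>L\<^esub> y \<in> carrier L"
      unfolding loc_carrier x(1,2) using x c loc_add loc_mult by (metis a_closed m_closed)+
    show "x \<oplus>\<^bsub>L\<^esub> y = y \<oplus>\<^bsub>L\<^esub> x" "x \<otimes>\<^bsub>L\<^esub> y = y \<otimes>\<^bsub>L\<^esub> x"
      unfolding x(1,2) using x c by (simp_all add: loc_add loc_mult m_comm a_comm)
    fix z assume "z \<in> carrier L"
    then obtain d r where z: "z = fr d r" "d \<in> carrier A" "r \<in> S" unfolding loc_carrier by blast
    then have r: "r \<in> carrier A" "s \<otimes> r \<in> S" "t \<otimes> r \<in> S" using S_carrier mult_S x by auto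
    show "x \<oplus>\<^bsub>L\<^esub> y \<oplus>\<^bsub>L\<^esub> z = x \<oplus>\<^bsub>L\<^esub> (y \<oplus>\<^bsub>L\<^esub> z)" "x \<otimes>\<^bsub>L\<^esub> y \<otimes>\<^bsub>L\<^esub> z = x \<otimes>\<^bsub>L\<^esub> (y \<otimes>\<^bsub>L\<^esub> z)"
      unfolding x(1,2) z(1) using x z c r by (simp_all add: loc_add loc_mult m_ac a_ac l_distr r_distr)
    have "(x \<oplus>\<^bsub>L\<^esub> y) \<otimes>\<^bsub>L\<^esub> z = fr (((a \<otimes> t) \<oplus> (b \<otimes> s)) \<otimes> d) (s \<otimes> t \<otimes> r)"
      unfolding x(1,2) z(1) using x z c r by (simp add: loc_add loc_mult)
    \<comment> \<open>The two sides of the distributive law arise with the denominators s t r and (s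
      r) (t r); expanding by \<open>r\<close> makes them comparable.\<close>
    also have "\<dots> = fr ((((a \<otimes> t) \<oplus> (b \<otimes> s)) \<otimes> d) \<otimes> r) ((s \<otimes> t \<otimes> r) \<otimes> r)"
      using x z c r mult_S by (subst frac_cancel) auto
    also have "\<dots> = x \<otimes>\<^bsub>L\<^esub> z \<oplus>\<^bsub>L\<^esub> y \<otimes>\<^bsub>L\<^esub> z"
      unfolding x(1,2) z(1) using x z c r by (simp add: loc_add loc_mult m_ac l_distr r_distr)
    finally show "(x \<oplus>\<^bsub>L\<^esub> y) \<otimes>\<^bsub>L\<^esub> z = x \<otimes>\<^bsub>L\<^esub> z \<oplus>\<^bsub>L\<^esub> y \<otimes>\<^bsub>L\<^esub> z" .
  next
    fix x assume "x \<in> carrier L"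
    then obtain a s where x: "x = fr a s" "a \<in> carrier A" "s \<in> S" unfolding loc_carrier by blast
    then have c: "s \<in> carrier A" "s \<otimes> s \<in> S" using S_carrier mult_S by auto
    show "\<zero>\<^bsub>L\<^esub> \<oplus>\<^bsub>L\<^esub> x = x" "\<one>\<^bsub>L\<^esub> \<otimes>\<^bsub>L\<^esub> x = x"
      unfolding x(1) loc_zero loc_one using x c one_S by (simp_all add: loc_add loc_mult)
    have "fr (\<ominus> a) s \<oplus>\<^bsub>L\<^esub> x = \<zero>\<^bsub>L\<^esub>"
      unfolding x(1) loc_zero using x c by (simp add: loc_add l_minus l_neg frac_zero)
    then show "\<exists>y\<in>carrier L. y \<oplus>\<^bsub>L\<^esub> x = \<zero>\<^bsub>L\<^esub>"
      using x unfolding loc_carrier by (intro bexI[of _ "fr (\<ominus> a) s"]) (auto simp: loc_carrier)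
  qed (use one_S in \<open>auto simp: loc_carrier loc_zero loc_one\<close>)
qed (use one_S kalg_scal_closed[OF kalg] in \<open>auto simp: loc_carrier loc_scal loc_one kalg_scal_one[OF kalg]
     kalg_scal_add[OF kalg] kalg_scal_mult[OF kalg] loc_add loc_mult\<close>)

lemma loc_cring: "cring L"
  by (rule kalg_cring[OF loc_kalgebra])

lemma loc_hom: "(\<lambda>a. fr a \<one>) \<in> alg_hom A L"
  using one_S by (intro alg_homI) (auto simp: loc_carrier loc_mult loc_add loc_scal loc_one)

lemma loc_uminus: 
  assumes "a \<in> carrier A" "s \<in> S" shows "\<ominus>\<^bsub>L\<^esub> fr a s = fr (\<ominus> a) s"
proof -
  interpret L: cring L by (rule loc_cring)
  have "fr (\<ominus> a) s \<oplus>\<^bsub>L\<^esub> fr a s = \<zero>\<^bsub>L\<^esub>"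
    unfolding loc_zero using assms S_carrier mult_S by (simp add: loc_add l_minus l_neg frac_zero)
  then show ?thesis using assms by (intro L.minus_equality) (auto simp: loc_carrier)
qed

lemma loc_diff:
  assumes "a \<in> carrier A" "b \<in> carrier A" "s \<in> S" "t \<in> S"
  shows "fr a s \<ominus>\<^bsub>L\<^esub> fr b t = fr ((a \<otimes> t) \<ominus> (b \<otimes> s)) (s \<otimes> t)"
  using assms S_carrier by (simp add: a_minus_def loc_uminus loc_add l_minus)

lemma loc_den_inverse:
  assumes "s \<in> S" shows "fr s \<one> \<in> Units L" "inv\<^bsub>L\<^esub> (fr s \<one>) = fr \<one> s"
proof -
  interpret L: cring L by (rule loc_cring)
  have c: "fr s \<one> \<in> carrier L" "fr \<one> s \<in> carrier L" using assms S_carrier one_S by (auto simp: loc_carrier)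
  have "fr s \<one> \<otimes>\<^bsub>L\<^esub> fr \<one> s = fr (\<one> \<otimes> s) (\<one> \<otimes> s)" using assms S_carrier one_S by (simp add: loc_mult)
  also have "\<dots> = \<one>\<^bsub>L\<^esub>" unfolding loc_one using assms one_S by (intro frac_cancel) auto
  finally have e: "fr s \<one> \<otimes>\<^bsub>L\<^esub> fr \<one> s = \<one>\<^bsub>L\<^esub>" .
  then show "fr s \<one> \<in> Units L" using c L.m_comm[OF c] unfolding Units_def by auto
  show "inv\<^bsub>L\<^esub> (fr s \<one>) = fr \<one> s" using L.comm_inv_char[OF c e] by simp
qed

lemma frac_split:
  assumes "a \<in> carrier A" "s \<in> S" shows "fr a s = fr a \<one> \<otimes>\<^bsub>L\<^esub> inv\<^bsub>L\<^esub> (fr s \<one>)"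
  using assms one_S S_carrier by (simp add: loc_den_inverse loc_mult)

end

text \<open>The universal property of localization. The description denotes a unique value as soon
  as \<open>h\<close> maps \<open>S\<close> to units, which is \<open>llift_frac\<close>.\<close>

definition llift :: "('a, 'k) kalg \<Rightarrow> 'a set \<Rightarrow> ('b, 'k) kalg \<Rightarrow> ('a \<Rightarrow> 'b) \<Rightarrow> ('a \<times> 'a) set \<Rightarrow> 'b" where
  "llift A S R h x = (THE y. \<exists>a\<in>carrier A. \<exists>s\<in>S. x = frac A S a s \<and> y = h a \<otimes>\<^bsub>R\<^esub> inv\<^bsub>R\<^esub> (h s))"

lemma (in cring) unit_frac_eq_iff:
  assumes "a \<in> carrier R" "b \<in> carrier R" "s \<in> Units R" "t \<in> Units R"
  shows "a \<otimes> inv s = b \<otimes> inv t \<longleftrightarrow> a \<otimes> t = b \<otimes> s"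
proof -
  have c: "s \<in> carrier R" "t \<in> carrier R" "inv s \<in> carrier R" "inv t \<in> carrier R" using assms by auto
  have "a \<otimes> t = (a \<otimes> inv s) \<otimes> (s \<otimes> t)" if True using assms c by (simp add: m_assoc flip: m_assoc[of "inv s" s t])
  moreover have "b \<otimes> s = (b \<otimes> inv t) \<otimes> (s \<otimes> t)"
    using assms c by (simp add: m_comm[of s t] m_assoc flip: m_assoc[of "inv t" t s])
  moreover have "s \<otimes> t \<in> Units R" using assms by simp
  ultimately show ?thesis
    using assms c by (metis Units_r_inv m_assoc m_closed r_one Units_inv_closed)
qed

context mult_loc begin

lemma llift_frac:
  assumes h: "h \<in> alg_hom A R" and R: "cring R" and u: "\<And>s. s \<in> S \<Longrightarrow> h s \<in> Units R"
    and as: "a \<in> carrier A" "s \<in> S"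
  shows "llift A S R h (fr a s) = h a \<otimes>\<^bsub>R\<^esub> inv\<^bsub>R\<^esub> (h s)"
  unfolding llift_def
proof (rule the_equality)
  interpret R: cring R by fact
  show "\<exists>b\<in>carrier A. \<exists>t\<in>S. fr a s = fr b t \<and> h a \<otimes>\<^bsub>R\<^esub> inv\<^bsub>R\<^esub> (h s) = h b \<otimes>\<^bsub>R\<^esub> inv\<^bsub>R\<^esub> (h t)"
    using as by blast
  fix y assume "\<exists>b\<in>carrier A. \<exists>t\<in>S. fr a s = fr b t \<and> y = h b \<otimes>\<^bsub>R\<^esub> inv\<^bsub>R\<^esub> (h t)"
  then obtain b t where b: "b \<in> carrier A" "t \<in> S" "fr a s = fr b t" "y = h b \<otimes>\<^bsub>R\<^esub> inv\<^bsub>R\<^esub> (h t)" by blast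
  then obtain v where v: "v \<in> S" "v \<otimes> (a \<otimes> t) = v \<otimes> (b \<otimes> s)" using frac_eq_iff as by metis
  note c = S_carrier[OF v(1)] S_carrier[OF as(2)] S_carrier[OF b(2)] as(1) b(1)
  have "h v \<otimes>\<^bsub>R\<^esub> (h a \<otimes>\<^bsub>R\<^esub> h t) = h v \<otimes>\<^bsub>R\<^esub> (h b \<otimes>\<^bsub>R\<^esub> h s)"
    using arg_cong[OF v(2), of h] c by (simp add: alg_hom_mult[OF h])
  then have "h a \<otimes>\<^bsub>R\<^esub> h t = h b \<otimes>\<^bsub>R\<^esub> h s"
    using u[OF v(1)] c alg_hom_closed[OF h] by (subst (asm) R.Units_l_cancel) auto
  then have "h a \<otimes>\<^bsub>R\<^esub> inv\<^bsub>R\<^esub> (h s) = h b \<otimes>\<^bsub>R\<^esub> inv\<^bsub>R\<^esub> (h t)"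
    using c alg_hom_closed[OF h] u as b by (subst R.unit_frac_eq_iff) auto
  then show "y = h a \<otimes>\<^bsub>R\<^esub> inv\<^bsub>R\<^esub> (h s)" using b by simp
qed

lemma llift_hom:
  assumes h: "h \<in> alg_hom A R" and R: "cring R" and u: "\<And>s. s \<in> S \<Longrightarrow> h s \<in> Units R"
  shows "llift A S R h \<in> alg_hom L R"
proof -
  interpret R: cring R by fact
  note ll = llift_frac[OF h R u]
  note hh = alg_hom_closed[OF h] alg_hom_mult[OF h] alg_hom_add[OF h] alg_hom_one[OF h] alg_hom_scal[OF h]
  have sc: "scal R c \<in> carrier R" for c
    using hh(1)[OF kalg_scal_closed[OF kalg], of c] by (simp add: hh(5))
  have inv: "inv\<^bsub>R\<^esub> (h s) \<in> carrier R" "h s \<in> carrier R" "h s \<otimes>\<^bsub>R\<^esub> inv\<^bsub>R\<^esub> (h s) = \<one>\<^bsub>R\<^esub>" if "s \<in> S" for s using u[OF that] by auto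
  show ?thesis
  proof (rule alg_homI)
    fix x y assume "x \<in> carrier L" "y \<in> carrier L"
    then obtain a s b t where x: "x = fr a s" "y = fr b t" "a \<in> carrier A" "s \<in> S" "b \<in> carrier A" "t \<in> S"
      unfolding loc_carrier by blast
    have c: "s \<in> carrier A" "t \<in> carrier A" "h a \<in> carrier R" "h b \<in> carrier R" using x S_carrier hh by auto
    note i = inv[OF x(4)] inv[OF x(6)]
    have st: "inv\<^bsub>R\<^esub> (h (s \<otimes> t)) = inv\<^bsub>R\<^esub> (h s) \<otimes>\<^bsub>R\<^esub> inv\<^bsub>R\<^esub> (h t)"
    proof (rule R.comm_inv_char)
      have "h (s \<otimes> t) \<otimes>\<^bsub>R\<^esub> (inv\<^bsub>R\<^esub> (h s) \<otimes>\<^bsub>R\<^esub> inv\<^bsub>R\<^esub> (h t)) =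
          (h s \<otimes>\<^bsub>R\<^esub> inv\<^bsub>R\<^esub> (h s)) \<otimes>\<^bsub>R\<^esub> (h t \<otimes>\<^bsub>R\<^esub> inv\<^bsub>R\<^esub> (h t))"
        using c i(1,2,4,5) by (simp add: hh(2) R.m_ac)
      then show "h (s \<otimes> t) \<otimes>\<^bsub>R\<^esub> (inv\<^bsub>R\<^esub> (h s) \<otimes>\<^bsub>R\<^esub> inv\<^bsub>R\<^esub> (h t)) = \<one>\<^bsub>R\<^esub>" using i by simp
    qed (use c i in \<open>auto simp: hh(1)\<close>)
    note st' = st[unfolded alg_hom_mult[OF h c(1,2)]]
    show "llift A S R h (x \<otimes>\<^bsub>L\<^esub> y) = llift A S R h x \<otimes>\<^bsub>R\<^esub> llift A S R h y"
      unfolding x(1,2) using x c i(1,2,4,5) by (simp add: loc_mult ll mult_S st' hh(2) R.m_ac)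
    have "llift A S R h (x \<oplus>\<^bsub>L\<^esub> y) = (h a \<otimes>\<^bsub>R\<^esub> h t \<oplus>\<^bsub>R\<^esub> h b \<otimes>\<^bsub>R\<^esub> h s) \<otimes>\<^bsub>R\<^esub> (inv\<^bsub>R\<^esub> (h s) \<otimes>\<^bsub>R\<^esub> inv\<^bsub>R\<^esub> (h t))"
      unfolding x(1,2) using x c by (simp add: loc_add ll mult_S st' hh(2,3))
    also have "\<dots> = (h a \<otimes>\<^bsub>R\<^esub> inv\<^bsub>R\<^esub> (h s)) \<otimes>\<^bsub>R\<^esub> (h t \<otimes>\<^bsub>R\<^esub> inv\<^bsub>R\<^esub> (h t)) \<oplus>\<^bsub>R\<^esub> (h b \<otimes>\<^bsub>R\<^esub> inv\<^bsub>R\<^esub> (h t)) \<otimes>\<^bsub>R\<^esub> (h s \<otimes>\<^bsub>R\<^esub> inv\<^bsub>R\<^esub> (h s))"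
      using c i(1,2,4,5) by (simp add: R.l_distr R.r_distr R.m_ac)
    also have "\<dots> = llift A S R h x \<oplus>\<^bsub>R\<^esub> llift A S R h y" unfolding x(1,2) using x c i by (simp add: ll)
    finally show "llift A S R h (x \<oplus>\<^bsub>L\<^esub> y) = llift A S R h x \<oplus>\<^bsub>R\<^esub> llift A S R h y" .
  next
    show "llift A S R h x \<in> carrier R" if "x \<in> carrier L" for x
      using that inv hh(1) by (auto simp: loc_carrier ll)
  qed (use one_S inv[OF one_S] kalg_scal_closed[OF kalg] hh(1) in \<open>auto simp: loc_scal loc_one ll hh(4,5) sc kalg_scal_closed[OF kalg]\<close>)
qed

end

section \<open>The spectrum\<close>

locale kalg_ring =
  fixes A :: "('a, 'k::field) kalg" (structure)
  assumes kalg: "kalgebra A"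

sublocale kalg_ring \<subseteq> cring A
  using kalg by (rule kalg_cring)

context kalg_ring begin

definition "basic f = {P. primeideal P A \<and> f \<notin> P}"

lemma prime_loc: "primeideal P A \<Longrightarrow> mult_loc A (carrier A - P)"
proof
  assume P: "primeideal P A"
  interpret P: primeideal P A by fact
  show "\<one> \<in> carrier A - P" using P.one_imp_carrier P.I_notcarr by auto
  show "s \<otimes> t \<in> carrier A - P" if "s \<in> carrier A - P" "t \<in> carrier A - P" for s t
    using that P.I_prime by auto
qed (use kalg in auto)

lemma zariski_istopology: "istopology (\<lambda>W. \<exists>E \<subseteq> carrier A. W = {P. primeideal P A \<and> \<not> E \<subseteq> P})"
  unfolding istopology_def
proof (intro conjI allI impI)
  fix V W assume "\<exists>E \<subseteq> carrier A. V = {P. primeideal P A \<and> \<not> E \<subseteq> P}" "\<exists>E \<subseteq> carrier A. W = {P. primeideal P A \<and> \<not> E \<subseteq> P}"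
  then obtain E F where E: "E \<subseteq> carrier A" "V = {P. primeideal P A \<and> \<not> E \<subseteq> P}"
    and F: "F \<subseteq> carrier A" "W = {P. primeideal P A \<and> \<not> F \<subseteq> P}" by blast
  let ?G = "{e \<otimes> f | e f. e \<in> E \<and> f \<in> F}"
  have "(\<not> E \<subseteq> P \<and> \<not> F \<subseteq> P) = (\<not> ?G \<subseteq> P)" if P: "primeideal P A" for P
  proof -
    interpret P: primeideal P A by fact
    show ?thesis
    proof
      assume "\<not> E \<subseteq> P \<and> \<not> F \<subseteq> P"
      then obtain e f where ef: "e \<in> E" "f \<in> F" "e \<notin> P" "f \<notin> P" by blast
      then have "e \<otimes> f \<notin> P" using P.I_prime E(1) F(1) by blast
      then show "\<not> ?G \<subseteq> P" using ef by blast
    next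
      assume "\<not> ?G \<subseteq> P"
      then obtain e f where ef: "e \<in> E" "f \<in> F" "e \<otimes> f \<notin> P" by blast
      then have "e \<notin> P" "f \<notin> P" using P.I_l_closed[of f e] P.I_r_closed[of e f] E(1) F(1) by blast+
      then show "\<not> E \<subseteq> P \<and> \<not> F \<subseteq> P" using ef by blast
    qed
  qed
  then show "\<exists>E \<subseteq> carrier A. V \<inter> W = {P. primeideal P A \<and> \<not> E \<subseteq> P}"
    using E F by (intro exI[of _ ?G]) blast
next
  fix K assume "\<forall>W\<in>K. \<exists>E \<subseteq> carrier A. W = {P. primeideal P A \<and> \<not> E \<subseteq> P}"
  then obtain E where "\<And>W. W \<in> K \<Longrightarrow> E W \<subseteq> carrier A \<and> W = {P. primeideal P A \<and> \<not> E W \<subseteq> P}" by metis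
  then show "\<exists>E \<subseteq> carrier A. \<Union>K = {P. primeideal P A \<and> \<not> E \<subseteq> P}"
    by (intro exI[of _ "\<Union>(E ` K)"]) blast
qed

lemma openin_zariski: "openin (zariski A) W \<longleftrightarrow> (\<exists>E \<subseteq> carrier A. W = {P. primeideal P A \<and> \<not> E \<subseteq> P})"
  unfolding zariski_def topology_inverse'[OF zariski_istopology] ..

lemma topspace_zariski: "topspace (zariski A) = {P. primeideal P A}"
proof
  show "topspace (zariski A) \<subseteq> {P. primeideal P A}"
    unfolding topspace_def openin_zariski by blast
  have "\<not> {\<one>} \<subseteq> P" if "primeideal P A" for P
    using mult_loc.one_S[OF prime_loc[OF that]] by blast
  then have "openin (zariski A) {P. primeideal P A}"
    unfolding openin_zariski by (intro exI[of _ "{\<one>}"]) auto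
  then show "{P. primeideal P A} \<subseteq> topspace (zariski A)" by (rule openin_subset)
qed

lemma openin_basic: "f \<in> carrier A \<Longrightarrow> openin (zariski A) (basic f)"
  unfolding openin_zariski basic_def by (intro exI[of _ "{f}"]) auto

lemma basic_subset:
  assumes "openin (zariski A) W" "P \<in> W" shows "\<exists>f\<in>carrier A. f \<notin> P \<and> basic f \<subseteq> W"
  using assms unfolding openin_zariski basic_def by blast

lemma Spec_simps [simp]: "tspace (Spec A) = zariski A" "stalk (Spec A) = stalk_at A"
  by (simp_all add: Spec_def)

lemma Spec_pts: "pts (Spec A) = {P. primeideal P A}"
  by (simp add: topspace_zariski)

lemma openin_prime: "openin (zariski A) W \<Longrightarrow> P \<in> W \<Longrightarrow> primeideal P A"
  unfolding openin_zariski by blast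

text \<open>An inverse b/t of a/1 yields u (a b) = u t with \<open>u\<close> and \<open>t\<close>
  outside \<open>P\<close>, impossible for \<open>a\<close> in \<open>P\<close>. Vanishing of a
  function at a point of the spectrum thereby becomes membership in the prime ideal, the form in
  which all zero sets below are computed.\<close>

lemma stalk_unit_iff:
  assumes P: "primeideal P A" and "a \<in> carrier A" "s \<in> carrier A - P"
  shows "frac A (carrier A - P) a s \<in> Units (stalk_at A P) \<longleftrightarrow> a \<notin> P"
proof -
  interpret P: primeideal P A by fact
  interpret mult_loc A "carrier A - P" by (rule prime_loc[OF P])
  interpret L: cring L by (rule loc_cring)
  have "fr a \<one> \<in> Units L \<longleftrightarrow> a \<notin> P"
  proof
    assume "fr a \<one> \<in> Units L"
    then have "inv\<^bsub>L\<^esub> (fr a \<one>) \<in> carrier L" "fr a \<one> \<otimes>\<^bsub>L\<^esub> inv\<^bsub>L\<^esub> (fr a \<one>) = \<one>\<^bsub>L\<^esub>" by auto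
    then obtain b t where b: "b \<in> carrier A" "t \<in> carrier A - P" "fr a \<one> \<otimes>\<^bsub>L\<^esub> fr b t = \<one>\<^bsub>L\<^esub>"
      unfolding loc_carrier by metis
    then have "fr (a \<otimes> b) (\<one> \<otimes> t) = fr \<one> \<one>" using assms(2) one_S by (simp add: loc_mult loc_one)
    then obtain u where u: "u \<in> carrier A - P" "u \<otimes> (a \<otimes> b \<otimes> \<one>) = u \<otimes> (\<one> \<otimes> (\<one> \<otimes> t))"
      using frac_eq_iff[of "a \<otimes> b" \<one> "\<one> \<otimes> t" \<one>] b assms(2) one_S by auto
    show "a \<notin> P"
    proof
      assume "a \<in> P"
      then have "u \<otimes> (a \<otimes> b) \<in> P" using u b by (intro P.I_l_closed P.I_r_closed) auto
      moreover have "u \<otimes> (a \<otimes> b) = u \<otimes> t" using u b assms(2) by simp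
      ultimately have "u \<otimes> t \<in> P" by simp
      then show False using mult_S[OF u(1) b(2)] by simp
    qed
  next
    assume "a \<notin> P" then show "fr a \<one> \<in> Units L" using loc_den_inverse(1)[of a] assms(2) by simp
  qed
  moreover have "fr a s \<in> Units L \<longleftrightarrow> fr a \<one> \<in> Units L"
  proof -
    have "fr a \<one> \<in> carrier L" "inv\<^bsub>L\<^esub> fr s \<one> \<in> Units L" "inv\<^bsub>L\<^esub> fr s \<one> \<in> carrier L"
      using alg_hom_closed[OF loc_hom assms(2)] loc_den_inverse(1)[OF assms(3)] by auto
    then show ?thesis unfolding frac_split[OF assms(2,3)] by (simp add: L.Units_mult_iff)
  qed
  ultimately show ?thesis by (simp add: stalk_at_def)
qed

lemma stalk_at_kalgebra: "primeideal P A \<Longrightarrow> kalgebra (stalk_at A P)"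
  unfolding stalk_at_def by (rule mult_loc.loc_kalgebra[OF prime_loc])

lemma stalk_at_carrier: "primeideal P A \<Longrightarrow> x \<in> carrier (stalk_at A P) \<longleftrightarrow> (\<exists>a\<in>carrier A. \<exists>s\<in>carrier A - P. x = frac A (carrier A - P) a s)"
  unfolding stalk_at_def by (rule mult_loc.loc_carrier[OF prime_loc])

lemma stalk_at_local:
  assumes P: "primeideal P A" shows "local_ring (stalk_at A P)"
proof -
  interpret P: primeideal P A by fact
  interpret mult_loc A "carrier A - P" by (rule prime_loc[OF P])
  have "\<one>\<^bsub>L\<^esub> \<noteq> \<zero>\<^bsub>L\<^esub>"
  proof
    assume "\<one>\<^bsub>L\<^esub> = \<zero>\<^bsub>L\<^esub>"
    then obtain u where "u \<in> carrier A - P" "u \<otimes> (\<one> \<otimes> \<one>) = u \<otimes> (\<zero> \<otimes> \<one>)"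
      unfolding loc_one loc_zero using frac_eq_iff[of \<one> \<zero> \<one> \<one>] one_S by auto
    then show False using P.zero_closed by auto
  qed
  moreover have "x \<oplus>\<^bsub>L\<^esub> y \<notin> Units L" if xy: "x \<in> carrier L" "y \<in> carrier L" "x \<notin> Units L" "y \<notin> Units L" for x y
  proof -
    obtain a s b t where x: "x = fr a s" "y = fr b t" "a \<in> carrier A" "s \<in> carrier A - P" "b \<in> carrier A" "t \<in> carrier A - P"
      using xy(1,2) unfolding loc_carrier by blast
    then have "a \<in> P" "b \<in> P" using xy stalk_unit_iff[OF P] by (auto simp: stalk_at_def)
    then have "(a \<otimes> t) \<oplus> (b \<otimes> s) \<in> P" using x P.I_r_closed by auto
    then show ?thesis unfolding x(1,2) loc_add[OF x(3,5,4,6)]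
      using stalk_unit_iff[OF P, of "(a \<otimes> t) \<oplus> (b \<otimes> s)" "s \<otimes> t"] mult_S[OF x(4,6)] x by (auto simp: stalk_at_def)
  qed
  ultimately show ?thesis unfolding stalk_at_def local_ring_iff using loc_cring by blast
qed

definition "loc_frac W s \<longleftrightarrow> (\<forall>P\<in>W. \<exists>D a f. openin (zariski A) D \<and> P \<in> D \<and> D \<subseteq> W \<and> a \<in> carrier A \<and> f \<in> carrier A \<and>
          (\<forall>Q\<in>D. f \<notin> Q \<and> s Q = frac A (carrier A - Q) a f))"

text \<open>A single fraction that represents the section on a whole open set. Naming this innermost
  clause of the structure sheaf allows the nested existentials for two sections to be
  combined.\<close>

definition "is_frac D s a f \<longleftrightarrow> openin (zariski A) D \<and> a \<in> carrier A \<and> f \<in> carrier A \<and>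
   (\<forall>Q\<in>D. f \<notin> Q \<and> s Q = frac A (carrier A - Q) a f)"

lemma is_fracD:
  assumes "is_frac D s a f"
  shows "openin (zariski A) D" "a \<in> carrier A" "f \<in> carrier A"
    "Q \<in> D \<Longrightarrow> f \<in> carrier A - Q" "Q \<in> D \<Longrightarrow> s Q = frac A (carrier A - Q) a f" "Q \<in> D \<Longrightarrow> primeideal Q A"
  using assms openin_prime[of D Q] unfolding is_frac_def by simp_all

lemma is_fracI:
  assumes "openin (zariski A) D" "a \<in> carrier A" "f \<in> carrier A"
    "\<And>Q. Q \<in> D \<Longrightarrow> f \<notin> Q" "\<And>Q. Q \<in> D \<Longrightarrow> s Q = frac A (carrier A - Q) a f"
  shows "is_frac D s a f"
  using assms unfolding is_frac_def by simp

lemma loc_frac_iff: "loc_frac W s \<longleftrightarrow> (\<forall>P\<in>W. \<exists>D a f. P \<in> D \<and> D \<subseteq> W \<and> is_frac D s a f)"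
  unfolding loc_frac_def is_frac_def by (intro ball_cong refl ex_cong1) (simp add: conj_ac)

lemma loc_fracD:
  assumes "loc_frac W s" "P \<in> W"
  shows "\<exists>D a f. P \<in> D \<and> D \<subseteq> W \<and> is_frac D s a f"
  using assms unfolding loc_frac_iff by (elim bspec)

lemma loc_fracI:
  assumes "\<And>P. P \<in> W \<Longrightarrow> \<exists>D a f. P \<in> D \<and> D \<subseteq> W \<and> is_frac D s a f"
  shows "loc_frac W s"
  unfolding loc_frac_iff by (intro ballI assms)

lemma Spec_sections: "sections (Spec A) W = {s \<in> (\<Pi>\<^sub>E P\<in>W. carrier (stalk_at A P)). loc_frac W s}"
  by (simp add: Spec_def loc_frac_def)

lemma Spec_sectionsI:
  assumes "s \<in> extensional W" "loc_frac W s" shows "s \<in> sections (Spec A) W"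
proof -
  have "s P \<in> carrier (stalk_at A P)" if P: "P \<in> W" for P
  proof -
    obtain D a f where D: "P \<in> D" "D \<subseteq> W" "is_frac D s a f" using loc_fracD[OF assms(2) P] by (elim exE conjE)
    note d = is_fracD(2)[OF D(3)] is_fracD(4-6)[OF D(3,1)]
    show ?thesis unfolding stalk_at_carrier[OF d(4)] d(3) using d(1,2) by (intro bexI) (rule refl)
  qed
  then show ?thesis using assms by (simp add: Spec_sections PiE_def Pi_def)
qed

lemma Spec_sections_loc: "s \<in> sections (Spec A) W \<Longrightarrow> loc_frac W s"
  by (simp add: Spec_sections)

lemma is_frac_two:
  assumes "loc_frac W s" "loc_frac W t" "P \<in> W"
  shows "\<exists>D a f b g. P \<in> D \<and> D \<subseteq> W \<and> is_frac D s a f \<and> is_frac D t b g"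
proof -
  obtain D a f where D: "P \<in> D" "D \<subseteq> W" "is_frac D s a f" using loc_fracD[OF assms(1,3)] by (elim exE conjE)
  obtain D' b g where D': "P \<in> D'" "D' \<subseteq> W" "is_frac D' t b g" using loc_fracD[OF assms(2,3)] by (elim exE conjE)
  have o: "openin (zariski A) (D \<inter> D')" using is_fracD(1)[OF D(3)] is_fracD(1)[OF D'(3)] by (rule openin_Int)
  have "is_frac (D \<inter> D') s a f" "is_frac (D \<inter> D') t b g"
    using o D(3) D'(3) unfolding is_frac_def by simp_all
  moreover have "P \<in> D \<inter> D'" "D \<inter> D' \<subseteq> W" using D D' by auto
  ultimately show ?thesis by (intro exI conjI)
qed

lemma Spec_lr: "locally_ringed (Spec A)"
proof (rule locally_ringedI)
  fix W s t assume W: "openin (tspace (Spec A)) W" and s: "s \<in> sections (Spec A) W" and t: "t \<in> sections (Spec A) W"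
  note two = is_frac_two[OF s[THEN Spec_sections_loc] t[THEN Spec_sections_loc]]
  let ?d = "\<lambda>p\<in>W. s p \<ominus>\<^bsub>stalk (Spec A) p\<^esub> t p" and ?m = "\<lambda>p\<in>W. s p \<otimes>\<^bsub>stalk (Spec A) p\<^esub> t p"
  have dm: "\<exists>D a f. P \<in> D \<and> D \<subseteq> W \<and> is_frac D ?d a f" "\<exists>D a f. P \<in> D \<and> D \<subseteq> W \<and> is_frac D ?m a f"
    if P: "P \<in> W" for P
  proof -
    obtain D a f b g where D: "P \<in> D" "D \<subseteq> W" "is_frac D s a f" "is_frac D t b g"
      using two[OF P] by (elim exE conjE)
    note d = is_fracD[OF D(3)] and e = is_fracD[OF D(4)]
    have q: "s Q \<ominus>\<^bsub>stalk_at A Q\<^esub> t Q = frac A (carrier A - Q) ((a \<otimes> g) \<ominus> (b \<otimes> f)) (f \<otimes> g)"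
        "s Q \<otimes>\<^bsub>stalk_at A Q\<^esub> t Q = frac A (carrier A - Q) (a \<otimes> b) (f \<otimes> g)" "f \<otimes> g \<notin> Q" if Q: "Q \<in> D" for Q
    proof -
      interpret mult_loc A "carrier A - Q" using d(6)[OF Q] by (rule prime_loc)
      show "f \<otimes> g \<notin> Q" using mult_S[OF d(4)[OF Q] e(4)[OF Q]] by simp
      show "s Q \<ominus>\<^bsub>stalk_at A Q\<^esub> t Q = frac A (carrier A - Q) ((a \<otimes> g) \<ominus> (b \<otimes> f)) (f \<otimes> g)"
        "s Q \<otimes>\<^bsub>stalk_at A Q\<^esub> t Q = frac A (carrier A - Q) (a \<otimes> b) (f \<otimes> g)"
        unfolding stalk_at_def d(5)[OF Q] e(5)[OF Q]
        using d(2) d(4)[OF Q] e(2) e(4)[OF Q] by (rule_tac [!] loc_diff loc_mult) assumption+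
    qed
    have "is_frac D ?d ((a \<otimes> g) \<ominus> (b \<otimes> f)) (f \<otimes> g)" "is_frac D ?m (a \<otimes> b) (f \<otimes> g)"
      using d(1-3) e(2,3) q D(2) by (auto intro!: is_fracI)
    then show "\<exists>D a f. P \<in> D \<and> D \<subseteq> W \<and> is_frac D ?d a f" "\<exists>D a f. P \<in> D \<and> D \<subseteq> W \<and> is_frac D ?m a f"
      using D(1,2) by (iprover)+
  qed
  show "?d \<in> sections (Spec A) W" "?m \<in> sections (Spec A) W"
    by (rule Spec_sectionsI[OF restrict_extensional loc_fracI], erule dm)+
  fix P assume P: "P \<in> W" "s P = t P"
  obtain D a f b g where D: "P \<in> D" "D \<subseteq> W" "is_frac D s a f" "is_frac D t b g"
    using two[OF P(1)] by (elim exE conjE)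
  note d = is_fracD[OF D(3)] and e = is_fracD[OF D(4)]
  interpret LP: mult_loc A "carrier A - P" using d(6)[OF D(1)] by (rule prime_loc)
  \<comment> \<open>Equality of the two fractions at \<open>P\<close> is witnessed by one
    \<open>u\<close> outside \<open>P\<close>, and the same \<open>u\<close> is a witness at every
    prime of \<open>D\<close> that lies in \<open>basic u\<close>.\<close>
  have "\<exists>u\<in>carrier A - P. u \<otimes> (a \<otimes> g) = u \<otimes> (b \<otimes> f)"
    using P(2) unfolding d(5)[OF D(1)] e(5)[OF D(1)] LP.frac_eq_iff[OF d(2) e(2) d(4)[OF D(1)] e(4)[OF D(1)]] .
  then obtain u where u: "u \<in> carrier A - P" "u \<otimes> (a \<otimes> g) = u \<otimes> (b \<otimes> f)" by (elim bexE)
  have eq: "s Q = t Q" if "Q \<in> D \<inter> basic u" for Q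
  proof -
    have Q: "primeideal Q A" "Q \<in> D" "u \<in> carrier A - Q" using that u(1) by (auto simp: basic_def)
    interpret LQ: mult_loc A "carrier A - Q" by (rule prime_loc[OF Q(1)])
    show ?thesis unfolding d(5)[OF Q(2)] e(5)[OF Q(2)] LQ.frac_eq_iff[OF d(2) e(2) d(4)[OF Q(2)] e(4)[OF Q(2)]]
      by (rule bexI[where x = u]) (rule u(2), rule Q(3))
  qed
  have "P \<in> D \<inter> basic u" using D(1) u(1) d(6)[OF D(1)] by (simp add: basic_def)
  moreover have "openin (tspace (Spec A)) (D \<inter> basic u)" using d(1) u by (simp add: openin_Int openin_basic)
  moreover have "D \<inter> basic u \<subseteq> W" using D(2) by auto
  moreover have "restrict s (D \<inter> basic u) = restrict t (D \<inter> basic u)" using eq by (intro restrict_ext)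
  ultimately show "\<exists>W'. openin (tspace (Spec A)) W' \<and> P \<in> W' \<and> W' \<subseteq> W \<and> restrict s W' = restrict t W'"
    by (intro exI conjI)
next
  fix W W' s assume W: "s \<in> sections (Spec A) W" "openin (tspace (Spec A)) W'" "W' \<subseteq> W"
  show "restrict s W' \<in> sections (Spec A) W'"
  proof (intro Spec_sectionsI loc_fracI)
    fix P assume P: "P \<in> W'"
    obtain D a f where D: "P \<in> D" "D \<subseteq> W" "is_frac D s a f"
      using loc_fracD[OF Spec_sections_loc[OF W(1)] subsetD[OF W(3) P]] by (elim exE conjE)
    have "is_frac (D \<inter> W') (restrict s W') a f"
      using D(3) W(2) unfolding is_frac_def by (simp add: openin_Int)
    moreover have "P \<in> D \<inter> W'" "D \<inter> W' \<subseteq> W'" using D P by auto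
    ultimately show "\<exists>D a f. P \<in> D \<and> D \<subseteq> W' \<and> is_frac D (restrict s W') a f" by (intro exI conjI)
  qed simp
next
  fix W s assume W: "s \<in> (\<Pi>\<^sub>E p\<in>W. carrier (stalk (Spec A) p))"
    "\<forall>p\<in>W. \<exists>W'. openin (tspace (Spec A)) W' \<and> p \<in> W' \<and> W' \<subseteq> W \<and> restrict s W' \<in> sections (Spec A) W'"
  show "s \<in> sections (Spec A) W"
  proof (intro Spec_sectionsI loc_fracI)
    fix P assume P: "P \<in> W"
    obtain W' where W': "P \<in> W'" "W' \<subseteq> W" "restrict s W' \<in> sections (Spec A) W'"
      using bspec[OF W(2) P] by (elim exE conjE)
    obtain D a f where D: "P \<in> D" "D \<subseteq> W'" "is_frac D (restrict s W') a f"
      using loc_fracD[OF Spec_sections_loc[OF W'(3)] W'(1)] by (elim exE conjE)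
    have "is_frac D s a f" using D(2,3) unfolding is_frac_def by (simp add: subset_iff)
    moreover have "D \<subseteq> W" using D(2) W'(2) by (rule subset_trans)
    ultimately show "\<exists>D a f. P \<in> D \<and> D \<subseteq> W \<and> is_frac D s a f" using D(1) by (intro exI conjI)
  qed (use W in \<open>simp add: PiE_def\<close>)
next
  fix p a assume p: "p \<in> pts (Spec A)" "a \<in> carrier (stalk (Spec A) p)"
  then have P: "primeideal p A" by (simp add: topspace_zariski)
  obtain b f where b: "b \<in> carrier A" "f \<in> carrier A - p" "a = frac A (carrier A - p) b f"
    using p(2) unfolding Spec_simps stalk_at_carrier[OF P] by (elim bexE)
  let ?s = "\<lambda>Q\<in>basic f. frac A (carrier A - Q) b f"
  have o: "openin (zariski A) (basic f)" using b by (simp add: openin_basic)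
  have "is_frac (basic f) ?s b f" using o b by (intro is_fracI) (auto simp: basic_def)
  then have "?s \<in> sections (Spec A) (basic f)"
    by (intro Spec_sectionsI loc_fracI exI conjI) simp_all
  moreover have "p \<in> basic f" "?s p = a" using b P by (simp_all add: basic_def)
  ultimately show "\<exists>W s. openin (tspace (Spec A)) W \<and> p \<in> W \<and> s \<in> sections (Spec A) W \<and> s p = a"
    using o unfolding Spec_simps by (intro exI conjI)
next
  fix W c assume W: "openin (tspace (Spec A)) W"
  have "is_frac W (\<lambda>p\<in>W. scal (stalk (Spec A) p) c) (scal A c) \<one>"
  proof (rule is_fracI)
    fix Q assume Q: "Q \<in> W"
    interpret mult_loc A "carrier A - Q" using openin_prime[of W Q] W Q by (intro prime_loc) auto
    show "\<one> \<notin> Q" using one_S by simp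
    show "(\<lambda>p\<in>W. scal (stalk (Spec A) p) c) Q = frac A (carrier A - Q) (scal A c) \<one>"
      using Q by (simp add: stalk_at_def loc_scal)
  qed (use W kalg_scal_closed[OF kalg] in auto)
  then show "(\<lambda>p\<in>W. scal (stalk (Spec A) p) c) \<in> sections (Spec A) W"
    by (intro Spec_sectionsI loc_fracI exI conjI) simp_all
qed (auto simp: Spec_sections topspace_zariski stalk_at_kalgebra stalk_at_local)

sublocale Sp: lr_space "Spec A"
  by (rule lr_space.intro[OF Spec_lr])

end

section \<open>Morphisms to a spectrum\<close>

text \<open>\<open>cof T A m\<close> is the algebra homomorphism from \<open>A\<close> to the functions on \<open>T\<close> induced by \<open>m : T \<rightarrow> Spec A\<close>
  (or to an open subspace), and \<open>slift T A\<close> is the inverse construction.\<close>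

definition gf :: "('a, 'k::field) kalg \<Rightarrow> 'a set set \<Rightarrow> 'a \<Rightarrow> 'a set \<Rightarrow> ('a \<times> 'a) set" where
  "gf A W a = (\<lambda>P\<in>W. frac A (carrier A - P) a \<one>\<^bsub>A\<^esub>)"

definition cof :: "('p, 'b, 'k::field) lrs \<Rightarrow> ('a, 'k) kalg \<Rightarrow> ('p, 'b, 'a set, ('a \<times> 'a) set) mor \<Rightarrow> 'a \<Rightarrow> 'p \<Rightarrow> 'b" where
  "cof T A m a = (\<lambda>p\<in>pts T. snd m p (frac A (carrier A - fst m p) a \<one>\<^bsub>A\<^esub>))"

definition slift :: "('p, 'b, 'k::field) lrs \<Rightarrow> ('a, 'k) kalg \<Rightarrow> ('a \<Rightarrow> 'p \<Rightarrow> 'b) \<Rightarrow> ('p, 'b, 'a set, ('a \<times> 'a) set) mor" where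
  "slift T A \<phi> =
     (\<lambda>p\<in>pts T. {a \<in> carrier A. \<phi> a p \<notin> Units (stalk T p)},
      \<lambda>p\<in>pts T. \<lambda>x\<in>carrier (stalk_at A {a \<in> carrier A. \<phi> a p \<notin> Units (stalk T p)}).
        llift A (carrier A - {a \<in> carrier A. \<phi> a p \<notin> Units (stalk T p)}) (stalk T p) (\<lambda>a. \<phi> a p) x)"

lemma (in lr_space) gam_homI:
  assumes A: "kalgebra A" and g: "\<And>a. a \<in> carrier A \<Longrightarrow> h a \<in> global X"
    and h: "\<And>p. p \<in> pts X \<Longrightarrow> (\<lambda>a. h a p) \<in> alg_hom A (stalk X p)"
  shows "h \<in> alg_hom A (gam X)"
proof -
  interpret A: cring A by (rule kalg_cring[OF A])
  note e = global_ext[OF g]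
  show ?thesis
  proof (rule alg_homI)
    fix x y assume xy: "x \<in> carrier A" "y \<in> carrier A"
    show "h (x \<otimes>\<^bsub>A\<^esub> y) = h x \<otimes>\<^bsub>gam X\<^esub> h y"
      using e[of "x \<otimes>\<^bsub>A\<^esub> y"] xy alg_hom_mult[OF h] by (intro extensionalityI[of _ "pts X"]) auto
    show "h (x \<oplus>\<^bsub>A\<^esub> y) = h x \<oplus>\<^bsub>gam X\<^esub> h y"
      using e[of "x \<oplus>\<^bsub>A\<^esub> y"] xy alg_hom_add[OF h] by (intro extensionalityI[of _ "pts X"]) auto
  next
    show "h (scal A c) = scal (gam X) c" for c
      using e[OF kalg_scal_closed[OF A], of c] alg_hom_scal[OF h] by (intro extensionalityI[of _ "pts X"]) (auto simp: const_fun_def)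
    show "h \<one>\<^bsub>A\<^esub> = \<one>\<^bsub>gam X\<^esub>"
      using e[OF A.one_closed] alg_hom_one[OF h] by (intro extensionalityI[of _ "pts X"]) auto
  qed (simp add: g)
qed

text \<open>This is the preimage of the maximal ideal of \<open>R\<close>, written with non-units so
  that no ideal of \<open>R\<close> has to be named. It is the point of the spectrum to which a
  homomorphism into a local ring belongs.\<close>

lemma prime_of_hom:
  assumes h: "h \<in> alg_hom A R" and A: "cring A" and R: "local_ring R"
  shows "primeideal {a \<in> carrier A. h a \<notin> Units R} A"
proof -
  interpret A: cring A by fact
  interpret R: cring R using R by (simp add: local_ring_def)
  have z: "h \<zero>\<^bsub>A\<^esub> = \<zero>\<^bsub>R\<^esub>" using alg_hom_zero[OF h A R.is_cring] .
  have mu: "h (a \<otimes>\<^bsub>A\<^esub> b) \<in> Units R \<longleftrightarrow> h a \<in> Units R \<and> h b \<in> Units R" if "a \<in> carrier A" "b \<in> carrier A" for a b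
    using that by (simp add: alg_hom_mult[OF h] R.Units_mult_iff alg_hom_closed[OF h])
  have neg: "h (\<ominus>\<^bsub>A\<^esub> a) \<notin> Units R" if "a \<in> carrier A" "h a \<notin> Units R" for a
    using mu[of "\<ominus>\<^bsub>A\<^esub> \<one>\<^bsub>A\<^esub>" a] that by (simp add: A.l_minus)
  have ad: "h a \<oplus>\<^bsub>R\<^esub> h b \<notin> Units R" if "a \<in> carrier A" "b \<in> carrier A" "h a \<notin> Units R" "h b \<notin> Units R" for a b
    using that alg_hom_closed[OF h] by (intro local_ring_nonunit_add[OF R])
  show ?thesis
  proof (rule primeidealI[OF _ A])
    show "ideal {a \<in> carrier A. h a \<notin> Units R} A"
    proof (rule idealI[OF A.ring_axioms])
      show "subgroup {a \<in> carrier A. h a \<notin> Units R} (add_monoid A)"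
        by (rule group.subgroupI[OF A.add.is_group])
          (use neg z local_ring_zero_nonunit[OF R] in \<open>auto simp: alg_hom_add[OF h] a_inv_def[symmetric] ad\<close>)
    qed (auto simp: mu)
    show "carrier A \<noteq> {a \<in> carrier A. h a \<notin> Units R}"
      using A.one_closed alg_hom_one[OF h] R.Units_one_closed by (metis (mono_tags, lifting) mem_Collect_eq)
  qed (auto simp: mu)
qed

locale spec_mor = T: lr_space T + A: kalg_ring A
  for T :: "('p, 'b, 'k::field) lrs" and A :: "('a, 'k) kalg"
begin

lemma cof_eq_pull: "morphism T (Spec A) m \<Longrightarrow> cof T A m a = pull T m (pts (Spec A)) (gf A (pts (Spec A)) a)"
  unfolding cof_def pull_def preim_pts gf_def by (intro restrict_ext) (simp add: mor_pt del: A.Spec_simps)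

lemma gf_is_frac: 
  assumes "openin (zariski A) W" "a \<in> carrier A" shows "A.is_frac W (gf A W a) a \<one>\<^bsub>A\<^esub>"
proof (rule A.is_fracI)
  fix Q assume Q: "Q \<in> W"
  interpret mult_loc A "carrier A - Q" by (rule A.prime_loc[OF A.openin_prime[OF assms(1) Q]])
  show "\<one>\<^bsub>A\<^esub> \<notin> Q" using one_S by simp
qed (use assms in \<open>auto simp: gf_def\<close>)

lemma gf_section: 
  assumes "openin (zariski A) W" "a \<in> carrier A" shows "gf A W a \<in> sections (Spec A) W"
  using gf_is_frac[OF assms] by (intro A.Spec_sectionsI A.loc_fracI exI conjI) (simp_all add: gf_def)

lemma gf_global: "a \<in> carrier A \<Longrightarrow> gf A (pts (Spec A)) a \<in> global (Spec A)"
  by (simp only: A.Spec_simps) (rule gf_section[OF openin_topspace])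

lemma fst_prime: "morphism T (Spec A) m \<Longrightarrow> p \<in> pts T \<Longrightarrow> primeideal (fst m p) A"
  using mor_pt[of T "Spec A" m p] by (simp add: A.Spec_pts del: A.Spec_simps)

lemma cof_hom:
  assumes m: "morphism T (Spec A) m" shows "cof T A m \<in> alg_hom A (gam T)"
proof -
  have h: "(\<lambda>a. cof T A m a p) \<in> alg_hom A (stalk T p)" if p: "p \<in> pts T" for p
  proof -
    interpret mult_loc A "carrier A - fst m p" by (rule A.prime_loc[OF fst_prime[OF m p]])
    have "snd m p \<in> alg_hom L (stalk T p)" using mor_hom[OF m p] by (simp add: stalk_at_def)
    from alg_hom_comp[OF this loc_hom] show ?thesis using p by (simp add: cof_def)
  qed
  show ?thesis
    by (rule T.gam_homI[OF A.kalg _ h]) (use mor_pull_global[OF m gf_global] in \<open>simp add: cof_eq_pull[OF m]\<close>)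
qed

text \<open>Stalk maps reflect units, so the image point is read off from the functions whose
  pullbacks vanish at \<open>p\<close>.\<close>

lemma fst_eq:
  assumes m: "morphism T (Spec A) m" and p: "p \<in> pts T"
  shows "fst m p = {a \<in> carrier A. cof T A m a p \<notin> Units (stalk T p)}"
proof -
  note P = fst_prime[OF m p]
  interpret P: primeideal "fst m p" A by (rule P)
  interpret mult_loc A "carrier A - fst m p" by (rule A.prime_loc[OF P])
  have "cof T A m a p \<in> Units (stalk T p) \<longleftrightarrow> a \<notin> fst m p" if a: "a \<in> carrier A" for a
  proof -
    have "fr a \<one>\<^bsub>A\<^esub> \<in> carrier (stalk (Spec A) (fst m p))" using alg_hom_closed[OF loc_hom a] by (simp add: stalk_at_def)
    then show ?thesis
      using mor_Units_iff[OF m p, of "fr a \<one>\<^bsub>A\<^esub>"] A.stalk_unit_iff[OF P a one_S] p by (simp add: cof_def)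
  qed
  then show ?thesis using P.Icarr by blast
qed

lemma snd_eq:
  assumes m: "morphism T (Spec A) m" and p: "p \<in> pts T" and as: "a \<in> carrier A" "s \<in> carrier A - fst m p"
  shows "snd m p (frac A (carrier A - fst m p) a s) = cof T A m a p \<otimes>\<^bsub>stalk T p\<^esub> inv\<^bsub>stalk T p\<^esub> (cof T A m s p)"
proof -
  interpret mult_loc A "carrier A - fst m p" by (rule A.prime_loc[OF fst_prime[OF m p]])
  have h: "snd m p \<in> alg_hom L (stalk T p)" using mor_hom[OF m p] by (simp add: stalk_at_def)
  have c: "fr a \<one>\<^bsub>A\<^esub> \<in> carrier L" "fr s \<one>\<^bsub>A\<^esub> \<in> Units L" "inv\<^bsub>L\<^esub> fr s \<one>\<^bsub>A\<^esub> \<in> carrier L"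
    using alg_hom_closed[OF loc_hom as(1)] loc_den_inverse(1)[OF as(2)] monoid.Units_inv_closed[OF ring.is_monoid[OF cring.axioms(1)[OF loc_cring]]] by auto
  show ?thesis
    unfolding frac_split[OF as] alg_hom_mult[OF h c(1,3)] alg_hom_inv[OF h loc_cring T.stalk_cring[OF p] c(2)]
    using p by (simp add: cof_def)
qed

text \<open>One half of the adjunction between spectra and global functions: \<open>fst_eq\<close>
  recovers the points and \<open>snd_eq\<close> the stalk maps from the pulled back functions. From
  here on, morphisms into affine schemes are compared through \<open>cof\<close> only.\<close>

lemma spec_mor_eqI:
  assumes m: "morphism T (Spec A) m" and n: "morphism T (Spec A) n"
    and e: "\<And>a. a \<in> carrier A \<Longrightarrow> cof T A m a = cof T A n a"
  shows "m = n"
proof (rule mor_fst_eqI[OF m n])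
  fix p assume p: "p \<in> pts T"
  show f: "fst m p = fst n p" using fst_eq[OF m p] fst_eq[OF n p] e by auto
  fix x assume x: "x \<in> carrier (stalk (Spec A) (fst m p))"
  then obtain a s where as: "a \<in> carrier A" "s \<in> carrier A - fst m p" "x = frac A (carrier A - fst m p) a s"
    unfolding A.Spec_simps A.stalk_at_carrier[OF fst_prime[OF m p]] by (elim bexE)
  then show "snd m p x = snd n p x"
    using snd_eq[OF m p as(1,2)] snd_eq[OF n p as(1)] e f by auto
qed

context
  fixes \<phi> :: "'a \<Rightarrow> 'p \<Rightarrow> 'b"
  assumes \<phi>: "\<phi> \<in> alg_hom A (gam T)"
begin

definition "ker_at p = {a \<in> carrier A. \<phi> a p \<notin> Units (stalk T p)}"

lemma at_hom: "p \<in> pts T \<Longrightarrow> (\<lambda>a. \<phi> a p) \<in> alg_hom A (stalk T p)"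
  using alg_hom_comp[OF T.gam_eval \<phi>] .

lemma ker_at_prime: "p \<in> pts T \<Longrightarrow> primeideal (ker_at p) A"
  unfolding ker_at_def by (rule prime_of_hom[OF at_hom A.is_cring T.stalk_local])

lemma slift_fst: "p \<in> pts T \<Longrightarrow> fst (slift T A \<phi>) p = ker_at p"
  by (simp add: slift_def ker_at_def)

lemma slift_snd:
  assumes p: "p \<in> pts T" and as: "a \<in> carrier A" "s \<in> carrier A - ker_at p"
  shows "snd (slift T A \<phi>) p (frac A (carrier A - ker_at p) a s) = \<phi> a p \<otimes>\<^bsub>stalk T p\<^esub> inv\<^bsub>stalk T p\<^esub> (\<phi> s p)"
proof -
  interpret mult_loc A "carrier A - ker_at p" by (rule A.prime_loc[OF ker_at_prime[OF p]])
  have "fr a s \<in> carrier (stalk_at A (ker_at p))"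
    using as by (auto simp: A.stalk_at_carrier[OF ker_at_prime[OF p]])
  then have "snd (slift T A \<phi>) p (fr a s) = llift A (carrier A - ker_at p) (stalk T p) (\<lambda>a. \<phi> a p) (fr a s)"
    using p by (simp add: slift_def ker_at_def)
  also have "\<dots> = \<phi> a p \<otimes>\<^bsub>stalk T p\<^esub> inv\<^bsub>stalk T p\<^esub> (\<phi> s p)"
    by (rule llift_frac[OF at_hom[OF p] T.stalk_cring[OF p] _ as]) (simp add: ker_at_def)
  finally show ?thesis .
qed

lemma slift_stalk_hom:
  assumes p: "p \<in> pts T" shows "snd (slift T A \<phi>) p \<in> alg_hom (stalk_at A (ker_at p)) (stalk T p)"
proof -
  interpret mult_loc A "carrier A - ker_at p" by (rule A.prime_loc[OF ker_at_prime[OF p]])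
  have "llift A (carrier A - ker_at p) (stalk T p) (\<lambda>a. \<phi> a p) \<in> alg_hom L (stalk T p)"
    by (rule llift_hom[OF at_hom[OF p] T.stalk_cring[OF p]]) (simp add: ker_at_def)
  from alg_hom_cong[OF this loc_kalgebra] show ?thesis
    using p by (simp add: slift_def ker_at_def stalk_at_def)
qed

lemma slift_basic_preim: "f \<in> carrier A \<Longrightarrow> openin (tspace T) {p \<in> pts T. f \<notin> ker_at p}"
  using T.unit_open[OF openin_topspace, of "\<phi> f"] alg_hom_closed[OF \<phi>, of f]
  by (simp add: ker_at_def)

text \<open>Near a given point a section of the structure sheaf is one fraction a/f whose
  denominator pulls back to a unit. Its pullback is the product of \<phi> a with the inverse of
  \<phi> f, and that inverse is a section near the point by \<open>sec_inv_local\<close>.\<close>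

lemma slift_morphism: "morphism T (Spec A) (slift T A \<phi>)"
proof (rule morphismI)
  show "fst (slift T A \<phi>) p \<in> pts (Spec A)" if "p \<in> pts T" for p
    using that ker_at_prime by (simp add: slift_fst A.topspace_zariski)
  show op: "openin (tspace T) (preim T (slift T A \<phi>) W)" if W: "openin (tspace (Spec A)) W" for W
  proof (subst openin_subopen, intro ballI)
    fix p assume "p \<in> preim T (slift T A \<phi>) W"
    then have p: "p \<in> pts T" "ker_at p \<in> W" by (auto simp: preim_def slift_fst)
    obtain f where f: "f \<in> carrier A" "f \<notin> ker_at p" "A.basic f \<subseteq> W"
      using A.basic_subset[of W "ker_at p"] W p(2) by auto
    have "{p \<in> pts T. f \<notin> ker_at p} \<subseteq> preim T (slift T A \<phi>) W"
      using f(3) ker_at_prime by (auto simp: preim_def slift_fst A.basic_def)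
    then show "\<exists>S. openin (tspace T) S \<and> p \<in> S \<and> S \<subseteq> preim T (slift T A \<phi>) W"
      using slift_basic_preim[OF f(1)] p f(2) by (intro exI[of _ "{p \<in> pts T. f \<notin> ker_at p}"]) simp
  qed
  show "a \<in> Units (stalk (Spec A) (fst (slift T A \<phi>) p))"
    if p: "p \<in> pts T" and a: "a \<in> carrier (stalk (Spec A) (fst (slift T A \<phi>) p))" "snd (slift T A \<phi>) p a \<in> Units (stalk T p)" for p a
  proof -
    interpret S: cring "stalk T p" by (rule T.stalk_cring[OF p])
    obtain b s where b: "b \<in> carrier A" "s \<in> carrier A - ker_at p" "a = frac A (carrier A - ker_at p) b s"
      using a(1) p unfolding A.Spec_simps slift_fst[OF p] A.stalk_at_carrier[OF ker_at_prime[OF p]] by (elim bexE)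
    have "\<phi> b p \<otimes>\<^bsub>stalk T p\<^esub> inv\<^bsub>stalk T p\<^esub> (\<phi> s p) \<in> Units (stalk T p)"
      using a(2) b slift_snd[OF p b(1,2)] by simp
    moreover have "\<phi> b p \<in> carrier (stalk T p)" "\<phi> s p \<in> Units (stalk T p)"
      using b alg_hom_closed[OF at_hom[OF p]] by (auto simp: ker_at_def)
    ultimately have "b \<notin> ker_at p" using S.Units_mult_iff by (auto simp: ker_at_def)
    then show ?thesis using A.stalk_unit_iff[OF ker_at_prime[OF p] b(1,2)] b(3) by (simp add: slift_fst[OF p])
  qed
  fix W s assume W: "openin (tspace (Spec A)) W" and s: "s \<in> sections (Spec A) W"
  let ?W = "preim T (slift T A \<phi>) W"
  show "pull T (slift T A \<phi>) W s \<in> sections T ?W"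
  proof (rule T.sec_local[OF op[OF W]])
    show "pull T (slift T A \<phi>) W s \<in> extensional ?W" by (simp add: pull_def)
    fix p assume pW: "p \<in> ?W"
    then have p: "p \<in> pts T" "ker_at p \<in> W" by (auto simp: preim_def slift_fst)
    obtain D a f where D: "ker_at p \<in> D" "D \<subseteq> W" "A.is_frac D s a f"
      using A.loc_fracD[OF A.Spec_sections_loc[OF s] p(2)] by (elim exE conjE)
    note d = A.is_fracD[OF D(3)]
    have gl: "\<phi> f \<in> global T" "\<phi> a \<in> global T" using alg_hom_closed[OF \<phi>] d(2,3) by auto
    have fu: "\<phi> f p \<in> Units (stalk T p)" using d(4)[OF D(1)] by (simp add: ker_at_def)
    obtain W1 t where t: "openin (tspace T) W1" "p \<in> W1" "W1 \<subseteq> pts T" "t \<in> sections T W1"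
      "\<forall>q\<in>W1. \<phi> f q \<in> Units (stalk T q) \<and> t q = inv\<^bsub>stalk T q\<^esub> (\<phi> f q)"
      using T.sec_inv_local[OF openin_topspace gl(1) p(1) fu] by (elim exE conjE)
    have oD: "openin (tspace T) (preim T (slift T A \<phi>) D)" by (rule op) (use d(1) in simp)
    let ?V = "W1 \<inter> preim T (slift T A \<phi>) D"
    have V: "openin (tspace T) ?V" using t(1) oD by (rule openin_Int)
    let ?t = "\<lambda>q\<in>?V. restrict (\<phi> a) ?V q \<otimes>\<^bsub>stalk T q\<^esub> restrict t ?V q"
    have "?t \<in> sections T ?V"
      by (rule T.sec_mult[OF V T.sec_restrict[OF openin_topspace gl(2) V] T.sec_restrict[OF t(1,4) V]]) (use t(3) in auto)
    moreover have "\<forall>q\<in>?V \<inter> ?W. pull T (slift T A \<phi>) W s q = ?t q"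
    proof
      fix q assume "q \<in> ?V \<inter> ?W"
      then have q: "q \<in> ?V" "q \<in> ?W" "q \<in> W1" "q \<in> pts T" "ker_at q \<in> D" by (auto simp: preim_def slift_fst)
      have "pull T (slift T A \<phi>) W s q = snd (slift T A \<phi>) q (s (ker_at q))"
        using q by (simp add: pull_def slift_fst)
      also have "\<dots> = \<phi> a q \<otimes>\<^bsub>stalk T q\<^esub> inv\<^bsub>stalk T q\<^esub> (\<phi> f q)"
        unfolding d(5)[OF q(5)] by (rule slift_snd[OF q(4) d(2) d(4)[OF q(5)]])
      finally show "pull T (slift T A \<phi>) W s q = ?t q" using q t(5) by simp
    qed
    moreover have "p \<in> ?V" using t(2) D(1) p by (simp add: preim_def slift_fst)
    ultimately show "\<exists>W' t. openin (tspace T) W' \<and> p \<in> W' \<and> t \<in> sections T W' \<and> (\<forall>q\<in>W' \<inter> ?W. pull T (slift T A \<phi>) W s q = t q)"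
      using V by (intro exI conjI)
  qed
qed (use slift_stalk_hom in \<open>simp_all add: slift_fst, simp_all add: slift_def ker_at_def\<close>)

lemma cof_slift: 
  assumes a: "a \<in> carrier A" shows "cof T A (slift T A \<phi>) a = \<phi> a"
proof (rule T.global_eqI)
  show "cof T A (slift T A \<phi>) a \<in> global T" using alg_hom_closed[OF cof_hom[OF slift_morphism] a] by simp
  show "\<phi> a \<in> global T" using alg_hom_closed[OF \<phi> a] by simp
  fix p assume p: "p \<in> pts T"
  interpret mult_loc A "carrier A - ker_at p" by (rule A.prime_loc[OF ker_at_prime[OF p]])
  interpret S: cring "stalk T p" by (rule T.stalk_cring[OF p])
  have "cof T A (slift T A \<phi>) a p = \<phi> a p \<otimes>\<^bsub>stalk T p\<^esub> inv\<^bsub>stalk T p\<^esub> (\<phi> \<one>\<^bsub>A\<^esub> p)"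
    using slift_snd[OF p a one_S] p by (simp add: cof_def slift_fst)
  then show "cof T A (slift T A \<phi>) a p = \<phi> a p"
    using alg_hom_one[OF at_hom[OF p]] alg_hom_closed[OF at_hom[OF p] a] S.comm_inv_char[of "\<one>\<^bsub>stalk T p\<^esub>" "\<one>\<^bsub>stalk T p\<^esub>"] by simp
qed

end

end

text \<open>Here \<open>Z\<close> is arbitrary, so the germ of a/1 may lie outside the stalk on
  which the composite is defined; extensionality then returns \<open>undefined\<close>.\<close>

lemma cof_mcomp:
  assumes "morphism T Y f"
  shows "cof T A (mcomp T Z g f) a = (\<lambda>p\<in>pts T. if frac A (carrier A - fst g (fst f p)) a \<one>\<^bsub>A\<^esub> \<in> carrier (stalk Z (fst g (fst f p)))
     then snd f p (cof Y A g a (fst f p)) else undefined)"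
  by (auto simp: cof_def mcomp_def mor_pt[OF assms])

lemma cof_mcomp_Spec:
  assumes f: "morphism T Y f" and g: "morphism Y (Spec A) g" and "kalgebra A" "a \<in> carrier A"
  shows "cof T A (mcomp T (Spec A) g f) a = pull T f (pts Y) (cof Y A g a)"
proof -
  interpret kalg_ring A by (rule kalg_ring.intro) fact
  have "frac A (carrier A - Q) a \<one>\<^bsub>A\<^esub> \<in> carrier (stalk (Spec A) Q)" if Q: "primeideal Q A" for Q
    unfolding Spec_simps stalk_at_carrier[OF Q] using mult_loc.one_S[OF prime_loc[OF Q]] assms(4) by (intro bexI) (rule refl)
  moreover have "primeideal (fst g (fst f p)) A" if "p \<in> pts T" for p
    using mor_pt[OF g mor_pt[OF f that]] by (simp add: topspace_zariski)
  ultimately show ?thesis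
    unfolding cof_mcomp[OF f] pull_def preim_pts[OF f] by (intro restrict_ext) simp
qed

text \<open>\<open>Spec_map\<close> acts on fractions by images of representatives,
  \<open>slift\<close> by products with inverses of germs. Identifying the two gives access to
  \<open>cof_slift\<close> and makes \<open>Spec_map\<close> a morphism.\<close>

lemma Spec_map_eq_slift:
  assumes A: "kalgebra A" and B: "kalgebra B" and h: "h \<in> alg_hom A B"
  shows "Spec_map A B h = slift (Spec B) A (\<lambda>a. gf B (pts (Spec B)) (h a))"
    and "(\<lambda>a. gf B (pts (Spec B)) (h a)) \<in> alg_hom A (gam (Spec B))"
proof -
  interpret A: kalg_ring A by (rule kalg_ring.intro) fact
  interpret B: kalg_ring B by (rule kalg_ring.intro) fact
  interpret spec_mor "Spec B" B by unfold_locales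
  interpret M: spec_mor "Spec B" A by unfold_locales
  have "cof (Spec B) B (id_mor (Spec B)) a = gf B (pts (Spec B)) a" if "a \<in> carrier B" for a
  proof -
    have "frac B (carrier B - Q) a \<one>\<^bsub>B\<^esub> \<in> carrier (stalk (Spec B) Q)" if "Q \<in> pts (Spec B)" for Q
      using B.Sp.global_carrier[OF gf_global[OF \<open>a \<in> carrier B\<close>], of Q] that by (simp add: gf_def)
    then show ?thesis unfolding cof_def gf_def by (intro restrict_ext) (simp del: B.Spec_simps)
  qed
  from alg_hom_cong[OF cof_hom[OF B.Sp.morphism_id] B, of "gf B (pts (Spec B))"] this
  have g: "gf B (pts (Spec B)) \<in> alg_hom B (gam (Spec B))" by simp
  then show gh: "(\<lambda>a. gf B (pts (Spec B)) (h a)) \<in> alg_hom A (gam (Spec B))" by (rule alg_hom_comp[OF _ h])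
  let ?\<phi> = "\<lambda>a. gf B (pts (Spec B)) (h a)"
  have k: "M.ker_at ?\<phi> Q = {a \<in> carrier A. h a \<in> Q}" if Q: "Q \<in> pts (Spec B)" for Q
  proof -
    have P: "primeideal Q B" using Q by (simp add: B.topspace_zariski)
    have "?\<phi> a Q \<in> Units (stalk (Spec B) Q) \<longleftrightarrow> h a \<notin> Q" if "a \<in> carrier A" for a
      using B.stalk_unit_iff[OF P alg_hom_closed[OF h that] mult_loc.one_S[OF B.prime_loc[OF P]]] Q by (simp add: gf_def)
    then show ?thesis unfolding M.ker_at_def[OF gh] by blast
  qed
  show "Spec_map A B h = slift (Spec B) A ?\<phi>"
  proof (rule prod_eqI)
    show "fst (Spec_map A B h) = fst (slift (Spec B) A ?\<phi>)"
      unfolding Spec_map_def slift_def fst_conv using k unfolding M.ker_at_def[OF gh] by (intro restrict_ext) simp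
    show "snd (Spec_map A B h) = snd (slift (Spec B) A ?\<phi>)"
    proof (rule extensionalityI[of _ "pts (Spec B)"])
      fix Q assume Q: "Q \<in> pts (Spec B)"
      have P: "primeideal Q B" using Q by (simp add: B.topspace_zariski)
      interpret LB: mult_loc B "carrier B - Q" by (rule B.prime_loc[OF P])
      note kp = M.ker_at_prime[OF gh Q]
      interpret LA: mult_loc A "carrier A - M.ker_at ?\<phi> Q" by (rule A.prime_loc[OF kp])
      have ext: "snd (slift (Spec B) A ?\<phi>) Q \<in> extensional (carrier (stalk_at A (M.ker_at ?\<phi> Q)))"
        using Q unfolding slift_def M.ker_at_def[OF gh] by simp
      show "snd (Spec_map A B h) Q = snd (slift (Spec B) A ?\<phi>) Q"
      proof (rule extensionalityI[OF _ ext])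
        show "snd (Spec_map A B h) Q \<in> extensional (carrier (stalk_at A (M.ker_at ?\<phi> Q)))"
          using Q unfolding Spec_map_def k[OF Q] by simp
        fix x assume x: "x \<in> carrier (stalk_at A (M.ker_at ?\<phi> Q))"
        obtain a s where as: "a \<in> carrier A" "s \<in> carrier A - M.ker_at ?\<phi> Q" "x = frac A (carrier A - M.ker_at ?\<phi> Q) a s"
          using x unfolding A.stalk_at_carrier[OF kp] by (elim bexE)
        have hs: "h t \<in> carrier B - Q" if "t \<in> carrier A - M.ker_at ?\<phi> Q" for t
          using that alg_hom_closed[OF h, of t] unfolding k[OF Q] by auto
        have "snd (Spec_map A B h) Q x = (\<Union>(a, s)\<in>x. frac B (carrier B - Q) (h a) (h s))"
          using x Q unfolding Spec_map_def k[OF Q] by simp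
        also have "\<dots> = LB.fr (h a) (h s)"
        proof (rule UN_const_eq)
          show "(a, s) \<in> x" unfolding as(3) by (rule LA.frac_self[OF as(1,2)])
          fix y assume y: "y \<in> x"
          obtain b t where bt: "y = (b, t)" by (cases y)
          have b: "b \<in> carrier A" "t \<in> carrier A - M.ker_at ?\<phi> Q" "LA.fr b t = LA.fr a s"
            using LA.frac_memD[OF y[unfolded as(3) bt] as(1,2)] by auto
          obtain u where u: "u \<in> carrier A - M.ker_at ?\<phi> Q" "u \<otimes>\<^bsub>A\<^esub> (b \<otimes>\<^bsub>A\<^esub> s) = u \<otimes>\<^bsub>A\<^esub> (a \<otimes>\<^bsub>A\<^esub> t)"
            using LA.frac_eq_iff[OF b(1) as(1) b(2) as(2)] b(3) by auto
          have c: "u \<in> carrier A" "s \<in> carrier A" "t \<in> carrier A" using u as b by auto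
          have "h u \<otimes>\<^bsub>B\<^esub> (h b \<otimes>\<^bsub>B\<^esub> h s) = h u \<otimes>\<^bsub>B\<^esub> (h a \<otimes>\<^bsub>B\<^esub> h t)"
            using arg_cong[OF u(2), of h] c b(1) as(1) by (simp add: alg_hom_mult[OF h])
          then have "LB.fr (h b) (h t) = LB.fr (h a) (h s)"
            using LB.frac_eq_iff[OF alg_hom_closed[OF h b(1)] alg_hom_closed[OF h as(1)] hs[OF b(2)] hs[OF as(2)]] hs[OF u(1)] by blast
          then show "(case y of (a, s) \<Rightarrow> frac B (carrier B - Q) (h a) (h s)) = LB.fr (h a) (h s)" by (simp add: bt)
        qed
        also have "\<dots> = ?\<phi> a Q \<otimes>\<^bsub>stalk (Spec B) Q\<^esub> inv\<^bsub>stalk (Spec B) Q\<^esub> (?\<phi> s Q)"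
          using LB.frac_split[OF alg_hom_closed[OF h as(1)] hs[OF as(2)]] Q by (simp add: gf_def stalk_at_def)
        also have "\<dots> = snd (slift (Spec B) A ?\<phi>) Q x"
          unfolding as(3) by (rule M.slift_snd[OF gh Q as(1,2), symmetric])
        finally show "snd (Spec_map A B h) Q x = snd (slift (Spec B) A ?\<phi>) Q x" .
      qed
    qed (simp_all add: Spec_map_def slift_def)
  qed
qed

section \<open>Reduced spaces\<close>

text \<open>Reducedness in the form in which it is used: a function with zero value at every point
  is zero, not merely nilpotent. Morphisms from such a space into a closed set factor through its
  reduced structure.\<close>

definition lreduced :: "('p, 'a, 'k) lrs \<Rightarrow> bool" where
  "lreduced X \<longleftrightarrow> (\<forall>W s. openin (tspace X) W \<longrightarrow> s \<in> sections X W \<longrightarrow> (\<forall>p\<in>W. vanishes X s p) \<longrightarrow>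
     (\<forall>p\<in>W. s p = \<zero>\<^bsub>stalk X p\<^esub>))"

lemma lreduced_open_sub: "openin (tspace X) W \<Longrightarrow> lreduced X \<Longrightarrow> lreduced (open_sub X W)"
  unfolding lreduced_def vanishes_def by auto

text \<open>If the section is a/f on a set containing \<open>basic e\<close>, then a e lies in every
  prime ideal: at primes containing \<open>e\<close> trivially, at the others because the section
  vanishes there. Hence a e is nilpotent, so zero, and a/f is zero in the stalk at \<open>P\<close>
  since \<open>e\<close> is outside \<open>P\<close>.\<close>

lemma (in kalg_ring) Spec_lreduced:
  assumes nil: "\<And>a n. a \<in> carrier A \<Longrightarrow> a [^] (n::nat) = \<zero> \<Longrightarrow> a = \<zero>"
  shows "lreduced (Spec A)"
  unfolding lreduced_def
proof (intro allI impI ballI)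
  fix W s P assume W: "openin (tspace (Spec A)) W" and s: "s \<in> sections (Spec A) W"
    and v: "\<forall>p\<in>W. vanishes (Spec A) s p" and P: "P \<in> W"
  obtain D a f where D: "P \<in> D" "D \<subseteq> W" "is_frac D s a f"
    using loc_fracD[OF Spec_sections_loc[OF s] P] by (elim exE conjE)
  note d = is_fracD[OF D(3)]
  obtain e where e: "e \<in> carrier A" "e \<notin> P" "basic e \<subseteq> D" using basic_subset[OF d(1) D(1)] by blast
  have ae: "a \<otimes> e \<in> Q" if Q: "primeideal Q A" for Q
  proof (cases "e \<in> Q")
    case True
    interpret Q: primeideal Q A by fact
    show ?thesis using True d(2) by (rule Q.I_l_closed)
  next
    case False
    then have QD: "Q \<in> D" using e(3) Q by (auto simp: basic_def)
    interpret Q: primeideal Q A by fact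
    have "s Q \<notin> Units (stalk_at A Q)" using v D(2) QD by (auto simp: vanishes_def)
    then have "a \<in> Q" using stalk_unit_iff[OF Q d(2) d(4)[OF QD]] d(5)[OF QD] by simp
    then show ?thesis using e(1) by (rule Q.I_r_closed)
  qed
  let ?x = "a \<otimes> e"
  have x: "?x \<in> carrier A" using d(2) e(1) by simp
  have "\<exists>n::nat. ?x [^] n = \<zero>"
  proof (rule ccontr)
    assume "\<nexists>n::nat. ?x [^] n = \<zero>"
    then have "\<exists>Q. primeideal Q A \<and> {\<zero>} \<subseteq> Q \<and> Q \<inter> range (\<lambda>n::nat. ?x [^] n) = {}"
      using x by (intro prime_avoiding zeroideal) (auto simp: nat_pow_mult intro: range_eqI[of _ _ "0::nat"])
    then obtain Q where Q: "primeideal Q A" "Q \<inter> range (\<lambda>n::nat. ?x [^] n) = {}" by blast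
    have "?x = ?x [^] (1::nat)" using x by simp
    then have "?x \<in> range (\<lambda>n::nat. ?x [^] n)" by (rule range_eqI)
    then show False using Q(2) ae[OF Q(1)] by auto
  qed
  then have z: "a \<otimes> e = \<zero>" using nil[OF x] by blast
  interpret mult_loc A "carrier A - P" by (rule prime_loc[OF d(6)[OF D(1)]])
  have "fr a f = fr \<zero> \<one>"
    using frac_eq_iff[OF d(2) zero_closed d(4)[OF D(1)] one_S] e z d(2,3) by (auto intro!: bexI[of _ e] simp: m_comm)
  then show "s P = \<zero>\<^bsub>stalk (Spec A) P\<^esub>" unfolding d(5)[OF D(1)] by (simp add: stalk_at_def loc_zero)
qed

section \<open>Reduced closed subspaces\<close>

lemma (in cring) ideal_by_mult:
  assumes "I \<subseteq> carrier R" "\<zero> \<in> I" "\<And>a b. a \<in> I \<Longrightarrow> b \<in> I \<Longrightarrow> a \<oplus> b \<in> I"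
    "\<And>a x. a \<in> I \<Longrightarrow> x \<in> carrier R \<Longrightarrow> x \<otimes> a \<in> I"
  shows "ideal I R"
proof (rule idealI[OF ring_axioms])
  have neg: "\<ominus> a \<in> I" if "a \<in> I" for a
    using assms(4)[OF that, of "\<ominus> \<one>"] assms(1) that by (auto simp: l_minus)
  show "subgroup I (add_monoid R)"
    by (rule group.subgroupI[OF add.is_group]) (use assms neg in \<open>auto simp: a_inv_def[symmetric]\<close>)
  show "x \<otimes> a \<in> I" "a \<otimes> x \<in> I" if "a \<in> I" "x \<in> carrier R" for a x
    using assms(4)[OF that] assms(1) that by (auto simp: m_comm subset_iff)
qed

text \<open>If the class of \<open>a\<close> has inverse the class of \<open>b\<close>, then 1 - a b
  lies in \<open>I\<close> and is a non-unit. Since 1 is the sum of 1 - a b and a b, the product a b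
  must be a unit in the local ring \<open>A\<close>, and so must \<open>a\<close>.\<close>

lemma quot_local:
  assumes A: "kalgebra A" "local_ring A" and I: "ideal I A" "I \<inter> Units A = {}"
  shows "a \<in> carrier A \<Longrightarrow> I +>\<^bsub>A\<^esub> a \<in> Units (quot A I) \<longleftrightarrow> a \<in> Units A"
    and "local_ring (quot A I)"
proof -
  interpret A: cring A by (rule kalg_cring[OF A(1)])
  interpret I: ideal I A by fact
  note q = quot_hom[OF I(1)]
  interpret Q: cring "quot A I" by (rule kalg_cring[OF quot_kalgebra[OF A(1) I(1)]])
  have iff: "I +>\<^bsub>A\<^esub> a \<in> Units (quot A I) \<longleftrightarrow> a \<in> Units A" if a: "a \<in> carrier A" for a
  proof
    assume u: "I +>\<^bsub>A\<^esub> a \<in> Units (quot A I)"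
    then have "inv\<^bsub>quot A I\<^esub> (I +>\<^bsub>A\<^esub> a) \<in> carrier (quot A I)" by simp
    then obtain b where b: "b \<in> carrier A" "inv\<^bsub>quot A I\<^esub> (I +>\<^bsub>A\<^esub> a) = I +>\<^bsub>A\<^esub> b" unfolding quot_carrier by (elim bexE)
    have "(I +>\<^bsub>A\<^esub> a) \<otimes>\<^bsub>quot A I\<^esub> (I +>\<^bsub>A\<^esub> b) = \<one>\<^bsub>quot A I\<^esub>"
      using Q.Units_r_inv[OF u] b(2) by simp
    then have "I +>\<^bsub>A\<^esub> (a \<otimes>\<^bsub>A\<^esub> b) = I +>\<^bsub>A\<^esub> \<one>\<^bsub>A\<^esub>"
      using alg_hom_mult[OF q a b(1)] alg_hom_one[OF q] by simp
    then have m: "\<one>\<^bsub>A\<^esub> \<ominus>\<^bsub>A\<^esub> a \<otimes>\<^bsub>A\<^esub> b \<in> I"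
      using quot_eq_iff[OF I(1) A.one_closed, of "a \<otimes>\<^bsub>A\<^esub> b"] a b(1) by simp
    have e: "\<one>\<^bsub>A\<^esub> = (\<one>\<^bsub>A\<^esub> \<ominus>\<^bsub>A\<^esub> a \<otimes>\<^bsub>A\<^esub> b) \<oplus>\<^bsub>A\<^esub> a \<otimes>\<^bsub>A\<^esub> b" using a b(1) by algebra
    have "a \<otimes>\<^bsub>A\<^esub> b \<in> Units A"
    proof (rule ccontr)
      assume "a \<otimes>\<^bsub>A\<^esub> b \<notin> Units A"
      then have "(\<one>\<^bsub>A\<^esub> \<ominus>\<^bsub>A\<^esub> a \<otimes>\<^bsub>A\<^esub> b) \<oplus>\<^bsub>A\<^esub> a \<otimes>\<^bsub>A\<^esub> b \<notin> Units A"
        using m I(2) I.Icarr a b(1) by (intro local_ring_nonunit_add[OF A(2)]) auto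
      then show False using e A.Units_one_closed by simp
    qed
    then show "a \<in> Units A" using A.Units_mult_iff[OF a b(1)] by simp
  qed (rule alg_hom_Units[OF q])
  then show "a \<in> carrier A \<Longrightarrow> I +>\<^bsub>A\<^esub> a \<in> Units (quot A I) \<longleftrightarrow> a \<in> Units A" .
  have "\<one>\<^bsub>quot A I\<^esub> \<noteq> \<zero>\<^bsub>quot A I\<^esub>"
  proof
    assume "\<one>\<^bsub>quot A I\<^esub> = \<zero>\<^bsub>quot A I\<^esub>"
    then have "\<one>\<^bsub>A\<^esub> \<in> I" using I.rcos_const_imp_mem[OF A.one_closed] by (simp add: quot_simps)
    then show False using I(2) A.Units_one_closed by auto
  qed
  moreover have "x \<oplus>\<^bsub>quot A I\<^esub> y \<notin> Units (quot A I)"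
    if xy: "x \<in> carrier (quot A I)" "y \<in> carrier (quot A I)" "x \<notin> Units (quot A I)" "y \<notin> Units (quot A I)" for x y
  proof -
    obtain a b where ab: "a \<in> carrier A" "b \<in> carrier A" "x = I +>\<^bsub>A\<^esub> a" "y = I +>\<^bsub>A\<^esub> b"
      using xy(1,2) unfolding quot_carrier by (elim bexE)
    have "x \<oplus>\<^bsub>quot A I\<^esub> y = I +>\<^bsub>A\<^esub> (a \<oplus>\<^bsub>A\<^esub> b)" using ab alg_hom_add[OF q] by simp
    then show ?thesis using ab xy(3,4) local_ring_nonunit_add[OF A(2) ab(1,2)] iff by simp
  qed
  ultimately show "local_ring (quot A I)" unfolding local_ring_iff using Q.is_cring by blast
qed

locale red_space = lr_space X for X :: "('p, 'a, 'k::field) lrs" +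
  fixes Z :: "'p set"
  assumes Z: "Z \<subseteq> pts X"
begin

abbreviation "cl p a \<equiv> van_ideal X Z p +>\<^bsub>stalk X p\<^esub> a"
abbreviation "RX \<equiv> reduced_sub X Z"

lemma Zp: "p \<in> Z \<Longrightarrow> p \<in> pts X"
  using Z by blast

lemma van_I:
  assumes "openin (tspace X) W" "p \<in> W" "s \<in> sections X W" "\<And>q. q \<in> W \<Longrightarrow> q \<in> Z \<Longrightarrow> s q \<notin> Units (stalk X q)"
  shows "s p \<in> van_ideal X Z p"
proof -
  have "s p \<in> carrier (stalk X p)" by (rule sec_carrier[OF assms(1,3,2)])
  moreover have "\<forall>q\<in>W \<inter> Z. vanishes X s q" using assms(4) by (simp add: vanishes_def)
  ultimately show ?thesis using assms(1-3) unfolding van_ideal_def by (intro CollectI conjI exI) (auto intro: refl)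
qed

lemma van_E:
  assumes "a \<in> van_ideal X Z p"
  obtains W s where "openin (tspace X) W" "p \<in> W" "s \<in> sections X W" "s p = a" "\<forall>q\<in>W \<inter> Z. s q \<notin> Units (stalk X q)"
  using assms unfolding van_ideal_def vanishes_def by (elim CollectE conjE exE)

lemma van_carrier: "a \<in> van_ideal X Z p \<Longrightarrow> a \<in> carrier (stalk X p)"
  by (simp add: van_ideal_def)

lemma van_ideal_ideal:
  assumes p: "p \<in> Z" shows "ideal (van_ideal X Z p) (stalk X p)"
proof -
  interpret S: cring "stalk X p" by (rule stalk_cring[OF Zp[OF p]])
  show ?thesis
  proof (rule S.ideal_by_mult)
    show "van_ideal X Z p \<subseteq> carrier (stalk X p)" using van_carrier by blast
    have "(\<lambda>p\<in>pts X. \<zero>\<^bsub>stalk X p\<^esub>) p \<in> van_ideal X Z p"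
      by (rule van_I[OF openin_topspace Zp[OF p] sec_zero[OF openin_topspace]])
        (simp add: local_ring_zero_nonunit[OF stalk_local])
    then show "\<zero>\<^bsub>stalk X p\<^esub> \<in> van_ideal X Z p" using Zp[OF p] by simp
  next
    fix a b assume "a \<in> van_ideal X Z p" "b \<in> van_ideal X Z p"
    obtain W s where s: "openin (tspace X) W" "p \<in> W" "s \<in> sections X W" "s p = a" "\<forall>q\<in>W \<inter> Z. s q \<notin> Units (stalk X q)"
      using \<open>a \<in> _\<close> by (rule van_E)
    obtain V t where t: "openin (tspace X) V" "p \<in> V" "t \<in> sections X V" "t p = b" "\<forall>q\<in>V \<inter> Z. t q \<notin> Units (stalk X q)"
      using \<open>b \<in> _\<close> by (rule van_E)
    have o: "openin (tspace X) (W \<inter> V)" using s(1) t(1) by (rule openin_Int)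
    have r: "restrict s (W \<inter> V) \<in> sections X (W \<inter> V)" "restrict t (W \<inter> V) \<in> sections X (W \<inter> V)"
      using sec_restrict[OF s(1,3) o] sec_restrict[OF t(1,3) o] by auto
    have "(\<lambda>q\<in>W \<inter> V. restrict s (W \<inter> V) q \<oplus>\<^bsub>stalk X q\<^esub> restrict t (W \<inter> V) q) p \<in> van_ideal X Z p"
    proof (rule van_I[OF o _ sec_add[OF o r]])
      fix q assume q: "q \<in> W \<inter> V" "q \<in> Z"
      have "s q \<oplus>\<^bsub>stalk X q\<^esub> t q \<notin> Units (stalk X q)"
        using q s(5) t(5) sec_carrier[OF s(1,3)] sec_carrier[OF t(1,3)]
        by (intro local_ring_nonunit_add[OF stalk_local[OF Zp]]) simp_all
      then show "(\<lambda>q\<in>W \<inter> V. restrict s (W \<inter> V) q \<oplus>\<^bsub>stalk X q\<^esub> restrict t (W \<inter> V) q) q \<notin> Units (stalk X q)"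
        using q by simp
    qed (use s t in auto)
    then show "a \<oplus>\<^bsub>stalk X p\<^esub> b \<in> van_ideal X Z p" using s(2,4) t(2,4) by simp
  next
    fix a x assume "a \<in> van_ideal X Z p" and x: "x \<in> carrier (stalk X p)"
    obtain W s where s: "openin (tspace X) W" "p \<in> W" "s \<in> sections X W" "s p = a" "\<forall>q\<in>W \<inter> Z. s q \<notin> Units (stalk X q)"
      using \<open>a \<in> _\<close> by (rule van_E)
    obtain V t where t: "openin (tspace X) V" "p \<in> V" "t \<in> sections X V" "t p = x"
      using germ_ex[OF Zp[OF p] x] by (elim exE conjE)
    have o: "openin (tspace X) (W \<inter> V)" using s(1) t(1) by (rule openin_Int)
    have r: "restrict s (W \<inter> V) \<in> sections X (W \<inter> V)" "restrict t (W \<inter> V) \<in> sections X (W \<inter> V)"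
      using sec_restrict[OF s(1,3) o] sec_restrict[OF t(1,3) o] by auto
    have "(\<lambda>q\<in>W \<inter> V. restrict t (W \<inter> V) q \<otimes>\<^bsub>stalk X q\<^esub> restrict s (W \<inter> V) q) p \<in> van_ideal X Z p"
    proof (rule van_I[OF o _ sec_mult[OF o r(2,1)]])
      fix q assume q: "q \<in> W \<inter> V" "q \<in> Z"
      interpret Q: cring "stalk X q" by (rule stalk_cring[OF Zp[OF q(2)]])
      show "(\<lambda>q\<in>W \<inter> V. restrict t (W \<inter> V) q \<otimes>\<^bsub>stalk X q\<^esub> restrict s (W \<inter> V) q) q \<notin> Units (stalk X q)"
        using q s(5) sec_carrier[OF s(1,3)] sec_carrier[OF t(1,3)] by (simp add: Q.Units_mult_iff)
    qed (use s t in auto)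
    then show "x \<otimes>\<^bsub>stalk X p\<^esub> a \<in> van_ideal X Z p" using s(2,4) t(2,4) by simp
  qed
qed

lemma van_nonunit: 
  assumes p: "p \<in> Z" shows "van_ideal X Z p \<inter> Units (stalk X p) = {}"
proof -
  have "a \<notin> Units (stalk X p)" if "a \<in> van_ideal X Z p" for a
    by (rule van_E[OF that]) (use p in auto)
  then show ?thesis by auto
qed

lemma R_simps [simp]: "tspace RX = subtopology (tspace X) Z" "stalk RX p = quot (stalk X p) (van_ideal X Z p)"
  by (simp_all add: reduced_sub_def)

lemma R_pts [simp]: "pts RX = Z"
  using Z by auto

lemma R_kalg: "p \<in> Z \<Longrightarrow> kalgebra (quot (stalk X p) (van_ideal X Z p))"
  by (rule quot_kalgebra[OF stalk_kalg[OF Zp] van_ideal_ideal])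

lemma R_local: "p \<in> Z \<Longrightarrow> local_ring (quot (stalk X p) (van_ideal X Z p))"
  by (rule quot_local(2)[OF stalk_kalg[OF Zp] stalk_local[OF Zp] van_ideal_ideal van_nonunit])

lemma cl_unit_iff: "p \<in> Z \<Longrightarrow> a \<in> carrier (stalk X p) \<Longrightarrow>
    cl p a \<in> Units (quot (stalk X p) (van_ideal X Z p)) \<longleftrightarrow> a \<in> Units (stalk X p)"
  by (rule quot_local(1)[OF stalk_kalg[OF Zp] stalk_local[OF Zp] van_ideal_ideal van_nonunit])

lemma cl_hom: "p \<in> Z \<Longrightarrow> (\<lambda>a. cl p a) \<in> alg_hom (stalk X p) (quot (stalk X p) (van_ideal X Z p))"
  by (rule quot_hom[OF van_ideal_ideal])

lemma cl_zero_iff: "p \<in> Z \<Longrightarrow> a \<in> carrier (stalk X p) \<Longrightarrow>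
    cl p a = \<zero>\<^bsub>quot (stalk X p) (van_ideal X Z p)\<^esub> \<longleftrightarrow> a \<in> van_ideal X Z p"
  using ideal.rcos_const_imp_mem[OF van_ideal_ideal] ring.a_rcos_zero[OF cring.axioms(1)[OF stalk_cring[OF Zp]] van_ideal_ideal]
  by (auto simp: quot_simps)

definition "lifts W' t s \<longleftrightarrow> openin (tspace X) W' \<and> t \<in> sections X W' \<and> (\<forall>q\<in>W' \<inter> Z. s q = cl q (t q))"

lemma liftsD:
  assumes "lifts W' t s" shows "openin (tspace X) W'" "t \<in> sections X W'"
    "q \<in> W' \<Longrightarrow> q \<in> Z \<Longrightarrow> s q = cl q (t q)" "q \<in> W' \<Longrightarrow> t q \<in> carrier (stalk X q)"
  using assms sec_carrier[of W' t q] by (simp_all add: lifts_def)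

lemma lifts_restrict:
  assumes "lifts W t s" "openin (tspace X) W'" "W' \<subseteq> W" shows "lifts W' (restrict t W') s"
  using assms(2,3) liftsD[OF assms(1)] sec_restrict[OF liftsD(1,2)[OF assms(1)] assms(2,3)]
  by (auto simp: lifts_def)

lemma R_sections: "s \<in> sections RX W \<longleftrightarrow> s \<in> extensional W \<and> W \<subseteq> Z \<and>
    (\<forall>p\<in>W. \<exists>W' t. p \<in> W' \<and> W' \<inter> Z \<subseteq> W \<and> lifts W' t s)" if W: "W \<subseteq> Z" for W
proof
  assume "s \<in> sections RX W"
  then have s: "s \<in> extensional W" "\<forall>p\<in>W. \<exists>W' t. openin (tspace X) W' \<and> p \<in> W' \<and> W' \<inter> Z \<subseteq> W \<and> t \<in> sections X W' \<and>
          (\<forall>q \<in> W' \<inter> Z. s q = cl q (t q))"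
    by (simp_all add: reduced_sub_def PiE_def)
  then show "s \<in> extensional W \<and> W \<subseteq> Z \<and> (\<forall>p\<in>W. \<exists>W' t. p \<in> W' \<and> W' \<inter> Z \<subseteq> W \<and> lifts W' t s)"
    unfolding lifts_def using W by (intro conjI ballI) (simp, simp, drule (1) bspec, elim exE conjE, intro exI conjI)
next
  assume R: "s \<in> extensional W \<and> W \<subseteq> Z \<and> (\<forall>p\<in>W. \<exists>W' t. p \<in> W' \<and> W' \<inter> Z \<subseteq> W \<and> lifts W' t s)"
  have "s p \<in> carrier (quot (stalk X p) (van_ideal X Z p))" if p: "p \<in> W" for p
  proof -
    obtain W' t where t: "p \<in> W'" "lifts W' t s" using R p by (elim conjE) (drule (1) bspec, elim exE conjE, rule that)
    show ?thesis unfolding quot_carrier using liftsD(3,4)[OF t(2), of p] t(1) p W by auto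
  qed
  moreover have "\<forall>p\<in>W. \<exists>W' t. openin (tspace X) W' \<and> p \<in> W' \<and> W' \<inter> Z \<subseteq> W \<and> t \<in> sections X W' \<and>
          (\<forall>q \<in> W' \<inter> Z. s q = cl q (t q))"
  proof
    fix p assume p: "p \<in> W"
    obtain W' t where "p \<in> W'" "W' \<inter> Z \<subseteq> W" "lifts W' t s"
      using bspec[OF conjunct2[OF conjunct2[OF R]] p] by (elim exE conjE)
    then show "\<exists>W' t. openin (tspace X) W' \<and> p \<in> W' \<and> W' \<inter> Z \<subseteq> W \<and> t \<in> sections X W' \<and> (\<forall>q \<in> W' \<inter> Z. s q = cl q (t q))"
      unfolding lifts_def by (elim conjE) (intro exI conjI)
  qed
  ultimately show "s \<in> sections RX W" using R by (simp add: reduced_sub_def PiE_def Pi_def)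
qed

lemma R_open: "openin (tspace RX) W \<longleftrightarrow> (\<exists>T. openin (tspace X) T \<and> W = T \<inter> Z)"
  by (simp add: openin_subtopology)

lemma R_openI: "openin (tspace X) T \<Longrightarrow> openin (tspace RX) (T \<inter> Z)"
  unfolding R_open by (rule exI[where x = T]) simp

lemma R_open_sub: "openin (tspace RX) W \<Longrightarrow> W \<subseteq> Z"
  by (auto simp: openin_subtopology)

lemma R_lift:
  assumes "openin (tspace RX) W" "s \<in> sections RX W" "p \<in> W"
  shows "\<exists>W' t. p \<in> W' \<and> W' \<inter> Z \<subseteq> W \<and> lifts W' t s"
  using assms(2,3) unfolding R_sections[OF R_open_sub[OF assms(1)]] by (elim conjE) (rule bspec)

lemma R_sectionI:
  assumes "openin (tspace RX) W" "s \<in> extensional W" "\<And>p. p \<in> W \<Longrightarrow> \<exists>W' t. p \<in> W' \<and> lifts W' t s"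
  shows "s \<in> sections RX W"
proof -
  obtain T where T: "openin (tspace X) T" "W = T \<inter> Z" using assms(1) unfolding R_open by (elim exE conjE)
  have "\<exists>W' t. p \<in> W' \<and> W' \<inter> Z \<subseteq> W \<and> lifts W' t s" if p: "p \<in> W" for p
  proof -
    obtain W' t where t: "p \<in> W'" "lifts W' t s" using assms(3)[OF p] by (elim exE conjE)
    have "lifts (W' \<inter> T) (restrict t (W' \<inter> T)) s"
      using liftsD(1)[OF t(2)] T(1) by (intro lifts_restrict[OF t(2)] openin_Int) simp_all
    moreover have "p \<in> W' \<inter> T" "W' \<inter> T \<inter> Z \<subseteq> W" using T(2) p t(1) by auto
    ultimately show ?thesis by (intro exI conjI)
  qed
  then show ?thesis using assms(2) R_open_sub[OF assms(1)] by (simp add: R_sections)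
qed

lemma R_lift2:
  assumes W: "openin (tspace RX) W" "s \<in> sections RX W" "s' \<in> sections RX W" "p \<in> W"
  shows "\<exists>W' t t'. p \<in> W' \<and> W' \<inter> Z \<subseteq> W \<and> lifts W' t s \<and> lifts W' t' s'"
proof -
  obtain W1 t where 1: "p \<in> W1" "W1 \<inter> Z \<subseteq> W" "lifts W1 t s" using R_lift[OF W(1,2,4)] by (elim exE conjE)
  obtain W2 t' where 2: "p \<in> W2" "W2 \<inter> Z \<subseteq> W" "lifts W2 t' s'" using R_lift[OF W(1,3,4)] by (elim exE conjE)
  have o: "openin (tspace X) (W1 \<inter> W2)" using liftsD(1)[OF 1(3)] liftsD(1)[OF 2(3)] by (rule openin_Int)
  have "lifts (W1 \<inter> W2) (restrict t (W1 \<inter> W2)) s" "lifts (W1 \<inter> W2) (restrict t' (W1 \<inter> W2)) s'"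
    using lifts_restrict[OF 1(3) o] lifts_restrict[OF 2(3) o] by auto
  moreover have "p \<in> W1 \<inter> W2" "W1 \<inter> W2 \<inter> Z \<subseteq> W" using 1 2 by auto
  ultimately show ?thesis by (intro exI conjI)
qed

lemma R_lr: "locally_ringed RX"
proof (rule locally_ringedI)
  fix W assume W: "openin (tspace RX) W"
  note WZ = R_open_sub[OF W]
  show "s \<in> (\<Pi>\<^sub>E p\<in>W. carrier (stalk RX p))" if "s \<in> sections RX W" for s
    using that by (simp add: reduced_sub_def)
  show "(\<lambda>p\<in>W. scal (stalk RX p) c) \<in> sections RX W" for c
  proof (rule R_sectionI[OF W])
    fix p assume "p \<in> W"
    obtain T where T: "openin (tspace X) T" "W = T \<inter> Z" using W unfolding R_open by (elim exE conjE)
    have "lifts T (\<lambda>p\<in>T. scal (stalk X p) c) (\<lambda>p\<in>W. scal (stalk RX p) c)"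
      using T sec_scal[OF T(1)] by (simp add: lifts_def quot_simps)
    moreover have "p \<in> T" using \<open>p \<in> W\<close> T by simp
    ultimately show "\<exists>W' t. p \<in> W' \<and> lifts W' t (\<lambda>p\<in>W. scal (stalk RX p) c)" by (intro exI conjI)
  qed simp
  fix s s' assume s: "s \<in> sections RX W" and s': "s' \<in> sections RX W"
  let ?d = "\<lambda>p\<in>W. s p \<ominus>\<^bsub>stalk RX p\<^esub> s' p" and ?m = "\<lambda>p\<in>W. s p \<otimes>\<^bsub>stalk RX p\<^esub> s' p"
  have dm: "(\<exists>W' t. p \<in> W' \<and> lifts W' t ?d) \<and> (\<exists>W' t. p \<in> W' \<and> lifts W' t ?m)" if p: "p \<in> W" for p
  proof -
    obtain W' t t' where t: "p \<in> W'" "W' \<inter> Z \<subseteq> W" "lifts W' t s" "lifts W' t' s'"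
      using R_lift2[OF W s s' p] by (elim exE conjE)
    note l = liftsD[OF t(3)] and l' = liftsD[OF t(4)]
    have "?d q = cl q (t q \<ominus>\<^bsub>stalk X q\<^esub> t' q)" "?m q = cl q (t q \<otimes>\<^bsub>stalk X q\<^esub> t' q)" if q: "q \<in> W'" "q \<in> Z" for q
    proof -
      have qW: "q \<in> W" using q t(2) by auto
      show "?d q = cl q (t q \<ominus>\<^bsub>stalk X q\<^esub> t' q)"
        using alg_hom_minus[OF cl_hom[OF q(2)] stalk_cring[OF Zp[OF q(2)]] kalg_cring[OF R_kalg[OF q(2)]] l(4)[OF q(1)] l'(4)[OF q(1)]]
          qW l(3)[OF q] l'(3)[OF q] by simp
      show "?m q = cl q (t q \<otimes>\<^bsub>stalk X q\<^esub> t' q)"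
        using alg_hom_mult[OF cl_hom[OF q(2)] l(4)[OF q(1)] l'(4)[OF q(1)]] qW l(3)[OF q] l'(3)[OF q] by simp
    qed
    then have "lifts W' (\<lambda>q\<in>W'. t q \<ominus>\<^bsub>stalk X q\<^esub> t' q) ?d" "lifts W' (\<lambda>q\<in>W'. t q \<otimes>\<^bsub>stalk X q\<^esub> t' q) ?m"
      using l(1) sec_diff[OF l(1) l(2) l'(2)] sec_mult[OF l(1) l(2) l'(2)] by (simp_all add: lifts_def del: restrict_apply) auto
    then show ?thesis using t(1) by (intro exI conjI)
  qed
  show "?d \<in> sections RX W" "?m \<in> sections RX W"
    by (rule R_sectionI[OF W restrict_extensional], drule dm, elim conjE, assumption)+
  fix p assume p: "p \<in> W" "s p = s' p"
  obtain W' t t' where t: "p \<in> W'" "W' \<inter> Z \<subseteq> W" "lifts W' t s" "lifts W' t' s'"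
    using R_lift2[OF W s s' p(1)] by (elim exE conjE)
  note l = liftsD[OF t(3)] and l' = liftsD[OF t(4)]
  have pZ: "p \<in> Z" using p WZ by auto
  \<comment> \<open>The difference of the two lifts has at \<open>p\<close> the germ of a section
    \<open>u\<close> that vanishes on \<open>Z\<close> near \<open>p\<close>. Sections with equal
    germs agree nearby, so at all nearby points of \<open>Z\<close> the difference is in the
    vanishing ideal and the classes coincide.\<close>
  have "cl p (t p) = cl p (t' p)" using l(3)[OF t(1) pZ] l'(3)[OF t(1) pZ] p(2) by simp
  then have "t p \<ominus>\<^bsub>stalk X p\<^esub> t' p \<in> van_ideal X Z p"
    using quot_eq_iff[OF van_ideal_ideal[OF pZ] l(4)[OF t(1)] l'(4)[OF t(1)]] by simp
  then obtain V u where u: "openin (tspace X) V" "p \<in> V" "u \<in> sections X V" "u p = t p \<ominus>\<^bsub>stalk X p\<^esub> t' p"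
      "\<forall>q\<in>V \<inter> Z. u q \<notin> Units (stalk X q)" by (rule van_E)
  have o: "openin (tspace X) (W' \<inter> V)" using l(1) u(1) by (rule openin_Int)
  let ?t = "restrict (\<lambda>q\<in>W'. t q \<ominus>\<^bsub>stalk X q\<^esub> t' q) (W' \<inter> V)" and ?u = "restrict u (W' \<inter> V)"
  have tu: "?t \<in> sections X (W' \<inter> V)" "?u \<in> sections X (W' \<inter> V)"
    by (rule sec_restrict[OF l(1) sec_diff[OF l(1,2) l'(2)] o], simp) (rule sec_restrict[OF u(1,3) o], simp)
  have pV: "p \<in> W' \<inter> V" "?t p = ?u p" using t(1) u(2,4) by simp_all
  obtain V' where V': "openin (tspace X) V'" "p \<in> V'" "V' \<subseteq> W' \<inter> V" "restrict ?t V' = restrict ?u V'"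
    using sec_germ_eq[OF o tu pV] by (elim exE conjE)
  have eq: "s q = s' q" if q: "q \<in> V' \<inter> Z" for q
  proof -
    have q': "q \<in> W'" "q \<in> V" "q \<in> Z" "q \<in> V'" using q V'(3) by auto
    have "t q \<ominus>\<^bsub>stalk X q\<^esub> t' q = u q" using fun_cong[OF V'(4), of q] q' by simp
    moreover have "u q \<in> van_ideal X Z q" by (rule van_I[OF u(1) q'(2) u(3)]) (use u(5) in auto)
    ultimately have "cl q (t q) = cl q (t' q)"
      using quot_eq_iff[OF van_ideal_ideal[OF q'(3)] l(4)[OF q'(1)] l'(4)[OF q'(1)]] by simp
    then show ?thesis using l(3)[OF q'(1,3)] l'(3)[OF q'(1,3)] by simp
  qed
  have "openin (tspace RX) (V' \<inter> Z)" using V'(1) by (rule R_openI)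
  moreover have "p \<in> V' \<inter> Z" "V' \<inter> Z \<subseteq> W" using V'(2,3) pZ t(2) by auto
  moreover have "restrict s (V' \<inter> Z) = restrict s' (V' \<inter> Z)" using eq by (rule restrict_ext)
  ultimately show "\<exists>W'. openin (tspace RX) W' \<and> p \<in> W' \<and> W' \<subseteq> W \<and> restrict s W' = restrict s' W'"
    by (intro exI conjI)
next
  fix W W' s assume W: "openin (tspace RX) W" "s \<in> sections RX W" "openin (tspace RX) W'" "W' \<subseteq> W"
  obtain T where T: "openin (tspace X) T" "W' = T \<inter> Z" using W(3) unfolding R_open by (elim exE conjE)
  show "restrict s W' \<in> sections RX W'"
  proof (rule R_sectionI[OF W(3)])
    fix p assume p: "p \<in> W'"
    obtain V t where t: "p \<in> V" "V \<inter> Z \<subseteq> W" "lifts V t s" using R_lift[OF W(1,2) subsetD[OF W(4) p]] by (elim exE conjE)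
    have "lifts (V \<inter> T) (restrict t (V \<inter> T)) s"
      using liftsD(1)[OF t(3)] T(1) by (intro lifts_restrict[OF t(3)] openin_Int) simp_all
    then have "lifts (V \<inter> T) (restrict t (V \<inter> T)) (restrict s W')" using T(2) by (simp add: lifts_def)
    moreover have "p \<in> V \<inter> T" using p t(1) T(2) by simp
    ultimately show "\<exists>W'a t. p \<in> W'a \<and> lifts W'a t (restrict s W')" by (intro exI conjI)
  qed simp
next
  fix W s assume W: "openin (tspace RX) W" "s \<in> (\<Pi>\<^sub>E p\<in>W. carrier (stalk RX p))"
    "\<forall>p\<in>W. \<exists>W'. openin (tspace RX) W' \<and> p \<in> W' \<and> W' \<subseteq> W \<and> restrict s W' \<in> sections RX W'"
  show "s \<in> sections RX W"
  proof (rule R_sectionI[OF W(1)])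
    show "s \<in> extensional W" using W(2) by (simp add: PiE_def)
    fix p assume p: "p \<in> W"
    obtain W' where W': "openin (tspace RX) W'" "p \<in> W'" "W' \<subseteq> W" "restrict s W' \<in> sections RX W'"
      using bspec[OF W(3) p] by (elim exE conjE)
    obtain V t where t: "p \<in> V" "V \<inter> Z \<subseteq> W'" "lifts V t (restrict s W')"
      using R_lift[OF W'(1,4,2)] by (elim exE conjE)
    have "lifts V t s" using t(2,3) by (auto simp: lifts_def subset_iff)
    then show "\<exists>W' t. p \<in> W' \<and> lifts W' t s" using t(1) by (intro exI conjI)
  qed
next
  fix p a assume pa: "p \<in> pts RX" "a \<in> carrier (stalk RX p)"
  then have p: "p \<in> Z" using R_pts by blast
  obtain b where b: "b \<in> carrier (stalk X p)" "a = cl p b" using pa(2) unfolding R_simps quot_carrier by (elim bexE)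
  obtain W s where s: "openin (tspace X) W" "p \<in> W" "s \<in> sections X W" "s p = b"
    using germ_ex[OF Zp[OF p] b(1)] by (elim exE conjE)
  let ?s = "\<lambda>q\<in>W \<inter> Z. cl q (s q)"
  have o: "openin (tspace RX) (W \<inter> Z)" using s(1) by (rule R_openI)
  have "lifts W s ?s" using s(1,3) by (simp add: lifts_def)
  then have "?s \<in> sections RX (W \<inter> Z)" by (intro R_sectionI[OF o] exI conjI) auto
  moreover have "p \<in> W \<inter> Z" "?s p = a" using p s(2,4) b(2) by simp_all
  ultimately show "\<exists>W s. openin (tspace RX) W \<and> p \<in> W \<and> s \<in> sections RX W \<and> s p = a" using o by (intro exI conjI)
qed (use R_kalg R_local Z in auto)

lemma incl_fst [simp]: "p \<in> Z \<Longrightarrow> fst (reduced_incl X Z) p = p"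
  and incl_snd [simp]: "p \<in> Z \<Longrightarrow> a \<in> carrier (stalk X p) \<Longrightarrow> snd (reduced_incl X Z) p a = cl p a"
  by (simp_all add: reduced_incl_def)

lemma incl_morphism: "morphism RX X (reduced_incl X Z)"
proof (rule morphismI)
  have eq: "preim RX (reduced_incl X Z) W = W \<inter> Z" for W using Z by (auto simp: preim_def)
  fix W assume W: "openin (tspace X) W"
  show o: "openin (tspace RX) (preim RX (reduced_incl X Z) W)" unfolding eq using W by (rule R_openI)
  fix s assume s: "s \<in> sections X W"
  have "lifts W s (pull RX (reduced_incl X Z) W s)"
    using W s sec_carrier[OF W s] unfolding lifts_def pull_def eq by simp
  then show "pull RX (reduced_incl X Z) W s \<in> sections RX (preim RX (reduced_incl X Z) W)"
    by (intro R_sectionI[OF o] exI conjI) (auto simp: pull_def eq)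
next
  fix p assume p: "p \<in> pts RX"
  then have pZ: "p \<in> Z" using R_pts by blast
  show "fst (reduced_incl X Z) p \<in> pts X" using Zp[OF pZ] pZ by simp
  show "snd (reduced_incl X Z) p \<in> extensional (carrier (stalk X (fst (reduced_incl X Z) p)))"
    using pZ by (simp add: reduced_incl_def)
  show "snd (reduced_incl X Z) p \<in> alg_hom (stalk X (fst (reduced_incl X Z) p)) (stalk RX p)"
    using alg_hom_cong[OF cl_hom[OF pZ] stalk_kalg[OF Zp[OF pZ]]] pZ by simp
  show "a \<in> Units (stalk X (fst (reduced_incl X Z) p))"
    if "a \<in> carrier (stalk X (fst (reduced_incl X Z) p))" "snd (reduced_incl X Z) p a \<in> Units (stalk RX p)" for a
    using that pZ by (simp add: cl_unit_iff)
qed (use Z in \<open>simp_all add: reduced_incl_def Int_absorb1\<close>)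

text \<open>The inclusion is injective on points and its stalk maps, being projections to quotients,
  are surjective; so it can be cancelled on the left.\<close>

lemma incl_mono:
  assumes f: "morphism T RX f" and g: "morphism T RX g"
    and e: "mcomp T X (reduced_incl X Z) f = mcomp T X (reduced_incl X Z) g"
  shows "f = g"
proof (rule mor_fst_eqI[OF f g])
  fix p assume p: "p \<in> pts T"
  have z: "fst f p \<in> Z" "fst g p \<in> Z" using mor_pt[OF f p] mor_pt[OF g p] unfolding R_pts by auto
  show pt: "fst f p = fst g p" using arg_cong[OF e, of "\<lambda>h. fst h p"] p z by simp
  fix C assume "C \<in> carrier (stalk RX (fst f p))"
  then obtain a where a: "a \<in> carrier (stalk X (fst f p))" "C = cl (fst f p) a" unfolding R_simps quot_carrier by (elim bexE)
  show "snd f p C = snd g p C" using arg_cong[OF e, of "\<lambda>h. snd h p a"] p z a pt by simp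
qed

text \<open>Passing to the quotient by the vanishing ideal does not change which germs are units. A
  lift of an everywhere vanishing section therefore vanishes on \<open>Z\<close> and is in the
  vanishing ideal.\<close>

lemma R_lreduced: "lreduced RX"
  unfolding lreduced_def
proof (intro allI impI ballI)
  fix W s p assume W: "openin (tspace RX) W" and s: "s \<in> sections RX W" and v: "\<forall>p\<in>W. vanishes RX s p" and p: "p \<in> W"
  obtain W' t where t: "p \<in> W'" "W' \<inter> Z \<subseteq> W" "lifts W' t s" using R_lift[OF W s p] by (elim exE conjE)
  note l = liftsD[OF t(3)]
  have pZ: "p \<in> Z" using R_open_sub[OF W] p by blast
  have "t p \<in> van_ideal X Z p"
  proof (rule van_I[OF l(1) t(1) l(2)])
    fix q assume q: "q \<in> W'" "q \<in> Z"
    then have "s q \<notin> Units (stalk RX q)" using v t(2) by (auto simp: vanishes_def)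
    then show "t q \<notin> Units (stalk X q)" using cl_unit_iff[OF q(2) l(4)[OF q(1)]] l(3)[OF q] by simp
  qed
  then show "s p = \<zero>\<^bsub>stalk RX p\<^esub>" using cl_zero_iff[OF pZ l(4)[OF t(1)]] l(3)[OF t(1) pZ] by simp
qed

end

definition rfac :: "('p, 'a, 'k::field) lrs \<Rightarrow> 'p set \<Rightarrow> ('q, 'b, 'k) lrs \<Rightarrow> ('q, 'b, 'p, 'a) mor \<Rightarrow> ('q, 'b, 'p, 'a set) mor" where
  "rfac X Z T f = (fst f, \<lambda>p\<in>pts T. \<lambda>C\<in>carrier (quot (stalk X (fst f p)) (van_ideal X Z (fst f p))).
     qlift (stalk X (fst f p)) (van_ideal X Z (fst f p)) (snd f p) C)"

text \<open>A germ vanishing on \<open>Z\<close> pulls back to a germ that vanishes at all points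
  near \<open>p\<close>, because \<open>f\<close> lands in \<open>Z\<close>; on a reduced source it
  is zero. Hence every stalk map kills the vanishing ideal and descends to the quotient.\<close>

lemma (in red_space) rfac:
  assumes T: "locally_ringed T" "lreduced T" and f: "morphism T X f" and i: "\<And>p. p \<in> pts T \<Longrightarrow> fst f p \<in> Z"
  shows "morphism T RX (rfac X Z T f)" and "mcomp T X (reduced_incl X Z) (rfac X Z T f) = f"
proof -
  interpret T: lr_space T by (rule lr_space.intro) fact
  have fst: "fst (rfac X Z T f) = fst f" by (simp add: rfac_def)
  have kill: "snd f p a = \<zero>\<^bsub>stalk T p\<^esub>" if p: "p \<in> pts T" and a: "a \<in> van_ideal X Z (fst f p)" for p a
  proof -
    obtain W s where s: "openin (tspace X) W" "fst f p \<in> W" "s \<in> sections X W" "s (fst f p) = a" "\<forall>q\<in>W \<inter> Z. s q \<notin> Units (stalk X q)"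
      using a by (rule van_E)
    have pp: "p \<in> preim T f W" using p s(2) by (simp add: preim_def)
    have "\<forall>q\<in>preim T f W. vanishes T (pull T f W s) q"
    proof
      fix q assume q: "q \<in> preim T f W"
      then have "q \<in> pts T" "fst f q \<in> W" by (auto simp: preim_def)
      then show "vanishes T (pull T f W s) q"
        using mor_Units_iff[OF f, of q "s (fst f q)"] s(5) i[of q] q sec_carrier[OF s(1,3)] by (simp add: vanishes_def pull_def)
    qed
    then have "pull T f W s p = \<zero>\<^bsub>stalk T p\<^esub>"
      using T(2) mor_preim_open[OF f s(1)] mor_pull[OF f s(1,3)] pp unfolding lreduced_def by simp
    then show ?thesis using pp s(4) by (simp add: pull_def)
  qed
  have snd: "snd (rfac X Z T f) p (cl (fst f p) a) = snd f p a" if p: "p \<in> pts T" and a: "a \<in> carrier (stalk X (fst f p))" for p a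
  proof -
    have "cl (fst f p) a \<in> carrier (quot (stalk X (fst f p)) (van_ideal X Z (fst f p)))" using a unfolding quot_carrier by auto
    then have "snd (rfac X Z T f) p (cl (fst f p) a) = qlift (stalk X (fst f p)) (van_ideal X Z (fst f p)) (snd f p) (cl (fst f p) a)"
      using p by (simp add: rfac_def)
    also have "\<dots> = snd f p a"
      by (rule qlift_eq[OF van_ideal_ideal[OF i[OF p]] mor_hom[OF f p] stalk_cring[OF Zp[OF i[OF p]]] T.stalk_cring[OF p] kill[OF p] a])
    finally show ?thesis .
  qed
  have pre: "preim T (rfac X Z T f) (S \<inter> Z) = preim T f S" for S using i by (auto simp: preim_def fst)
  show m: "morphism T RX (rfac X Z T f)"
  proof (rule morphismI)
    fix W assume W: "openin (tspace RX) W"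
    obtain S where S: "openin (tspace X) S" "W = S \<inter> Z" using W unfolding R_open by (elim exE conjE)
    show o: "openin (tspace T) (preim T (rfac X Z T f) W)" unfolding S(2) pre by (rule mor_preim_open[OF f S(1)])
    fix s assume s: "s \<in> sections RX W"
    show "pull T (rfac X Z T f) W s \<in> sections T (preim T (rfac X Z T f) W)"
    proof (rule T.sec_local[OF o])
      fix p assume "p \<in> preim T (rfac X Z T f) W"
      then have p: "p \<in> pts T" "fst f p \<in> W" by (auto simp: preim_def fst)
      obtain W' t where t: "fst f p \<in> W'" "W' \<inter> Z \<subseteq> W" "lifts W' t s" using R_lift[OF W s p(2)] by (elim exE conjE)
      note l = liftsD[OF t(3)]
      have "pull T (rfac X Z T f) W s q = pull T f W' t q" if q: "q \<in> preim T f W' \<inter> preim T (rfac X Z T f) W" for q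
      proof -
        have q': "q \<in> pts T" "fst f q \<in> W'" "q \<in> preim T f W'" "q \<in> preim T (rfac X Z T f) W" using q by (auto simp: preim_def)
        show ?thesis using q' l(3)[OF q'(2) i[OF q'(1)]] snd[OF q'(1) l(4)[OF q'(2)]] by (simp add: pull_def fst)
      qed
      moreover have "p \<in> preim T f W'" using p t(1) by (simp add: preim_def)
      ultimately show "\<exists>W'a t. openin (tspace T) W'a \<and> p \<in> W'a \<and> t \<in> sections T W'a \<and>
          (\<forall>q\<in>W'a \<inter> preim T (rfac X Z T f) W. pull T (rfac X Z T f) W s q = t q)"
        using mor_preim_open[OF f l(1)] mor_pull[OF f l(1,2)] by (intro exI conjI ballI)
    qed (simp add: pull_def)
  next
    fix p assume p: "p \<in> pts T"
    show "fst (rfac X Z T f) p \<in> pts RX" unfolding fst R_pts by (rule i[OF p])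
    show "snd (rfac X Z T f) p \<in> extensional (carrier (stalk RX (fst (rfac X Z T f) p)))"
      using p by (simp add: rfac_def)
    have "qlift (stalk X (fst f p)) (van_ideal X Z (fst f p)) (snd f p) \<in> alg_hom (stalk RX (fst f p)) (stalk T p)"
      unfolding R_simps by (rule qlift_hom[OF van_ideal_ideal[OF i[OF p]] mor_hom[OF f p] stalk_kalg[OF Zp[OF i[OF p]]] T.stalk_cring[OF p] kill[OF p]])
    from alg_hom_cong[OF this, of "snd (rfac X Z T f) p"]
    show "snd (rfac X Z T f) p \<in> alg_hom (stalk RX (fst (rfac X Z T f) p)) (stalk T p)"
      using p R_kalg[OF i[OF p]] by (simp add: rfac_def)
    fix C assume C: "C \<in> carrier (stalk RX (fst (rfac X Z T f) p))" "snd (rfac X Z T f) p C \<in> Units (stalk T p)"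
    obtain a where a: "a \<in> carrier (stalk X (fst f p))" "C = cl (fst f p) a" using C(1) unfolding R_simps fst quot_carrier by (elim bexE)
    then show "C \<in> Units (stalk RX (fst (rfac X Z T f) p))"
      using C(2) snd[OF p a(1)] mor_Units_iff[OF f p a(1)] cl_unit_iff[OF i[OF p] a(1)] by (simp add: fst)
  qed (use mor_ext[OF f] in \<open>simp_all add: rfac_def\<close>)
  show "mcomp T X (reduced_incl X Z) (rfac X Z T f) = f"
  proof (rule mor_fst_eqI[OF morphism_mcomp[OF m incl_morphism lr] f])
    fix p assume p: "p \<in> pts T"
    show "fst (mcomp T X (reduced_incl X Z) (rfac X Z T f)) p = fst f p" using p i[OF p] by (simp add: fst)
    fix a assume "a \<in> carrier (stalk X (fst (mcomp T X (reduced_incl X Z) (rfac X Z T f)) p))"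
    then have a: "a \<in> carrier (stalk X (fst f p))" using p i[OF p] by (simp add: fst)
    show "snd (mcomp T X (reduced_incl X Z) (rfac X Z T f)) p a = snd f p a"
      using p i[OF p] a by (simp add: fst snd)
  qed
qed

lemma alg_hom_pow:
  assumes "h \<in> alg_hom A B" "cring A" "x \<in> carrier A" shows "h (x [^]\<^bsub>A\<^esub> (n::nat)) = h x [^]\<^bsub>B\<^esub> n"
proof -
  interpret A: cring A by fact
  show ?thesis using assms(3) by (induction n) (simp_all add: alg_hom_one[OF assms(1)] alg_hom_mult[OF assms(1)])
qed

lemma (in lr_space) gam_nilpotent:
  assumes "lreduced X" "s \<in> global X" "s [^]\<^bsub>gam X\<^esub> (n::nat) = \<zero>\<^bsub>gam X\<^esub>"
  shows "s = \<zero>\<^bsub>gam X\<^esub>"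
proof -
  have "\<forall>p\<in>pts X. vanishes X s p"
  proof
    fix p assume p: "p \<in> pts X"
    interpret S: cring "stalk X p" by (rule stalk_cring[OF p])
    have "s p [^]\<^bsub>stalk X p\<^esub> n = \<zero>\<^bsub>stalk X p\<^esub>"
      using alg_hom_pow[OF gam_eval[OF p] kalg_cring[OF gam_kalgebra], of s n] assms(2,3) p by simp
    then show "vanishes X s p"
      using S.Units_pow_closed[of "s p" n] local_ring_zero_nonunit[OF stalk_local[OF p]] by (auto simp: vanishes_def)
  qed
  then have "\<forall>p\<in>pts X. s p = \<zero>\<^bsub>stalk X p\<^esub>" using assms(1,2) openin_topspace unfolding lreduced_def by blast
  then show ?thesis using global_ext[OF assms(2)] by (intro extensionalityI[of _ "pts X"]) simp_all
qed

section \<open>Polynomial algebras\<close>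

abbreviation cst :: "'k::field \<Rightarrow> 'k mpoly" where "cst \<equiv> Poly_Mapping.single 0"

definition var :: "nat \<Rightarrow> 'k::field mpoly" where
  "var i = Poly_Mapping.single (Poly_Mapping.single i 1) 1"

abbreviation PR :: "nat \<Rightarrow> 'k::field mpoly set" where "PR n \<equiv> carrier (polyring n)"

lemma polyring_simps [simp]:
  "monoid.mult (polyring n) = (*)" "one (polyring n) = 1" "ring.zero (polyring n) = 0" "add (polyring n) = (+)"
  "scal (polyring n) = cst"
  by (simp_all add: polyring_def)

lemma PR_iff: "p \<in> PR n \<longleftrightarrow> (\<forall>m\<in>Poly_Mapping.keys p. Poly_Mapping.keys m \<subseteq> {..<n})"
  by (simp add: polyring_def)

lemma PR_cst [simp]: "cst c \<in> PR n"
  by (simp add: PR_iff)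

lemma PR_0 [simp]: "0 \<in> PR n" and PR_1 [simp]: "1 \<in> PR n"
  by (simp_all add: PR_iff)

lemma PR_var [simp]: "i < n \<Longrightarrow> var i \<in> PR n"
  by (simp add: PR_iff var_def)

lemma PR_add [simp]: "p \<in> PR n \<Longrightarrow> q \<in> PR n \<Longrightarrow> p + q \<in> PR n"
  using keys_add[of p q] unfolding PR_iff by blast

lemma PR_uminus [simp]: "p \<in> PR n \<Longrightarrow> - p \<in> PR n"
  unfolding PR_iff by simp

lemma PR_diff [simp]: "p \<in> PR n \<Longrightarrow> q \<in> PR n \<Longrightarrow> p - q \<in> PR n"
  using PR_add[of p n "- q"] by simp

lemma PR_mult [simp]:
  assumes "p \<in> PR n" "q \<in> PR n" shows "p * q \<in> PR n"
  unfolding PR_iff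
proof
  fix m assume "m \<in> Poly_Mapping.keys (p * q)"
  then obtain a b where "a \<in> Poly_Mapping.keys p" "b \<in> Poly_Mapping.keys q" "m = a + b" using keys_mult[of p q] by blast
  then show "Poly_Mapping.keys m \<subseteq> {..<n}" using keys_add[of a b] assms unfolding PR_iff by blast
qed

lemma PR_power [simp]: "p \<in> PR n \<Longrightarrow> p ^ k \<in> PR n"
  by (induction k) simp_all

lemma PR_mono: "p \<in> PR n \<Longrightarrow> n \<le> m \<Longrightarrow> p \<in> PR m"
  unfolding PR_iff by (meson lessThan_subset_iff order_trans)

lemma polyring_kalgebra: "kalgebra (polyring n)"
proof (rule kalgebraI)
  show "cring (polyring n)"
    by (intro cringI abelian_groupI comm_monoidI) (auto simp: algebra_simps intro: bexI[of _ "- _"])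
qed (simp_all add: single_add mult_single)

interpretation poly: kalg_ring "polyring n" for n
  by (rule kalg_ring.intro[OF polyring_kalgebra])

lemma poly_a_inv [simp]: "p \<in> PR n \<Longrightarrow> \<ominus>\<^bsub>polyring n\<^esub> p = - p"
  using poly.minus_equality[of n "- p" p] by simp

lemma poly_minus [simp]: "p \<in> PR n \<Longrightarrow> q \<in> PR n \<Longrightarrow> p \<ominus>\<^bsub>polyring n\<^esub> q = p - q"
  by (simp add: a_minus_def)

lemma poly_pow [simp]: "p [^]\<^bsub>polyring n\<^esub> (k::nat) = p ^ k"
  by (induction k) (simp_all add: mult.commute)

lemma pm_sum: "p = (\<Sum>m\<in>Poly_Mapping.keys p. Poly_Mapping.single m (Poly_Mapping.lookup p m))"
  by (rule poly_mapping_eqI) (simp add: lookup_sum lookup_single when_def in_keys_iff)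

lemma pm_induct:
  assumes "\<And>m c. P (Poly_Mapping.single m c)" "\<And>p q. P p \<Longrightarrow> P q \<Longrightarrow> P (p + q)"
  shows "P (p :: 'a \<Rightarrow>\<^sub>0 'b::comm_monoid_add)"
proof -
  have P0: "P 0" using assms(1)[of _ 0] by simp
  have "P (\<Sum>m\<in>K. Poly_Mapping.single m (Poly_Mapping.lookup p m))" if "finite K" for K
    using that by (induction rule: finite_induct) (simp_all add: assms P0)
  from this[OF finite_keys, of p] show ?thesis using pm_sum[of p] by simp
qed

lemma single_eq_prod:
  "Poly_Mapping.single m c = cst c * (\<Prod>i\<in>Poly_Mapping.keys m. var i ^ Poly_Mapping.lookup m i)" for c :: "'k::field"
proof -
  have pow: "var i ^ k = Poly_Mapping.single (Poly_Mapping.single i k) (1::'k)" for i k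
    by (induction k) (simp_all add: var_def mult_single single_add[symmetric])
  have "(\<Prod>i\<in>K. var i ^ Poly_Mapping.lookup m i) = Poly_Mapping.single (\<Sum>i\<in>K. Poly_Mapping.single i (Poly_Mapping.lookup m i)) (1::'k)"
    if "finite K" for K
    using that by (induction rule: finite_induct) (simp_all add: pow mult_single)
  from this[OF finite_keys, of m] show ?thesis using pm_sum[of m] by (simp add: mult_single)
qed

text \<open>Monomials are products of powers of variables by \<open>single_eq_prod\<close>, so
  constants and variables generate. The main consequence is \<open>polyring_hom_eq\<close>: a
  homomorphism is determined by its values on variables.\<close>

lemma polyring_induct [consumes 1, case_names cst var add mult]:
  fixes P :: "'k::field mpoly \<Rightarrow> bool"
  assumes p: "p \<in> PR n" and c: "\<And>c. P (cst c)" and v: "\<And>i. i < n \<Longrightarrow> P (var i)"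
    and a: "\<And>p q. p \<in> PR n \<Longrightarrow> q \<in> PR n \<Longrightarrow> P p \<Longrightarrow> P q \<Longrightarrow> P (p + q)"
    and m: "\<And>p q. p \<in> PR n \<Longrightarrow> q \<in> PR n \<Longrightarrow> P p \<Longrightarrow> P q \<Longrightarrow> P (p * q)"
  shows "P p"
proof -
  have P1: "P 1" "P 0" using c[of 1] c[of 0] by simp_all
  have pw: "P (var i ^ k) \<and> (var i ^ k :: 'k mpoly) \<in> PR n" if "i < n" for i k
    by (induction k) (use that v m P1 in auto)
  have pr: "P (\<Prod>i\<in>K. var i ^ e i) \<and> (\<Prod>i\<in>K. var i ^ e i :: 'k mpoly) \<in> PR n" if "finite K" "K \<subseteq> {..<n}" for K e
    using that
  proof (induction rule: finite_induct)
    case (insert x K)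
    then show ?case using pw[of x "e x"] m[of "var x ^ e x" "\<Prod>i\<in>K. var i ^ e i"] by auto
  qed (simp add: P1)
  have s: "P (Poly_Mapping.single x c) \<and> Poly_Mapping.single x c \<in> PR n" if k: "Poly_Mapping.keys x \<subseteq> {..<n}" for x and c :: 'k
  proof -
    let ?q = "(\<Prod>i\<in>Poly_Mapping.keys x. var i ^ Poly_Mapping.lookup x i) :: 'k mpoly"
    have q: "P ?q" "?q \<in> PR n"
      using pr[OF finite_keys k, of "Poly_Mapping.lookup x"] by (rule conjunct1, rule conjunct2)
    show ?thesis unfolding single_eq_prod[of x c]
      by (rule conjI[OF m[OF PR_cst q(2) c q(1)] PR_mult[OF PR_cst q(2)]])
  qed
  have "P (\<Sum>x\<in>K. Poly_Mapping.single x (Poly_Mapping.lookup p x)) \<and> (\<Sum>x\<in>K. Poly_Mapping.single x (Poly_Mapping.lookup p x)) \<in> PR n"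
    if "finite K" "K \<subseteq> Poly_Mapping.keys p" for K
    using that
  proof (induction rule: finite_induct)
    case (insert x K)
    then have "Poly_Mapping.keys x \<subseteq> {..<n}" using p unfolding PR_iff by blast
    then show ?case
      using insert s[of x "Poly_Mapping.lookup p x"]
        a[of "Poly_Mapping.single x (Poly_Mapping.lookup p x)" "\<Sum>x\<in>K. Poly_Mapping.single x (Poly_Mapping.lookup p x)"]
      by (simp add: insert_subset)
  qed (simp add: P1)
  from this[OF finite_keys subset_refl] show ?thesis using pm_sum[of p] by simp
qed

lemma polyring_hom_eq:
  assumes f: "f \<in> alg_hom (polyring n) B" and g: "g \<in> alg_hom (polyring n) B"
    and e: "\<And>i. i < n \<Longrightarrow> f (var i) = g (var i)" and p: "p \<in> PR n"
  shows "f p = g p"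
  using p
proof (induction rule: polyring_induct)
  case (cst c) show ?case using alg_hom_scal[OF f, of c] alg_hom_scal[OF g, of c] by simp
next
  case (add p q) then show ?case using alg_hom_add[OF f, of p q] alg_hom_add[OF g, of p q] by simp
next
  case (mult p q) then show ?case using alg_hom_mult[OF f, of p q] alg_hom_mult[OF g, of p q] by simp
qed (rule e)

text \<open>The values are indexed by all natural numbers, and the lemmas ask every one of them to
  lie in the carrier. This is why the families \<open>vars\<close>, \<open>secv\<close> and
  \<open>csub\<close> below are padded with 0 beyond the last variable.\<close>

definition ev :: "('b, 'k::field) kalg \<Rightarrow> (nat \<Rightarrow> 'b) \<Rightarrow> 'k mpoly \<Rightarrow> 'b" where
  "ev A a p = finsum A (\<lambda>m. scal A (Poly_Mapping.lookup p m) \<otimes>\<^bsub>A\<^esub>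
     finprod A (\<lambda>i. a i [^]\<^bsub>A\<^esub> Poly_Mapping.lookup m i) (Poly_Mapping.keys m)) (Poly_Mapping.keys p)"

context kalg_ring begin

context
  fixes a :: "nat \<Rightarrow> 'a"
  assumes a: "\<And>i. a i \<in> carrier A"
begin

abbreviation mono_ev :: "(nat \<Rightarrow>\<^sub>0 nat) \<Rightarrow> 'a" where "mono_ev m \<equiv> finprod A (\<lambda>i. a i [^]\<^bsub>A\<^esub> Poly_Mapping.lookup m i) (Poly_Mapping.keys m)"

lemma scal_closed [simp]: "scal A c \<in> carrier A"
  by (rule kalg_scal_closed[OF kalg])

lemma mon_closed [simp]: "mono_ev m \<in> carrier A"
  using a by (intro finprod_closed) auto

lemma mon_superset:
  assumes "finite K" "Poly_Mapping.keys m \<subseteq> K"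
  shows "mono_ev m = (\<Otimes>i\<in>K. a i [^] Poly_Mapping.lookup m i)"
  using a by (intro finprod_mono_neutral_cong_left[OF assms]) (auto simp: in_keys_iff)

lemma mon_add: "mono_ev (m + m') = mono_ev m \<otimes> mono_ev m'"
proof -
  let ?K = "Poly_Mapping.keys m \<union> Poly_Mapping.keys m'"
  have "mono_ev (m + m') = (\<Otimes>i\<in>?K. a i [^] Poly_Mapping.lookup (m + m') i)"
    by (rule mon_superset) (use keys_add[of m m'] in auto)
  also have "\<dots> = (\<Otimes>i\<in>?K. a i [^] Poly_Mapping.lookup m i \<otimes> a i [^] Poly_Mapping.lookup m' i)"
    using a by (intro finprod_cong') (auto simp: lookup_add nat_pow_mult)
  also have "\<dots> = (\<Otimes>i\<in>?K. a i [^] Poly_Mapping.lookup m i) \<otimes> (\<Otimes>i\<in>?K. a i [^] Poly_Mapping.lookup m' i)"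
    using a by (intro finprod_multf) auto
  also have "\<dots> = mono_ev m \<otimes> mono_ev m'" using mon_superset[of ?K m] mon_superset[of ?K m'] by simp
  finally show ?thesis .
qed

lemma ev_superset:
  assumes "finite K" "Poly_Mapping.keys p \<subseteq> K"
  shows "ev A a p = (\<Oplus>m\<in>K. scal A (Poly_Mapping.lookup p m) \<otimes> mono_ev m)"
  unfolding ev_def by (intro add.finprod_mono_neutral_cong_left[OF assms]) (auto simp: in_keys_iff kalg_scal_zero[OF kalg])

lemma ev_closed [simp]: "ev A a p \<in> carrier A"
  unfolding ev_def by (intro finsum_closed) auto

lemma ev_add: "ev A a (p + q) = ev A a p \<oplus> ev A a q"
proof -
  let ?K = "Poly_Mapping.keys p \<union> Poly_Mapping.keys q"
  have "ev A a (p + q) = (\<Oplus>m\<in>?K. scal A (Poly_Mapping.lookup (p + q) m) \<otimes> mono_ev m)"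
    by (rule ev_superset) (use keys_add[of p q] in auto)
  also have "\<dots> = (\<Oplus>m\<in>?K. (scal A (Poly_Mapping.lookup p m) \<otimes> mono_ev m) \<oplus> (scal A (Poly_Mapping.lookup q m) \<otimes> mono_ev m))"
    by (intro add.finprod_cong') (auto simp: lookup_add kalg_scal_add[OF kalg] l_distr)
  also have "\<dots> = (\<Oplus>m\<in>?K. scal A (Poly_Mapping.lookup p m) \<otimes> mono_ev m) \<oplus> (\<Oplus>m\<in>?K. scal A (Poly_Mapping.lookup q m) \<otimes> mono_ev m)"
    by (intro finsum_addf) auto
  also have "\<dots> = ev A a p \<oplus> ev A a q" using ev_superset[of ?K p] ev_superset[of ?K q] by simp
  finally show ?thesis .
qed

lemma ev_single: "ev A a (Poly_Mapping.single m c) = scal A c \<otimes> mono_ev m"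
  using ev_superset[of "{m}" "Poly_Mapping.single m c"] by (simp add: add.finprod_insert)

lemma ev_mult: "ev A a (p * q) = ev A a p \<otimes> ev A a q"
proof (induction p rule: pm_induct)
  case (1 m c)
  show ?case
    by (induction q rule: pm_induct)
      (simp_all add: mult_single ev_single mon_add kalg_scal_mult[OF kalg] m_ac distrib_left ev_add r_distr l_distr)
qed (simp add: distrib_right ev_add l_distr)

lemma ev_cst [simp]: "ev A a (cst c) = scal A c"
  by (simp add: ev_single)

lemma ev_var [simp]: "ev A a (var i) = a i"
proof -
  have "mono_ev (Poly_Mapping.single i 1) = a i" using a by simp
  then show ?thesis unfolding var_def ev_single using a by (simp add: kalg_scal_one[OF kalg])
qed

lemma ev_hom: "ev A a \<in> alg_hom (polyring n) A"
  using ev_cst[of 1] by (intro alg_homI) (simp_all add: ev_mult ev_add kalg_scal_one[OF kalg])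

end

end

lemma ev_natural:
  assumes A: "kalgebra A" and a: "\<And>i. a i \<in> carrier A" and h: "h \<in> alg_hom A B" and B: "kalgebra B" and p: "p \<in> PR n"
  shows "h (ev A a p) = ev B (\<lambda>i. h (a i)) p"
proof -
  interpret A: kalg_ring A by (rule kalg_ring.intro) fact
  interpret B: kalg_ring B by (rule kalg_ring.intro) fact
  have c: "\<And>i. h (a i) \<in> carrier B" using alg_hom_closed[OF h a] .
  show ?thesis
    by (rule polyring_hom_eq[OF alg_hom_comp[OF h A.ev_hom[OF a]] B.ev_hom[OF c] _ p])
      (simp add: A.ev_var[OF a] B.ev_var[OF c])
qed

section \<open>Functions on open subsets of a spectrum\<close>

context kalg_ring begin

lemma frac_one_carrier: "primeideal P A \<Longrightarrow> a \<in> carrier A \<Longrightarrow> frac A (carrier A - P) a \<one> \<in> carrier (stalk_at A P)"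
  using stalk_at_carrier[of P] mult_loc.one_S[OF prime_loc] by blast

lemma basic_open [simp]: "f \<in> carrier A \<Longrightarrow> openin (tspace (Spec A)) (basic f)"
  by (simp add: openin_basic)

lemma open_lr: "openin (tspace (Spec A)) W \<Longrightarrow> locally_ringed (open_sub (Spec A) W)"
  by (rule Sp.open_sub_lr)

lemma open_pts: "openin (tspace (Spec A)) W \<Longrightarrow> pts (open_sub (Spec A) W) = W"
  using openin_subset[of "tspace (Spec A)" W] by auto

lemma mor_open_iff: "openin (tspace (Spec A)) W \<Longrightarrow> morphism T (open_sub (Spec A) W) m \<longleftrightarrow> morphism T (Spec A) m \<and> fst m ` pts T \<subseteq> W"
  by (rule morphism_open_sub_iff[OF _ Spec_lr])

lemma gfr_section:
  assumes W: "openin (tspace (Spec A)) W" and a: "a \<in> carrier A" "f \<in> carrier A" and f: "\<And>P. P \<in> W \<Longrightarrow> f \<notin> P"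
  shows "(\<lambda>P\<in>W. frac A (carrier A - P) a f) \<in> sections (Spec A) W"
proof -
  have "is_frac W (\<lambda>P\<in>W. frac A (carrier A - P) a f) a f" using assms by (intro is_fracI) auto
  then show ?thesis by (intro Spec_sectionsI loc_fracI exI conjI) auto
qed

lemma one_notin: "primeideal P A \<Longrightarrow> \<one> \<notin> P"
  using mult_loc.one_S[OF prime_loc] by blast

lemma gf_sec:
  assumes W: "openin (tspace (Spec A)) W" and a: "a \<in> carrier A" shows "gf A W a \<in> sections (Spec A) W"
  unfolding gf_def using openin_prime[of W] W by (intro gfr_section a one_closed one_notin) auto

lemma gf_hom:
  assumes W: "openin (tspace (Spec A)) W" shows "gf A W \<in> alg_hom A (gam (open_sub (Spec A) W))"
proof -
  interpret X: lr_space "open_sub (Spec A) W" by (rule lr_space.intro[OF open_lr[OF W]])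
  show ?thesis
  proof (rule X.gam_homI[OF kalg])
    show "gf A W a \<in> global (open_sub (Spec A) W)" if "a \<in> carrier A" for a
      unfolding open_pts[OF W] using gf_sec[OF W that] by simp
    fix P assume "P \<in> pts (open_sub (Spec A) W)"
    then have P: "P \<in> W" unfolding open_pts[OF W] .
    have pr: "primeideal P A" using openin_prime[of W P] W P by simp
    show "(\<lambda>a. gf A W a P) \<in> alg_hom A (stalk (open_sub (Spec A) W) P)"
      using mult_loc.loc_hom[OF prime_loc[OF pr]] P by (simp add: gf_def stalk_at_def)
  qed
qed

lemma gf_vanishes:
  assumes W: "openin (tspace (Spec A)) W" "P \<in> W" "a \<in> carrier A" "s \<in> carrier A" "s \<notin> P"
  shows "frac A (carrier A - P) a s \<in> Units (stalk_at A P) \<longleftrightarrow> a \<notin> P"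
  using assms openin_prime[of W P] by (intro stalk_unit_iff) auto

end

context spec_mor begin

lemma pull_gf:
  assumes W: "openin (tspace (Spec A)) W" and m: "morphism T (open_sub (Spec A) W) m"
  shows "pull T m W (gf A W a) = cof T A m a"
  using m unfolding A.mor_open_iff[OF W] by (auto simp: pull_def cof_def gf_def preim_def fun_eq_iff restrict_def)

lemma pull_gfr:
  assumes W: "openin (tspace (Spec A)) W" and m: "morphism T (open_sub (Spec A) W) m"
    and a: "a \<in> carrier A" "f \<in> carrier A" and f: "\<And>P. P \<in> W \<Longrightarrow> f \<notin> P"
  shows "pull T m W (\<lambda>P\<in>W. frac A (carrier A - P) a f) = (\<lambda>p\<in>pts T. cof T A m a p \<otimes>\<^bsub>stalk T p\<^esub> inv\<^bsub>stalk T p\<^esub> (cof T A m f p))"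
proof -
  have m': "morphism T (Spec A) m" "\<And>p. p \<in> pts T \<Longrightarrow> fst m p \<in> W" using m unfolding A.mor_open_iff[OF W] by auto
  then have pre: "preim T m W = pts T" by (auto simp: preim_def)
  show ?thesis unfolding pull_def pre
  proof (rule restrict_ext)
    fix p assume p: "p \<in> pts T"
    show "snd m p ((\<lambda>P\<in>W. frac A (carrier A - P) a f) (fst m p)) = cof T A m a p \<otimes>\<^bsub>stalk T p\<^esub> inv\<^bsub>stalk T p\<^esub> (cof T A m f p)"
      using snd_eq[OF m'(1) p a(1), of f] a(2) f[OF m'(2)[OF p]] m'(2)[OF p] by simp
  qed
qed

lemma land_basic:
  assumes m: "morphism T (Spec A) m" and p: "p \<in> pts T" and f: "f \<in> carrier A"
  shows "fst m p \<in> A.basic f \<longleftrightarrow> cof T A m f p \<in> Units (stalk T p)"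
  using fst_eq[OF m p] fst_prime[OF m p] f unfolding A.basic_def by auto

end

section \<open>Morphisms to open subsets of affine space\<close>

lemma (in cring) unit_of_inverse: "a \<in> carrier R \<Longrightarrow> b \<in> carrier R \<Longrightarrow> a \<otimes> b = \<one> \<Longrightarrow> b \<in> Units R"
  using Units_mult_iff[of a b] Units_one_closed by simp

lemma (in cring) inverse_eq:
  assumes "a \<in> carrier R" "b \<in> carrier R" "g \<in> carrier R" "a \<otimes> g = \<one>" "b \<otimes> g = \<one>"
  shows "a = b"
  using inv_unique[of a g b] assms by (simp add: m_comm)

abbreviation Aff :: "nat \<Rightarrow> 'k::field mpoly set set \<Rightarrow> 'k sch" where
  "Aff n W \<equiv> open_sub (Spec (polyring n)) W"

abbreviation DD :: "nat \<Rightarrow> 'k::field mpoly \<Rightarrow> 'k mpoly set set" where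
  "DD n f \<equiv> kalg_ring.basic (polyring n) f"

text \<open>The morphism to affine space with coordinate functions \<open>s\<close>. Together with
  \<open>mor_poly_eqI\<close> it says that affine space represents tuples of functions.\<close>

definition mk :: "nat \<Rightarrow> ('p, 'b, 'k::field) lrs \<Rightarrow> (nat \<Rightarrow> 'p \<Rightarrow> 'b) \<Rightarrow> ('p, 'b, 'k mpoly set, ('k mpoly \<times> 'k mpoly) set) mor" where
  "mk n T s = slift T (polyring n) (ev (gam T) s)"

lemma DD_iff: "P \<in> DD n f \<longleftrightarrow> primeideal P (polyring n) \<and> f \<notin> P"
  unfolding poly.basic_def by simp

lemma DD_open [simp]: "f \<in> PR n \<Longrightarrow> openin (tspace (Spec (polyring n))) (DD n f)"
  by (rule poly.basic_open)

lemma gam_kalgebra': "locally_ringed T \<Longrightarrow> kalgebra (gam T)"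
  by (rule lr_space.gam_kalgebra[OF lr_space.intro])

lemma ev_gam_hom:
  assumes "locally_ringed T" "\<And>i. s i \<in> global T" shows "ev (gam T) s \<in> alg_hom (polyring n) (gam T)"
  using kalg_ring.ev_hom[OF kalg_ring.intro[OF gam_kalgebra'[OF assms(1)]], of s] assms(2) by simp

lemma ev_gam_var:
  assumes "locally_ringed T" "\<And>i. s i \<in> global T" shows "ev (gam T) s (var i) = s i"
  using kalg_ring.ev_var[OF kalg_ring.intro[OF gam_kalgebra'[OF assms(1)]], of s] assms(2) by simp

lemma spec_mor_poly: "locally_ringed T \<Longrightarrow> spec_mor T (polyring n)"
  by (intro spec_mor.intro lr_space.intro kalg_ring.intro polyring_kalgebra)

lemma mk_morphism:
  assumes "locally_ringed T" "\<And>i. s i \<in> global T" shows "morphism T (Spec (polyring n)) (mk n T s)"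
  unfolding mk_def by (rule spec_mor.slift_morphism[OF spec_mor_poly[OF assms(1)] ev_gam_hom[OF assms]])

lemma cof_mk:
  assumes "locally_ringed T" "\<And>i. s i \<in> global T" "p \<in> PR n"
  shows "cof T (polyring n) (mk n T s) p = ev (gam T) s p"
  unfolding mk_def by (rule spec_mor.cof_slift[OF spec_mor_poly[OF assms(1)] ev_gam_hom[OF assms(1,2)] assms(3)])

lemma cof_poly_hom:
  "locally_ringed T \<Longrightarrow> morphism T (Spec (polyring n)) m \<Longrightarrow> cof T (polyring n) m \<in> alg_hom (polyring n) (gam T)"
  by (rule spec_mor.cof_hom[OF spec_mor_poly])

lemma cof_global: "locally_ringed T \<Longrightarrow> morphism T (Spec (polyring n)) m \<Longrightarrow> p \<in> PR n \<Longrightarrow> cof T (polyring n) m p \<in> global T"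
  using alg_hom_closed[OF cof_poly_hom] by simp

lemma mor_poly_eqI:
  assumes T: "locally_ringed T" and m: "morphism T (Spec (polyring n)) m" "morphism T (Spec (polyring n)) m'"
    and e: "\<And>i. i < n \<Longrightarrow> cof T (polyring n) m (var i) = cof T (polyring n) m' (var i)"
  shows "m = m'"
proof -
  have "cof T (polyring n) m p = cof T (polyring n) m' p" if p: "p \<in> PR n" for p
    by (rule polyring_hom_eq[OF cof_poly_hom[OF T m(1)] cof_poly_hom[OF T m(2)] e p])
  then show ?thesis by (rule spec_mor.spec_mor_eqI[OF spec_mor_poly[OF T] m])
qed

lemma mor_Aff_iff: "openin (tspace (Spec (polyring n))) W \<Longrightarrow>
    morphism T (Aff n W) m \<longleftrightarrow> morphism T (Spec (polyring n)) m \<and> fst m ` pts T \<subseteq> W"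
  by (rule poly.mor_open_iff)

lemma mor_AffD: "openin (tspace (Spec (polyring n))) W \<Longrightarrow> morphism T (Aff n W) m \<Longrightarrow> morphism T (Spec (polyring n)) m"
  by (simp add: mor_Aff_iff del: poly.Spec_simps)

lemma mor_DD_iff:
  assumes T: "locally_ringed T" and f: "f \<in> PR n"
  shows "morphism T (Aff n (DD n f)) m \<longleftrightarrow> morphism T (Spec (polyring n)) m \<and> (\<forall>p\<in>pts T. cof T (polyring n) m f p \<in> Units (stalk T p))"
  unfolding mor_Aff_iff[OF DD_open[OF f]]
proof (rule conj_cong[OF refl])
  assume m: "morphism T (Spec (polyring n)) m"
  show "fst m ` pts T \<subseteq> DD n f \<longleftrightarrow> (\<forall>p\<in>pts T. cof T (polyring n) m f p \<in> Units (stalk T p))"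
    using spec_mor.land_basic[OF spec_mor_poly[OF T] m _ f] by (simp add: image_subset_iff)
qed

lemma Aff_lr: "openin (tspace (Spec (polyring n))) W \<Longrightarrow> locally_ringed (Aff n W)"
  by (rule poly.open_lr)

lemma Aff_pts: "openin (tspace (Spec (polyring n))) W \<Longrightarrow> pts (Aff n W) = W"
  by (rule poly.open_pts)

lemma gf_global': "openin (tspace (Spec (polyring n))) W \<Longrightarrow> p \<in> PR n \<Longrightarrow> gf (polyring n) W p \<in> global (Aff n W)"
  using alg_hom_closed[OF poly.gf_hom, of n W p] by (simp del: poly.Spec_simps)

lemma cof_id_open:
  assumes A: "kalgebra A" and W: "openin (tspace (Spec A)) W" and a: "a \<in> carrier A"
  shows "cof (open_sub (Spec A) W) A (id_mor (open_sub (Spec A) W)) a = gf A W a"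
proof -
  interpret kalg_ring A by (rule kalg_ring.intro) fact
  have "frac A (carrier A - P) a \<one>\<^bsub>A\<^esub> \<in> carrier (stalk_at A P)" if "P \<in> W" for P
    using openin_prime[of W P] W that a by (intro frac_one_carrier) auto
  then show ?thesis unfolding cof_def gf_def open_pts[OF W] id_mor_def by (intro restrict_ext) simp
qed

lemma pull_gf_Aff:
  assumes T: "locally_ringed T" and W: "openin (tspace (Spec (polyring n))) W" and m: "morphism T (Aff n W) m"
  shows "pull T m W (gf (polyring n) W p) = cof T (polyring n) m p"
  by (rule spec_mor.pull_gf[OF spec_mor_poly[OF T] W m])

lemma ev_PR_closed: "(\<And>i. q i \<in> PR m) \<Longrightarrow> ev (polyring m) q p \<in> PR m"
  using poly.ev_closed[of q m p] by simp

text \<open>The polynomial map with components \<open>q\<close>. The projections, constant sections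
  and target maps below are all of this form, so that composing them is substitution of polynomials
  (\<open>cof_sm_comp\<close>).\<close>

definition sm :: "nat \<Rightarrow> 'k::field mpoly set set \<Rightarrow> nat \<Rightarrow> (nat \<Rightarrow> 'k mpoly) \<Rightarrow> 'k smor" where
  "sm m W n q = mk n (Aff m W) (\<lambda>i. gf (polyring m) W (q i))"

context
  fixes m :: nat and W :: "'k::field mpoly set set" and q :: "nat \<Rightarrow> 'k mpoly"
  assumes W: "openin (tspace (Spec (polyring m))) W" and q: "\<And>i. q i \<in> PR m"
begin

lemma sm_morphism: "morphism (Aff m W) (Spec (polyring n)) (sm m W n q)"
  unfolding sm_def by (intro mk_morphism Aff_lr W gf_global' q)

lemma cof_sm:
  assumes p: "p \<in> PR n" shows "cof (Aff m W) (polyring n) (sm m W n q) p = gf (polyring m) W (ev (polyring m) q p)"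
proof -
  have "cof (Aff m W) (polyring n) (sm m W n q) p = ev (gam (Aff m W)) (\<lambda>i. gf (polyring m) W (q i)) p"
    unfolding sm_def by (intro cof_mk Aff_lr W gf_global' q p)
  also have "\<dots> = gf (polyring m) W (ev (polyring m) q p)"
    by (rule ev_natural[OF polyring_kalgebra q poly.gf_hom[OF W] gam_kalgebra'[OF Aff_lr[OF W]] p, symmetric])
  finally show ?thesis .
qed

lemma sm_fst:
  assumes P: "P \<in> W" shows "fst (sm m W n q) P = {a \<in> PR n. ev (polyring m) q a \<in> P}"
proof -
  have "P \<in> pts (Aff m W)" using P Aff_pts[OF W] by simp
  then have "fst (sm m W n q) P = {a \<in> PR n. cof (Aff m W) (polyring n) (sm m W n q) a P \<notin> Units (stalk (Aff m W) P)}"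
    by (rule spec_mor.fst_eq[OF spec_mor_poly[OF Aff_lr[OF W]] sm_morphism])
  also have "\<dots> = {a \<in> PR n. ev (polyring m) q a \<in> P}"
  proof -
    have "cof (Aff m W) (polyring n) (sm m W n q) a P \<notin> Units (stalk (Aff m W) P) \<longleftrightarrow> ev (polyring m) q a \<in> P"
      if a: "a \<in> PR n" for a
      unfolding cof_sm[OF a] gf_def
      using poly.gf_vanishes[OF W P ev_PR_closed[OF q, where p = a] poly.one_closed] poly.one_notin[of P m] poly.openin_prime[of m W P] W P by simp
    then show ?thesis by auto
  qed
  finally show ?thesis .
qed

lemma sm_DD:
  assumes f: "f \<in> PR n" and l: "\<And>P. P \<in> W \<Longrightarrow> ev (polyring m) q f \<notin> P"
  shows "morphism (Aff m W) (Aff n (DD n f)) (sm m W n q)"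
  unfolding mor_Aff_iff[OF DD_open[OF f]]
proof (intro conjI sm_morphism subsetI)
  fix Q assume "Q \<in> fst (sm m W n q) ` pts (Aff m W)"
  then obtain P where P: "P \<in> W" "Q = fst (sm m W n q) P" using Aff_pts[OF W] by auto
  have "primeideal Q (polyring n)"
    unfolding P(2) by (rule spec_mor.fst_prime[OF spec_mor_poly[OF Aff_lr[OF W]] sm_morphism]) (use P Aff_pts[OF W] in simp)
  then show "Q \<in> DD n f" using l[OF P(1)] f unfolding DD_iff P(2) sm_fst[OF P(1)] by simp
qed

lemma cof_sm_comp:
  assumes T: "locally_ringed T" and f: "morphism T (Aff m W) f" and p: "p \<in> PR n"
  shows "cof T (polyring n) (mcomp T (Spec (polyring n)) (sm m W n q) f) p = cof T (polyring m) f (ev (polyring m) q p)"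
proof -
  have "cof T (polyring n) (mcomp T (Spec (polyring n)) (sm m W n q) f) p =
      pull T f (pts (Aff m W)) (cof (Aff m W) (polyring n) (sm m W n q) p)"
    by (rule cof_mcomp_Spec[OF f sm_morphism polyring_kalgebra p])
  also have "\<dots> = cof T (polyring m) f (ev (polyring m) q p)"
    unfolding Aff_pts[OF W] cof_sm[OF p] by (rule pull_gf_Aff[OF T W f])
  finally show ?thesis .
qed

end

section \<open>Affine charts\<close>

text \<open>\<open>kalgA N T s\<close> is the algebra of functions on \<open>T\<close> generated by \<open>s\<^sub>0, \<dots>, s\<^sub>N\<^sub>-\<^sub>1\<close>, realized as a quotient of a
  polynomial ring, and \<open>tospec N T s\<close> is the canonical morphism from \<open>T\<close> to its spectrum.\<close>

definition keri :: "nat \<Rightarrow> ('p, 'b, 'k::field) lrs \<Rightarrow> (nat \<Rightarrow> 'p \<Rightarrow> 'b) \<Rightarrow> 'k mpoly set" where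
  "keri N T s = {p \<in> PR N. ev (gam T) s p = \<zero>\<^bsub>gam T\<^esub>}"

definition kalgA :: "nat \<Rightarrow> ('p, 'b, 'k::field) lrs \<Rightarrow> (nat \<Rightarrow> 'p \<Rightarrow> 'b) \<Rightarrow> ('k mpoly set, 'k) kalg" where
  "kalgA N T s = quot (polyring N) (keri N T s)"

definition kcl :: "nat \<Rightarrow> ('p, 'b, 'k::field) lrs \<Rightarrow> (nat \<Rightarrow> 'p \<Rightarrow> 'b) \<Rightarrow> 'k mpoly \<Rightarrow> 'k mpoly set" where
  "kcl N T s p = keri N T s +>\<^bsub>polyring N\<^esub> p"

definition tospec :: "nat \<Rightarrow> ('p, 'b, 'k::field) lrs \<Rightarrow> (nat \<Rightarrow> 'p \<Rightarrow> 'b) \<Rightarrow> ('p, 'b, 'k mpoly set set, ('k mpoly set \<times> 'k mpoly set) set) mor" where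
  "tospec N T s = slift T (kalgA N T s) (qlift (polyring N) (keri N T s) (ev (gam T) s))"

locale chart_data = lr_space T for T :: "('p, 'b, 'k::field) lrs" +
  fixes N :: nat and s :: "nat \<Rightarrow> 'p \<Rightarrow> 'b"
  assumes s: "\<And>i. s i \<in> global T"
begin

abbreviation "A \<equiv> kalgA N T s"
abbreviation "J \<equiv> keri N T s"
abbreviation "c \<equiv> kcl N T s"
abbreviation "\<psi> \<equiv> qlift (polyring N) J (ev (gam T) s)"

lemma J_ideal: "ideal J (polyring N)"
  unfolding keri_def by (rule kernel_ideal[OF ev_gam_hom[OF lr s] poly.is_cring kalg_cring[OF gam_kalgebra]])

lemma A_kalg: "kalgebra A"
  unfolding kalgA_def by (rule quot_kalgebra[OF polyring_kalgebra J_ideal])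

lemma c_hom: "c \<in> alg_hom (polyring N) A"
  using quot_hom[OF J_ideal] unfolding kalgA_def kcl_def by (simp add: kcl_def[abs_def])

lemma A_carrier: "x \<in> carrier A \<Longrightarrow> \<exists>p\<in>PR N. x = c p"
  unfolding kalgA_def kcl_def quot_carrier .

lemma c_closed: "p \<in> PR N \<Longrightarrow> c p \<in> carrier A"
  by (rule alg_hom_closed[OF c_hom])

lemma c_eq_iff: "p \<in> PR N \<Longrightarrow> q \<in> PR N \<Longrightarrow> c p = c q \<longleftrightarrow> ev (gam T) s p = ev (gam T) s q"
proof -
  assume pq: "p \<in> PR N" "q \<in> PR N"
  interpret G: cring "gam T" by (rule kalg_cring[OF gam_kalgebra])
  have "c p = c q \<longleftrightarrow> p - q \<in> J" unfolding kcl_def using quot_eq_iff[OF J_ideal pq] pq by simp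
  also have "\<dots> \<longleftrightarrow> ev (gam T) s p \<ominus>\<^bsub>gam T\<^esub> ev (gam T) s q = \<zero>\<^bsub>gam T\<^esub>"
    using alg_hom_minus[OF ev_gam_hom[OF lr s] poly.is_cring G.is_cring pq] pq unfolding keri_def by simp
  also have "\<dots> \<longleftrightarrow> ev (gam T) s p = ev (gam T) s q"
    by (rule G.r_right_minus_eq) (rule alg_hom_closed[OF ev_gam_hom[OF lr s]], rule pq)+
  finally show ?thesis .
qed

lemma \<psi>_c: "p \<in> PR N \<Longrightarrow> \<psi> (c p) = ev (gam T) s p"
  unfolding kcl_def by (rule qlift_eq[OF J_ideal ev_gam_hom[OF lr s] poly.is_cring kalg_cring[OF gam_kalgebra]]) (simp add: keri_def)

lemma \<psi>_hom: "\<psi> \<in> alg_hom A (gam T)"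
  unfolding kalgA_def by (rule qlift_hom[OF J_ideal ev_gam_hom[OF lr s] polyring_kalgebra kalg_cring[OF gam_kalgebra]]) (simp add: keri_def)

lemma fin_gen: "fin_gen_alg A"
proof -
  have "c ` carrier (polyring N) = carrier A" using A_carrier c_closed by auto
  then show ?thesis unfolding fin_gen_alg_def using A_kalg c_hom by blast
qed

sublocale sA: spec_mor T A
  by (intro spec_mor.intro lr_space.intro kalg_ring.intro A_kalg lr)

lemma tospec_morphism: "morphism T (Spec A) (tospec N T s)"
  unfolding tospec_def by (rule sA.slift_morphism[OF \<psi>_hom])

lemma cof_tospec: "p \<in> PR N \<Longrightarrow> cof T A (tospec N T s) (c p) = ev (gam T) s p"
  unfolding tospec_def using sA.cof_slift[OF \<psi>_hom c_closed] \<psi>_c by simp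

abbreviation "SA \<equiv> Spec A"
abbreviation "G \<equiv> gf A (pts (Spec A))"

lemma SA_lr: "locally_ringed SA"
  by (rule sA.A.Spec_lr)

lemma G_hom: "G \<in> alg_hom A (gam SA)"
  using sA.A.gf_hom[OF openin_topspace] by (simp only: open_sub_all)

lemma G_pull: "morphism Y SA m \<Longrightarrow> locally_ringed Y \<Longrightarrow> pull Y m (pts SA) (G a) = cof Y A m a"
  using spec_mor.cof_eq_pull[of Y A m a] by (simp add: spec_mor.intro lr_space.intro kalg_ring.intro A_kalg)

text \<open>Only one composite has to be supplied. The other one is an endomorphism of a spectrum
  and is tested on functions, where the generators \<open>s i\<close> return to the classes of the
  variables.\<close>

lemma chart_iso:
  assumes u: "morphism SA T u" and us: "\<And>i. i < N \<Longrightarrow> pull SA u (pts T) (s i) = G (c (var i))"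
    and uv: "mcomp T T u (tospec N T s) = id_mor T"
  shows "isomorphism T SA (tospec N T s)"
proof (rule isomorphismI[OF tospec_morphism u uv])
  interpret S: spec_mor SA A by (intro spec_mor.intro lr_space.intro kalg_ring.intro A_kalg SA_lr)
  note pu = pull_hom[OF u SA_lr lr]
  show "mcomp SA SA (tospec N T s) u = id_mor SA"
  proof (rule S.spec_mor_eqI[OF morphism_mcomp[OF u tospec_morphism SA_lr] sA.A.Sp.morphism_id])
    fix a assume "a \<in> carrier A"
    then obtain p where p: "p \<in> PR N" "a = c p" using A_carrier by (elim bexE[OF A_carrier])
    have "cof SA A (mcomp SA SA (tospec N T s) u) a = pull SA u (pts T) (cof T A (tospec N T s) a)"
      by (rule cof_mcomp_Spec[OF u tospec_morphism A_kalg]) (use p c_closed in simp)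
    also have "\<dots> = pull SA u (pts T) (ev (gam T) s p)" using p cof_tospec by simp
    also have "\<dots> = G (c p)"
    proof (rule polyring_hom_eq[OF alg_hom_comp[OF pu ev_gam_hom[OF lr s]] alg_hom_comp[OF G_hom c_hom] _ p(1)])
      show "pull SA u (pts T) (ev (gam T) s (var i)) = G (c (var i))" if "i < N" for i
        using us[OF that] ev_gam_var[OF lr s] by simp
    qed
    also have "\<dots> = cof SA A (id_mor SA) a"
      unfolding p(2) using cof_id_open[OF A_kalg openin_topspace c_closed[OF p(1)], unfolded open_sub_all] by (rule sym)
    finally show "cof SA A (mcomp SA SA (tospec N T s) u) a = cof SA A (id_mor SA) a" .
  qed
qed

definition "tup i = G (c (if i < N then var i else 0))"

lemma tup_global: "tup i \<in> global SA"
  unfolding tup_def using alg_hom_closed[OF G_hom c_closed, of "if i < N then var i else 0"] by simp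

lemma ev_tup: "p \<in> PR N \<Longrightarrow> ev (gam SA) tup p = G (c p)"
proof (rule polyring_hom_eq[OF ev_gam_hom[OF SA_lr tup_global] alg_hom_comp[OF G_hom c_hom]])
  show "ev (gam SA) tup (var i) = G (c (var i))" if "i < N" for i
    unfolding ev_gam_var[OF SA_lr tup_global] tup_def using that by simp
qed

end

text \<open>The coordinates and the inverse of \<open>f\<close> embed the basic open set of \<open>f\<close> in an affine space of dimension \<open>m + 1\<close>.\<close>

definition ch :: "nat \<Rightarrow> 'k::field mpoly \<Rightarrow> nat \<Rightarrow> 'k sfun" where
  "ch m f i = (if i < m then gf (polyring m) (DD m f) (var i)
     else if i = m then (\<lambda>P\<in>DD m f. frac (polyring m) (PR m - P) 1 f) else gf (polyring m) (DD m f) 0)"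

lemma ch_global:
  assumes f: "f \<in> PR m" shows "ch m f i \<in> global (Aff m (DD m f))"
proof -
  have "(\<lambda>P\<in>DD m f. frac (polyring m) (PR m - P) 1 f) \<in> global (Aff m (DD m f))"
    using poly.gfr_section[OF DD_open[OF f] _ f, of 1] Aff_pts[OF DD_open[OF f]] by (simp add: DD_iff)
  then show ?thesis unfolding ch_def using gf_global'[OF DD_open[OF f]] by simp
qed

lemma ch_inverse:
  assumes f: "f \<in> PR m"
  shows "ch m f m \<otimes>\<^bsub>gam (Aff m (DD m f))\<^esub> gf (polyring m) (DD m f) f = \<one>\<^bsub>gam (Aff m (DD m f))\<^esub>"
  unfolding gam_simps Aff_pts[OF DD_open[OF f]]
proof (rule restrict_ext)
  fix P assume P: "P \<in> DD m f"
  then have pr: "primeideal P (polyring m)" "f \<in> PR m - P" using f by (auto simp: DD_iff)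
  interpret mult_loc "polyring m" "PR m - P" by (rule poly.prime_loc[OF pr(1)])
  have "fr 1 f \<otimes>\<^bsub>L\<^esub> fr f 1 = fr (1 * f) (1 * f)" using loc_mult[of 1 f f 1] pr(2) f one_S by simp
  also have "\<dots> = fr 1 1" using frac_cancel[of 1 1 f] pr(2) one_S by simp
  finally show "ch m f m P \<otimes>\<^bsub>stalk (Aff m (DD m f)) P\<^esub> gf (polyring m) (DD m f) f P = \<one>\<^bsub>stalk (Aff m (DD m f)) P\<^esub>"
    using P by (simp add: ch_def gf_def stalk_at_def loc_one)
qed

text \<open>Two cases are served at once: \<open>j\<close> is the identity for the chart of a basic
  open set in \<open>DD_chart\<close>, and the inclusion of a reduced zero set in
  \<open>finite_mor_std\<close>. In both, the functions taken as generators are the pulled back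
  coordinates and the pulled back inverse of \<open>f\<close>.\<close>

locale chart_mor = lr_space T for T :: "('p, 'b, 'k::field) lrs" +
  fixes m :: nat and f :: "'k mpoly" and j :: "('p, 'b, 'k mpoly set, ('k mpoly \<times> 'k mpoly) set) mor"
  assumes f: "f \<in> PR m" and j: "morphism T (Aff m (DD m f)) j"
begin

abbreviation "Y \<equiv> Aff m (DD m f)"

definition "sj i = pull T j (DD m f) (ch m f i)"

lemma Y_lr: "locally_ringed Y" and Y_pts: "pts Y = DD m f"
  using Aff_lr[OF DD_open[OF f]] Aff_pts[OF DD_open[OF f]] .

lemma pj_hom: "pull T j (DD m f) \<in> alg_hom (gam Y) (gam T)"
  using pull_hom[OF j lr Y_lr] unfolding Y_pts .

lemma sj_global: "sj i \<in> global T"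
  using alg_hom_closed[OF pj_hom] ch_global[OF f] unfolding sj_def by simp

sublocale cd: chart_data T "Suc m" sj
  by unfold_locales (rule sj_global)

lemma ev_sj: "p \<in> PR m \<Longrightarrow> ev (gam T) sj p = cof T (polyring m) j p"
proof (rule polyring_hom_eq[OF ev_gam_hom[OF lr sj_global] cof_poly_hom[OF lr mor_AffD[OF DD_open[OF f] j]]])
  show "ev (gam T) sj (var i) = cof T (polyring m) j (var i)" if "i < m" for i
    unfolding ev_gam_var[OF lr sj_global] sj_def ch_def using that pull_gf_Aff[OF lr DD_open[OF f] j, of "var i"] by simp
qed

lemma sj_inverse: "sj m \<otimes>\<^bsub>gam T\<^esub> cof T (polyring m) j f = \<one>\<^bsub>gam T\<^esub>"
proof -
  have "pull T j (DD m f) (ch m f m \<otimes>\<^bsub>gam Y\<^esub> gf (polyring m) (DD m f) f) = sj m \<otimes>\<^bsub>gam T\<^esub> cof T (polyring m) j f"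
    using alg_hom_mult[OF pj_hom, of "ch m f m" "gf (polyring m) (DD m f) f"] ch_global[OF f, of m] gf_global'[OF DD_open[OF f] f]
    unfolding sj_def pull_gf_Aff[OF lr DD_open[OF f] j, symmetric] by simp
  then show ?thesis unfolding ch_inverse[OF f] alg_hom_one[OF pj_hom] by simp
qed

lemma c_inverse: "cd.c (var m) \<otimes>\<^bsub>cd.A\<^esub> cd.c f = \<one>\<^bsub>cd.A\<^esub>"
proof -
  note fm = PR_mono[OF f, of "Suc m"]
  have "ev (gam T) sj (var m * f) = ev (gam T) sj 1"
    using alg_hom_mult[OF ev_gam_hom[OF lr sj_global, where n = "Suc m"], of "var m" f] fm sj_inverse ev_sj[OF f]
      alg_hom_one[OF ev_gam_hom[OF lr sj_global, where n = "Suc m"]] ev_gam_var[OF lr sj_global] by simp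
  then have "cd.c (var m * f) = cd.c 1" using cd.c_eq_iff[of "var m * f" 1] fm by simp
  then show ?thesis using alg_hom_mult[OF cd.c_hom, of "var m" f] alg_hom_one[OF cd.c_hom] fm by simp
qed

definition "uj = mk m cd.SA cd.tup"

lemma cof_uj: "p \<in> PR m \<Longrightarrow> cof cd.SA (polyring m) uj p = cd.G (cd.c p)"
  unfolding uj_def using cof_mk[OF cd.SA_lr cd.tup_global] cd.ev_tup PR_mono[of p m "Suc m"] by simp

lemma G_inverse: "cd.G (cd.c (var m)) \<otimes>\<^bsub>gam cd.SA\<^esub> cd.G (cd.c f) = \<one>\<^bsub>gam cd.SA\<^esub>"
  using alg_hom_mult[OF cd.G_hom cd.c_closed cd.c_closed, of "var m" f] c_inverse alg_hom_one[OF cd.G_hom] PR_mono[OF f, of "Suc m"] by simp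

lemma Gc_closed: "p \<in> PR (Suc m) \<Longrightarrow> cd.G (cd.c p) \<in> carrier (gam cd.SA)"
  by (rule alg_hom_closed[OF cd.G_hom cd.c_closed])

lemma uj_morphism: "morphism cd.SA Y uj"
  unfolding mor_DD_iff[OF cd.SA_lr f]
proof (intro conjI ballI)
  show "morphism cd.SA (Spec (polyring m)) uj" unfolding uj_def by (rule mk_morphism[OF cd.SA_lr cd.tup_global])
  interpret GS: cring "gam cd.SA" by (rule kalg_cring[OF cd.sA.A.Sp.gam_kalgebra])
  have "cd.G (cd.c f) \<in> Units (gam cd.SA)"
    by (rule GS.unit_of_inverse[OF Gc_closed Gc_closed G_inverse]) (simp_all add: PR_mono[OF f])
  then show "cof cd.SA (polyring m) uj f p \<in> Units (stalk cd.SA p)" if "p \<in> pts cd.SA" for p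
    unfolding cof_uj[OF f] by (rule alg_hom_Units[OF cd.sA.A.Sp.gam_eval[OF that]])
qed

lemma pull_uj:
  assumes i: "i < Suc m" shows "pull cd.SA uj (DD m f) (ch m f i) = cd.G (cd.c (var i))"
proof (cases "i < m")
  case True then show ?thesis
    using pull_gf_Aff[OF cd.SA_lr DD_open[OF f] uj_morphism, of "var i"] cof_uj[of "var i"] by (simp add: ch_def)
next
  case False
  \<comment> \<open>The last coordinate of the chart is the inverse of \<open>f\<close>, which is
    not a polynomial. Its pullback and the class of \<open>var m\<close> are both inverse to the
    class of \<open>f\<close>, hence equal.\<close>
  then have i: "i = m" using i by simp
  interpret GS: cring "gam cd.SA" by (rule kalg_cring[OF cd.sA.A.Sp.gam_kalgebra])
  note pu = pull_hom[OF uj_morphism cd.SA_lr Y_lr, unfolded Y_pts]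
  let ?x = "pull cd.SA uj (DD m f) (ch m f m)" and ?g = "cd.G (cd.c f)" and ?y = "cd.G (cd.c (var m))"
  have "ch m f m \<in> carrier (gam Y)" "gf (polyring m) (DD m f) f \<in> carrier (gam Y)"
    using ch_global[OF f, of m] gf_global'[OF DD_open[OF f] f] by simp_all
  note e = alg_hom_mult[OF pu this] and xc = alg_hom_closed[OF pu this(1)]
  have x1: "?x \<otimes>\<^bsub>gam cd.SA\<^esub> ?g = \<one>\<^bsub>gam cd.SA\<^esub>"
    using e unfolding ch_inverse[OF f] alg_hom_one[OF pu] pull_gf_Aff[OF cd.SA_lr DD_open[OF f] uj_morphism] cof_uj[OF f] by (rule sym)
  have "?x = ?y"
    by (rule GS.inverse_eq[OF xc Gc_closed Gc_closed x1 G_inverse]) (simp_all add: PR_mono[OF f])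
  then show ?thesis using i by simp
qed

lemma uj_tospec: "mcomp T Y uj (tospec (Suc m) T sj) = j"
proof (rule mor_poly_eqI[OF lr])
  show "morphism T (Spec (polyring m)) j" by (rule mor_AffD[OF DD_open[OF f] j])
  have u': "morphism cd.SA (Spec (polyring m)) uj" by (rule mor_AffD[OF DD_open[OF f] uj_morphism])
  show "morphism T (Spec (polyring m)) (mcomp T Y uj (tospec (Suc m) T sj))"
    unfolding mcomp_open_sub by (rule morphism_mcomp[OF cd.tospec_morphism u' poly.Spec_lr])
  fix i assume i: "i < m"
  have "cof T (polyring m) (mcomp T Y uj (tospec (Suc m) T sj)) (var i) = pull T (tospec (Suc m) T sj) (pts cd.SA) (cd.G (cd.c (var i)))"
    unfolding mcomp_open_sub using cof_mcomp_Spec[OF cd.tospec_morphism u' polyring_kalgebra, of "var i"] cof_uj[of "var i"] i by simp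
  also have "\<dots> = ev (gam T) sj (var i)"
    using cd.G_pull[OF cd.tospec_morphism lr] cd.cof_tospec[of "var i"] i by simp
  also have "\<dots> = cof T (polyring m) j (var i)" using ev_sj[of "var i"] i by simp
  finally show "cof T (polyring m) (mcomp T Y uj (tospec (Suc m) T sj)) (var i) = cof T (polyring m) j (var i)" .
qed

end

lemma DD_chart:
  fixes f :: "'k::field mpoly" assumes f: "f \<in> PR m"
  shows "isomorphism (Aff m (DD m f)) (Spec (kalgA (Suc m) (Aff m (DD m f)) (ch m f))) (tospec (Suc m) (Aff m (DD m f)) (ch m f))"
    and "fin_gen_alg (kalgA (Suc m) (Aff m (DD m f)) (ch m f))"
proof -
  let ?Y = "Aff m (DD m f)"
  interpret Y: lr_space ?Y by (rule lr_space.intro[OF Aff_lr[OF DD_open[OF f]]])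
  interpret chart_mor ?Y m f "id_mor ?Y"
    by unfold_locales (rule f, rule Y.morphism_id)
  have sj: "sj = ch m f"
  proof
    fix i
    have g: "sj i \<in> global ?Y" "ch m f i \<in> global ?Y" by (rule sj_global, rule ch_global[OF f])
    show "sj i = ch m f i"
    proof (rule Y.global_eqI[OF g])
      fix P assume P: "P \<in> pts ?Y"
      show "sj i P = ch m f i P"
        unfolding sj_def pull_at[OF Y.morphism_id P, unfolded Y_pts] id_mor_fst[OF P]
        by (rule id_mor_snd[OF P Y.global_carrier[OF g(2) P]])
    qed
  qed
  show "isomorphism ?Y (Spec (kalgA (Suc m) ?Y (ch m f))) (tospec (Suc m) ?Y (ch m f))"
  proof -
    have us: "pull cd.SA uj (pts ?Y) (sj i) = cd.G (cd.c (var i))" if "i < Suc m" for i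
      unfolding Y_pts fun_cong[OF sj, of i] by (rule pull_uj[OF that])
    from cd.chart_iso[OF uj_morphism us uj_tospec] show ?thesis unfolding sj .
  qed
  show "fin_gen_alg (kalgA (Suc m) ?Y (ch m f))" using cd.fin_gen unfolding sj .
qed

lemma kscheme_Aff:
  assumes W: "openin (tspace (Spec (polyring n))) W" shows "kscheme (Aff n W)"
  unfolding kscheme_def
proof (intro conjI ballI Aff_lr[OF W])
  fix p assume "p \<in> pts (Aff n W)"
  then have p: "p \<in> W" unfolding Aff_pts[OF W] .
  obtain f where f: "f \<in> PR n" "f \<notin> p" "DD n f \<subseteq> W" using poly.basic_subset[of n W p] W p by auto
  have pr: "primeideal p (polyring n)" using poly.openin_prime[of n W p] W p by simp
  have "openin (tspace (Aff n W)) (DD n f)" using DD_open[OF f(1)] f(3) W by (simp del: poly.Spec_simps)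
  moreover have "p \<in> DD n f" using pr f(2) by (simp add: DD_iff)
  moreover have "isomorphism (open_sub (Aff n W) (DD n f)) (Spec (kalgA (Suc n) (Aff n (DD n f)) (ch n f))) (tospec (Suc n) (Aff n (DD n f)) (ch n f))"
    unfolding open_sub_open_sub[OF f(3)] by (rule DD_chart(1)[OF f(1)])
  ultimately show "\<exists>W' (A :: ('a mpoly set, 'a) kalg) g. openin (tspace (Aff n W)) W' \<and> p \<in> W' \<and> fin_gen_alg A \<and>
      isomorphism (open_sub (Aff n W) W') (Spec A) g"
    using DD_chart(2)[OF f(1)] by (intro exI conjI)
qed

lemma Aff_lreduced:
  assumes W: "openin (tspace (Spec (polyring n))) W" shows "lreduced (Aff n W)"
  by (rule lreduced_open_sub[OF W poly.Spec_lreduced]) simp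

section \<open>Relative affine line\<close>

definition vars :: "nat \<Rightarrow> nat \<Rightarrow> 'k::field mpoly" where
  "vars n i = (if i < n then var i else 0)"

lemma vars_PR: "n \<le> m \<Longrightarrow> vars n i \<in> PR m"
  by (simp add: vars_def)

lemma ev_vars:
  assumes "n \<le> m" "p \<in> PR n" shows "ev (polyring m) (vars n) p = p"
proof -
  have i: "(\<lambda>p. p) \<in> alg_hom (polyring n) (polyring m)"
    by (rule alg_homI) (use PR_mono[OF _ assms(1)] in auto)
  show ?thesis
    by (rule polyring_hom_eq[OF poly.ev_hom[OF vars_PR[OF assms(1)]] i _ assms(2)])
      (simp add: poly.ev_var[OF vars_PR[OF assms(1)]], simp add: vars_def)
qed

definition prj :: "nat \<Rightarrow> 'k::field mpoly \<Rightarrow> 'k smor" where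
  "prj n f = sm (Suc n) (DD (Suc n) f) n (vars n)"

lemma prj_morphism:
  assumes f: "f \<in> PR n" shows "morphism (Aff (Suc n) (DD (Suc n) f)) (Aff n (DD n f)) (prj n f)"
  unfolding prj_def
  by (rule sm_DD[OF DD_open[OF PR_mono[OF f]] vars_PR f]) (simp_all add: ev_vars[OF _ f] DD_iff)

text \<open>Since \<open>f\<close> does not involve the last variable, the set where it is
  invertible in affine (n+1)-space is the product of the corresponding set in n-space with a line. A
  morphism to the base and one function are exactly the n+1 coordinates of a morphism to this
  set.\<close>

lemma affine_space_Aff:
  assumes f: "f \<in> PR n"
  shows "is_affine_space (Aff n (DD n f)) (Aff (Suc n) (DD (Suc n) f)) (prj n f) [gf (polyring (Suc n)) (DD (Suc n) f) (var n)]"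
proof -
  let ?X = "Aff n (DD n f)" and ?P = "Aff (Suc n) (DD (Suc n) f)" and ?x = "gf (polyring (Suc n)) (DD (Suc n) f) (var n)"
  note f' = PR_mono[OF f, of "Suc n", simplified]
  note oX = DD_open[OF f] and oP = DD_open[OF f']
  have x: "?x \<in> global ?P" by (rule gf_global'[OF oP]) simp
  have "\<exists>!m. morphism T ?P m \<and> mcomp T ?X (prj n f) m = h \<and> map (pull T m (pts ?P)) [?x] = s"
    if T: "kscheme T" and h: "morphism T ?X h" and s: "set s \<subseteq> global T" "length s = length [?x]" for T :: "'a sch" and h s
  proof -
    have lr: "locally_ringed T" using T by (simp add: kscheme_def)
    obtain t where t: "s = [t]" "t \<in> global T" using s by (cases s) auto
    note h' = mor_AffD[OF oX h]
    let ?t = "\<lambda>i. if i < n then cof T (polyring n) h (var i) else t"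
    have tg: "?t i \<in> global T" for i using cof_global[OF lr h'] t(2) by simp
    have evt: "ev (gam T) ?t p = cof T (polyring n) h p" if "p \<in> PR n" for p
      by (rule polyring_hom_eq[OF ev_gam_hom[OF lr tg] cof_poly_hom[OF lr h'] _ that]) (simp add: ev_gam_var[OF lr tg])
    have comp: "cof T (polyring n) (mcomp T ?X (prj n f) m) (var i) = cof T (polyring (Suc n)) m (var i)"
      if m: "morphism T ?P m" and i: "i < n" for m i
      unfolding mcomp_open_sub prj_def using cof_sm_comp[OF oP _ lr m PR_var[OF i], where q = "vars n"] vars_PR[of n "Suc n"] i by (simp add: vars_def)
    have x': "pull T m (pts ?P) ?x = cof T (polyring (Suc n)) m (var n)" if m: "morphism T ?P m" for m
      unfolding Aff_pts[OF oP] by (rule pull_gf_Aff[OF lr oP m])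
    let ?m = "mk (Suc n) T ?t"
    have cm: "cof T (polyring (Suc n)) ?m p = ev (gam T) ?t p" if "p \<in> PR (Suc n)" for p
      by (rule cof_mk[OF lr tg that])
    have m: "morphism T ?P ?m"
      unfolding mor_DD_iff[OF lr f'] using mk_morphism[OF lr tg] cm[OF f'] evt[OF f] h[unfolded mor_DD_iff[OF lr f]] by auto
    have hm: "mcomp T ?X (prj n f) ?m = h"
    proof (rule mor_poly_eqI[OF lr _ h'])
      show "morphism T (Spec (polyring n)) (mcomp T ?X (prj n f) ?m)"
        by (rule mor_AffD[OF oX morphism_mcomp[OF m prj_morphism[OF f] Aff_lr[OF oX]]])
      fix i assume i: "i < n"
      show "cof T (polyring n) (mcomp T ?X (prj n f) ?m) (var i) = cof T (polyring n) h (var i)"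
        unfolding comp[OF m i] using cm[of "var i"] ev_gam_var[OF lr, of ?t i, OF tg] i by simp
    qed
    show ?thesis
    proof (rule ex1I[of _ ?m])
      show "morphism T ?P ?m \<and> mcomp T ?X (prj n f) ?m = h \<and> map (pull T ?m (pts ?P)) [?x] = s"
        using m hm x'[OF m] cm[of "var n"] ev_gam_var[OF lr, of ?t n, OF tg] t(1) by simp
      fix m' assume m': "morphism T ?P m' \<and> mcomp T ?X (prj n f) m' = h \<and> map (pull T m' (pts ?P)) [?x] = s"
      show "m' = ?m"
      proof (rule mor_poly_eqI[OF lr mor_AffD[OF oP] mor_AffD[OF oP m]])
        show "morphism T ?P m'" using m' by simp
        fix i assume i: "i < Suc n"
        show "cof T (polyring (Suc n)) m' (var i) = cof T (polyring (Suc n)) ?m (var i)"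
        proof (cases "i < n")
          case True then show ?thesis using comp[of m' i] comp[OF m] m' hm by simp
        next
          case False
          then have "i = n" using i by simp
          then show ?thesis using x'[of m'] cm[of "var n"] ev_gam_var[OF lr, of ?t n, OF tg] m' t(1) by simp
        qed
      qed
    qed
  qed
  then show ?thesis
    unfolding is_affine_space_def using kscheme_Aff[OF oP] prj_morphism[OF f] x by simp
qed

lemma affine_space_zero:
  assumes X: "kscheme X" shows "is_affine_space X X (id_mor X) []"
proof -
  interpret lr_space X using X by (intro lr_space.intro) (simp add: kscheme_def)
  show ?thesis unfolding is_affine_space_def using X morphism_id
    by (auto intro!: ex1I simp: mcomp_id_left)
qed

section \<open>Open immersions as etale neighbourhoods\<close>

text \<open>The image of \<open>P\<close> works: as \<open>P\<close> contains \<open>I\<close>,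
  membership of a class in it does not depend on the representative. It provides a point of the
  closed subscheme above each point of a thickening.\<close>

lemma quot_prime_lift:
  assumes A: "kalgebra A" and I: "ideal I A" and P: "primeideal P A" "I \<subseteq> P"
  shows "\<exists>Q. primeideal Q (quot A I) \<and> {a \<in> carrier A. I +>\<^bsub>A\<^esub> a \<in> Q} = P"
proof -
  interpret A: cring A by (rule kalg_cring[OF A])
  interpret P: primeideal P A by fact
  let ?c = "\<lambda>a. I +>\<^bsub>A\<^esub> a"
  note c = quot_hom[OF I]
  interpret Q: cring "quot A I" by (rule kalg_cring[OF quot_kalgebra[OF A I]])
  let ?Q = "?c ` P"
  have mem: "?c a \<in> ?Q \<longleftrightarrow> a \<in> P" if a: "a \<in> carrier A" for a
  proof
    assume "?c a \<in> ?Q"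
    then obtain b where b: "b \<in> P" "?c a = ?c b" by auto
    have "a \<ominus>\<^bsub>A\<^esub> b \<in> P" using quot_eq_iff[OF I a P.Icarr[OF b(1)]] b(2) P(2) by blast
    then have "(a \<ominus>\<^bsub>A\<^esub> b) \<oplus>\<^bsub>A\<^esub> b \<in> P" using b(1) by simp
    moreover have "(a \<ominus>\<^bsub>A\<^esub> b) \<oplus>\<^bsub>A\<^esub> b = a" using a P.Icarr[OF b(1)] by algebra
    ultimately show "a \<in> P" by simp
  qed auto
  have eq: "{a \<in> carrier A. ?c a \<in> ?Q} = P" using mem P.Icarr by blast
  have "ideal ?Q (quot A I)"
  proof (rule Q.ideal_by_mult)
    show "?Q \<subseteq> carrier (quot A I)" using P.Icarr alg_hom_closed[OF c] by blast
    show "\<zero>\<^bsub>quot A I\<^esub> \<in> ?Q" using alg_hom_zero[OF c A.is_cring Q.is_cring] P.zero_closed by (metis imageI)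
    show "x \<oplus>\<^bsub>quot A I\<^esub> y \<in> ?Q" if xy: "x \<in> ?Q" "y \<in> ?Q" for x y
    proof -
      obtain a where a: "x = ?c a" "a \<in> P" using xy(1) by (rule imageE)
      obtain b where b: "y = ?c b" "b \<in> P" using xy(2) by (rule imageE)
      show ?thesis using a b using alg_hom_add[OF c P.Icarr P.Icarr, of a b] P.a_closed[of a b] by (metis imageI)
    qed
    show "x \<otimes>\<^bsub>quot A I\<^esub> y \<in> ?Q" if xy: "y \<in> ?Q" "x \<in> carrier (quot A I)" for x y
    proof -
      obtain b where b: "y = ?c b" "b \<in> P" using xy(1) by (rule imageE)
      obtain a where a: "a \<in> carrier A" "x = ?c a" using xy(2) unfolding quot_carrier by (elim bexE)
      show ?thesis using alg_hom_mult[OF c a(1) P.Icarr[OF b(2)]] P.I_l_closed[OF b(2) a(1)] a(2) b(1) by (metis imageI)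
    qed
  qed
  then have "primeideal ?Q (quot A I)"
  proof (rule primeidealI[OF _ Q.is_cring])
    have "\<one>\<^bsub>A\<^esub> \<notin> P" using P.one_imp_carrier P.I_notcarr by auto
    then have "?c \<one>\<^bsub>A\<^esub> \<notin> ?Q" using mem[OF A.one_closed] by simp
    then show "carrier (quot A I) \<noteq> ?Q" using alg_hom_closed[OF c A.one_closed] by blast
    fix x y assume xy: "x \<in> carrier (quot A I)" "y \<in> carrier (quot A I)" "x \<otimes>\<^bsub>quot A I\<^esub> y \<in> ?Q"
    obtain a b where ab: "a \<in> carrier A" "b \<in> carrier A" "x = ?c a" "y = ?c b"
      using xy(1,2) unfolding quot_carrier by (elim bexE)
    have "?c (a \<otimes>\<^bsub>A\<^esub> b) \<in> ?Q" using xy(3) alg_hom_mult[OF c ab(1,2)] ab(3,4) by simp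
    then have "a \<otimes>\<^bsub>A\<^esub> b \<in> P" using mem[of "a \<otimes>\<^bsub>A\<^esub> b"] ab(1,2) by simp
    then show "x \<in> ?Q \<or> y \<in> ?Q" using P.I_prime[OF ab(1,2)] ab(3,4) by auto
  qed
  then show ?thesis using eq by (intro exI conjI)
qed

lemma kscheme_lr: "kscheme X \<Longrightarrow> locally_ringed X"
  by (simp add: kscheme_def)

text \<open>A square-zero thickening does not change the set of prime ideals, hence a morphism from it lands in an open
  subset if its restriction does.\<close>

lemma etale_open:
  fixes P :: "'k::field sch"
  assumes P: "kscheme P" and N: "openin (tspace P) N" "kscheme (open_sub P N)"
  shows "etale (open_sub P N) P (id_mor (open_sub P N))"
  unfolding etale_def
proof (intro conjI allI impI P N(2))
  note lr = kscheme_lr[OF P]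
  let ?V = "open_sub P N" and ?i = "id_mor (open_sub P N)"
  have Vp: "pts ?V = N" using openin_subset[OF N(1)] by auto
  show "morphism ?V P ?i" by (rule open_incl_morphism[OF lr N(1)])
  fix A :: "('k mpoly set, 'k) kalg" and I u0 w
  assume H: "kalgebra A \<and> ideal I A \<and> (\<forall>a\<in>I. \<forall>b\<in>I. a \<otimes>\<^bsub>A\<^esub> b = \<zero>\<^bsub>A\<^esub>) \<and>
        morphism (Spec (quot A I)) ?V u0 \<and> morphism (Spec A) P w \<and>
        mcomp (Spec (quot A I)) P ?i u0 =
        mcomp (Spec (quot A I)) P w (Spec_map A (quot A I) (\<lambda>a. I +>\<^bsub>A\<^esub> a))"
  let ?c = "\<lambda>a. I +>\<^bsub>A\<^esub> a" and ?S = "Spec (quot A I)"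
  have A: "kalgebra A" and I: "ideal I A" and sq: "\<And>a b. a \<in> I \<Longrightarrow> b \<in> I \<Longrightarrow> a \<otimes>\<^bsub>A\<^esub> b = \<zero>\<^bsub>A\<^esub>"
    and u0: "morphism ?S ?V u0" and w: "morphism (Spec A) P w"
    and e: "mcomp ?S P ?i u0 = mcomp ?S P w (Spec_map A (quot A I) ?c)" using H by auto
  interpret A: kalg_ring A by (rule kalg_ring.intro[OF A])
  interpret Q: kalg_ring "quot A I" by (rule kalg_ring.intro[OF quot_kalgebra[OF A I]])
  have idl: "mcomp T P ?i u = u" if "morphism T ?V u" for T :: "('c, 'd, 'k) lrs" and u
    using mcomp_id_left[OF that] by simp
  have land: "fst w ` pts (Spec A) \<subseteq> N"
  proof (rule image_subsetI)
    fix R assume "R \<in> pts (Spec A)"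
    then have R: "primeideal R A" by (simp add: A.topspace_zariski)
    interpret R: primeideal R A by fact
    have IR: "I \<subseteq> R"
    proof
      fix a assume a: "a \<in> I"
      then have "a \<in> carrier A" by (rule ideal.Icarr[OF I])
      moreover have "a \<otimes>\<^bsub>A\<^esub> a \<in> R" using sq[OF a a] R.zero_closed by simp
      ultimately show "a \<in> R" using R.I_prime[of a a] by blast
    qed
    obtain B where B: "primeideal B (quot A I)" "{a \<in> carrier A. ?c a \<in> B} = R"
      using quot_prime_lift[OF A I R IR] by (elim exE conjE)
    have Bp: "B \<in> pts ?S" using B(1) by (simp add: Q.topspace_zariski)
    have "fst (Spec_map A (quot A I) ?c) B = R" using B(2) Bp unfolding Spec_map_def by simp
    then have "fst w R = fst (mcomp ?S P w (Spec_map A (quot A I) ?c)) B" by (simp only: mcomp_fst[OF Bp])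
    also have "\<dots> = fst u0 B" unfolding e[symmetric] idl[OF u0] ..
    also have "\<dots> \<in> N" using mor_pt[OF u0 Bp] unfolding Vp .
    finally show "fst w R \<in> N" .
  qed
  have wV: "morphism (Spec A) ?V w" unfolding morphism_open_sub_iff[OF N(1) lr] using w land by simp
  show "\<exists>!u. morphism (Spec A) ?V u \<and> mcomp ?S ?V u (Spec_map A (quot A I) ?c) = u0 \<and> mcomp (Spec A) P ?i u = w"
  proof (rule ex1I[of _ w])
    show "morphism (Spec A) ?V w \<and> mcomp ?S ?V w (Spec_map A (quot A I) ?c) = u0 \<and> mcomp (Spec A) P ?i w = w"
      using wV idl[OF wV] e idl[OF u0] by simp
    show "u = w" if "morphism (Spec A) ?V u \<and> mcomp ?S ?V u (Spec_map A (quot A I) ?c) = u0 \<and> mcomp (Spec A) P ?i u = w" for u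
      using that idl[of "Spec A" u] by simp
  qed
qed

text \<open>The reduced structures on \<open>Z\<close> inside \<open>P\<close> and inside the open
  subspace are both reduced, so each inclusion factors through the other one. Both composites of the
  two factorizations are identities because closed inclusions can be cancelled.\<close>

lemma etale_nbhd_open:
  fixes P :: "'k::field sch"
  assumes P: "kscheme P" and N: "openin (tspace P) N" "kscheme (open_sub P N)" and Z: "Z \<subseteq> N"
  shows "etale_nbhd (open_sub P N) (id_mor (open_sub P N)) P Z"
proof -
  let ?V = "open_sub P N" and ?i = "id_mor (open_sub P N)"
  note lr = kscheme_lr[OF P] and lrV = kscheme_lr[OF N(2)]
  have Vp: "pts ?V = N" using openin_subset[OF N(1)] by auto
  have pre: "preim ?V ?i Z = Z" using Z Vp by (auto simp: preim_def id_mor_def)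
  interpret RP: red_space P Z
    by (intro red_space.intro lr_space.intro red_space_axioms.intro lr) (use Z openin_subset[OF N(1)] in blast)
  interpret RV: red_space ?V Z
    by (intro red_space.intro lr_space.intro red_space_axioms.intro lrV) (use Z Vp in simp)
  let ?i1 = "reduced_incl ?V Z" and ?i2 = "reduced_incl P Z"
  have i1: "morphism RV.RX ?V ?i1" and i2: "morphism RP.RX P ?i2" by (rule RV.incl_morphism, rule RP.incl_morphism)
  have i1P: "morphism RV.RX P ?i1" using i1 unfolding morphism_open_sub_iff[OF N(1) lr] by simp
  have i2V: "morphism RP.RX ?V ?i2" unfolding morphism_open_sub_iff[OF N(1) lr]
    using i2 Z unfolding RP.R_pts by auto
  have l1: "fst ?i1 p \<in> Z" if "p \<in> pts RV.RX" for p using that unfolding RV.R_pts by simp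
  have l2: "fst ?i2 p \<in> Z" if "p \<in> pts RP.RX" for p using that unfolding RP.R_pts by simp
  let ?u = "rfac P Z RV.RX ?i1" and ?g = "rfac ?V Z RP.RX ?i2"
  have u: "morphism RV.RX RP.RX ?u" "mcomp RV.RX P ?i2 ?u = ?i1"
    by (rule RP.rfac[OF RV.R_lr RV.R_lreduced i1P], erule l1)+
  have g: "morphism RP.RX RV.RX ?g" "mcomp RP.RX ?V ?i1 ?g = ?i2"
    by (rule RV.rfac[OF RP.R_lr RP.R_lreduced i2V], erule l2)+
  note g2 = g(2)[unfolded mcomp_open_sub]
  have "isomorphism RV.RX RP.RX ?u"
  proof (rule isomorphismI[OF u(1) g(1)])
    show "mcomp RV.RX RV.RX ?g ?u = id_mor RV.RX"
    proof (rule RV.incl_mono[OF morphism_mcomp[OF u(1) g(1) RV.R_lr] lr_space.morphism_id[OF lr_space.intro[OF RV.R_lr]]])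
      have "mcomp RV.RX ?V ?i1 (mcomp RV.RX RV.RX ?g ?u) = mcomp RV.RX ?V (mcomp RP.RX ?V ?i1 ?g) ?u"
        by (rule mcomp_assoc[OF u(1) g(1) i1])
      also have "\<dots> = ?i1" using u(2) g2 by simp
      also have "\<dots> = mcomp RV.RX ?V ?i1 (id_mor RV.RX)" by (rule mcomp_id_right[OF i1, symmetric])
      finally show "mcomp RV.RX ?V ?i1 (mcomp RV.RX RV.RX ?g ?u) = mcomp RV.RX ?V ?i1 (id_mor RV.RX)" .
    qed
    show "mcomp RP.RX RP.RX ?u ?g = id_mor RP.RX"
    proof (rule RP.incl_mono[OF morphism_mcomp[OF g(1) u(1) RP.R_lr] lr_space.morphism_id[OF lr_space.intro[OF RP.R_lr]]])
      have "mcomp RP.RX P ?i2 (mcomp RP.RX RP.RX ?u ?g) = mcomp RP.RX P (mcomp RV.RX P ?i2 ?u) ?g"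
        by (rule mcomp_assoc[OF g(1) u(1) i2])
      also have "\<dots> = ?i2" unfolding u(2) by (rule g2)
      also have "\<dots> = mcomp RP.RX P ?i2 (id_mor RP.RX)" by (rule mcomp_id_right[OF i2, symmetric])
      finally show "mcomp RP.RX P ?i2 (mcomp RP.RX RP.RX ?u ?g) = mcomp RP.RX P ?i2 (id_mor RP.RX)" .
    qed
  qed
  moreover have "mcomp RV.RX P ?i2 ?u = mcomp RV.RX P ?i ?i1"
    unfolding u(2) using mcomp_id_left[OF i1] by simp
  ultimately show ?thesis
    unfolding etale_nbhd_def pre using etale_open[OF P N] by (intro conjI exI)
qed

section \<open>Finite morphisms\<close>

lemma finite_hom_id:
  assumes "kalgebra A" shows "finite_hom A A (\<lambda>a. a)"
proof -
  interpret A: cring A by (rule kalg_cring[OF assms])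
  have "\<exists>c \<in> {\<one>\<^bsub>A\<^esub>} \<rightarrow> carrier A. a = (\<Oplus>\<^bsub>A\<^esub>s\<in>{\<one>\<^bsub>A\<^esub>}. c s \<otimes>\<^bsub>A\<^esub> s)" if a: "a \<in> carrier A" for a
    by (rule bexI[of _ "\<lambda>_. a"]) (use a in \<open>simp_all add: A.finsum_insert\<close>)
  then show ?thesis unfolding finite_hom_def
    by (intro conjI exI[of _ "{\<one>\<^bsub>A\<^esub>}"]) (auto intro: alg_homI)
qed

lemma Spec_map_id:
  assumes A: "kalgebra A" shows "Spec_map A A (\<lambda>a. a) = id_mor (Spec A)"
proof -
  interpret A: kalg_ring A by (rule kalg_ring.intro[OF A])
  interpret spec_mor "Spec A" A by unfold_locales
  have i: "(\<lambda>a. a) \<in> alg_hom A A" by (rule alg_homI) auto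
  note e = Spec_map_eq_slift[OF A A i]
  show ?thesis unfolding e(1)
  proof (rule spec_mor_eqI[OF slift_morphism[OF e(2)] A.Sp.morphism_id])
    fix a assume a: "a \<in> carrier A"
    show "cof (Spec A) A (slift (Spec A) A (\<lambda>a. gf A (pts (Spec A)) a)) a = cof (Spec A) A (id_mor (Spec A)) a"
      unfolding cof_slift[OF e(2) a] cof_id_open[OF A openin_topspace a, unfolded open_sub_all] ..
  qed
qed

lemma mcomp_cong:
  assumes "\<And>p. p \<in> pts X \<Longrightarrow> fst f p = fst f' p"
    "\<And>p a. p \<in> pts X \<Longrightarrow> a \<in> carrier (stalk Z (fst g (fst f p))) \<Longrightarrow> snd f p (snd g (fst f p) a) = snd f' p (snd g (fst f p) a)"
  shows "mcomp X Z g f = mcomp X Z g f'"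
  unfolding mcomp_def using assms(2) by (simp add: assms(1)[symmetric] fun_eq_iff restrict_def)

text \<open>Over a chart of \<open>X\<close> with ring \<open>A\<close>, composing the chart with
  \<open>f\<close> makes the preimage a spectrum of the same ring, so the identity of
  \<open>A\<close> serves as finite homomorphism.\<close>

lemma finite_mor_iso:
  fixes X :: "('q, 'c, 'k::field) lrs" and R :: "('p, 'b, 'k) lrs"
  assumes X: "kscheme X" and R: "locally_ringed R" and f: "isomorphism R X f"
  shows "finite_mor R X f"
proof -
  note lr = kscheme_lr[OF X]
  have m: "morphism R X f" using f by (simp add: isomorphism_def)
  have "\<exists>W (A :: ('k mpoly set, 'k) kalg) (B :: ('k mpoly set, 'k) kalg) h \<alpha> \<beta>.
        openin (tspace X) W \<and> q \<in> W \<and> kalgebra A \<and> kalgebra B \<and> finite_hom B A h \<and>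
        isomorphism (open_sub R (preim R f W)) (Spec A) \<alpha> \<and>
        isomorphism (open_sub X W) (Spec B) \<beta> \<and>
        mcomp (open_sub R (preim R f W)) (Spec B) \<beta> f =
        mcomp (open_sub R (preim R f W)) (Spec B) (Spec_map B A h) \<alpha>" if q: "q \<in> pts X" for q
  proof -
    obtain W and A :: "('k mpoly set, 'k) kalg" and \<beta> where W: "openin (tspace X) W" "q \<in> W" "fin_gen_alg A" "isomorphism (open_sub X W) (Spec A) \<beta>"
      using X q unfolding kscheme_def by (elim conjE) (drule (1) bspec, elim exE conjE, rule that)
    have A: "kalgebra A" using W(3) by (simp add: fin_gen_alg_def)
    interpret A: kalg_ring A by (rule kalg_ring.intro[OF A])
    let ?R = "open_sub R (preim R f W)" and ?X = "open_sub X W"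
    have oR: "openin (tspace R) (preim R f W)" by (rule mor_preim_open[OF m W(1)])
    have lrR: "locally_ringed ?R" and lrX: "locally_ringed ?X"
      by (rule lr_space.open_sub_lr[OF lr_space.intro[OF R] oR], rule lr_space.open_sub_lr[OF lr_space.intro[OF lr] W(1)])
    let ?f = "mcomp ?R X f (id_mor ?R)"
    have i: "isomorphism ?R ?X ?f" by (rule isomorphism_restrict[OF f R lr W(1)])
    have a: "isomorphism ?R (Spec A) (mcomp ?R (Spec A) \<beta> ?f)" by (rule isomorphism_comp[OF i W(4) lrR A.Spec_lr])
    have "mcomp ?R (Spec A) \<beta> f = mcomp ?R (Spec A) \<beta> ?f"
    proof -
      have p: "p \<in> pts R" if "p \<in> pts ?R" for p using that by simp
      have bm: "morphism ?X (Spec A) \<beta>" and fm: "morphism ?R ?X ?f" using W(4) i by (auto simp: isomorphism_def)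
      have "snd f p (snd \<beta> (fst f p) x) = snd ?f p (snd \<beta> (fst f p) x)"
        if "p \<in> pts ?R" "x \<in> carrier (stalk (Spec A) (fst \<beta> (fst f p)))" for p x
      proof -
        have "fst ?f p = fst f p" using that(1) by simp
        then have fp: "fst f p \<in> pts ?X" using mor_pt[OF fm that(1)] by simp
        have c: "snd \<beta> (fst f p) x \<in> carrier (stalk X (fst f p))" using mor_closed[OF bm fp that(2)] by simp
        show ?thesis using that(1) c mor_closed[OF m p[OF that(1)] c] by simp
      qed
      then show ?thesis by (intro mcomp_cong) simp_all
    qed
    also have "\<dots> = mcomp ?R (Spec A) (Spec_map A A (\<lambda>a. a)) (mcomp ?R (Spec A) \<beta> ?f)"
      unfolding Spec_map_id[OF A] using a by (intro mcomp_id_left[symmetric]) (simp add: isomorphism_def)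
    finally show ?thesis
      using W(1,2,4) A finite_hom_id[OF A] a by (intro exI conjI)
  qed
  then show ?thesis unfolding finite_mor_def using m by blast
qed

text \<open>The image of a section \<open>z\<close> of \<open>\<pi> : P \<rightarrow> X\<close>, with its reduced structure, is isomorphic to \<open>X\<close>.\<close>

lemma finite_mor_section:
  assumes X: "kscheme X" "lreduced X" and P: "locally_ringed P" and pi: "morphism P X \<pi>"
    and z: "morphism X P z" "mcomp X X \<pi> z = id_mor X"
  defines "Z \<equiv> fst z ` pts X"
  shows "finite_mor (reduced_sub P Z) X (mcomp (reduced_sub P Z) X \<pi> (reduced_incl P Z))"
proof -
  note lr = kscheme_lr[OF X(1)]
  interpret RP: red_space P Z
    by (intro red_space.intro lr_space.intro red_space_axioms.intro P) (use mor_pt[OF z(1)] in \<open>auto simp: Z_def\<close>)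
  interpret X: lr_space X by (rule lr_space.intro[OF lr])
  let ?i = "reduced_incl P Z" and ?R = RP.RX
  let ?\<phi> = "mcomp ?R X \<pi> ?i" and ?\<psi> = "rfac P Z X z"
  note i = RP.incl_morphism
  have \<phi>: "morphism ?R X ?\<phi>" by (rule morphism_mcomp[OF i pi lr])
  have land: "fst z p \<in> Z" if "p \<in> pts X" for p using that by (simp add: Z_def)
  have \<psi>: "morphism X ?R ?\<psi>" "mcomp X P ?i ?\<psi> = z"
    by (rule RP.rfac[OF lr X(2) z(1)], erule land)+
  have zx: "fst \<pi> (fst z x) = x" "a \<in> carrier (stalk X x) \<Longrightarrow> snd z x (snd \<pi> (fst z x) a) = a" if x: "x \<in> pts X" for x a
    using arg_cong[OF z(2), of "\<lambda>h. fst h x"] arg_cong[OF z(2), of "\<lambda>h. snd h x a"] x by auto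
  have "isomorphism ?R X ?\<phi>"
  proof (rule isomorphismI[OF \<phi> \<psi>(1)])
    have "mcomp X X ?\<phi> ?\<psi> = mcomp X X \<pi> (mcomp X P ?i ?\<psi>)" by (rule mcomp_assoc[OF \<psi>(1) i pi, symmetric])
    then show "mcomp X X ?\<phi> ?\<psi> = id_mor X" using \<psi>(2) z(2) by simp
    show "mcomp ?R ?R ?\<psi> ?\<phi> = id_mor ?R"
    proof (rule RP.incl_mono[OF morphism_mcomp[OF \<phi> \<psi>(1) RP.R_lr] lr_space.morphism_id[OF lr_space.intro[OF RP.R_lr]]])
      have "mcomp ?R P ?i (mcomp ?R ?R ?\<psi> ?\<phi>) = mcomp ?R P (mcomp X P ?i ?\<psi>) ?\<phi>"
        by (rule mcomp_assoc[OF \<phi> \<psi>(1) i])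
      also have "\<dots> = mcomp ?R P z ?\<phi>" unfolding \<psi>(2) ..
      also have "\<dots> = ?i"
      proof (rule mor_fst_eqI[OF morphism_mcomp[OF \<phi> z(1) P] i])
        fix p assume p: "p \<in> pts ?R"
        then have pZ: "p \<in> Z" unfolding RP.R_pts .
        then obtain x where x: "x \<in> pts X" "p = fst z x" by (auto simp: Z_def)
        have zpi: "fst z (fst \<pi> q) = q" if "q \<in> Z" for q using that zx(1) by (auto simp: Z_def)
        have ip: "fst ?i p = p" using pZ by simp
        have f: "fst (mcomp ?R P z ?\<phi>) p = p" using p ip zpi[OF pZ] by simp
        then show "fst (mcomp ?R P z ?\<phi>) p = fst ?i p" using ip by simp
        fix a assume "a \<in> carrier (stalk P (fst (mcomp ?R P z ?\<phi>) p))"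
        then have a: "a \<in> carrier (stalk P p)" unfolding f .
        note pP = RP.Zp[OF pZ]
        \<comment> \<open>The germ \<open>a\<close> and its pullback along \<open>z\<close> after
          \<open>\<pi>\<close> have the same image under \<open>z\<close>. Their difference is thus
          sent to zero at every nearby point of \<open>Z\<close>, so it vanishes on
          \<open>Z\<close>, and the two germs agree in the reduced structure.\<close>
        let ?e = "mcomp P P z \<pi>"
        have e: "morphism P P ?e" by (rule morphism_mcomp[OF pi z(1) P])
        obtain W s where s: "openin (tspace P) W" "p \<in> W" "s \<in> sections P W" "s p = a"
          using RP.germ_ex[OF pP a] by (elim exE conjE)
        let ?V = "W \<inter> preim P ?e W"
        have oV: "openin (tspace P) ?V" using s(1) mor_preim_open[OF e s(1)] by (rule openin_Int)
        let ?t = "pull P ?e W s"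
        have r: "restrict ?t ?V \<in> sections P ?V" "restrict s ?V \<in> sections P ?V"
          using RP.sec_restrict[OF mor_preim_open[OF e s(1)] mor_pull[OF e s(1,3)] oV] RP.sec_restrict[OF s(1,3) oV] by auto
        have pV: "p \<in> ?V" using s(2) pP zpi[OF pZ] by (simp add: preim_def)
        have tq: "?t q = snd \<pi> q (snd z (fst \<pi> q) (s q))" "s q \<in> carrier (stalk P q)" if "q \<in> ?V" "q \<in> Z" for q
        proof -
          show "s q \<in> carrier (stalk P q)" using RP.sec_carrier[OF s(1,3)] that(1) by simp
          then show "?t q = snd \<pi> q (snd z (fst \<pi> q) (s q))" using that RP.Zp[OF that(2)] zpi[OF that(2)] by (simp add: pull_def)
        qed
        have "(\<lambda>q\<in>?V. restrict ?t ?V q \<ominus>\<^bsub>stalk P q\<^esub> restrict s ?V q) p \<in> van_ideal P Z p"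
        proof (rule RP.van_I[OF oV pV RP.sec_diff[OF oV r]])
          fix q assume q: "q \<in> ?V" "q \<in> Z"
          obtain y where y: "y \<in> pts X" "q = fst z y" using q(2) by (auto simp: Z_def)
          note qP = RP.Zp[OF q(2)]
          interpret S: cring "stalk P q" by (rule RP.stalk_cring[OF qP])
          interpret SX: cring "stalk X y" by (rule X.stalk_cring[OF y(1)])
          have piq: "fst \<pi> q = y" using zx(1)[OF y(1)] y(2) by simp
          have c1: "snd z y (s q) \<in> carrier (stalk X y)" using mor_closed[OF z(1) y(1)] tq(2)[OF q] y(2) by simp
          have c2: "?t q \<in> carrier (stalk P q)"
            unfolding tq(1)[OF q] piq using mor_closed[OF pi qP] c1 piq by simp
          have h: "snd z y \<in> alg_hom (stalk P q) (stalk X y)" using mor_hom[OF z(1) y(1)] y(2) by simp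
          have "snd z y (?t q) = snd z y (s q)" unfolding tq(1)[OF q] piq using zx(2)[OF y(1) c1] y(2) by simp
          then have "snd z y (?t q \<ominus>\<^bsub>stalk P q\<^esub> s q) = \<zero>\<^bsub>stalk X y\<^esub>"
            unfolding alg_hom_minus[OF h S.is_cring SX.is_cring c2 tq(2)[OF q]] using c1 by (simp add: SX.r_right_minus_eq)
          then have "?t q \<ominus>\<^bsub>stalk P q\<^esub> s q \<notin> Units (stalk P q)"
            using alg_hom_Units[OF h, of "?t q \<ominus>\<^bsub>stalk P q\<^esub> s q"] local_ring_zero_nonunit[OF X.stalk_local[OF y(1)]] by auto
          then show "(\<lambda>q\<in>?V. restrict ?t ?V q \<ominus>\<^bsub>stalk P q\<^esub> restrict s ?V q) q \<notin> Units (stalk P q)" using q(1) by simp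
        qed
        then have v: "snd \<pi> p (snd z (fst \<pi> p) a) \<ominus>\<^bsub>stalk P p\<^esub> a \<in> van_ideal P Z p"
          using pV tq(1)[OF pV pZ] s(4) by simp
        have pix: "fst \<pi> p = x" using zx(1)[OF x(1)] x(2) by simp
        have c1: "snd z x a \<in> carrier (stalk X x)" using mor_closed[OF z(1) x(1)] a x(2) by simp
        have c2: "snd \<pi> p (snd z x a) \<in> carrier (stalk P p)" using mor_closed[OF pi pP] c1 pix by simp
        have "RP.cl p (snd \<pi> p (snd z x a)) = RP.cl p a"
          using quot_eq_iff[OF RP.van_ideal_ideal[OF pZ] c2 a] v pix by simp
        moreover have "snd (mcomp ?R P z ?\<phi>) p a = RP.cl p (snd \<pi> p (snd z x a))"
          using p ip pix x(2)[symmetric] a c1 c2 pZ by simp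
        ultimately show "snd (mcomp ?R P z ?\<phi>) p a = snd ?i p a" using pZ a by simp
      qed
      also have "\<dots> = mcomp ?R P ?i (id_mor ?R)" by (rule mcomp_id_right[OF i, symmetric])
      finally show "mcomp ?R P ?i (mcomp ?R ?R ?\<psi> ?\<phi>) = mcomp ?R P ?i (id_mor ?R)" .
    qed
  qed
  then show ?thesis by (rule finite_mor_iso[OF X(1) RP.R_lr])
qed

text \<open>The \<open>B\<close>-submodule of \<open>A\<close> generated by \<open>S\<close>, with
  \<open>A\<close> regarded as a module through \<open>h\<close>.\<close>

definition bspan :: "('b, 'k) kalg \<Rightarrow> ('a, 'k) kalg \<Rightarrow> ('b \<Rightarrow> 'a) \<Rightarrow> 'a set \<Rightarrow> 'a set" where
  "bspan B A h S = {(\<Oplus>\<^bsub>A\<^esub>s\<in>S. h (c s) \<otimes>\<^bsub>A\<^esub> s) | c. c \<in> S \<rightarrow> carrier B}"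

context
  fixes A :: "('a, 'k::field) kalg" and B :: "('b, 'k) kalg" and h S
  assumes A: "kalgebra A" and B: "kalgebra B" and h: "h \<in> alg_hom B A" and S: "finite S" "S \<subseteq> carrier A"
begin

interpretation A: cring A by (rule kalg_cring[OF A])
interpretation B: cring B by (rule kalg_cring[OF B])

lemma hc: "c \<in> S \<rightarrow> carrier B \<Longrightarrow> s \<in> S \<Longrightarrow> h (c s) \<in> carrier A"
  using alg_hom_closed[OF h] by blast

lemma bspan_carrier: "x \<in> bspan B A h S \<Longrightarrow> x \<in> carrier A"
  unfolding bspan_def using S hc by (auto intro!: A.finsum_closed)

lemma bspan_add: "x \<in> bspan B A h S \<Longrightarrow> y \<in> bspan B A h S \<Longrightarrow> x \<oplus>\<^bsub>A\<^esub> y \<in> bspan B A h S"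
proof -
  assume "x \<in> bspan B A h S" "y \<in> bspan B A h S"
  then obtain c d where c: "c \<in> S \<rightarrow> carrier B" "d \<in> S \<rightarrow> carrier B"
    "x = (\<Oplus>\<^bsub>A\<^esub>s\<in>S. h (c s) \<otimes>\<^bsub>A\<^esub> s)" "y = (\<Oplus>\<^bsub>A\<^esub>s\<in>S. h (d s) \<otimes>\<^bsub>A\<^esub> s)" unfolding bspan_def by blast
  have "x \<oplus>\<^bsub>A\<^esub> y = (\<Oplus>\<^bsub>A\<^esub>s\<in>S. h (c s) \<otimes>\<^bsub>A\<^esub> s \<oplus>\<^bsub>A\<^esub> h (d s) \<otimes>\<^bsub>A\<^esub> s)"
    unfolding c(3,4) using hc[OF c(1)] hc[OF c(2)] S by (intro A.finsum_addf[symmetric]) auto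
  also have "\<dots> = (\<Oplus>\<^bsub>A\<^esub>s\<in>S. h (c s \<oplus>\<^bsub>B\<^esub> d s) \<otimes>\<^bsub>A\<^esub> s)"
    using hc[OF c(1)] hc[OF c(2)] S c(1,2) alg_hom_add[OF h] by (intro A.finsum_cong') (auto simp: A.l_distr Pi_iff subset_iff)
  finally show ?thesis unfolding bspan_def using c(1,2) by (intro CollectI exI[of _ "\<lambda>s. c s \<oplus>\<^bsub>B\<^esub> d s"]) auto
qed

lemma bspan_zero: "\<zero>\<^bsub>A\<^esub> \<in> bspan B A h S"
proof -
  have "(\<Oplus>\<^bsub>A\<^esub>s\<in>S. h \<zero>\<^bsub>B\<^esub> \<otimes>\<^bsub>A\<^esub> s) = (\<Oplus>\<^bsub>A\<^esub>s\<in>S. \<zero>\<^bsub>A\<^esub>)"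
    using S alg_hom_zero[OF h B.is_cring A.is_cring] by (intro A.finsum_cong') auto
  then have "\<zero>\<^bsub>A\<^esub> = (\<Oplus>\<^bsub>A\<^esub>s\<in>S. h \<zero>\<^bsub>B\<^esub> \<otimes>\<^bsub>A\<^esub> s)" by simp
  then show ?thesis unfolding bspan_def by (intro CollectI exI[of _ "\<lambda>_. \<zero>\<^bsub>B\<^esub>"]) auto
qed

lemma bspan_scale:
  assumes b: "b \<in> carrier B" and x: "x \<in> bspan B A h S" shows "h b \<otimes>\<^bsub>A\<^esub> x \<in> bspan B A h S"
proof -
  obtain c where c: "c \<in> S \<rightarrow> carrier B" "x = (\<Oplus>\<^bsub>A\<^esub>s\<in>S. h (c s) \<otimes>\<^bsub>A\<^esub> s)" using x unfolding bspan_def by blast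
  note hb = alg_hom_closed[OF h b]
  have "h b \<otimes>\<^bsub>A\<^esub> x = (\<Oplus>\<^bsub>A\<^esub>s\<in>S. h b \<otimes>\<^bsub>A\<^esub> (h (c s) \<otimes>\<^bsub>A\<^esub> s))"
    unfolding c(2) using hb hc[OF c(1)] S by (intro A.finsum_rdistr) auto
  also have "\<dots> = (\<Oplus>\<^bsub>A\<^esub>s\<in>S. h (b \<otimes>\<^bsub>B\<^esub> c s) \<otimes>\<^bsub>A\<^esub> s)"
    using hb hc[OF c(1)] S c(1) b alg_hom_mult[OF h b] by (intro A.finsum_cong') (auto simp: A.m_assoc Pi_iff subset_iff)
  finally show ?thesis unfolding bspan_def using c(1) b by (intro CollectI exI[of _ "\<lambda>s. b \<otimes>\<^bsub>B\<^esub> c s"]) auto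
qed

lemma bspan_base:
  assumes s: "s \<in> S" shows "s \<in> bspan B A h S"
proof -
  let ?c = "\<lambda>r. if r = s then \<one>\<^bsub>B\<^esub> else \<zero>\<^bsub>B\<^esub>"
  have "(\<Oplus>\<^bsub>A\<^esub>r\<in>S. h (?c r) \<otimes>\<^bsub>A\<^esub> r) = (\<Oplus>\<^bsub>A\<^esub>r\<in>S. if s = r then r else \<zero>\<^bsub>A\<^esub>)"
    using S alg_hom_zero[OF h B.is_cring A.is_cring] alg_hom_one[OF h] by (intro A.finsum_cong') auto
  also have "\<dots> = s" using S s by (subst A.add.finprod_singleton) auto
  finally show ?thesis unfolding bspan_def by (intro CollectI exI[of _ ?c]) auto
qed

lemma bspan_finsum: "finite K \<Longrightarrow> (\<And>k. k \<in> K \<Longrightarrow> g k \<in> bspan B A h S) \<Longrightarrow> finsum A g K \<in> bspan B A h S"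
proof (induction rule: finite_induct)
  case empty then show ?case using bspan_zero by simp
next
  case (insert k K)
  have "finsum A g (insert k K) = g k \<oplus>\<^bsub>A\<^esub> finsum A g K"
    using insert bspan_carrier by (intro A.finsum_insert) auto
  then show ?case using insert bspan_add by simp
qed

lemma bspan_mult:
  assumes g: "g \<in> carrier A" "\<And>s. s \<in> S \<Longrightarrow> g \<otimes>\<^bsub>A\<^esub> s \<in> bspan B A h S" and x: "x \<in> bspan B A h S"
  shows "g \<otimes>\<^bsub>A\<^esub> x \<in> bspan B A h S"
proof -
  obtain c where c: "c \<in> S \<rightarrow> carrier B" "x = (\<Oplus>\<^bsub>A\<^esub>s\<in>S. h (c s) \<otimes>\<^bsub>A\<^esub> s)" using x unfolding bspan_def by blast
  have "g \<otimes>\<^bsub>A\<^esub> x = (\<Oplus>\<^bsub>A\<^esub>s\<in>S. g \<otimes>\<^bsub>A\<^esub> (h (c s) \<otimes>\<^bsub>A\<^esub> s))"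
    unfolding c(2) using g(1) hc[OF c(1)] S by (intro A.finsum_rdistr) auto
  also have "\<dots> = (\<Oplus>\<^bsub>A\<^esub>s\<in>S. h (c s) \<otimes>\<^bsub>A\<^esub> (g \<otimes>\<^bsub>A\<^esub> s))"
    using g(1) hc[OF c(1)] S by (intro A.finsum_cong') (auto simp: A.m_lcomm subset_iff)
  also have "\<dots> \<in> bspan B A h S"
    by (rule bspan_finsum[OF S(1)]) (use g(2) c(1) in \<open>auto intro: bspan_scale\<close>)
  finally show ?thesis .
qed

lemma finite_hom_bspan: "carrier A \<subseteq> bspan B A h S \<Longrightarrow> finite_hom B A h"
  unfolding finite_hom_def using h S unfolding bspan_def by blast

end

text \<open>A polynomial in the fibre coordinate with scalar leading coefficient. Division by that
  coefficient is possible in the field, so the zero set is finite over every open subset of the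
  base, and the property survives specialization of base variables.\<close>

definition mlike :: "nat \<Rightarrow> 'k::field mpoly \<Rightarrow> bool" where
  "mlike n K \<longleftrightarrow> (\<exists>a d k. a \<noteq> 0 \<and> 0 < d \<and> (\<forall>i<d. k i \<in> PR n) \<and> K = cst a * var n ^ d + (\<Sum>i<d. k i * var n ^ i))"

abbreviation ZK :: "nat \<Rightarrow> 'k::field mpoly \<Rightarrow> 'k mpoly \<Rightarrow> 'k mpoly set set" where
  "ZK n f K \<equiv> {p \<in> DD (Suc n) f. K \<in> p}"

lemma sum_PR: "(\<And>i. i \<in> I \<Longrightarrow> g i \<in> PR n) \<Longrightarrow> finite I \<Longrightarrow> (\<Sum>i\<in>I. g i) \<in> PR n"
  by (induction I rule: infinite_finite_induct) auto

lemma mlike_PR: "mlike n K \<Longrightarrow> K \<in> PR (Suc n)"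
  unfolding mlike_def using PR_mono[of _ n "Suc n"] by (auto intro!: PR_add PR_mult PR_power sum_PR)

text \<open>The functions on the zero set of \<open>K\<close> form a finite module over the base, spanned by powers of the fibre
  coordinate; the inverse of \<open>f\<close> is the additional coordinate of both charts.\<close>

lemma finite_mor_std:
  fixes f K :: "'k::field mpoly"
  assumes f: "f \<in> PR n" and K: "mlike n K"
  shows "finite_mor (reduced_sub (Aff (Suc n) (DD (Suc n) f)) (ZK n f K)) (Aff n (DD n f))
     (mcomp (reduced_sub (Aff (Suc n) (DD (Suc n) f)) (ZK n f K)) (Aff n (DD n f)) (prj n f)
       (reduced_incl (Aff (Suc n) (DD (Suc n) f)) (ZK n f K)))"
proof -
  define m where "m = Suc n"
  let ?P = "Aff m (DD m f)" and ?X = "Aff n (DD n f)" and ?Z = "{p \<in> DD m f. K \<in> p}"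
  have fm: "f \<in> PR m" and nm: "n \<le> m" using PR_mono[OF f] by (auto simp: m_def)
  note oX = DD_open[OF f] and oP = DD_open[OF fm]
  interpret P: lr_space ?P by (rule lr_space.intro[OF Aff_lr[OF oP]])
  interpret X: lr_space ?X by (rule lr_space.intro[OF Aff_lr[OF oX]])
  have ZP: "?Z \<subseteq> pts ?P" unfolding Aff_pts[OF oP] by blast
  interpret RP: red_space ?P ?Z by unfold_locales (rule ZP)
  let ?R = RP.RX and ?i = "reduced_incl ?P ?Z"
  interpret R: lr_space ?R by (rule lr_space.intro[OF RP.R_lr])
  interpret cm: chart_mor ?R m f ?i by unfold_locales (rule fm, rule RP.incl_morphism)
  let ?s = cm.sj and ?A = cm.cd.A and ?c = cm.cd.c and ?SA = cm.cd.SA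
  let ?ts = "tospec (Suc m) ?R ?s"
  interpret A: cring ?A by (rule kalg_cring[OF cm.cd.A_kalg])
  interpret GR: cring "gam ?R" by (rule kalg_cring[OF R.gam_kalgebra])
  have evh: "ev (gam ?R) ?s \<in> alg_hom (polyring N) (gam ?R)" for N by (rule ev_gam_hom[OF RP.R_lr cm.sj_global])
  have evX: "ev (gam ?X) (ch n f) \<in> alg_hom (polyring N) (gam ?X)" for N by (rule ev_gam_hom[OF X.lr ch_global[OF f]])
  have KP: "K \<in> PR m" "K \<in> PR (Suc m)" using mlike_PR[OF K] PR_mono[OF mlike_PR[OF K], of "Suc (Suc n)"] by (auto simp: m_def)
  have iP: "morphism ?R (Spec (polyring m)) ?i" by (rule mor_AffD[OF oP RP.incl_morphism])

  \<comment> \<open>\<open>K\<close> has value zero at every point of its zero set, and the reduced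
    structure turns this into the equation \<open>K = 0\<close> among functions.\<close>
  have K0: "?c K = \<zero>\<^bsub>?A\<^esub>"
  proof -
    let ?k = "cof ?R (polyring m) ?i K"
    have g: "?k \<in> global ?R" by (rule cof_global[OF RP.R_lr iP KP(1)])
    have "\<forall>p\<in>pts ?R. vanishes ?R ?k p"
    proof
      fix p assume p: "p \<in> pts ?R"
      then have pZ: "p \<in> ?Z" unfolding RP.R_pts .
      have "K \<in> fst ?i p" using pZ RP.incl_fst[OF pZ] by simp
      then show "vanishes ?R ?k p"
        unfolding spec_mor.fst_eq[OF spec_mor_poly[OF RP.R_lr] iP p] vanishes_def by simp
    qed
    then have "\<forall>p\<in>pts ?R. ?k p = \<zero>\<^bsub>stalk ?R p\<^esub>"
      using RP.R_lreduced g openin_topspace[of "tspace ?R"] unfolding lreduced_def by blast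
    then have "?k = \<zero>\<^bsub>gam ?R\<^esub>"
      unfolding gam_simps using R.global_ext[OF g] by (intro extensionalityI[of _ "pts ?R"]) (simp_all del: RP.R_simps RP.R_pts)
    then have "ev (gam ?R) ?s K = ev (gam ?R) ?s 0"
      unfolding cm.ev_sj[OF KP(1)] using alg_hom_zero[OF evh poly.is_cring GR.is_cring] by simp
    then have "?c K = ?c 0" using cm.cd.c_eq_iff[OF KP(2) PR_0] by simp
    then show ?thesis using alg_hom_zero[OF cm.cd.c_hom poly.is_cring cm.cd.sA.A.is_cring] by simp
  qed

  \<comment> \<open>The chart ring consists of functions on a reduced space and so has no
    nilpotents. This is what lets the candidate inverse \<open>cm.uj\<close> factor through the
    reduced zero set.\<close>
  have SAred: "lreduced ?SA"
  proof (rule cm.cd.sA.A.Spec_lreduced)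
    fix a and r :: nat assume a: "a \<in> carrier ?A" "a [^]\<^bsub>?A\<^esub> r = \<zero>\<^bsub>?A\<^esub>"
    obtain p where p: "p \<in> PR (Suc m)" "a = ?c p" using cm.cd.A_carrier[OF a(1)] by (elim bexE)
    have "?c (p ^ r) = ?c 0"
      using a(2) alg_hom_pow[OF cm.cd.c_hom poly.is_cring p(1), of r] alg_hom_zero[OF cm.cd.c_hom poly.is_cring cm.cd.sA.A.is_cring] p(2) by simp
    then have "ev (gam ?R) ?s (p ^ r) = ev (gam ?R) ?s 0" using cm.cd.c_eq_iff[of "p ^ r" 0] p(1) by simp
    then have pz: "ev (gam ?R) ?s p [^]\<^bsub>gam ?R\<^esub> r = \<zero>\<^bsub>gam ?R\<^esub>"
      using alg_hom_pow[OF evh poly.is_cring p(1), of r]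
        alg_hom_zero[OF evh poly.is_cring GR.is_cring] by simp
    have gl: "ev (gam ?R) ?s p \<in> global ?R" using alg_hom_closed[OF evh p(1)] by (simp only: gam_simps)
    have "ev (gam ?R) ?s p = \<zero>\<^bsub>gam ?R\<^esub>" by (rule R.gam_nilpotent[OF RP.R_lreduced gl pz])
    then have "ev (gam ?R) ?s p = ev (gam ?R) ?s 0"
      using alg_hom_zero[OF evh poly.is_cring GR.is_cring] by simp
    then show "a = \<zero>\<^bsub>?A\<^esub>"
      using cm.cd.c_eq_iff[OF p(1) PR_0] p(2) alg_hom_zero[OF cm.cd.c_hom poly.is_cring cm.cd.sA.A.is_cring] by simp
  qed

  have land: "fst cm.uj Q \<in> ?Z" if Q: "Q \<in> pts ?SA" for Q
  proof -
    have uP: "morphism ?SA (Spec (polyring m)) cm.uj" by (rule mor_AffD[OF oP cm.uj_morphism])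
    have "fst cm.uj Q \<in> DD m f" using mor_pt[OF cm.uj_morphism Q] unfolding Aff_pts[OF oP] .
    moreover have "K \<in> fst cm.uj Q"
    proof -
      have "cof ?SA (polyring m) cm.uj K = \<zero>\<^bsub>gam ?SA\<^esub>"
        unfolding cm.cof_uj[OF KP(1)] K0
        by (rule alg_hom_zero[OF cm.cd.G_hom cm.cd.sA.A.is_cring kalg_cring[OF cm.cd.sA.A.Sp.gam_kalgebra]])
      then have "cof ?SA (polyring m) cm.uj K Q \<notin> Units (stalk ?SA Q)"
        using local_ring_zero_nonunit[OF cm.cd.sA.A.Sp.stalk_local[OF Q]] Q by (simp only: gam_simps restrict_apply') simp
      then show ?thesis using KP(1) unfolding spec_mor.fst_eq[OF spec_mor_poly[OF cm.cd.SA_lr] uP Q] by simp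
    qed
    ultimately show ?thesis by simp
  qed
  let ?u = "rfac ?P ?Z ?SA cm.uj"
  have u: "morphism ?SA ?R ?u" "mcomp ?SA ?P ?i ?u = cm.uj"
    by (rule RP.rfac[OF cm.cd.SA_lr SAred cm.uj_morphism], erule land)+
  have iso: "isomorphism ?R ?SA ?ts"
  proof (rule cm.cd.chart_iso[OF u(1)])
    fix i assume i: "i < Suc m"
    have "?s i = pull ?R ?i (pts ?P) (ch m f i)" unfolding cm.sj_def Aff_pts[OF oP] ..
    then have "pull ?SA ?u (pts ?R) (?s i) = pull ?SA ?u (preim ?R ?i (pts ?P)) (pull ?R ?i (pts ?P) (ch m f i))"
      by (simp only: preim_pts[OF RP.incl_morphism])
    also have "\<dots> = pull ?SA (mcomp ?SA ?P ?i ?u) (pts ?P) (ch m f i)"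
      by (rule pull_mcomp[OF u(1) P.lr openin_topspace ch_global[OF fm], symmetric])
    also have "\<dots> = cm.cd.G (?c (var i))" unfolding u(2) Aff_pts[OF oP] by (rule cm.pull_uj[OF i])
    finally show "pull ?SA ?u (pts ?R) (?s i) = cm.cd.G (?c (var i))" .
  next
    show "mcomp ?R ?R ?u ?ts = id_mor ?R"
    proof (rule RP.incl_mono[OF morphism_mcomp[OF cm.cd.tospec_morphism u(1) RP.R_lr] R.morphism_id])
      have "mcomp ?R ?P ?i (mcomp ?R ?R ?u ?ts) = mcomp ?R ?P (mcomp ?SA ?P ?i ?u) ?ts"
        by (rule mcomp_assoc[OF cm.cd.tospec_morphism u(1) RP.incl_morphism])
      also have "\<dots> = ?i" unfolding u(2) by (rule cm.uj_tospec)
      also have "\<dots> = mcomp ?R ?P ?i (id_mor ?R)" by (rule mcomp_id_right[OF RP.incl_morphism, symmetric])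
      finally show "mcomp ?R ?P ?i (mcomp ?R ?R ?u ?ts) = mcomp ?R ?P ?i (id_mor ?R)" .
    qed
  qed

  interpret CX: chart_data ?X "Suc n" "ch n f" by unfold_locales (rule ch_global[OF f])
  interpret B: cring CX.A by (rule kalg_cring[OF CX.A_kalg])
  let ?B = CX.A and ?\<phi> = "mcomp ?R ?X (prj n f) ?i"
  have pm: "morphism ?P ?X (prj n f)" using prj_morphism[OF f] unfolding m_def .
  have \<phi>: "morphism ?R ?X ?\<phi>" by (rule morphism_mcomp[OF RP.incl_morphism pm X.lr])
  note pull\<phi> = pull_hom[OF \<phi> RP.R_lr X.lr]
  \<comment> \<open>The two charts number their coordinates differently. Over the base, index
    \<open>n\<close> is the inverse of \<open>f\<close>; over the zero set, index \<open>n\<close>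
    is the fibre coordinate and the inverse of \<open>f\<close> has index m = n + 1.\<close>
  define \<rho> :: "nat \<Rightarrow> 'k mpoly" where "\<rho> = (\<lambda>i. if i < n then var i else if i = n then var m else 0)"
  have \<rho>: "\<rho> i \<in> PR (Suc m)" for i unfolding \<rho>_def m_def by simp
  note er = poly.ev_hom[of \<rho> "Suc m", OF \<rho>]
  have er_var: "ev (polyring (Suc m)) \<rho> (var i) = \<rho> i" for i by (rule poly.ev_var[OF \<rho>])
  have er_id: "ev (polyring (Suc m)) \<rho> p = p" if p: "p \<in> PR n" for p
  proof (rule polyring_hom_eq[OF er _ _ p])
    show "(\<lambda>p. p) \<in> alg_hom (polyring n) (polyring (Suc m))" by (rule alg_homI) (use PR_mono[of _ n "Suc m"] nm in auto)
  qed (simp only: er_var, simp add: \<rho>_def)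
  have cofphi: "cof ?R (polyring n) ?\<phi> p = cof ?R (polyring m) ?i p" if p: "p \<in> PR n" for p
  proof -
    have "cof ?R (polyring n) (mcomp ?R (Spec (polyring n)) (prj n f) ?i) p = cof ?R (polyring m) ?i (ev (polyring m) (vars n) p)"
      unfolding prj_def m_def[symmetric] by (rule cof_sm_comp[OF oP vars_PR[OF nm] RP.R_lr RP.incl_morphism p])
    then show ?thesis unfolding mcomp_open_sub ev_vars[OF nm p] .
  qed
  have pf: "pull ?R ?\<phi> (pts ?X) (gf (polyring n) (DD n f) p) = cof ?R (polyring m) ?i p" if p: "p \<in> PR n" for p
    unfolding Aff_pts[OF oX] pull_gf_Aff[OF RP.R_lr oX \<phi>] by (rule cofphi[OF p])
  have nat: "pull ?R ?\<phi> (pts ?X) (ev (gam ?X) (ch n f) p) = ev (gam ?R) ?s (ev (polyring (Suc m)) \<rho> p)" if p: "p \<in> PR (Suc n)" for p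
  proof (rule polyring_hom_eq[OF alg_hom_comp[OF pull\<phi> evX]
        alg_hom_comp[OF evh er] _ p])
    fix i assume i: "i < Suc n"
    show "pull ?R ?\<phi> (pts ?X) (ev (gam ?X) (ch n f) (var i)) = ev (gam ?R) ?s (ev (polyring (Suc m)) \<rho> (var i))"
    proof (cases "i < n")
      case True
      then have v: "var i \<in> PR n" "var i \<in> PR m" using nm by auto
      have "ch n f i = gf (polyring n) (DD n f) (var i)" "\<rho> i = var i" using True by (simp_all add: ch_def \<rho>_def)
      then show ?thesis unfolding ev_gam_var[OF X.lr ch_global[OF f]] er_var using pf[OF v(1)] cm.ev_sj[OF v(2)] by simp
    next
      case False
      then have i: "i = n" using i by simp
      have ri: "\<rho> n = var m" by (simp add: \<rho>_def)
      have cc: "ch n f n \<in> carrier (gam ?X)" "gf (polyring n) (DD n f) f \<in> carrier (gam ?X)"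
        using ch_global[OF f] gf_global'[OF oX f] by (simp_all only: gam_simps)
      have "pull ?R ?\<phi> (pts ?X) (ch n f n) \<otimes>\<^bsub>gam ?R\<^esub> cof ?R (polyring m) ?i f = \<one>\<^bsub>gam ?R\<^esub>"
        using alg_hom_mult[OF pull\<phi> cc] unfolding ch_inverse[OF f] alg_hom_one[OF pull\<phi>] pf[OF f] by (rule sym)
      moreover note cm.sj_inverse
      moreover have "pull ?R ?\<phi> (pts ?X) (ch n f n) \<in> carrier (gam ?R)" by (rule alg_hom_closed[OF pull\<phi> cc(1)])
      moreover have "?s m \<in> carrier (gam ?R)" using cm.sj_global by (simp only: gam_simps)
      moreover have "cof ?R (polyring m) ?i f \<in> carrier (gam ?R)" by (rule alg_hom_closed[OF cof_poly_hom[OF RP.R_lr iP] fm])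
      ultimately have "pull ?R ?\<phi> (pts ?X) (ch n f n) = ?s m" by (intro GR.inverse_eq[of _ "?s m" "cof ?R (polyring m) ?i f"])
      then show ?thesis unfolding i ev_gam_var[OF X.lr ch_global[OF f]] er_var ri ev_gam_var[OF RP.R_lr cm.sj_global] .
    qed
  qed
  have kill: "?c (ev (polyring (Suc m)) \<rho> p) = \<zero>\<^bsub>?A\<^esub>" if p: "p \<in> CX.J" for p
  proof -
    have p': "p \<in> PR (Suc n)" "ev (gam ?X) (ch n f) p = \<zero>\<^bsub>gam ?X\<^esub>" using p by (simp_all only: keri_def mem_Collect_eq)
    have "ev (gam ?R) ?s (ev (polyring (Suc m)) \<rho> p) = \<zero>\<^bsub>gam ?R\<^esub>"
      unfolding nat[OF p'(1), symmetric] p'(2) by (rule alg_hom_zero[OF pull\<phi> kalg_cring[OF X.gam_kalgebra] GR.is_cring])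
    also have "\<dots> = ev (gam ?R) ?s 0"
      using alg_hom_zero[OF evh poly.is_cring GR.is_cring] by simp
    finally have "?c (ev (polyring (Suc m)) \<rho> p) = ?c 0"
      using cm.cd.c_eq_iff[OF ev_PR_closed[OF \<rho>] PR_0] by simp
    then show ?thesis using alg_hom_zero[OF cm.cd.c_hom poly.is_cring cm.cd.sA.A.is_cring] by simp
  qed
  have ch: "(\<lambda>p. ?c (ev (polyring (Suc m)) \<rho> p)) \<in> alg_hom (polyring (Suc n)) ?A" by (rule alg_hom_comp[OF cm.cd.c_hom er])
  let ?h = "qlift (polyring (Suc n)) CX.J (\<lambda>p. ?c (ev (polyring (Suc m)) \<rho> p))"
  have h: "?h \<in> alg_hom ?B ?A"
    unfolding kalgA_def[of "Suc n"] by (rule qlift_hom[OF CX.J_ideal ch polyring_kalgebra cm.cd.sA.A.is_cring kill])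
  have hc: "?h (CX.c p) = ?c (ev (polyring (Suc m)) \<rho> p)" if "p \<in> PR (Suc n)" for p
    unfolding kcl_def[of "Suc n"] by (rule qlift_eq[OF CX.J_ideal ch poly.is_cring cm.cd.sA.A.is_cring kill that])

  obtain a d k where ad: "a \<noteq> 0" "0 < d" "\<And>i. i < d \<Longrightarrow> k i \<in> PR n" "K = cst a * var n ^ d + (\<Sum>i<d. k i * var n ^ i)"
    using K unfolding mlike_def by blast
  \<comment> \<open>Candidate generators: the powers of the fibre coordinate below the degree of
    \<open>K\<close>.\<close>
  let ?S = "(\<lambda>i. ?c (var n ^ i)) ` {..<d}"
  have tP: "(var n ^ i :: 'k mpoly) \<in> PR (Suc m)" for i by (simp add: m_def)
  have S: "finite ?S" "?S \<subseteq> carrier ?A" using cm.cd.c_closed[OF tP] by auto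
  note sp = cm.cd.A_kalg CX.A_kalg h S
  let ?M = "bspan ?B ?A ?h ?S"
  have base: "?c p \<otimes>\<^bsub>?A\<^esub> x \<in> ?M" if p: "p \<in> PR n" and x: "x \<in> ?M" for p x
    using bspan_scale[OF sp CX.c_closed x, of p] hc[of p] er_id[OF p] PR_mono[OF p, of "Suc n"] by simp
  have pw: "?c (var n ^ i) \<in> ?M" if "i \<le> d" for i
  proof (cases "i < d")
    case True then show ?thesis by (intro bspan_base[OF sp]) auto
  next
    case False
    then have i: "i = d" using that by simp
    have s: "?c (\<Sum>i\<in>I. k i * var n ^ i) \<in> ?M \<and> (\<Sum>i\<in>I. k i * var n ^ i) \<in> PR (Suc m)" if "finite I" "I \<subseteq> {..<d}" for I
      using that
    proof (induction rule: finite_induct)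
      case empty
      show ?case using bspan_zero[OF sp] alg_hom_zero[OF cm.cd.c_hom poly.is_cring cm.cd.sA.A.is_cring] by simp
    next
      case (insert i I)
      then have i: "i < d" "?c (\<Sum>i\<in>I. k i * var n ^ i) \<in> ?M" "(\<Sum>i\<in>I. k i * var n ^ i) \<in> PR (Suc m)" by auto
      have ki: "k i \<in> PR n" "k i \<in> PR (Suc m)" using ad(3)[OF i(1)] PR_mono[of "k i" n "Suc m"] nm by auto
      have kt: "k i * var n ^ i \<in> PR (Suc m)" using ki(2) tP by simp
      have "?c (k i * var n ^ i) = ?c (k i) \<otimes>\<^bsub>?A\<^esub> ?c (var n ^ i)" using alg_hom_mult[OF cm.cd.c_hom ki(2) tP, of i] by simp
      also have "\<dots> \<in> ?M" by (rule base[OF ki(1) bspan_base[OF sp]]) (use i in auto)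
      finally have "?c (k i * var n ^ i) \<oplus>\<^bsub>?A\<^esub> ?c (\<Sum>i\<in>I. k i * var n ^ i) \<in> ?M" using i(2) by (intro bspan_add[OF sp])
      then have "?c (k i * var n ^ i + (\<Sum>i\<in>I. k i * var n ^ i)) \<in> ?M" using alg_hom_add[OF cm.cd.c_hom kt i(3)] by simp
      then show ?case using insert.hyps kt i(3) by simp
    qed
    let ?r = "\<Sum>i<d. k i * var n ^ i"
    have r: "?c ?r \<in> ?M" "?r \<in> PR (Suc m)" using s[of "{..<d}"] by auto
    \<comment> \<open>The equation of the zero set is solved for the top power; the scalar leading
      coefficient is inverted in the field.\<close>
    have t: "var n ^ d = cst (inverse a) * K + cst (- inverse a) * ?r"
    proof -
      have "cst (inverse a) * K = (cst (inverse a) * cst a) * var n ^ d + cst (inverse a) * ?r" by (simp add: ad(4) algebra_simps)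
      also have "cst (inverse a) * cst a = (1 :: 'k mpoly)" using ad(1) by (simp add: mult_single)
      finally show ?thesis by (simp add: single_uminus)
    qed
    have "?c (cst (- inverse a) * ?r) = ?c (cst (- inverse a)) \<otimes>\<^bsub>?A\<^esub> ?c ?r"
      using alg_hom_mult[OF cm.cd.c_hom PR_cst r(2), of "- inverse a"] by simp
    then have 1: "?c (cst (- inverse a) * ?r) \<in> ?M" using base[OF PR_cst r(1), of "- inverse a"] by simp
    have "?c (cst (inverse a) * K) = ?c (cst (inverse a)) \<otimes>\<^bsub>?A\<^esub> ?c K"
      using alg_hom_mult[OF cm.cd.c_hom PR_cst KP(2), of "inverse a"] by simp
    then have 2: "?c (cst (inverse a) * K) = \<zero>\<^bsub>?A\<^esub>" using K0 cm.cd.c_closed[OF PR_cst] by simp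
    have "?c (var n ^ d) = ?c (cst (inverse a) * K) \<oplus>\<^bsub>?A\<^esub> ?c (cst (- inverse a) * ?r)"
      unfolding t using alg_hom_add[OF cm.cd.c_hom, of "cst (inverse a) * K" "cst (- inverse a) * ?r"] KP(2) r(2) by simp
    then show ?thesis using 1 2 i bspan_carrier[OF sp 1] by simp
  qed
  have tmul: "?c (var n) \<otimes>\<^bsub>?A\<^esub> x \<in> ?M" if x: "x \<in> ?M" for x
  proof (rule bspan_mult[OF sp _ _ x])
    show "?c (var n) \<in> carrier ?A" using cm.cd.c_closed[OF tP[of 1]] by simp
    fix s assume "s \<in> ?S"
    then obtain i where i: "i < d" "s = ?c (var n ^ i)" by auto
    have "?c (var n) \<otimes>\<^bsub>?A\<^esub> s = ?c (var n ^ Suc i)"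
      using alg_hom_mult[OF cm.cd.c_hom tP[of 1] tP[of i]] i(2) by simp
    then show "?c (var n) \<otimes>\<^bsub>?A\<^esub> s \<in> ?M" using pw[of "Suc i"] i(1) by simp
  qed
  \<comment> \<open>The span is stable under every coordinate of the chart: the base variables and
    the inverse of \<open>f\<close> come from the base ring, and the fibre coordinate is
    \<open>tmul\<close>. As it contains 1, it is the whole ring.\<close>
  have mult: "\<forall>x\<in>?M. ?c p \<otimes>\<^bsub>?A\<^esub> x \<in> ?M" if p: "p \<in> PR (Suc m)" for p
    using p
  proof (induction rule: polyring_induct)
    case (cst c) show ?case using base[OF PR_cst] by blast
  next
    case (var i)
    show ?case
    proof (cases "i = n")
      case True then show ?thesis using tmul by blast
    next
      case False
      define j where "j = (if i < n then i else n)"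
      have "\<rho> j = var i" "j < Suc n" using False var unfolding \<rho>_def j_def m_def by (auto simp: less_Suc_eq)
      then have "?c (var i) = ?h (CX.c (var j))" "CX.c (var j) \<in> carrier ?B"
        using hc[of "var j"] er_var[of j] CX.c_closed[of "var j"] by auto
      then show ?thesis using bspan_scale[OF sp] by simp
    qed
  next
    case (add p q)
    show ?case
    proof
      fix x assume x: "x \<in> ?M"
      have "?c (p + q) \<otimes>\<^bsub>?A\<^esub> x = ?c p \<otimes>\<^bsub>?A\<^esub> x \<oplus>\<^bsub>?A\<^esub> ?c q \<otimes>\<^bsub>?A\<^esub> x"
        using alg_hom_add[OF cm.cd.c_hom add(1,2)] cm.cd.c_closed add(1,2) bspan_carrier[OF sp x] by (simp add: cm.cd.sA.A.l_distr)
      then show "?c (p + q) \<otimes>\<^bsub>?A\<^esub> x \<in> ?M" using bspan_add[OF sp] add(3,4) x by simp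
    qed
  next
    case (mult p q)
    show ?case
    proof
      fix x assume x: "x \<in> ?M"
      have "?c (p * q) \<otimes>\<^bsub>?A\<^esub> x = ?c p \<otimes>\<^bsub>?A\<^esub> (?c q \<otimes>\<^bsub>?A\<^esub> x)"
        using alg_hom_mult[OF cm.cd.c_hom mult(1,2)] cm.cd.c_closed mult(1,2) bspan_carrier[OF sp x] by (simp add: cm.cd.sA.A.m_assoc)
      then show "?c (p * q) \<otimes>\<^bsub>?A\<^esub> x \<in> ?M" using mult(3,4) x by simp
    qed
  qed
  have "carrier ?A \<subseteq> ?M"
  proof
    fix x assume "x \<in> carrier ?A"
    then obtain p where p: "p \<in> PR (Suc m)" "x = ?c p" using cm.cd.A_carrier by (elim bexE[OF cm.cd.A_carrier])
    have "\<one>\<^bsub>?A\<^esub> \<in> ?M" using pw[of 0] alg_hom_one[OF cm.cd.c_hom] by simp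
    then have "?c p \<otimes>\<^bsub>?A\<^esub> \<one>\<^bsub>?A\<^esub> \<in> ?M" using mult[OF p(1)] by blast
    then show "x \<in> ?M" using p cm.cd.c_closed[OF p(1)] by simp
  qed
  then have fin: "finite_hom ?B ?A ?h" by (rule finite_hom_bspan[OF sp])

  let ?\<beta> = "tospec (Suc n) ?X (ch n f)"
  have \<beta>: "isomorphism ?X (Spec ?B) ?\<beta>" by (rule DD_chart(1)[OF f])
  have compat: "mcomp ?R (Spec ?B) ?\<beta> ?\<phi> = mcomp ?R (Spec ?B) (Spec_map ?B ?A ?h) ?ts"
  proof -
    interpret SB: spec_mor ?R ?B by (intro spec_mor.intro lr_space.intro kalg_ring.intro RP.R_lr CX.A_kalg)
    interpret SAB: spec_mor ?SA ?B by (intro spec_mor.intro lr_space.intro kalg_ring.intro cm.cd.SA_lr CX.A_kalg)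
    note sm = Spec_map_eq_slift[OF CX.A_kalg cm.cd.A_kalg h]
    have smm: "morphism ?SA (Spec ?B) (Spec_map ?B ?A ?h)" unfolding sm(1) by (rule SAB.slift_morphism[OF sm(2)])
    show ?thesis
    proof (rule SB.spec_mor_eqI[OF morphism_mcomp[OF \<phi> CX.tospec_morphism CX.SA_lr] morphism_mcomp[OF cm.cd.tospec_morphism smm CX.SA_lr]])
      fix b assume b: "b \<in> carrier ?B"
      then obtain p where p: "p \<in> PR (Suc n)" "b = CX.c p" using CX.A_carrier by (elim bexE[OF CX.A_carrier])
      have "cof ?R ?B (mcomp ?R (Spec ?B) ?\<beta> ?\<phi>) b = pull ?R ?\<phi> (pts ?X) (cof ?X ?B ?\<beta> b)"
        by (rule cof_mcomp_Spec[OF \<phi> CX.tospec_morphism CX.A_kalg b])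
      also have "\<dots> = ev (gam ?R) ?s (ev (polyring (Suc m)) \<rho> p)" unfolding p(2) CX.cof_tospec[OF p(1)] by (rule nat[OF p(1)])
      also have "\<dots> = cof ?R ?A ?ts (?c (ev (polyring (Suc m)) \<rho> p))" by (rule cm.cd.cof_tospec[OF ev_PR_closed[OF \<rho>], symmetric])
      also have "\<dots> = pull ?R ?ts (pts ?SA) (cm.cd.G (?h b))"
        unfolding p(2) hc[OF p(1)] by (rule cm.cd.G_pull[OF cm.cd.tospec_morphism RP.R_lr, symmetric])
      also have "\<dots> = pull ?R ?ts (pts ?SA) (cof ?SA ?B (Spec_map ?B ?A ?h) b)"
        unfolding sm(1) SAB.cof_slift[OF sm(2) b] ..
      also have "\<dots> = cof ?R ?B (mcomp ?R (Spec ?B) (Spec_map ?B ?A ?h) ?ts) b"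
        by (rule cof_mcomp_Spec[OF cm.cd.tospec_morphism smm CX.A_kalg b, symmetric])
      finally show "cof ?R ?B (mcomp ?R (Spec ?B) ?\<beta> ?\<phi>) b = cof ?R ?B (mcomp ?R (Spec ?B) (Spec_map ?B ?A ?h) ?ts) b" .
    qed
  qed
  have R1: "open_sub ?R (preim ?R ?\<phi> (pts ?X)) = ?R" unfolding preim_pts[OF \<phi>] by (rule open_sub_all)
  have X1: "open_sub ?X (pts ?X) = ?X" by (rule open_sub_all)
  have "\<exists>W (A :: ('k mpoly set, 'k) kalg) (B :: ('k mpoly set, 'k) kalg) h \<alpha> \<beta>.
       openin (tspace ?X) W \<and> q \<in> W \<and> kalgebra A \<and> kalgebra B \<and> finite_hom B A h \<and>
       isomorphism (open_sub ?R (preim ?R ?\<phi> W)) (Spec A) \<alpha> \<and>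
       isomorphism (open_sub ?X W) (Spec B) \<beta> \<and>
       mcomp (open_sub ?R (preim ?R ?\<phi> W)) (Spec B) \<beta> ?\<phi> =
       mcomp (open_sub ?R (preim ?R ?\<phi> W)) (Spec B) (Spec_map B A h) \<alpha>" if q: "q \<in> pts ?X" for q
    apply (rule exI[where x = "pts ?X"], rule exI[where x = ?A], rule exI[where x = ?B], rule exI[where x = ?h],
        rule exI[where x = ?ts], rule exI[where x = ?\<beta>])
    unfolding R1 X1
    by (intro conjI openin_topspace q cm.cd.A_kalg CX.A_kalg fin iso \<beta> compat)
  then have "finite_mor ?R ?X ?\<phi>" unfolding finite_mor_def using \<phi> by blast
  then show ?thesis unfolding m_def .
qed

section \<open>Standard framed correspondences\<close>

text \<open>The coordinate \<open>var n\<close> is the fibre coordinate over the open subset of affine \<open>n\<close>-space where \<open>f\<close> is invertible;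
  \<open>K\<close> cuts out the support, \<open>w\<close> the complement of the etale neighbourhood, the framing is \<open>H/f\<close>.\<close>

definition stdc :: "nat \<Rightarrow> 'k::field mpoly \<Rightarrow> 'k mpoly \<Rightarrow> 'k mpoly \<Rightarrow> 'k mpoly \<Rightarrow> 'k mpoly \<Rightarrow> 'k fcorr" where
  "stdc n f K w H y = \<lparr>aff = Aff (Suc n) (DD (Suc n) f), aproj = prj n f,
     acoord = [gf (polyring (Suc n)) (DD (Suc n) f) (var n)], supp = ZK n f K,
     nbhd = Aff (Suc n) (DD (Suc n) (f * w)), emap = id_mor (Aff (Suc n) (DD (Suc n) (f * w))),
     fram = [\<lambda>p\<in>DD (Suc n) (f * w). frac (polyring (Suc n)) (PR (Suc n) - p) H f],
     targ = sm (Suc n) (DD (Suc n) (f * w)) 1 (\<lambda>_. y)\<rparr>"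

text \<open>The last clause is tested at primes: the support avoids the removed set w = 0, and away
  from that set \<open>H\<close> and \<open>K\<close> have the same zeros. \<open>H\<close> may have
  further zeros inside w = 0, which is what happens when only a part of the zero set of
  \<open>H\<close> is taken as support.\<close>

definition std_ok :: "nat \<Rightarrow> 'k::field mpoly \<Rightarrow> 'k mpoly \<Rightarrow> 'k mpoly \<Rightarrow> 'k mpoly \<Rightarrow> 'k mpoly \<Rightarrow> bool" where
  "std_ok n f K w H y \<longleftrightarrow> f \<in> PR n \<and> mlike n K \<and> w \<in> PR (Suc n) \<and> H \<in> PR (Suc n) \<and> y \<in> PR (Suc n) \<and>
     (\<forall>p. primeideal p (polyring (Suc n)) \<longrightarrow> f \<notin> p \<longrightarrow> (K \<in> p \<longrightarrow> w \<notin> p) \<and> (w \<notin> p \<longrightarrow> (H \<in> p \<longleftrightarrow> K \<in> p)))"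

context
  fixes p :: "'k::field mpoly set" and m assumes p: "primeideal p (polyring m)"
begin

interpretation primeideal p "polyring m" by (rule p)

lemma prime_mult_iff: "a \<in> PR m \<Longrightarrow> b \<in> PR m \<Longrightarrow> a * b \<in> p \<longleftrightarrow> a \<in> p \<or> b \<in> p"
  using I_prime[of a b] I_l_closed[of b a] I_r_closed[of a b] by auto

lemma prime_add: "a \<in> p \<Longrightarrow> b \<in> p \<Longrightarrow> a + b \<in> p"
  using a_closed[of a b] by simp

lemma prime_uminus: "a \<in> p \<Longrightarrow> - a \<in> p"
  using I_l_closed[of a "- 1"] Icarr[of a] by simp

lemma prime_add_iff: "a \<in> p \<Longrightarrow> a + b \<in> p \<longleftrightarrow> b \<in> p"
  using prime_add[of a b] prime_add[of "a + b" "- a"] prime_uminus[of a] by auto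

lemma prime_diff: "a \<in> p \<Longrightarrow> b \<in> p \<Longrightarrow> a - b \<in> p"
  using prime_add[of a "- b"] prime_uminus[of b] by simp

lemma prime_one: "1 \<notin> p"
  using poly.one_notin[OF p] by simp

lemma prime_zero: "0 \<in> p"
  using zero_closed by simp

end

lemma DD_mult: "a \<in> PR m \<Longrightarrow> b \<in> PR m \<Longrightarrow> DD m (a * b) = DD m a \<inter> DD m b"
  by (rule Set.set_eqI) (use prime_mult_iff[where m = m and a = a and b = b] in \<open>auto simp add: DD_iff\<close>)

lemma pull_id: "locally_ringed X \<Longrightarrow> s \<in> global X \<Longrightarrow> pull X (id_mor X) (pts X) s = s"
proof -
  assume X: "locally_ringed X" and s: "s \<in> global X"
  interpret lr_space X by (rule lr_space.intro[OF X])
  show ?thesis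
  proof (rule global_eqI[OF mor_pull_global[OF morphism_id s] s])
    fix p assume p: "p \<in> pts X"
    show "pull X (id_mor X) (pts X) s p = s p"
      unfolding pull_at[OF morphism_id p] id_mor_fst[OF p] by (rule id_mor_snd[OF p global_carrier[OF s p]])
  qed
qed

lemma iso_id: "locally_ringed X \<Longrightarrow> isomorphism X X (id_mor X)"
proof -
  assume "locally_ringed X"
  from lr_space.morphism_id[OF lr_space.intro[OF this]] have i: "morphism X X (id_mor X)" .
  show ?thesis by (rule isomorphismI[OF i i mcomp_id_left[OF i] mcomp_id_left[OF i]])
qed

lemma Aff_sub_morphism:
  assumes "openin (tspace (Spec (polyring m))) N" "openin (tspace (Spec (polyring m))) N'" "N' \<subseteq> N"
  shows "morphism (Aff m N') (Aff m N) (id_mor (Aff m N'))"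
proof -
  have "morphism (Aff m N') (Spec (polyring m)) (id_mor (Aff m N'))" by (rule open_incl_morphism[OF poly.Spec_lr assms(2)])
  moreover have "fst (id_mor (Aff m N')) ` pts (Aff m N') \<subseteq> N" using assms(3) Aff_pts[OF assms(2)] by (auto simp: id_mor_def)
  ultimately show ?thesis unfolding mor_Aff_iff[OF assms(1)] by (rule conjI)
qed

lemma cof_id_Aff: "openin (tspace (Spec (polyring m))) N \<Longrightarrow> p \<in> PR m \<Longrightarrow> cof (Aff m N) (polyring m) (id_mor (Aff m N)) p = gf (polyring m) N p"
  by (rule cof_id_open[OF polyring_kalgebra])

lemma sm_restrict:
  assumes N: "openin (tspace (Spec (polyring m))) N" "openin (tspace (Spec (polyring m))) N'" "N' \<subseteq> N" and q: "\<And>i. q i \<in> PR m"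
  shows "mcomp (Aff m N') (Spec (polyring k)) (sm m N k q) (id_mor (Aff m N')) = sm m N' k q"
proof (rule mor_poly_eqI[OF Aff_lr[OF N(2)]])
  note i = Aff_sub_morphism[OF N]
  show "morphism (Aff m N') (Spec (polyring k)) (mcomp (Aff m N') (Spec (polyring k)) (sm m N k q) (id_mor (Aff m N')))"
    by (rule morphism_mcomp[OF i sm_morphism[OF N(1) q] poly.Spec_lr])
  show "morphism (Aff m N') (Spec (polyring k)) (sm m N' k q)" by (rule sm_morphism[OF N(2) q])
  fix j assume j: "j < k"
  show "cof (Aff m N') (polyring k) (mcomp (Aff m N') (Spec (polyring k)) (sm m N k q) (id_mor (Aff m N'))) (var j) =
      cof (Aff m N') (polyring k) (sm m N' k q) (var j)"
    unfolding cof_sm_comp[OF N(1) q Aff_lr[OF N(2)] i PR_var[OF j]] cof_sm[OF N(2) q PR_var[OF j]]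
    by (rule cof_id_Aff[OF N(2) ev_PR_closed[OF q]])
qed

lemma id_comp_Aff:
  assumes "openin (tspace (Spec (polyring m))) N" "openin (tspace (Spec (polyring m))) N'" "N' \<subseteq> N"
  shows "mcomp (Aff m N') (Spec (polyring m)) (id_mor (Aff m N)) (id_mor (Aff m N')) = id_mor (Aff m N')"
  using mcomp_id_left[OF Aff_sub_morphism[OF assms]] by simp

lemma frac_section_global:
  assumes "N \<subseteq> DD m f" "openin (tspace (Spec (polyring m))) N" "f \<in> PR m" "H \<in> PR m"
  shows "(\<lambda>p\<in>N. frac (polyring m) (PR m - p) H f) \<in> global (Aff m N)"
proof -
  have "\<And>P. P \<in> N \<Longrightarrow> f \<notin> P" using assms(1) by (auto simp: DD_iff)
  then show ?thesis unfolding Aff_pts[OF assms(2)] using poly.gfr_section[OF assms(2)] assms(3,4) by simp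
qed

lemma open_sub_Aff: "N' \<subseteq> N \<Longrightarrow> open_sub (Aff m N) N' = Aff m N'"
  by (rule open_sub_open_sub)

lemma openin_Aff: "openin (tspace (Spec (polyring m))) N \<Longrightarrow> openin (tspace (Spec (polyring m))) N' \<Longrightarrow> N' \<subseteq> N \<Longrightarrow>
   openin (tspace (Aff m N)) N'"
  by (simp del: poly.Spec_simps)

lemma etale_nbhd_Aff:
  assumes "openin (tspace (Spec (polyring m))) N" "openin (tspace (Spec (polyring m))) N'" "N' \<subseteq> N" "Z \<subseteq> N'"
  shows "etale_nbhd (Aff m N') (id_mor (Aff m N')) (Aff m N) Z"
  using etale_nbhd_open[OF kscheme_Aff[OF assms(1)] openin_Aff[OF assms(1-3)], unfolded open_sub_Aff[OF assms(3)], OF kscheme_Aff[OF assms(2)] assms(4)] .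

context
  fixes n :: nat and f K w H y :: "'k::field mpoly"
  assumes ok: "std_ok n f K w H y"
begin

lemma okD: "f \<in> PR n" "f \<in> PR (Suc n)" "mlike n K" "w \<in> PR (Suc n)" "H \<in> PR (Suc n)" "y \<in> PR (Suc n)" "f * w \<in> PR (Suc n)"
  "K \<in> PR (Suc n)"
  using ok PR_mono[of f n "Suc n"] mlike_PR[of n K] by (auto simp: std_ok_def)

lemma okN: "DD (Suc n) (f * w) \<subseteq> DD (Suc n) f" "ZK n f K \<subseteq> DD (Suc n) (f * w)"
  using ok okD DD_mult[of f "Suc n" w] by (auto simp: std_ok_def DD_iff)

lemma okH: "p \<in> DD (Suc n) (f * w) \<Longrightarrow> H \<in> p \<longleftrightarrow> K \<in> p"
  using ok okD DD_mult[of f "Suc n" w] by (auto simp: std_ok_def DD_iff)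

lemma okO: "openin (tspace (Spec (polyring (Suc n)))) (DD (Suc n) f)" "openin (tspace (Spec (polyring (Suc n)))) (DD (Suc n) (f * w))"
  "openin (tspace (Spec (polyring n))) (DD n f)"
  by (rule DD_open[OF okD(2)], rule DD_open[OF okD(7)], rule DD_open[OF okD(1)])

text \<open>The clauses on support and framing follow from the polynomial conditions: the complement
  of the support is the basic open set of \<open>f * K\<close>, and \<open>H/f\<close> is a unit at
  a prime exactly when \<open>H\<close> is not in it. What remains to be supplied is that the target
  map lands in \<open>Y\<close>.\<close>

lemma stdc_explicit:
  fixes Y :: "'k sch"
  assumes t: "morphism (Aff (Suc n) (DD (Suc n) (f * w))) Y (sm (Suc n) (DD (Suc n) (f * w)) 1 (\<lambda>_. y))"
  shows "explicit_corr 1 (Aff n (DD n f)) Y (stdc n f K w H y)"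
proof -
  let ?P = "Aff (Suc n) (DD (Suc n) f)" and ?N = "DD (Suc n) (f * w)"
  let ?V = "Aff (Suc n) ?N"
  have cl: "closedin (tspace ?P) (ZK n f K)"
    unfolding closedin_def Aff_pts[OF okO(1)]
  proof
    have "DD (Suc n) f - ZK n f K = DD (Suc n) (f * K)"
      unfolding DD_mult[OF okD(2,8)] by (auto simp: DD_iff)
    moreover have "openin (tspace ?P) (DD (Suc n) (f * K))"
      by (rule openin_Aff[OF okO(1) DD_open]) (use okD DD_mult[OF okD(2,8)] in auto)
    ultimately show "openin (tspace ?P) (DD (Suc n) f - ZK n f K)" by simp
  qed blast
  have van: "{q \<in> pts ?V. \<forall>\<phi> \<in> set [\<lambda>p\<in>?N. frac (polyring (Suc n)) (PR (Suc n) - p) H f]. vanishes ?V \<phi> q} = preim ?V (id_mor ?V) (ZK n f K)"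
  proof -
    have "vanishes ?V (\<lambda>p\<in>?N. frac (polyring (Suc n)) (PR (Suc n) - p) H f) q \<longleftrightarrow> K \<in> q" if q: "q \<in> ?N" for q
      using poly.gf_vanishes[OF okO(2) q okD(5,2)] okH[OF q] q okN(1) by (auto simp: vanishes_def DD_iff)
    then show ?thesis using okN unfolding Aff_pts[OF okO(2)] preim_def by (auto simp: id_mor_def Aff_pts[OF okO(2)] simp del: open_sub_simps poly.Spec_simps)
  qed
  show ?thesis
    unfolding explicit_corr_def stdc_def fcorr.select_convs
    using affine_space_Aff[OF okD(1)] cl finite_mor_std[OF okD(1,3)] etale_nbhd_Aff[OF okO(1,2) okN] van t
      frac_section_global[OF okN(1) okO(2) okD(2,5)] by simp
qed

text \<open>Removing the zero set of \<open>K2\<close> from the neighbourhood multiplies the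
  polynomial \<open>w\<close> by \<open>K2\<close>, so cutting a support stays among the standard
  correspondences.\<close>

lemma stdc_cut:
  assumes K2: "K2 \<in> PR (Suc n)"
  shows "cut_support (Aff 1 V) (stdc n f K w H y) (ZK n f K1) (ZK n f K2) = stdc n f K1 (w * K2) H y"
proof -
  let ?N = "DD (Suc n) (f * w)" and ?N' = "DD (Suc n) (f * (w * K2))"
  have eq: "?N' = ?N \<inter> DD (Suc n) K2" using okD K2 by (simp add: DD_mult Int_assoc)
  have sub: "?N' \<subseteq> ?N" unfolding eq by blast
  have oN': "openin (tspace (Spec (polyring (Suc n)))) ?N'" by (rule DD_open) (use okD K2 in simp)
  have "pts (Aff (Suc n) ?N) - preim (Aff (Suc n) ?N) (id_mor (Aff (Suc n) ?N)) (ZK n f K2) = ?N'"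
    unfolding eq preim_def Aff_pts[OF okO(2)] using okN(1) by (auto simp: id_mor_def Aff_pts[OF okO(2)] DD_iff simp del: open_sub_simps poly.Spec_simps)
  then have V: "open_sub (Aff (Suc n) ?N) (pts (Aff (Suc n) ?N) - preim (Aff (Suc n) ?N) (id_mor (Aff (Suc n) ?N)) (ZK n f K2)) = Aff (Suc n) ?N'"
    by (simp only: open_sub_Aff[OF sub])
  show ?thesis
    unfolding cut_support_def stdc_def fcorr.select_convs Let_def V
    unfolding mcomp_open_sub id_comp_Aff[OF okO(2) oN' sub] sm_restrict[OF okO(2) oN' sub okD(6)] Aff_pts[OF oN']
    using sub by (simp add: Int_absorb1)
qed

text \<open>Both correspondences use the same affine space and support, so \<theta> is the identity
  and the refining map is the inclusion of the smaller neighbourhood.\<close>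

lemma stdc_refines:
  assumes w': "w' \<in> PR (Suc n)" and sub: "DD (Suc n) (f * w') \<subseteq> DD (Suc n) (f * w)"
  shows "Defs.refines (Aff n (DD n f)) (Aff 1 V) (stdc n f K w' H y) (stdc n f K w H y)"
proof -
  let ?P = "Aff (Suc n) (DD (Suc n) f)" and ?X = "Aff n (DD n f)"
  let ?N = "DD (Suc n) (f * w)" and ?N' = "DD (Suc n) (f * w')"
  have oN': "openin (tspace (Spec (polyring (Suc n)))) ?N'" by (rule DD_open) (use okD w' in simp)
  note lrP = Aff_lr[OF okO(1)]
  have subP: "?N' \<subseteq> DD (Suc n) f" using sub okN(1) by blast
  have fr: "pull (Aff (Suc n) ?N') (id_mor (Aff (Suc n) ?N')) (pts (Aff (Suc n) ?N)) (\<lambda>p\<in>?N. frac (polyring (Suc n)) (PR (Suc n) - p) H f) =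
      (\<lambda>p\<in>?N'. frac (polyring (Suc n)) (PR (Suc n) - p) H f)"
  proof (rule extensionalityI[of _ ?N'])
    note i = Aff_sub_morphism[OF okO(2) oN' sub]
    note g = frac_section_global[OF subP oN' okD(2,5)]
    interpret N': lr_space "Aff (Suc n) ?N'" by (rule lr_space.intro[OF Aff_lr[OF oN']])
    show "pull (Aff (Suc n) ?N') (id_mor (Aff (Suc n) ?N')) (pts (Aff (Suc n) ?N)) (\<lambda>p\<in>?N. frac (polyring (Suc n)) (PR (Suc n) - p) H f) \<in> extensional ?N'"
      unfolding pull_def preim_pts[OF i] Aff_pts[OF oN'] by simp
    fix p assume p: "p \<in> ?N'"
    then have pp: "p \<in> pts (Aff (Suc n) ?N')" unfolding Aff_pts[OF oN'] .
    have "pull (Aff (Suc n) ?N') (id_mor (Aff (Suc n) ?N')) (pts (Aff (Suc n) ?N)) (\<lambda>p\<in>?N. frac (polyring (Suc n)) (PR (Suc n) - p) H f) p =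
        snd (id_mor (Aff (Suc n) ?N')) p (frac (polyring (Suc n)) (PR (Suc n) - p) H f)"
      unfolding pull_at[OF i pp] id_mor_fst[OF pp] using subsetD[OF sub p] by simp
    also have "\<dots> = frac (polyring (Suc n)) (PR (Suc n) - p) H f"
      by (rule id_mor_snd[OF pp]) (use N'.global_carrier[OF g pp] p in simp)
    finally show "pull (Aff (Suc n) ?N') (id_mor (Aff (Suc n) ?N')) (pts (Aff (Suc n) ?N)) (\<lambda>p\<in>?N. frac (polyring (Suc n)) (PR (Suc n) - p) H f) p =
       (\<lambda>p\<in>?N'. frac (polyring (Suc n)) (PR (Suc n) - p) H f) p" using p by simp
  qed simp
  have co: "pull ?P (id_mor ?P) (pts ?P) (gf (polyring (Suc n)) (DD (Suc n) f) (var n)) = gf (polyring (Suc n)) (DD (Suc n) f) (var n)"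
    by (rule pull_id[OF lrP gf_global'[OF okO(1)]]) simp
  have im: "fst (id_mor ?P) ` ZK n f K = ZK n f K"
    by (rule trans[OF image_cong[OF refl] image_ident]) (simp add: id_mor_def Aff_pts[OF okO(1)] del: open_sub_simps poly.Spec_simps)
  show ?thesis
    unfolding Defs.refines_def stdc_def fcorr.select_convs
  proof (rule exI[of _ "id_mor ?P"], rule exI[of _ "id_mor (Aff (Suc n) ?N')"], intro conjI)
    show "isomorphism ?P ?P (id_mor ?P)" by (rule iso_id[OF lrP])
    show "mcomp ?P ?X (prj n f) (id_mor ?P) = prj n f" by (rule mcomp_id_right[OF prj_morphism[OF okD(1)]])
    show "morphism (Aff (Suc n) ?N') (Aff (Suc n) ?N) (id_mor (Aff (Suc n) ?N'))" by (rule Aff_sub_morphism[OF okO(2) oN' sub])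
    show "mcomp (Aff (Suc n) ?N') ?P (id_mor (Aff (Suc n) ?N)) (id_mor (Aff (Suc n) ?N')) = mcomp (Aff (Suc n) ?N') ?P (id_mor ?P) (id_mor (Aff (Suc n) ?N'))"
      unfolding mcomp_open_sub id_comp_Aff[OF okO(2) oN' sub] id_comp_Aff[OF okO(1) oN' subP] ..
    show "sm (Suc n) ?N' 1 (\<lambda>_. y) = mcomp (Aff (Suc n) ?N') (Aff 1 V) (sm (Suc n) ?N 1 (\<lambda>_. y)) (id_mor (Aff (Suc n) ?N'))"
      unfolding mcomp_open_sub sm_restrict[OF okO(2) oN' sub okD(6)] ..
  qed (simp_all only: list.map co im fr)
qed

end

section \<open>Sections with constant coordinate and composition\<close>

context
  fixes q :: "nat \<Rightarrow> 'k::field mpoly" and m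
  assumes q: "\<And>i. q i \<in> PR m"
begin

lemma pev_mult: "ev (polyring m) q (a * b) = ev (polyring m) q a * ev (polyring m) q b"
  and pev_add: "ev (polyring m) q (a + b) = ev (polyring m) q a + ev (polyring m) q b"
  and pev_cst: "ev (polyring m) q (cst c) = cst c"
  and pev_var: "ev (polyring m) q (var i) = q i"
  using poly.ev_mult[where a = q and p = a and q = b, OF q] poly.ev_add[where a = q and p = a and q = b, OF q]
    poly.ev_cst[where a = q and c = c, OF q] poly.ev_var[where a = q and i = i, OF q] by simp_all

lemma pev_zero: "ev (polyring m) q 0 = 0" and pev_one: "ev (polyring m) q 1 = 1"
  using pev_cst[of 0] pev_cst[of 1] by simp_all

lemma pev_uminus: "ev (polyring m) q (- a) = - ev (polyring m) q a"
  using pev_add[of a "- a"] pev_zero by (simp add: eq_neg_iff_add_eq_0 add.commute)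

lemma pev_diff: "ev (polyring m) q (a - b) = ev (polyring m) q a - ev (polyring m) q b"
  using pev_add[of a "- b"] pev_uminus by simp

lemma pev_power: "ev (polyring m) q (a ^ k) = ev (polyring m) q a ^ k"
  by (induction k) (simp_all add: pev_mult pev_one)

lemmas pev = pev_mult pev_add pev_cst pev_var pev_zero pev_one pev_uminus pev_diff pev_power

end

definition secv :: "nat \<Rightarrow> 'k::field \<Rightarrow> nat \<Rightarrow> 'k mpoly" where
  "secv n c i = (if i < n then var i else if i = n then cst c else 0)"

definition csec :: "nat \<Rightarrow> 'k::field mpoly \<Rightarrow> 'k \<Rightarrow> 'k smor" where
  "csec n f c = sm n (DD n f) (Suc n) (secv n c)"

lemma secv_PR: "secv n c i \<in> PR n"
  by (simp add: secv_def)

lemma ev_secv: "p \<in> PR n \<Longrightarrow> ev (polyring n) (secv n c) p = p"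
proof (rule polyring_hom_eq[OF poly.ev_hom[OF secv_PR] _ _])
  show "(\<lambda>p. p) \<in> alg_hom (polyring n) (polyring n)" by (rule alg_homI) auto
qed (simp_all add: poly.ev_var[OF secv_PR], simp add: secv_def)

context
  fixes n :: nat and f :: "'k::field mpoly"
  assumes f: "f \<in> PR n"
begin

private lemma f': "f \<in> PR (Suc n)"
  using PR_mono[OF f] by simp

lemma csec_morphism: "morphism (Aff n (DD n f)) (Aff (Suc n) (DD (Suc n) f)) (csec n f c)"
  unfolding csec_def by (rule sm_DD[OF DD_open[OF f] secv_PR f']) (simp add: ev_secv[OF f] DD_iff)

lemma const_section: "is_const_section (Aff n (DD n f)) (Aff (Suc n) (DD (Suc n) f)) (prj n f)
    (gf (polyring (Suc n)) (DD (Suc n) f) (var n)) c (csec n f c)"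
proof -
  let ?X = "Aff n (DD n f)" and ?P = "Aff (Suc n) (DD (Suc n) f)"
  note oX = DD_open[OF f] and oP = DD_open[OF f']
  have v: "\<And>i. secv n c i \<in> PR n" by (rule secv_PR)
  have sv: "ev (polyring n) (secv n c) (var i) = secv n c i" for i by (rule poly.ev_var[OF v])
  have "mcomp ?X ?X (prj n f) (csec n f c) = id_mor ?X"
  proof (rule mor_poly_eqI[OF Aff_lr[OF oX]])
    show "morphism ?X (Spec (polyring n)) (mcomp ?X ?X (prj n f) (csec n f c))"
      by (rule mor_AffD[OF oX morphism_mcomp[OF csec_morphism prj_morphism[OF f] Aff_lr[OF oX]]])
    show "morphism ?X (Spec (polyring n)) (id_mor ?X)"
      by (rule open_incl_morphism[OF poly.Spec_lr oX])
    fix i assume i: "i < n"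
    have "cof ?X (polyring n) (mcomp ?X ?X (prj n f) (csec n f c)) (var i) = cof ?X (polyring (Suc n)) (csec n f c) (ev (polyring (Suc n)) (vars n) (var i))"
      unfolding mcomp_open_sub prj_def by (rule cof_sm_comp[OF oP vars_PR Aff_lr[OF oX] csec_morphism PR_var[OF i]]) simp
    also have "ev (polyring (Suc n)) (vars n) (var i) = var i" by (rule ev_vars) (use i in auto)
    also have "cof ?X (polyring (Suc n)) (csec n f c) (var i) = gf (polyring n) (DD n f) (ev (polyring n) (secv n c) (var i))"
      unfolding csec_def by (rule cof_sm[OF oX v]) (use i in simp)
    also have "\<dots> = gf (polyring n) (DD n f) (var i)" unfolding sv using i by (simp add: secv_def)
    also have "\<dots> = cof ?X (polyring n) (id_mor ?X) (var i)" by (rule cof_id_Aff[OF oX PR_var[OF i], symmetric])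
    finally show "cof ?X (polyring n) (mcomp ?X ?X (prj n f) (csec n f c)) (var i) = cof ?X (polyring n) (id_mor ?X) (var i)" .
  qed
  moreover have "pull ?X (csec n f c) (pts ?P) (gf (polyring (Suc n)) (DD (Suc n) f) (var n)) = const_fun ?X c"
  proof -
    have "pull ?X (csec n f c) (pts ?P) (gf (polyring (Suc n)) (DD (Suc n) f) (var n)) = cof ?X (polyring (Suc n)) (csec n f c) (var n)"
      unfolding Aff_pts[OF oP] by (rule pull_gf_Aff[OF Aff_lr[OF oX] oP csec_morphism])
    also have "\<dots> = gf (polyring n) (DD n f) (ev (polyring n) (secv n c) (var n))"
      unfolding csec_def by (rule cof_sm[OF oX v]) simp
    also have "\<dots> = gf (polyring n) (DD n f) (scal (polyring n) c)" unfolding sv by (simp add: secv_def)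
    also have "\<dots> = const_fun ?X c" using alg_hom_scal[OF poly.gf_hom[OF oX], of c] by (simp only: gam_simps)
    finally show ?thesis .
  qed
  ultimately show ?thesis unfolding is_const_section_def using csec_morphism by blast
qed

text \<open>Modulo \<open>var n\<close> every polynomial is congruent to its value at fibre
  coordinate zero. A prime containing \<open>var n\<close> is therefore determined by its
  restriction to the base, and it is the image of that restriction under the section.\<close>

lemma zero_section_image: "fst (csec n f 0) ` pts (Aff n (DD n f)) = ZK n f (var n)"
proof -
  note oX = DD_open[OF f] and oP = DD_open[OF f']
  have v: "\<And>i. secv n (0::'k) i \<in> PR n" by (rule secv_PR)
  have fst: "fst (csec n f 0) p = {a \<in> PR (Suc n). ev (polyring n) (secv n 0) a \<in> p}" if "p \<in> DD n f" for p
    unfolding csec_def by (rule sm_fst[OF oX v that])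
  show ?thesis unfolding Aff_pts[OF oX]
  proof (intro equalityI subsetI)
    fix q assume "q \<in> fst (csec n f 0) ` DD n f"
    then obtain p where p: "p \<in> DD n f" "q = fst (csec n f 0) p" by blast
    have "p \<in> pts (Aff n (DD n f))" unfolding Aff_pts[OF oX] by (rule p)
    from mor_pt[OF csec_morphism[where c = 0] this] 
    have m: "fst (csec n f 0) p \<in> DD (Suc n) f" unfolding Aff_pts[OF oP] .
    have "ev (polyring n) (secv n (0::'k)) (var n) = 0" unfolding poly.ev_var[OF v] by (simp add: secv_def)
    moreover have "0 \<in> p" using p(1) prime_zero by (auto simp: DD_iff)
    ultimately have "var n \<in> q" unfolding p(2) fst[OF p(1)] by simp
    then show "q \<in> ZK n f (var n)" using m p(2) by simp
  next
    fix q assume q: "q \<in> ZK n f (var n)"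
    then have qD: "q \<in> DD (Suc n) f" "var n \<in> q" and pr: "primeideal q (polyring (Suc n))" by (auto simp: DD_iff)
    let ?p = "fst (prj n f) q"
    have pq: "?p = {a \<in> PR n. a \<in> q}"
    proof -
      have "\<And>i. vars n i \<in> PR (Suc n)" by (rule vars_PR) simp
      note e = sm_fst[where q = "vars n" and n = n, OF oP this qD(1)]
      show ?thesis unfolding prj_def e by (auto simp: ev_vars[of n "Suc n"])
    qed
    have "q \<in> pts (Aff (Suc n) (DD (Suc n) f))" unfolding Aff_pts[OF oP] by (rule qD)
    from mor_pt[OF prj_morphism[OF f] this] have pD: "?p \<in> DD n f" unfolding Aff_pts[OF oX] .
    have d: "a - ev (polyring n) (secv n (0::'k)) a \<in> q" if a: "a \<in> PR (Suc n)" for a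
      using a
    proof (induction rule: polyring_induct)
      case (cst d) show ?case using pev_cst[where q = "secv n 0" and c = d and m = n, OF v] prime_zero[OF pr] by simp
    next
      case (var i)
      show ?case unfolding poly.ev_var[OF v] using var qD(2) prime_zero[OF pr] by (auto simp: secv_def less_Suc_eq)
    next
      case (add a b)
      have "a + b - ev (polyring n) (secv n (0::'k)) (a + b) = (a - ev (polyring n) (secv n (0::'k)) a) + (b - ev (polyring n) (secv n (0::'k)) b)"
        using pev_add[where q = "secv n 0" and m = n and a = a and b = b, OF v] by simp
      then show ?case using prime_add[OF pr add(3,4)] by (simp only:)
    next
      case (mult a b)
      let ?e = "ev (polyring n) (secv n (0::'k))"
      have c: "?e a \<in> PR (Suc n)" "?e b \<in> PR (Suc n)" using ev_PR_closed[of "secv n (0::'k)" n, OF v] PR_mono[of _ n "Suc n"] by auto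
      have 1: "(a - ?e a) * b \<in> q" "?e a * (b - ?e b) \<in> q"
        using prime_mult_iff[OF pr, of "a - ?e a" b] prime_mult_iff[OF pr, of "?e a" "b - ?e b"] mult c by simp_all
      have "a * b - ?e (a * b) = (a - ?e a) * b + ?e a * (b - ?e b)"
        using pev_mult[where q = "secv n 0" and m = n and a = a and b = b, OF v] by (simp add: algebra_simps)
      then show ?case using prime_add[OF pr 1] by simp
    qed
    have "fst (csec n f 0) ?p = q" unfolding fst[OF pD]
    proof -
      have "ev (polyring n) (secv n (0::'k)) a \<in> q \<longleftrightarrow> a \<in> q" if "a \<in> PR (Suc n)" for a
        using prime_add_iff[OF pr d[OF that], of "ev (polyring n) (secv n (0::'k)) a"] by simp
      moreover have "ev (polyring n) (secv n (0::'k)) a \<in> PR n" for a by (rule ev_PR_closed[OF v])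
      moreover have "a \<in> q \<Longrightarrow> a \<in> PR (Suc n)" for a using ideal.Icarr[OF primeideal.axioms(1)[OF pr]] .
      ultimately show "{a \<in> PR (Suc n). ev (polyring n) (secv n 0) a \<in> ?p} = q" unfolding pq by auto
    qed
    then show "q \<in> fst (csec n f 0) ` DD n f" using pD by (metis imageI)
  qed
qed

end

lemma pull_frac_sm:
  fixes N :: "'k::field mpoly set set"
  assumes N: "openin (tspace (Spec (polyring m))) N" "N \<subseteq> DD m f" and N': "openin (tspace (Spec (polyring m'))) N'"
    and q: "\<And>i. q i \<in> PR m'" and g: "morphism (Aff m' N') (Aff m N) (sm m' N' m q)" and fH: "f \<in> PR m" "H \<in> PR m"
  shows "pull (Aff m' N') (sm m' N' m q) N (\<lambda>p\<in>N. frac (polyring m) (PR m - p) H f) =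
    (\<lambda>p\<in>N'. frac (polyring m') (PR m' - p) (ev (polyring m') q H) (ev (polyring m') q f))"
proof -
  let ?T = "Aff m' N'" and ?g = "sm m' N' m q" and ?e = "ev (polyring m') q"
  have fN: "P \<in> N \<Longrightarrow> f \<notin> P" for P using N(2) by (auto simp: DD_iff)
  have "pull ?T ?g N (\<lambda>p\<in>N. frac (polyring m) (PR m - p) H f) =
      (\<lambda>p\<in>pts ?T. cof ?T (polyring m) ?g H p \<otimes>\<^bsub>stalk ?T p\<^esub> inv\<^bsub>stalk ?T p\<^esub> (cof ?T (polyring m) ?g f p))"
    by (rule spec_mor.pull_gfr[OF spec_mor_poly[OF Aff_lr[OF N']] N(1) g fH(2,1) fN])
  also have "\<dots> = (\<lambda>p\<in>N'. frac (polyring m') (PR m' - p) (?e H) (?e f))"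
    unfolding Aff_pts[OF N']
  proof (rule restrict_ext)
    fix p assume p: "p \<in> N'"
    then have pp: "p \<in> pts ?T" unfolding Aff_pts[OF N'] .
    have pr: "primeideal p (polyring m')" using poly.openin_prime[of m' N' p] N' p by simp
    have "fst ?g p \<in> N" using mor_pt[OF g pp] unfolding Aff_pts[OF N(1)] .
    then have "f \<notin> fst ?g p" by (rule fN)
    then have fp: "?e f \<in> PR m' - p" unfolding sm_fst[OF N' q p] using fH ev_PR_closed[of q m', OF q] by simp
    have st: "stalk ?T p = localization (polyring m') (PR m' - p)" by (simp add: stalk_at_def)
    show "cof ?T (polyring m) ?g H p \<otimes>\<^bsub>stalk ?T p\<^esub> inv\<^bsub>stalk ?T p\<^esub> (cof ?T (polyring m) ?g f p) =
        frac (polyring m') (PR m' - p) (?e H) (?e f)"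
      unfolding cof_sm[OF N' q fH(1)] cof_sm[OF N' q fH(2)] st mult_loc.frac_split[OF poly.prime_loc[OF pr] ev_PR_closed[of q m', OF q] fp]
      using p by (simp add: gf_def del: open_sub_simps poly.Spec_simps)
  qed
  finally show ?thesis .
qed

text \<open>The support is the image of the identity section, so its finiteness is an instance of
  \<open>finite_mor_section\<close>. Reducedness of \<open>X\<close> identifies \<open>X\<close>
  with the reduced structure on the set of all its points.\<close>

lemma explicit_graph_corr:
  assumes X: "kscheme X" "lreduced X" and g: "morphism X Y g"
  shows "explicit_corr 0 X Y (graph_corr X g)"
proof -
  interpret lr_space X by (rule lr_space.intro[OF kscheme_lr[OF X(1)]])
  have im: "fst (id_mor X) ` pts X = pts X" by (rule trans[OF image_cong[OF refl] image_ident]) (simp add: id_mor_def)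
  have e: "etale_nbhd X (id_mor X) X (pts X)"
    using etale_nbhd_open[OF X(1) openin_topspace _ order_refl] X(1) unfolding open_sub_all by simp
  show ?thesis unfolding explicit_corr_def graph_corr_def fcorr.select_convs
    using affine_space_zero[OF X(1)] finite_mor_section[OF X kscheme_lr[OF X(1)] morphism_id morphism_id mcomp_id_left[OF morphism_id]]
      e g preim_pts[OF morphism_id] unfolding im by simp
qed

section \<open>Composition\<close>

text \<open>For a correspondence over the product of an n-dimensional base with a line, variable
  \<open>n\<close> is the homotopy parameter and variable \<open>Suc n\<close> the fibre coordinate.
  Restriction to parameter value \<open>c\<close> puts \<open>c\<close> for the former and renumbers
  the latter to \<open>n\<close>.\<close>

definition csub :: "nat \<Rightarrow> 'k::field \<Rightarrow> nat \<Rightarrow> 'k mpoly" where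
  "csub n c i = (if i < n then var i else if i = n then cst c else if i = Suc n then var n else 0)"

lemma csub_PR: "csub n c i \<in> PR (Suc n)"
  by (simp add: csub_def)

abbreviation subst :: "nat \<Rightarrow> 'k::field \<Rightarrow> 'k mpoly \<Rightarrow> 'k mpoly" where
  "subst n c \<equiv> ev (polyring (Suc n)) (csub n c)"

lemmas subst_simps = pev[of "csub n c" "Suc n" for n c, OF csub_PR]

lemma subst_PR: "subst n c p \<in> PR (Suc n)"
  by (rule ev_PR_closed[OF csub_PR])

lemma subst_base: "p \<in> PR n \<Longrightarrow> subst n c p = p"
proof (rule polyring_hom_eq[OF poly.ev_hom[OF csub_PR]])
  show "(\<lambda>p. p) \<in> alg_hom (polyring n) (polyring (Suc n))" by (rule alg_homI) (auto simp: PR_mono)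
qed (simp_all add: subst_simps csub_def)

lemma subst_secv: "p \<in> PR (Suc n) \<Longrightarrow> subst n c p = ev (polyring n) (secv n c) p"
proof (rule polyring_hom_eq[OF poly.ev_hom[OF csub_PR]])
  have "ev (polyring n) (secv n c) \<in> alg_hom (polyring (Suc n)) (polyring n)" by (rule poly.ev_hom[OF secv_PR])
  moreover have "(\<lambda>p. p) \<in> alg_hom (polyring n) (polyring (Suc n))" by (rule alg_homI) (auto simp: PR_mono)
  ultimately show "ev (polyring n) (secv n c) \<in> alg_hom (polyring (Suc n)) (polyring (Suc n))" by (rule alg_hom_comp[rotated])
qed (auto simp: subst_simps pev_var[OF secv_PR] csub_def secv_def)

lemma subst_sum: "subst n c (\<Sum>i\<in>I. g i) = (\<Sum>i\<in>I. subst n c (g i))"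
  by (induction I rule: infinite_finite_induct) (simp_all add: subst_simps)

text \<open>The leading coefficient is a scalar and is untouched by the substitution, while the
  other coefficients stay polynomials in the base variables. So finiteness of the support passes to
  both ends of a homotopy.\<close>

lemma mlike_subst:
  assumes "mlike (Suc n) K" shows "mlike n (subst n c K)"
proof -
  obtain a d k where K: "a \<noteq> 0" "0 < d" "\<And>i. i < d \<Longrightarrow> k i \<in> PR (Suc n)"
    "K = cst a * var (Suc n) ^ d + (\<Sum>i<d. k i * var (Suc n) ^ i)" using assms unfolding mlike_def by blast
  have "subst n c (k i) \<in> PR n" if "i < d" for i
    unfolding subst_secv[OF K(3)[OF that]] by (rule ev_PR_closed[OF secv_PR])
  moreover have "subst n c K = cst a * var n ^ d + (\<Sum>i<d. subst n c (k i) * var n ^ i)"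
    unfolding K(4) subst_simps subst_sum by (simp add: csub_def)
  ultimately show ?thesis using K(1,2) unfolding mlike_def by (intro exI[of _ a] exI[of _ d] exI[of _ "\<lambda>i. subst n c (k i)"]) simp
qed

text \<open>The conditions at a prime \<open>p\<close> are those of the original data at its
  preimage under the substitution, which is a prime not containing \<open>f\<close> because the
  substitution induces a morphism of the basic open sets.\<close>

lemma std_ok_subst:
  assumes ok: "std_ok (Suc n) f K w H y" and f: "f \<in> PR n"
  shows "std_ok n f (subst n c K) (subst n c w) (subst n c H) (subst n c y)"
proof -
  note o = okD[OF ok]
  have "(subst n c K \<in> p \<longrightarrow> subst n c w \<notin> p) \<and> (subst n c w \<notin> p \<longrightarrow> (subst n c H \<in> p) = (subst n c K \<in> p))"
    if p: "primeideal p (polyring (Suc n))" "f \<notin> p" for p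
  proof -
    have f': "f \<in> PR (Suc n)" "f \<in> PR (Suc (Suc n))" using PR_mono[OF f] by simp_all
    have pD: "p \<in> DD (Suc n) f" using p by (simp add: DD_iff)
    have m: "morphism (Aff (Suc n) (DD (Suc n) f)) (Aff (Suc (Suc n)) (DD (Suc (Suc n)) f)) (sm (Suc n) (DD (Suc n) f) (Suc (Suc n)) (csub n c))"
      by (rule sm_DD[OF DD_open[OF f'(1)] csub_PR f'(2)]) (simp add: subst_base[OF f] DD_iff)
    have "p \<in> pts (Aff (Suc n) (DD (Suc n) f))" unfolding Aff_pts[OF DD_open[OF f'(1)]] by (rule pD)
    from mor_pt[OF m this] have "{a \<in> PR (Suc (Suc n)). subst n c a \<in> p} \<in> DD (Suc (Suc n)) f"
      unfolding Aff_pts[OF DD_open[OF f'(2)]] sm_fst[OF DD_open[OF f'(1)] csub_PR pD] .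
    then have "primeideal {a \<in> PR (Suc (Suc n)). subst n c a \<in> p} (polyring (Suc (Suc n)))" "f \<notin> {a \<in> PR (Suc (Suc n)). subst n c a \<in> p}"
      by (simp_all add: DD_iff)
    then have "(K \<in> {a \<in> PR (Suc (Suc n)). subst n c a \<in> p} \<longrightarrow> w \<notin> {a \<in> PR (Suc (Suc n)). subst n c a \<in> p}) \<and>
       (w \<notin> {a \<in> PR (Suc (Suc n)). subst n c a \<in> p} \<longrightarrow> (H \<in> {a \<in> PR (Suc (Suc n)). subst n c a \<in> p}) = (K \<in> {a \<in> PR (Suc (Suc n)). subst n c a \<in> p}))"
      using ok unfolding std_ok_def by (elim conjE) (erule allE, erule (1) impE, erule (1) impE)
    then show ?thesis using o by simp
  qed
  then show ?thesis unfolding std_ok_def using f mlike_subst[OF o(3)] subst_PR[of n c w] subst_PR[of n c H] subst_PR[of n c y] by simp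
qed

text \<open>The fibre product of a constant section with a neighbourhood over the product with the
  line is the slice at parameter \<open>c\<close>. The second projection is the inclusion of this
  slice, given by \<open>csub\<close>.\<close>

lemma const_section_pullback:
  fixes N N' :: "'k::field mpoly set set" and c :: 'k
  assumes f: "f \<in> PR n" and w: "w \<in> PR (Suc (Suc n))"
  defines "N' \<equiv> DD (Suc (Suc n)) (f * w)" and "N \<equiv> DD (Suc n) (f * subst n c w)"
  shows "morphism (Aff (Suc n) N) (Aff (Suc (Suc n)) N') (sm (Suc n) N (Suc (Suc n)) (csub n c))"
    and "is_pullback (Aff n (DD n f)) (Aff (Suc (Suc n)) N') (Aff (Suc n) (DD (Suc n) f)) (csec n f c)
      (sm (Suc (Suc n)) N' (Suc n) (vars (Suc n))) (Aff (Suc n) N) (sm (Suc n) N n (vars n)) (sm (Suc n) N (Suc (Suc n)) (csub n c))"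
proof -
  let ?p2 = "sm (Suc n) N (Suc (Suc n)) (csub n c)"
  let ?X = "Aff n (DD n f)" and ?V' = "Aff (Suc (Suc n)) N'" and ?Q = "Aff (Suc n) (DD (Suc n) f)" and ?N = "Aff (Suc n) N"
  let ?p1 = "sm (Suc n) N n (vars n)" and ?q = "sm (Suc (Suc n)) N' (Suc n) (vars (Suc n))" and ?z = "csec n f c"
  have f1: "f \<in> PR (Suc n)" and f2: "f \<in> PR (Suc (Suc n))" using PR_mono[OF f] by simp_all
  note sw = subst_PR[of n c w]
  have fw': "f * w \<in> PR (Suc (Suc n))" and fw: "f * subst n c w \<in> PR (Suc n)" using f2 w f1 sw by simp_all
  have sfw: "subst n c (f * w) = f * subst n c w" by (simp add: subst_simps subst_base[OF f])
  have oN': "openin (tspace (Spec (polyring (Suc (Suc n))))) N'" unfolding N'_def by (rule DD_open[OF fw'])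
  have oN: "openin (tspace (Spec (polyring (Suc n)))) N" unfolding N_def by (rule DD_open[OF fw])
  note oX = DD_open[OF f] and oQ = DD_open[OF f1]
  have fN: "f \<notin> P" if "P \<in> N" for P using that f1 sw unfolding N_def by (simp add: DD_mult) (simp add: DD_iff)
  have fN': "f \<notin> P" if "P \<in> N'" for P using that f2 w unfolding N'_def by (simp add: DD_mult) (simp add: DD_iff)
  have v1: "\<And>i. vars n i \<in> PR (Suc n)" by (rule vars_PR) simp
  have v2: "\<And>i. vars (Suc n) i \<in> PR (Suc (Suc n))" by (rule vars_PR) simp
  have p1: "morphism ?N ?X ?p1" by (rule sm_DD[OF oN v1 f]) (simp add: ev_vars[OF _ f] fN)
  show p2: "morphism ?N ?V' ?p2" unfolding N'_def by (rule sm_DD[OF oN csub_PR fw']) (simp add: sfw N_def DD_iff)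
  have q: "morphism ?V' ?Q ?q" by (rule sm_DD[OF oN' v2 f1]) (simp add: ev_vars[OF _ f1] fN')
  note z = csec_morphism[OF f, of c]
  note lX = Aff_lr[OF oX] and lQ = Aff_lr[OF oQ] and lV' = Aff_lr[OF oN'] and lN = Aff_lr[OF oN]
  have ez: "ev (polyring n) (secv n c) (var i) = secv n c i" for i by (rule pev_var[OF secv_PR])
  have cz: "cof T (polyring (Suc n)) (mcomp T ?Q ?z a) (var i) = cof T (polyring n) a (secv n c i)"
    if "locally_ringed T" "morphism T ?X a" "i < Suc n" for T :: "'k sch" and a i
    unfolding mcomp_open_sub csec_def cof_sm_comp[OF oX secv_PR that(1,2) PR_var[OF that(3)]] ez ..
  have cq: "cof T (polyring (Suc n)) (mcomp T ?Q ?q b) (var i) = cof T (polyring (Suc (Suc n))) b (var i)"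
    if "locally_ringed T" "morphism T ?V' b" "i < Suc n" for T :: "'k sch" and b i
    unfolding mcomp_open_sub cof_sm_comp[OF oN' v2 that(1,2) PR_var[OF that(3)]] ev_vars[OF le_SucI[OF order_refl] PR_var[OF that(3)]] ..
  have c1: "cof T (polyring n) (mcomp T ?X ?p1 m) (var i) = cof T (polyring (Suc n)) m (var i)"
    if "locally_ringed T" "morphism T ?N m" "i < n" for T :: "'k sch" and m i
    unfolding mcomp_open_sub cof_sm_comp[OF oN v1 that(1,2) PR_var[OF that(3)]] ev_vars[OF le_SucI[OF order_refl] PR_var[OF that(3)]] ..
  have c2: "cof T (polyring (Suc (Suc n))) (mcomp T ?V' ?p2 m) p = cof T (polyring (Suc n)) m (subst n c p)"
    if "locally_ringed T" "morphism T ?N m" "p \<in> PR (Suc (Suc n))" for T :: "'k sch" and m p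
    unfolding mcomp_open_sub by (rule cof_sm_comp[OF oN csub_PR that])
  have comm: "mcomp ?N ?Q ?z ?p1 = mcomp ?N ?Q ?q ?p2"
  proof (rule mor_poly_eqI[OF lN mor_AffD[OF oQ morphism_mcomp[OF p1 z lQ]] mor_AffD[OF oQ morphism_mcomp[OF p2 q lQ]]])
    fix i assume i: "i < Suc n"
    have "cof ?N (polyring n) ?p1 (secv n c i) = gf (polyring (Suc n)) N (secv n c i)"
      unfolding cof_sm[OF oN v1 secv_PR] ev_vars[OF le_SucI[OF order_refl] secv_PR] ..
    moreover have "cof ?N (polyring (Suc (Suc n))) ?p2 (var i) = gf (polyring (Suc n)) N (csub n c i)"
      using i by (subst cof_sm[OF oN csub_PR]) (simp_all add: subst_simps)
    moreover have "secv n c i = csub n c i" using i by (simp add: secv_def csub_def)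
    ultimately show "cof ?N (polyring (Suc n)) (mcomp ?N ?Q ?z ?p1) (var i) = cof ?N (polyring (Suc n)) (mcomp ?N ?Q ?q ?p2) (var i)"
      unfolding cz[OF lN p1 i] cq[OF lN p2 i] by simp
  qed
  have univ: "\<exists>!m. morphism T ?N m \<and> mcomp T ?X ?p1 m = a \<and> mcomp T ?V' ?p2 m = b"
    if T: "kscheme T" and a: "morphism T ?X a" and b: "morphism T ?V' b" and ab: "mcomp T ?Q ?z a = mcomp T ?Q ?q b" for T :: "'k sch" and a b
  proof -
    note lT = kscheme_lr[OF T]
    note a' = mor_AffD[OF oX a] and b' = mor_AffD[OF oN' b]
    have e: "cof T (polyring n) a (secv n c i) = cof T (polyring (Suc (Suc n))) b (var i)" if "i < Suc n" for i
      using cz[OF lT a that] cq[OF lT b that] unfolding ab by simp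
    \<comment> \<open>The base coordinates are taken from \<open>a\<close> and the fibre coordinate
      from the last coordinate of \<open>b\<close>. The remaining coordinates of \<open>b\<close>
      are determined by agreement over the common target; the parameter, in particular, is the
      constant \<open>c\<close>.\<close>
    let ?s = "\<lambda>i. if i < n then cof T (polyring n) a (var i) else cof T (polyring (Suc (Suc n))) b (var (Suc n))"
    have s: "\<And>i. ?s i \<in> global T" using cof_global[OF lT a'] cof_global[OF lT b'] by simp
    let ?m = "mk (Suc n) T ?s"
    note m' = mk_morphism[where s = ?s and n = "Suc n", OF lT s]
    have cm: "cof T (polyring (Suc n)) ?m p = ev (gam T) ?s p" if "p \<in> PR (Suc n)" for p by (rule cof_mk[where s = ?s, OF lT s that])
    have evs: "ev (gam T) ?s (var i) = ?s i" for i by (rule ev_gam_var[where s = ?s, OF lT s])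
    have cms: "cof T (polyring (Suc n)) ?m (subst n c p) = cof T (polyring (Suc (Suc n))) b p" if p: "p \<in> PR (Suc (Suc n))" for p
    proof (rule polyring_hom_eq[OF alg_hom_comp[OF cof_poly_hom[OF lT m'] poly.ev_hom[OF csub_PR]] cof_poly_hom[OF lT b'] _ p])
      fix i assume i: "i < Suc (Suc n)"
      consider "i < n" | "i = n" | "i = Suc n" using i by linarith
      then show "cof T (polyring (Suc n)) ?m (subst n c (var i)) = cof T (polyring (Suc (Suc n))) b (var i)"
      proof cases
        case 1
        then show ?thesis using e[of i] by (simp add: subst_simps csub_def cm evs secv_def)
      next
        case 2
        have "cof T (polyring (Suc n)) ?m (cst c) = scal (gam T) c" using alg_hom_scal[OF cof_poly_hom[OF lT m'], of c] by simp
        moreover have "cof T (polyring n) a (cst c) = scal (gam T) c" using alg_hom_scal[OF cof_poly_hom[OF lT a'], of c] by simp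
        ultimately show ?thesis using e[of n] 2 by (simp add: subst_simps csub_def secv_def)
      next
        case 3
        then show ?thesis by (simp add: subst_simps csub_def cm evs)
      qed
    qed
    have m: "morphism T ?N ?m"
      unfolding N_def mor_DD_iff[OF lT fw]
    proof (intro conjI m' ballI)
      fix p assume "p \<in> pts T"
      then show "cof T (polyring (Suc n)) ?m (f * subst n c w) p \<in> Units (stalk T p)"
        using b unfolding sfw[symmetric] cms[OF fw'] N'_def mor_DD_iff[OF lT fw'] by blast
    qed
    show ?thesis
    proof (rule ex1I[of _ ?m], intro conjI m)
      show "mcomp T ?X ?p1 ?m = a"
      proof (rule mor_poly_eqI[OF lT mor_AffD[OF oX morphism_mcomp[OF m p1 lX]] a'])
        fix i assume i: "i < n"
        show "cof T (polyring n) (mcomp T ?X ?p1 ?m) (var i) = cof T (polyring n) a (var i)"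
          unfolding c1[OF lT m i] using i by (simp add: cm evs)
      qed
      show "mcomp T ?V' ?p2 ?m = b"
      proof (rule mor_poly_eqI[OF lT mor_AffD[OF oN' morphism_mcomp[OF m p2 lV']] b'])
        fix i assume i: "i < Suc (Suc n)"
        show "cof T (polyring (Suc (Suc n))) (mcomp T ?V' ?p2 ?m) (var i) = cof T (polyring (Suc (Suc n))) b (var i)"
          unfolding c2[OF lT m PR_var[OF i]] by (rule cms[OF PR_var[OF i]])
      qed
      fix m1 assume "morphism T ?N m1 \<and> mcomp T ?X ?p1 m1 = a \<and> mcomp T ?V' ?p2 m1 = b"
      then have m1: "morphism T ?N m1" "mcomp T ?X ?p1 m1 = a" "mcomp T ?V' ?p2 m1 = b" by auto
      show "m1 = ?m"
      proof (rule mor_poly_eqI[OF lT mor_AffD[OF oN m1(1)] m'])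
        fix i assume i: "i < Suc n"
        show "cof T (polyring (Suc n)) m1 (var i) = cof T (polyring (Suc n)) ?m (var i)"
        proof (cases "i < n")
          case True
          then show ?thesis using c1[OF lT m1(1) True] unfolding m1(2) by (simp add: cm evs)
        next
          case False
          have "subst n c (var (Suc n)) = var n" by (simp add: subst_simps csub_def)
          then have "cof T (polyring (Suc n)) m1 (var n) = cof T (polyring (Suc (Suc n))) b (var (Suc n))"
            using c2[OF lT m1(1), of "var (Suc n)"] unfolding m1(3) by simp
          then show ?thesis using False i by (simp add: cm evs less_Suc_eq)
        qed
      qed
    qed
  qed
  show "is_pullback ?X ?V' ?Q ?z ?q ?N ?p1 ?p2"
    unfolding is_pullback_def using kscheme_Aff[OF oN] p1 p2 comm univ by blast
qed

text \<open>The graph of a constant section contributes neither coordinates nor framing, and its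
  support is everything. What is left of the composite is the pullback of the data of the given
  correspondence to the slice, that is, substitution in its four polynomials.\<close>

lemma stdc_composite:
  assumes ok: "std_ok (Suc n) f K w H y" and f: "f \<in> PR n"
  shows "is_composite (Aff n (DD n f)) (Aff (Suc n) (DD (Suc n) f)) (Aff 1 V) (stdc (Suc n) f K w H y)
    (graph_corr (Aff n (DD n f)) (csec n f c)) (stdc n f (subst n c K) (subst n c w) (subst n c H) (subst n c y))"
proof -
  let ?X = "Aff n (DD n f)" and ?Q = "Aff (Suc n) (DD (Suc n) f)" and ?P' = "Aff (Suc (Suc n)) (DD (Suc (Suc n)) f)"
  let ?D' = "DD (Suc (Suc n)) (f * w)" and ?D = "DD (Suc n) (f * subst n c w)"
  let ?V' = "Aff (Suc (Suc n)) ?D'" and ?N = "Aff (Suc n) ?D"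
  let ?p1 = "sm (Suc n) ?D n (vars n)" and ?p2 = "sm (Suc n) ?D (Suc (Suc n)) (csub n c)"
  note o = okD[OF ok] and oo = okO[OF ok] and on = okN[OF ok]
  note ok' = std_ok_subst[OF ok f, of c]
  note o' = okD[OF ok'] and oo' = okO[OF ok'] and on' = okN[OF ok']
  note pb = const_section_pullback[OF f o(4), of c]
  have v1: "\<And>i. vars n i \<in> PR (Suc n)" by (rule vars_PR) simp
  have v2: "\<And>i. vars (Suc n) i \<in> PR (Suc (Suc n))" by (rule vars_PR) simp
  have p1: "morphism ?N ?X ?p1" using pb(2) unfolding is_pullback_def by blast
  have em: "mcomp ?V' ?Q (prj (Suc n) f) (id_mor ?V') = sm (Suc (Suc n)) ?D' (Suc n) (vars (Suc n))"
    unfolding mcomp_open_sub prj_def by (rule sm_restrict[OF oo(1,2) on(1) v2])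
  have en: "mcomp ?N ?X (prj n f) (id_mor ?N) = ?p1"
    unfolding mcomp_open_sub prj_def by (rule sm_restrict[OF oo'(1,2) on'(1) v1])
  have idX: "morphism ?X ?X (id_mor ?X)" by (rule lr_space.morphism_id[OF lr_space.intro[OF Aff_lr[OF oo'(3)]]])
  have "pull ?N (id_mor ?N) (pts (Aff (Suc n) (DD (Suc n) f))) (gf (polyring (Suc n)) (DD (Suc n) f) (var n)) = gf (polyring (Suc n)) ?D (var n)"
    unfolding Aff_pts[OF oo'(1)]
    by (rule trans[OF pull_gf_Aff[OF Aff_lr[OF oo'(2)] oo'(1) Aff_sub_morphism[OF oo'(1,2) on'(1)]] cof_id_Aff[OF oo'(2)]]) simp
  moreover have "pull ?N ?p2 (pts ?V') (pull ?V' (id_mor ?V') (pts ?P') (gf (polyring (Suc (Suc n))) (DD (Suc (Suc n)) f) (var (Suc n)))) = gf (polyring (Suc n)) ?D (var n)"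
  proof -
    have "pull ?V' (id_mor ?V') (pts ?P') (gf (polyring (Suc (Suc n))) (DD (Suc (Suc n)) f) (var (Suc n))) = gf (polyring (Suc (Suc n))) ?D' (var (Suc n))"
      unfolding Aff_pts[OF oo(1)]
      by (rule trans[OF pull_gf_Aff[OF Aff_lr[OF oo(2)] oo(1) Aff_sub_morphism[OF oo(1,2) on(1)]] cof_id_Aff[OF oo(2)]]) simp
    moreover have "pull ?N ?p2 ?D' (gf (polyring (Suc (Suc n))) ?D' (var (Suc n))) = gf (polyring (Suc n)) ?D (subst n c (var (Suc n)))"
      by (rule trans[OF pull_gf_Aff[OF Aff_lr[OF oo'(2)] oo(2) pb(1)] cof_sm[OF oo'(2) csub_PR]]) simp
    ultimately show ?thesis unfolding Aff_pts[OF oo(2)] by (simp add: subst_simps csub_def)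
  qed
  ultimately have co: "map (pull ?N (id_mor ?N) (pts (Aff (Suc n) (DD (Suc n) f)))) [gf (polyring (Suc n)) (DD (Suc n) f) (var n)] =
      map (pull ?N ?p1 (pts ?X) \<circ> pull ?X (id_mor ?X) (pts ?X)) [] @
      map (pull ?N ?p2 (pts ?V') \<circ> pull ?V' (id_mor ?V') (pts ?P')) [gf (polyring (Suc (Suc n))) (DD (Suc (Suc n)) f) (var (Suc n))]"
    by (simp only: list.map append_Nil o_apply)
  have su: "ZK n f (subst n c K) = fst (id_mor ?N) ` (preim ?N ?p1 (preim ?X (id_mor ?X) (pts ?X)) \<inter> preim ?N ?p2 (preim ?V' (id_mor ?V') (ZK (Suc n) f K)))"
  proof -
    have "preim ?V' (id_mor ?V') (ZK (Suc n) f K) = ZK (Suc n) f K"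
      using on(2) unfolding preim_def Aff_pts[OF oo(2)] by (auto simp: id_mor_def Aff_pts[OF oo(2)] simp del: open_sub_simps poly.Spec_simps)
    moreover have "preim ?N ?p2 (ZK (Suc n) f K) = ZK n f (subst n c K)"
    proof -
      have "fst ?p2 p \<in> ZK (Suc n) f K \<longleftrightarrow> subst n c K \<in> p" if p: "p \<in> ?D" for p
      proof -
        have "p \<in> pts ?N" unfolding Aff_pts[OF oo'(2)] by (rule p)
        from mor_pt[OF pb(1) this] have "fst ?p2 p \<in> ?D'" unfolding Aff_pts[OF oo(2)] .
        then have "fst ?p2 p \<in> DD (Suc (Suc n)) f" using on(1) by blast
        then show ?thesis using o(8) by (simp add: sm_fst[OF oo'(2) csub_PR p])
      qed
      then show ?thesis using on' unfolding preim_def Aff_pts[OF oo'(2)] by blast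
    qed
    moreover have "preim ?N ?p1 (preim ?X (id_mor ?X) (pts ?X)) = ?D" unfolding preim_pts[OF idX] preim_pts[OF p1] Aff_pts[OF oo'(2)] ..
    moreover have "?D \<inter> ZK n f (subst n c K) = ZK n f (subst n c K)" using on'(2) by blast
    moreover have "fst (id_mor ?N) ` ZK n f (subst n c K) = ZK n f (subst n c K)"
    proof (rule trans[OF image_cong[OF refl] image_ident])
      fix x assume "x \<in> ZK n f (subst n c K)"
      then have "x \<in> pts ?N" using on'(2) unfolding Aff_pts[OF oo'(2)] by blast
      then show "fst (id_mor ?N) x = x" by (rule id_mor_fst)
    qed
    ultimately show ?thesis by (simp only:)
  qed
  have fr: "[\<lambda>p\<in>?D. frac (polyring (Suc n)) (PR (Suc n) - p) (subst n c H) f] = map (pull ?N ?p1 (pts ?X)) [] @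
      map (pull ?N ?p2 (pts ?V')) [\<lambda>p\<in>?D'. frac (polyring (Suc (Suc n))) (PR (Suc (Suc n)) - p) H f]"
    using pull_frac_sm[OF oo(2) on(1) oo'(2) csub_PR pb(1) o(2,5)] unfolding Aff_pts[OF oo(2)] subst_base[OF f] by simp
  have ta: "sm (Suc n) ?D 1 (\<lambda>_. subst n c y) = mcomp ?N (Aff 1 V) (sm (Suc (Suc n)) ?D' 1 (\<lambda>_. y)) ?p2"
    unfolding mcomp_open_sub
  proof (rule mor_poly_eqI[OF Aff_lr[OF oo'(2)]])
    show "morphism ?N (Spec (polyring 1)) (sm (Suc n) ?D 1 (\<lambda>_. subst n c y))" by (rule sm_morphism[OF oo'(2) subst_PR])
    show "morphism ?N (Spec (polyring 1)) (mcomp ?N (Spec (polyring 1)) (sm (Suc (Suc n)) ?D' 1 (\<lambda>_. y)) ?p2)"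
      by (rule morphism_mcomp[OF pb(1) sm_morphism[OF oo(2) o(6)] poly.Spec_lr])
    fix i assume i: "i < (1::nat)"
    have "cof ?N (polyring 1) (mcomp ?N (Spec (polyring 1)) (sm (Suc (Suc n)) ?D' 1 (\<lambda>_. y)) ?p2) (var i) = cof ?N (polyring (Suc (Suc n))) ?p2 y"
      unfolding cof_sm_comp[OF oo(2) o(6) Aff_lr[OF oo'(2)] pb(1) PR_var[OF i]] pev_var[where q = "\<lambda>_. y", OF o(6)] ..
    also have "\<dots> = gf (polyring (Suc n)) ?D (subst n c y)" by (rule cof_sm[OF oo'(2) csub_PR o(6)])
    also have "\<dots> = cof ?N (polyring 1) (sm (Suc n) ?D 1 (\<lambda>_. subst n c y)) (var i)"
      unfolding cof_sm[OF oo'(2) subst_PR PR_var[OF i]] pev_var[where q = "\<lambda>_. subst n c y", OF subst_PR] ..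
    finally show "cof ?N (polyring 1) (sm (Suc n) ?D 1 (\<lambda>_. subst n c y)) (var i) = cof ?N (polyring 1) (mcomp ?N (Spec (polyring 1)) (sm (Suc (Suc n)) ?D' 1 (\<lambda>_. y)) ?p2) (var i)" by simp
  qed
  show ?thesis
    unfolding is_composite_def stdc_def graph_corr_def fcorr.select_convs Let_def em en
    unfolding mcomp_id_left[OF idX] mcomp_id_left[OF p1]
    using pb(2) co su fr ta by (intro exI[of _ ?p1] exI[of _ ?p2] conjI refl) (simp_all only: mcomp_id_left[OF p1])
qed

lemma stdc_fr_comp:
  assumes ok: "std_ok (Suc n) f K w H y" and f: "f \<in> PR n"
    and t: "morphism (Aff (Suc (Suc n)) (DD (Suc (Suc n)) (f * w))) (Aff 1 V) (sm (Suc (Suc n)) (DD (Suc (Suc n)) (f * w)) 1 (\<lambda>_. y))"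
    and V: "openin (tspace (Spec (polyring 1))) V"
  shows "explicit_corr 1 (Aff n (DD n f)) (Aff 1 V) (stdc n f (subst n c K) (subst n c w) (subst n c H) (subst n c y))" 
    and "fr_comp 1 0 (Aff n (DD n f)) (Aff (Suc n) (DD (Suc n) f)) (Aff 1 V)
      (fr_class 1 (Aff (Suc n) (DD (Suc n) f)) (Aff 1 V) (stdc (Suc n) f K w H y))
      (fr_class 0 (Aff n (DD n f)) (Aff (Suc n) (DD (Suc n) f)) (graph_corr (Aff n (DD n f)) (csec n f c)))
      (fr_class 1 (Aff n (DD n f)) (Aff 1 V) (stdc n f (subst n c K) (subst n c w) (subst n c H) (subst n c y)))"
proof -
  let ?X = "Aff n (DD n f)" and ?Y = "Aff 1 V" and ?t = "stdc n f (subst n c K) (subst n c w) (subst n c H) (subst n c y)"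
  note co = stdc_composite[OF ok f, of V c]
  note ok' = std_ok_subst[OF ok f, of c]
  note pb = const_section_pullback[OF f okD(4)[OF ok], of c]
  \<comment> \<open>The target of the composite is the given target after the second projection of
    the fibre product, so it lands in \<open>V\<close> without a new computation.\<close>
  have tm: "morphism (Aff (Suc n) (DD (Suc n) (f * subst n c w))) ?Y (sm (Suc n) (DD (Suc n) (f * subst n c w)) 1 (\<lambda>_. subst n c y))"
  proof -
    obtain p1 p2 where pb: "is_pullback ?X (nbhd (stdc (Suc n) f K w H y)) (Aff (Suc n) (DD (Suc n) f)) (targ (graph_corr ?X (csec n f c)))
        (mcomp (nbhd (stdc (Suc n) f K w H y)) (Aff (Suc n) (DD (Suc n) f)) (aproj (stdc (Suc n) f K w H y)) (emap (stdc (Suc n) f K w H y))) (nbhd ?t) p1 p2"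
      and tg: "targ ?t = mcomp (nbhd ?t) ?Y (targ (stdc (Suc n) f K w H y)) p2"
      using co unfolding is_composite_def Let_def graph_corr_def fcorr.select_convs by (elim exE conjE)
    from pb have m: "morphism (nbhd ?t) (nbhd (stdc (Suc n) f K w H y)) p2"
      unfolding is_pullback_def by (rule conjunct1[OF conjunct2[OF conjunct2]])
    show ?thesis using morphism_mcomp[OF m[unfolded stdc_def fcorr.select_convs] t Aff_lr[OF V]] tg unfolding stdc_def fcorr.select_convs by (simp only:)
  qed
  show ex: "explicit_corr 1 ?X ?Y ?t" by (rule stdc_explicit[OF ok' tm])
  have "explicit_corr 0 ?X (Aff (Suc n) (DD (Suc n) f)) (graph_corr ?X (csec n f c))"
    by (rule explicit_graph_corr[OF kscheme_Aff[OF DD_open[OF f]] Aff_lreduced[OF DD_open[OF f]] csec_morphism[OF f]])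
  then show "fr_comp 1 0 (Aff n (DD n f)) (Aff (Suc n) (DD (Suc n) f)) (Aff 1 V)
      (fr_class 1 (Aff (Suc n) (DD (Suc n) f)) (Aff 1 V) (stdc (Suc n) f K w H y))
      (fr_class 0 (Aff n (DD n f)) (Aff (Suc n) (DD (Suc n) f)) (graph_corr (Aff n (DD n f)) (csec n f c)))
      (fr_class 1 (Aff n (DD n f)) (Aff 1 V) ?t)"
    unfolding fr_comp_def using stdc_explicit[OF ok t] ex co
    by (intro exI[of _ "stdc (Suc n) f K w H y"] exI[of _ "graph_corr ?X (csec n f c)"] exI[of _ ?t]) simp
qed

section \<open>Equivalence of correspondences\<close>

lemma fr_equiv_sym: "(s, t) \<in> fr_equiv n X Y \<Longrightarrow> (t, s) \<in> fr_equiv n X Y"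
  unfolding fr_equiv_def Let_def by (rule symD[OF sym_rtrancl[OF sym_Un_converse]])

lemma fr_class_eqI: "(s, t) \<in> fr_equiv n X Y \<Longrightarrow> fr_class n X Y s = fr_class n X Y t"
  unfolding fr_class_def using fr_equiv_sym[of s t n X Y] unfolding fr_equiv_def Let_def
  by (auto intro: rtrancl_trans)

lemma fr_class_eq_iff: "fr_class n X Y s = fr_class n X Y t \<longleftrightarrow> (s, t) \<in> fr_equiv n X Y"
proof
  have "t \<in> fr_class n X Y t" unfolding fr_class_def fr_equiv_def Let_def by simp
  then show "(s, t) \<in> fr_equiv n X Y" if "fr_class n X Y s = fr_class n X Y t"
    unfolding that[symmetric] by (simp add: fr_class_def)
qed (rule fr_class_eqI)

lemma refines_equiv: "explicit_corr n X Y t' \<Longrightarrow> explicit_corr n X Y t \<Longrightarrow> Defs.refines X Y t' t \<Longrightarrow> (t', t) \<in> fr_equiv n X Y"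
  unfolding fr_equiv_def Let_def by (rule r_into_rtrancl) simp

context
  fixes Y :: "'k::field sch" and W
  assumes Y: "locally_ringed Y" "openin (tspace Y) W"
begin

lemma explicit_corr_open_sub: "explicit_corr n X (open_sub Y W) t \<Longrightarrow> explicit_corr n X Y t"
  unfolding explicit_corr_def morphism_open_sub_iff[OF Y(2,1)] by simp

text \<open>The target enters a refinement only through composites, which are the same terms for
  \<open>Y\<close> and its open subspace. A chain of refinements over the subspace is thus one over
  \<open>Y\<close>, and pushing forward along the inclusion is well defined on classes.\<close>

lemma fr_equiv_open_sub: "fr_equiv n X (open_sub Y W) \<subseteq> fr_equiv n X Y"
proof -
  have "Defs.refines X (open_sub Y W) t' t \<longleftrightarrow> Defs.refines X Y t' t" for t' t
    unfolding Defs.refines_def by simp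
  then show ?thesis unfolding fr_equiv_def Let_def
    by (intro rtrancl_mono Un_mono converse_mono[THEN iffD2] subsetI) (auto intro: explicit_corr_open_sub)
qed

end

lemma graph_pullback:
  assumes A: "kscheme A" and Y: "locally_ringed Y" and g: "morphism A Y g"
  shows "is_pullback A Y Y g (id_mor Y) A (id_mor A) g"
proof -
  have i: "morphism A A (id_mor A)" by (rule lr_space.morphism_id[OF lr_space.intro[OF kscheme_lr[OF A]]])
  have "\<exists>!m. morphism T A m \<and> mcomp T A (id_mor A) m = a \<and> mcomp T Y g m = b"
    if "morphism T A a" "morphism T Y b" "mcomp T Y g a = mcomp T Y (id_mor Y) b" for T :: "'a sch" and a b
  proof (rule ex1I[of _ a])
    show "morphism T A a \<and> mcomp T A (id_mor A) a = a \<and> mcomp T Y g a = b"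
      using that mcomp_id_left[OF that(1)] mcomp_id_left[OF that(2)] by simp
    fix m assume m: "morphism T A m \<and> mcomp T A (id_mor A) m = a \<and> mcomp T Y g m = b"
    then have "mcomp T A (id_mor A) m = m" by (intro mcomp_id_left) simp
    then show "m = a" using m by simp
  qed
  then show ?thesis unfolding is_pullback_def
    using A i g mcomp_id_right[OF g] mcomp_id_left[OF g] by simp
qed

text \<open>The fibre product with an identity is the neighbourhood of \<open>t\<close> itself, and
  an open inclusion does not change the pair of maps \<open>targ t\<close>. So the composite is the
  same record \<open>t\<close>, now read with the larger target.\<close>

lemma graph_composite:
  fixes t :: "'k::field fcorr"
  assumes X: "locally_ringed X" and Y: "locally_ringed Y" "openin (tspace Y) W" and t: "explicit_corr n X (open_sub Y W) t"
    and k: "kscheme (nbhd t)" "kscheme (aff t)" and e: "morphism (nbhd t) (aff t) (emap t)" "supp t \<subseteq> fst (emap t) ` pts (nbhd t)"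
  shows "is_composite X (open_sub Y W) Y (graph_corr (open_sub Y W) (id_mor (open_sub Y W))) t t"
proof -
  let ?Y = "open_sub Y W" and ?N = "nbhd t"
  have lY: "locally_ringed ?Y" by (rule lr_space.open_sub_lr[OF lr_space.intro[OF Y(1)] Y(2)])
  have g: "morphism ?N ?Y (targ t)" and a: "morphism (aff t) X (aproj t)" and c: "set (acoord t) \<subseteq> global (aff t)" "set (fram t) \<subseteq> global ?N"
    using t unfolding explicit_corr_def is_affine_space_def by auto
  have iN: "morphism ?N ?N (id_mor ?N)" by (rule lr_space.morphism_id[OF lr_space.intro[OF kscheme_lr[OF k(1)]]])
  have iY: "morphism ?Y ?Y (id_mor ?Y)" by (rule lr_space.morphism_id[OF lr_space.intro[OF lY]])
  note lN = kscheme_lr[OF k(1)]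
  have p: "pull ?N (id_mor ?N) (pts ?N) s = s" if "s \<in> global ?N" for s by (rule pull_id[OF lN that])
  have co: "map (pull ?N (emap t) (pts (aff t))) (acoord t) = map (pull ?N (id_mor ?N) (pts ?N) \<circ> pull ?N (emap t) (pts (aff t))) (acoord t)"
  proof (rule map_cong[OF refl])
    fix x assume "x \<in> set (acoord t)"
    then have "x \<in> global (aff t)" using c(1) by blast
    from p[OF mor_pull_global[OF e(1) this]]
    show "pull ?N (emap t) (pts (aff t)) x = (pull ?N (id_mor ?N) (pts ?N) \<circ> pull ?N (emap t) (pts (aff t))) x" by simp
  qed
  have fr: "fram t = map (pull ?N (id_mor ?N) (pts ?N)) (fram t)" by (rule sym, rule map_idI) (use c(2) p in blast)
  have pp: "preim ?N (id_mor ?N) (preim ?N (emap t) (supp t)) = preim ?N (emap t) (supp t)" unfolding preim_def by (auto simp: id_mor_def)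
  have su: "supp t = fst (emap t) ` (preim ?N (emap t) (supp t) \<inter> pts ?N)" using e(2) unfolding preim_def by blast
  have ta: "targ t = mcomp ?N Y (id_mor ?Y) (targ t)" using mcomp_id_left[OF g] by simp
  show ?thesis
    unfolding is_composite_def Let_def graph_corr_def fcorr.select_convs mcomp_id_left[OF iY]
  proof (rule exI[of _ "id_mor ?N"], rule exI[of _ "targ t"], intro conjI)
    show "is_pullback ?N ?Y ?Y (targ t) (id_mor ?Y) ?N (id_mor ?N) (targ t)" by (rule graph_pullback[OF k(1) lY g])
    show "mcomp ?N X (aproj t) (emap t) = mcomp ?N X (mcomp ?N X (aproj t) (emap t)) (id_mor ?N)"
      by (rule mcomp_id_right[OF morphism_mcomp[OF e(1) a X], symmetric])
    show "supp t = fst (emap t) ` (preim ?N (id_mor ?N) (preim ?N (emap t) (supp t)) \<inter> preim ?N (targ t) (preim ?Y (id_mor ?Y) (pts ?Y)))"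
      unfolding pp preim_pts[OF iY] preim_pts[OF g] by (rule su)
    show "targ t = mcomp ?N Y (id_mor ?Y) (targ t)" by (rule ta)
  qed (use co fr in simp_all)
qed

section \<open>The suspension\<close>

lemma affine_space_ex1:
  fixes P T :: "'k::field sch"
  assumes "is_affine_space X P \<pi> c" "kscheme T" "morphism T X h" "set s \<subseteq> global T" "length s = length c"
  shows "\<exists>!m. morphism T P m \<and> mcomp T X \<pi> m = h \<and> map (pull T m (pts P)) c = s"
proof -
  note a = conjunct2[OF conjunct2[OF conjunct2[OF assms(1)[unfolded is_affine_space_def]]]]
  from a[THEN spec, of T, THEN spec, of h, THEN spec, of s] show ?thesis by (rule mp) (intro conjI assms)
qed

lemma affine_space_unique:
  fixes P T :: "'k::field sch"
  assumes "is_affine_space X P \<pi> c" "kscheme T" "morphism T X h" "set s \<subseteq> global T" "length s = length c"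
    and "morphism T P m" "mcomp T X \<pi> m = h" "map (pull T m (pts P)) c = s"
    and "morphism T P m'" "mcomp T X \<pi> m' = h" "map (pull T m' (pts P)) c = s"
  shows "m = m'"
proof -
  from affine_space_ex1[OF assms(1-5)] show ?thesis using assms(6-11) by (elim ex1E) metis
qed

lemma affine_space_ex:
  fixes P T :: "'k::field sch"
  assumes "is_affine_space X P \<pi> c" "kscheme T" "morphism T X h" "set s \<subseteq> global T" "length s = length c"
  obtains m where "morphism T P m" "mcomp T X \<pi> m = h" "map (pull T m (pts P)) c = s"
proof -
  from affine_space_ex1[OF assms] show thesis using that by (elim ex1E conjE)
qed

text \<open>The composite and the identity are both classified by the same projection and the same
  coordinate function.\<close>

lemma affine_line_hom:
  fixes P P' :: "'k::field sch"
  assumes X: "locally_ringed X" and P: "is_affine_space X P \<pi> [c]" and P': "is_affine_space X P' \<pi>' [c']"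
    and h: "morphism P P' \<theta>" "mcomp P X \<pi>' \<theta> = \<pi>" "pull P \<theta> (pts P') c' = c"
    and h': "morphism P' P \<theta>'" "mcomp P' X \<pi> \<theta>' = \<pi>'" "pull P' \<theta>' (pts P) c = c'"
  shows "mcomp P P \<theta>' \<theta> = id_mor P"
proof (rule affine_space_unique[OF P])
  have k: "kscheme P" and pi: "morphism P X \<pi>" and c: "c \<in> global P" and k': "kscheme P'" and pi': "morphism P' X \<pi>'"
    using P P' unfolding is_affine_space_def by auto
  note l = kscheme_lr[OF k] and i = lr_space.morphism_id[OF lr_space.intro[OF kscheme_lr[OF k]]]
  show "kscheme P" "morphism P X \<pi>" "set [c] \<subseteq> global P" "length [c] = length [c]" using k pi c by auto
  show "morphism P P (id_mor P)" "mcomp P X \<pi> (id_mor P) = \<pi>" "map (pull P (id_mor P) (pts P)) [c] = [c]"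
    using i mcomp_id_right[OF pi] pull_id[OF l c] by auto
  show "morphism P P (mcomp P P \<theta>' \<theta>)" by (rule morphism_mcomp[OF h(1) h'(1) l])
  show "mcomp P X \<pi> (mcomp P P \<theta>' \<theta>) = \<pi>"
    unfolding mcomp_assoc[OF h(1) h'(1) pi] h'(2) by (rule h(2))
  have "pull P (mcomp P P \<theta>' \<theta>) (pts P) c = pull P \<theta> (preim P' \<theta>' (pts P)) (pull P' \<theta>' (pts P) c)"
    by (rule pull_mcomp[OF h(1) l openin_topspace c])
  then show "map (pull P (mcomp P P \<theta>' \<theta>) (pts P)) [c] = [c]" unfolding preim_pts[OF h'(1)] h'(3) h(3) by simp
qed

definition sigma_model :: "'k::field sch \<Rightarrow> 'k sch \<Rightarrow> 'k smor \<Rightarrow> 'k sfun \<Rightarrow> 'k smor \<Rightarrow> 'k fcorr" where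
  "sigma_model X P \<pi> c z = \<lparr>aff = P, aproj = \<pi>, acoord = [c], supp = fst z ` pts X,
     nbhd = P, emap = id_mor P, fram = [c], targ = \<pi>\<rparr>"

text \<open>Any two models of \<open>\<sigma>\<close> are isomorphic by the universal property; the zero locus of the coordinate is
  read off from the standard model, where it is the zero section.\<close>

lemma sigma_unique:
  fixes n :: nat and f :: "'k::field mpoly"
  assumes f: "f \<in> PR n"
  defines "X \<equiv> Aff n (DD n f)" and "P0 \<equiv> Aff (Suc n) (DD (Suc n) f)" and "c0 \<equiv> gf (polyring (Suc n)) (DD (Suc n) f) (var n)"
  assumes P: "is_affine_space X P \<pi> [c]" and z: "is_const_section X P \<pi> c 0 z"
  shows "explicit_corr 1 X X (sigma_model X P \<pi> c z)"
    and "Defs.refines X X (sigma_model X P0 (prj n f) c0 (csec n f 0)) (sigma_model X P \<pi> c z)"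
proof -
  have f': "f \<in> PR (Suc n)" using PR_mono[OF f] by simp
  note oX = DD_open[OF f] and oP = DD_open[OF f']
  have P0: "is_affine_space X P0 (prj n f) [c0]" unfolding X_def P0_def c0_def by (rule affine_space_Aff[OF f])
  have z0: "is_const_section X P0 (prj n f) c0 0 (csec n f 0)" unfolding X_def P0_def c0_def by (rule const_section[OF f])
  have kX: "kscheme X" unfolding X_def by (rule kscheme_Aff[OF oX])
  note lX = kscheme_lr[OF kX]
  have kP: "kscheme P" and pi: "morphism P X \<pi>" and c: "c \<in> global P" and k0: "kscheme P0" and pi0: "morphism P0 X (prj n f)" and c0: "c0 \<in> global P0"
    using P P0 unfolding is_affine_space_def by auto
  note lP = kscheme_lr[OF kP] and l0 = kscheme_lr[OF k0]
  obtain \<theta> where t: "morphism P0 P \<theta>" "mcomp P0 X \<pi> \<theta> = prj n f" "map (pull P0 \<theta> (pts P)) [c] = [c0]"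
    by (rule affine_space_ex[OF P k0 pi0, of "[c0]"]) (use c0 in auto)
  obtain \<theta>' where t': "morphism P P0 \<theta>'" "mcomp P X (prj n f) \<theta>' = \<pi>" "map (pull P \<theta>' (pts P0)) [c0] = [c]"
    by (rule affine_space_ex[OF P0 kP pi, of "[c]"]) (use c in auto)
  have t3: "pull P0 \<theta> (pts P) c = c0" "pull P \<theta>' (pts P0) c0 = c" using t(3) t'(3) by simp_all
  have tt: "mcomp P0 P0 \<theta>' \<theta> = id_mor P0" by (rule affine_line_hom[OF lX P0 P t(1,2) t3(1) t'(1,2) t3(2)])
  have tt': "mcomp P P \<theta> \<theta>' = id_mor P" by (rule affine_line_hom[OF lX P P0 t'(1,2) t3(2) t(1,2) t3(1)])
  have iso: "isomorphism P0 P \<theta>" by (rule isomorphismI[OF t(1) t'(1) tt tt'])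
  have zz: "morphism X P z" "mcomp X X \<pi> z = id_mor X" "pull X z (pts P) c = const_fun X 0" using z unfolding is_const_section_def by auto
  have z0': "morphism X P0 (csec n f 0)" "mcomp X X (prj n f) (csec n f 0) = id_mor X" "pull X (csec n f 0) (pts P0) c0 = const_fun X 0"
    using z0 unfolding is_const_section_def by auto
  \<comment> \<open>Both sides are sections with constant coordinate zero, hence equal by the
    universal property. So \<theta> carries one zero section to the other.\<close>
  have tz: "mcomp X P \<theta> (csec n f 0) = z"
  proof (rule affine_space_unique[OF P kX])
    show "morphism X X (id_mor X)" by (rule lr_space.morphism_id[OF lr_space.intro[OF lX]])
    show "set [const_fun X 0] \<subseteq> global X" using mor_pull_global[OF zz(1) c] zz(3) by simp
    show "length [const_fun X 0] = length [c]" by simp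
    show "morphism X P (mcomp X P \<theta> (csec n f 0))" by (rule morphism_mcomp[OF z0'(1) t(1) lP])
    show "mcomp X X \<pi> (mcomp X P \<theta> (csec n f 0)) = id_mor X" unfolding mcomp_assoc[OF z0'(1) t(1) pi] t(2) by (rule z0'(2))
    have "pull X (mcomp X P \<theta> (csec n f 0)) (pts P) c = pull X (csec n f 0) (preim P0 \<theta> (pts P)) (pull P0 \<theta> (pts P) c)"
      by (rule pull_mcomp[OF z0'(1) lP openin_topspace c])
    then show "map (pull X (mcomp X P \<theta> (csec n f 0)) (pts P)) [c] = [const_fun X 0]" unfolding preim_pts[OF t(1)] t3 z0'(3) by simp
  qed (use zz in simp_all)
  let ?O = "fst (csec n f 0) ` pts X" and ?Z = "fst z ` pts X"
  have Z0: "?O = ZK n f (var n)" unfolding X_def by (rule zero_section_image[OF f])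
  have imZ: "fst \<theta> ` ?O = ?Z" unfolding image_image tz[symmetric] by (rule image_cong[OF refl]) simp
  have ZP: "?Z \<subseteq> pts P" "?O \<subseteq> pts P0" using mor_pt[OF zz(1)] mor_pt[OF z0'(1)] by auto
  have retr: "fst \<theta> (fst \<theta>' p) = p" if "p \<in> pts P" for p using mcomp_fst[OF that, of P \<theta> \<theta>'] that unfolding tt' by simp
  have retr0: "fst \<theta>' (fst \<theta> p) = p" if "p \<in> pts P0" for p using mcomp_fst[OF that, of P0 \<theta>' \<theta>] that unfolding tt by simp
  have Zp: "p \<in> ?Z \<longleftrightarrow> fst \<theta>' p \<in> ?O" if p: "p \<in> pts P" for p
  proof
    assume "p \<in> ?Z"
    then obtain q where "q \<in> ?O" "p = fst \<theta> q" unfolding imZ[symmetric] by blast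
    then show "fst \<theta>' p \<in> ?O" using retr0 ZP(2) by auto
  next
    assume "fst \<theta>' p \<in> ?O"
    then have "fst \<theta> (fst \<theta>' p) \<in> ?Z" unfolding imZ[symmetric] by (rule imageI)
    then show "p \<in> ?Z" unfolding retr[OF p] .
  qed
  have pts0: "pts P0 = DD (Suc n) f" unfolding P0_def by (rule Aff_pts[OF oP])
  have van0: "vanishes P0 c0 q \<longleftrightarrow> q \<in> ?O" if q: "q \<in> pts P0" for q
  proof -
    have qD: "q \<in> DD (Suc n) f" using q unfolding pts0 .
    have pr: "primeideal q (polyring (Suc n))" using qD by (simp add: DD_iff)
    show ?thesis unfolding Z0 vanishes_def c0_def P0_def gf_def
      using poly.gf_vanishes[OF oP qD PR_var[OF lessI] poly.one_closed poly.one_notin[OF pr]] qD by simp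
  qed
  have van: "vanishes P c p \<longleftrightarrow> p \<in> ?Z" if p: "p \<in> pts P" for p
  proof -
    note q = mor_pt[OF t'(1) p]
    have "c p = snd \<theta>' p (c0 (fst \<theta>' p))" using pull_at[OF t'(1) p, of c0] unfolding t3 .
    moreover have "c0 (fst \<theta>' p) \<in> carrier (stalk P0 (fst \<theta>' p))" by (rule lr_space.global_carrier[OF lr_space.intro[OF l0] c0 q])
    ultimately have "c p \<in> Units (stalk P p) \<longleftrightarrow> c0 (fst \<theta>' p) \<in> Units (stalk P0 (fst \<theta>' p))" using mor_Units_iff[OF t'(1) p] by simp
    then show ?thesis using van0[OF q] Zp[OF p] unfolding vanishes_def by simp
  qed
  have iP: "morphism P P (id_mor P)" by (rule lr_space.morphism_id[OF lr_space.intro[OF lP]])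
  have cl: "closedin (tspace P) ?Z"
  proof -
    have "closedin (tspace P0) ?O" unfolding closedin_def pts0 Z0
    proof
      have "DD (Suc n) f - ZK n f (var n) = DD (Suc n) (f * var n)"
        unfolding DD_mult[OF f' PR_var[OF lessI]] by (auto simp: DD_iff)
      moreover have "openin (tspace P0) (DD (Suc n) (f * var n))" unfolding P0_def
        by (rule openin_Aff[OF oP DD_open]) (use f' in \<open>auto simp: DD_mult\<close>)
      ultimately show "openin (tspace P0) (DD (Suc n) f - ZK n f (var n))" by simp
    qed blast
    then have "closedin (tspace P) {p \<in> pts P. fst \<theta>' p \<in> ?O}"
      using t'(1) unfolding morphism_def by (intro closedin_continuous_map_preimage) auto
    moreover have "{p \<in> pts P. fst \<theta>' p \<in> ?O} = ?Z" using Zp ZP(1) by blast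
    ultimately show ?thesis by simp
  qed
  have et: "etale_nbhd P (id_mor P) P ?Z"
    using etale_nbhd_open[OF kP openin_topspace _ ZP(1)] kP unfolding open_sub_all by simp
  have lr: "lreduced X" unfolding X_def by (rule Aff_lreduced[OF oX])
  have pre: "preim P (id_mor P) ?Z = ?Z" using ZP(1) unfolding preim_def by (auto simp: id_mor_def)
  show "explicit_corr 1 X X (sigma_model X P \<pi> c z)"
    unfolding explicit_corr_def sigma_model_def fcorr.select_convs pre
    using P cl finite_mor_section[OF kX lr lP pi zz(1,2)] et c pi van ZP(1) by auto
  show "Defs.refines X X (sigma_model X P0 (prj n f) c0 (csec n f 0)) (sigma_model X P \<pi> c z)"
    unfolding Defs.refines_def sigma_model_def fcorr.select_convs
  proof (rule exI[of _ \<theta>], rule exI[of _ \<theta>], intro conjI iso imZ t)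
    show "mcomp P0 P (id_mor P) \<theta> = mcomp P0 P \<theta> (id_mor P0)" unfolding mcomp_id_left[OF t(1)] mcomp_id_right[OF t(1)] ..
  qed (use t t3 in simp_all)
qed

text \<open>The definition of \<open>sigma\<close> chooses some model of the relative line. Nothing
  is known about the chosen one, so the standard model is compared with an arbitrary one in
  \<open>sigma_unique\<close>.\<close>

lemma sigma_eq:
  fixes n :: nat and f :: "'k::field mpoly"
  assumes f: "f \<in> PR n"
  shows "sigma (Aff n (DD n f)) = fr_class 1 (Aff n (DD n f)) (Aff n (DD n f))
    (sigma_model (Aff n (DD n f)) (Aff (Suc n) (DD (Suc n) f)) (prj n f) (gf (polyring (Suc n)) (DD (Suc n) f) (var n)) (csec n f 0))"
    (is "sigma ?X = fr_class 1 ?X ?X ?s")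
proof -
  have "is_sigma ?X ?s" unfolding is_sigma_def sigma_model_def using affine_space_Aff[OF f] const_section[OF f] by blast
  then have "is_sigma ?X (SOME s. is_sigma ?X s)" by (rule someI)
  then obtain P \<pi> c z where P: "is_affine_space ?X P \<pi> [c]" "is_const_section ?X P \<pi> c 0 z" "(SOME s. is_sigma ?X s) = sigma_model ?X P \<pi> c z"
    unfolding is_sigma_def sigma_model_def by (elim exE conjE)
  note u = sigma_unique[OF f P(1,2)]
  have "explicit_corr 1 ?X ?X ?s" by (rule sigma_unique(1)[OF f affine_space_Aff[OF f] const_section[OF f]])
  then show ?thesis unfolding sigma_def P(3) using fr_class_eqI[OF refines_equiv[OF _ u]] by simp
qed

text \<open>The framing of \<open>stdc\<close> is divided by \<open>f\<close>, and t f / f = t; the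
  target \<open>var 0\<close> is the projection to the base. The condition on \<open>w\<close> says
  that nothing is removed from the relative line.\<close>

lemma sigma_stdc:
  assumes f: "f \<in> PR (1::nat)" and w: "DD 2 (f * w) = DD 2 f"
  shows "stdc 1 f (var 1) w (var 1 * f) (var 0) = sigma_model (Aff 1 (DD 1 f)) (Aff 2 (DD 2 f)) (prj 1 f) (gf (polyring 2) (DD 2 f) (var 1)) (csec 1 f 0)"
proof -
  have f': "f \<in> PR 2" using PR_mono[OF f] by simp
  note oP = DD_open[OF f']
  have v1: "var 1 \<in> PR 2" and v0: "\<And>i::nat. var 0 \<in> PR 2" by simp_all
  have fr: "(\<lambda>p\<in>DD 2 f. frac (polyring 2) (PR 2 - p) (var 1 * f) f) = gf (polyring 2) (DD 2 f) (var 1)"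
    unfolding gf_def
  proof (rule restrict_ext)
    fix p assume "p \<in> DD 2 f"
    then have p: "primeideal p (polyring 2)" "f \<in> PR 2 - p" using f' by (auto simp: DD_iff)
    interpret mult_loc "polyring 2" "PR 2 - p" by (rule poly.prime_loc[OF p(1)])
    show "frac (polyring 2) (PR 2 - p) (var 1 * f) f = frac (polyring 2) (PR 2 - p) (var 1) \<one>\<^bsub>polyring 2\<^esub>"
      using frac_cancel[OF v1 one_S p(2)] by simp
  qed
  have ta: "sm 2 (DD 2 f) 1 (\<lambda>_. var 0) = prj 1 f"
    unfolding prj_def Suc_1
  proof (rule mor_poly_eqI[OF Aff_lr[OF oP]])
    have v: "\<And>i. vars 1 i \<in> PR 2" by (rule vars_PR) simp
    show "morphism (Aff 2 (DD 2 f)) (Spec (polyring 1)) (sm 2 (DD 2 f) 1 (\<lambda>_. var 0))" by (rule sm_morphism[OF oP v0])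
    show "morphism (Aff 2 (DD 2 f)) (Spec (polyring 1)) (sm 2 (DD 2 f) 1 (vars 1))" by (rule sm_morphism[OF oP v])
    fix i assume i: "i < (1::nat)"
    show "cof (Aff 2 (DD 2 f)) (polyring 1) (sm 2 (DD 2 f) 1 (\<lambda>_. var 0)) (var i) = cof (Aff 2 (DD 2 f)) (polyring 1) (sm 2 (DD 2 f) 1 (vars 1)) (var i)"
      unfolding cof_sm[OF oP v0 PR_var[OF i]] cof_sm[OF oP v PR_var[OF i]] pev_var[where q = "\<lambda>_. var 0", OF v0] pev_var[where q = "vars 1", OF v]
      using i by (simp add: vars_def)
  qed
  show ?thesis unfolding stdc_def sigma_model_def zero_section_image[OF f] Suc_1 w fr ta ..
qed

section \<open>Polynomials in one variable\<close>

text \<open>Horner evaluation of a one-variable polynomial at a multivariate one. Degrees,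
  divisibility and division with remainder are taken from one-variable polynomials and transported
  along \<open>pe\<close>.\<close>

definition pe :: "'k::field poly \<Rightarrow> 'k mpoly \<Rightarrow> 'k mpoly" where
  "pe F y = fold_coeffs (\<lambda>a b. cst a + y * b) F 0"

lemma pe_0 [simp]: "pe 0 y = 0"
  by (simp add: pe_def)

lemma pe_pCons [simp]: "pe (pCons a F) y = cst a + y * pe F y"
  by (cases "a = 0 \<and> F = 0") (auto simp: pe_def)

lemma pe_1 [simp]: "pe 1 y = 1"
  by (simp add: one_pCons)

lemma pe_add: "pe (F + G) y = pe F y + pe G y"
  by (induction F G rule: poly_induct2) (simp_all add: single_add algebra_simps)

lemma pe_smult: "pe (smult c F) y = cst c * pe F y"
  by (induction F) (simp_all add: mult_single algebra_simps)

lemma pe_mult: "pe (F * G) y = pe F y * pe G y"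
  by (induction F) (simp_all add: pe_add pe_smult algebra_simps)

lemma pe_PR: "y \<in> PR n \<Longrightarrow> pe F y \<in> PR n"
  by (induction F) simp_all

lemma ev_pe:
  assumes q: "\<And>i. q i \<in> PR m" shows "ev (polyring m) q (pe F y) = pe F (ev (polyring m) q y)"
  by (induction F) (simp_all add: pev[of q m, OF q])

text \<open>The difference F(y) - F(z) is a multiple of y - z; each Horner step splits into (y - z)
  F(y) and z (F(y) - F(z)).\<close>

lemma pe_diff:
  assumes P: "primeideal P (polyring m)" and yz: "y \<in> PR m" "z \<in> PR m" "y - z \<in> P"
  shows "pe F y - pe F z \<in> P"
proof (induction F)
  case 0 show ?case using prime_zero[OF P] by simp
next
  case (pCons a F)
  have "(y - z) * pe F y \<in> P" using prime_mult_iff[OF P, of "y - z" "pe F y"] yz pe_PR[OF yz(1), of F] by simp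
  moreover have "z * (pe F y - pe F z) \<in> P"
    using prime_mult_iff[OF P, of z "pe F y - pe F z"] yz pe_PR[OF yz(1), of F] pe_PR[OF yz(2), of F] pCons by simp
  moreover have "pe (pCons a F) y - pe (pCons a F) z = (y - z) * pe F y + z * (pe F y - pe F z)" by (simp add: algebra_simps)
  ultimately show ?case using prime_add[OF P] by metis
qed

lemma pe_cong:
  assumes "primeideal P (polyring m)" "y \<in> PR m" "z \<in> PR m" "y - z \<in> P"
  shows "pe F y \<in> P \<longleftrightarrow> pe F z \<in> P"
  using prime_add_iff[OF assms(1) pe_diff[OF assms], of F "pe F z"] by simp

lemma PR_1_pe:
  assumes "p \<in> PR 1" shows "\<exists>F. p = pe F (var 0)"
  using assms
proof (induction rule: polyring_induct)
  case (cst c) show ?case by (rule exI[of _ "[:c:]"]) simp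
next
  case (var i) then show ?case by (intro exI[of _ "[:0, 1:]"]) simp
next
  case (add p q) then show ?case by (metis pe_add)
next
  case (mult p q) then show ?case by (metis pe_mult)
qed

text \<open>A non-zero member of least degree divides all others, for the remainder of a division is
  again a member. Closure under A - C B is the one property of an ideal that this argument
  uses.\<close>

lemma poly_ideal_principal:
  fixes I :: "'k::field poly set"
  assumes I: "\<And>A B C. A \<in> I \<Longrightarrow> B \<in> I \<Longrightarrow> A - C * B \<in> I" and D: "D0 \<in> I" "D0 \<noteq> 0"
  shows "\<exists>D\<in>I. D \<noteq> 0 \<and> (\<forall>A\<in>I. D dvd A)"
proof -
  obtain D where D: "D \<in> I \<and> D \<noteq> 0" "\<And>A. A \<in> I \<and> A \<noteq> 0 \<Longrightarrow> degree D \<le> degree A"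
    using ex_has_least_nat[of "\<lambda>D. D \<in> I \<and> D \<noteq> 0" D0 degree] assms by blast
  have "D dvd A" if "A \<in> I" for A
  proof (rule ccontr)
    assume "\<not> D dvd A"
    then have nz: "A mod D \<noteq> 0" by (simp add: dvd_eq_mod_eq_0)
    have "A mod D = A - (A div D) * D" by (simp add: minus_div_mult_eq_mod)
    then have "A mod D \<in> I" using I[OF that] D(1) by simp
    then show False using D nz degree_mod_less[of D A] by fastforce
  qed
  then show ?thesis using D(1) by blast
qed

text \<open>The functions vanishing on the complement of an open subset of the affine line form an ideal, generated by \<open>f\<close>.\<close>

lemma open_affine_line:
  fixes W :: "'k::field mpoly set set"
  assumes W: "openin (tspace (Spec (polyring 1))) W"
  shows "\<exists>F. W = DD 1 (pe F (var 0))"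
proof -
  have v: "var 0 \<in> PR (1::nat)" by simp
  obtain E :: "'k mpoly set" where E: "E \<subseteq> PR 1" "W = {P. primeideal P (polyring 1) \<and> \<not> E \<subseteq> P}"
    using W poly.openin_zariski[of 1 W] by auto
  \<comment> \<open>If \<open>E\<close> contains no non-zero polynomial, then \<open>W\<close> is
    empty and is the basic open set of 0. Otherwise the ideal of polynomials vanishing on the
    complement has the non-zero member that division needs.\<close>
  show ?thesis
  proof (cases "E \<subseteq> {0}")
    case True
    then have "E \<subseteq> P" if "primeideal P (polyring 1)" for P using prime_zero[OF that] by auto
    moreover have "0 \<in> P" if "primeideal P (polyring 1)" for P :: "'k mpoly set" using prime_zero[OF that] .
    ultimately have "W = DD 1 (pe 0 (var 0))" unfolding E(2) by (intro Set.set_eqI) (simp only: mem_Collect_eq DD_iff pe_0 cong: conj_cong)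
    then show ?thesis by blast
  next
    case False
    let ?I = "{F. \<forall>P. primeideal P (polyring 1) \<longrightarrow> E \<subseteq> P \<longrightarrow> pe F (var 0) \<in> P}"
    obtain e where e: "e \<in> E" "e \<noteq> 0" using False by blast
    obtain D0 where D0: "e = pe D0 (var 0)" using PR_1_pe e(1) E(1) by blast
    have EI: "F \<in> ?I" if "pe F (var 0) \<in> E" for F using that by blast
    have "\<exists>D\<in>?I. D \<noteq> 0 \<and> (\<forall>A\<in>?I. D dvd A)"
    proof (rule poly_ideal_principal)
      fix A B C assume AB: "A \<in> ?I" "B \<in> ?I"
      have "pe (A - C * B) (var 0) \<in> P" if P: "primeideal P (polyring 1)" "E \<subseteq> P" for P
      proof -
        have "pe C (var 0) * pe B (var 0) \<in> P"
          using prime_mult_iff[OF P(1) pe_PR[OF v, of C] pe_PR[OF v, of B]] AB(2) P by blast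
        moreover have "pe A (var 0) \<in> P" using AB(1) P by blast
        moreover have "pe (A - C * B) (var 0) = pe A (var 0) - pe C (var 0) * pe B (var 0)"
          using pe_add[of "A - C * B" "C * B" "var 0"] by (simp add: pe_mult)
        ultimately show ?thesis using prime_diff[OF P(1)] by simp
      qed
      then show "A - C * B \<in> ?I" by blast
    next
      show "D0 \<in> ?I" using EI e(1) D0 by simp
      show "D0 \<noteq> 0" using e(2) D0 by auto
    qed
    then obtain D where D: "D \<in> ?I" "\<And>A. A \<in> ?I \<Longrightarrow> D dvd A" by blast
    have "\<not> E \<subseteq> P \<longleftrightarrow> pe D (var 0) \<notin> P" if P: "primeideal P (polyring 1)" for P
    proof -
      have "E \<subseteq> P" if d: "pe D (var 0) \<in> P"
      proof
        fix x assume x: "x \<in> E"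
        then obtain A where A: "x = pe A (var 0)" using PR_1_pe E(1) by blast
        then have "D dvd A" using D(2) EI x by simp
        then obtain B where "A = D * B" by (rule dvdE)
        then show "x \<in> P" unfolding A using prime_mult_iff[OF P pe_PR[OF v, of D] pe_PR[OF v, of B]] d by (simp add: pe_mult)
      qed
      then show ?thesis using D(1) P by blast
    qed
    then have "W = DD 1 (pe D (var 0))" unfolding E(2) by (intro Set.set_eqI) (simp only: mem_Collect_eq DD_iff cong: conj_cong)
    then show ?thesis by blast
  qed
qed

text \<open>Removing common factors with \<open>F\<close> from \<open>G\<close> does not change the intersection of the two basic open sets.\<close>

lemma coprime_part:
  fixes F G :: "'k::field poly"
  assumes "F \<noteq> 0" "G \<noteq> 0"
  obtains H A B where "H \<noteq> 0" "A * F + B * H = 1" "DD 1 (pe F (var 0)) \<inter> DD 1 (pe H (var 0)) \<subseteq> DD 1 (pe G (var 0))"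
proof -
  have v: "var 0 \<in> PR (1::nat)" by simp
  let ?S = "\<lambda>H. H \<noteq> 0 \<and> DD 1 (pe F (var 0)) \<inter> DD 1 (pe H (var 0)) \<subseteq> DD 1 (pe G (var 0))"
  \<comment> \<open>Least degree replaces the repeated removal of common factors. If
    \<open>D\<close> is a common divisor of \<open>F\<close> and \<open>H\<close>, then
    \<open>D\<close> is invertible wherever \<open>F\<close> is, so \<open>H\<close> divided by
    \<open>D\<close> is again admissible; minimality makes \<open>D\<close> constant.\<close>
  obtain H where H: "?S H" "\<And>H'. ?S H' \<Longrightarrow> degree H \<le> degree H'"
    using ex_has_least_nat[of ?S G degree] assms(2) by blast
  let ?I = "{A * F + B * H | A B. True}"
  have "\<exists>D\<in>?I. D \<noteq> 0 \<and> (\<forall>A\<in>?I. D dvd A)"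
  proof (rule poly_ideal_principal)
    fix X Y C assume "X \<in> ?I" "Y \<in> ?I"
    then obtain A B A' B' where "X = A * F + B * H" "Y = A' * F + B' * H" by blast
    then have "X - C * Y = (A - C * A') * F + (B - C * B') * H" by (simp add: algebra_simps)
    then show "X - C * Y \<in> ?I" by blast
  next
    have "F = 1 * F + 0 * H" by simp
    then show "F \<in> ?I" by blast
  qed (rule assms(1))
  then obtain D A B where D: "D = A * F + B * H" "D \<noteq> 0" "\<And>X. X \<in> ?I \<Longrightarrow> D dvd X" by blast
  have "F = 1 * F + 0 * H" "H = 0 * F + 1 * H" by simp_all
  then have "D dvd F" "D dvd H" using D(3) by blast+
  then obtain F' H' where FH: "F = D * F'" "H = D * H'" by (auto elim!: dvdE)
  have "?S H'"
  proof
    show "H' \<noteq> 0" using H(1) FH by auto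
    have "DD 1 (pe F (var 0)) = DD 1 (pe D (var 0)) \<inter> DD 1 (pe F' (var 0))" "DD 1 (pe H (var 0)) = DD 1 (pe D (var 0)) \<inter> DD 1 (pe H' (var 0))"
      unfolding FH pe_mult by (rule DD_mult[OF pe_PR[OF v] pe_PR[OF v]])+
    then show "DD 1 (pe F (var 0)) \<inter> DD 1 (pe H' (var 0)) \<subseteq> DD 1 (pe G (var 0))" using H(1) by blast
  qed
  then have "degree H \<le> degree H'" by (rule H(2))
  then have "degree D = 0" using FH(2) H(1) D(2) by (auto simp: degree_mult_eq)
  then obtain d where d: "D = [:d:]" "d \<noteq> 0" using D(2) by (metis degree_eq_zeroE pCons_0_0)
  have "smult (inverse d) A * F + smult (inverse d) B * H = smult (inverse d) D" unfolding D(1) by (simp add: smult_add_right)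
  also have "\<dots> = 1" using d by (simp add: one_pCons)
  finally have "smult (inverse d) A * F + smult (inverse d) B * H = 1" .
  then show thesis using H(1) by (intro that[of H "smult (inverse d) A" "smult (inverse d) B"]) blast+
qed

section \<open>Degrees in the fibre coordinate\<close>

definition low :: "nat \<Rightarrow> nat \<Rightarrow> 'k::field mpoly set" where
  "low n d = {(\<Sum>i<d. k i * var n ^ i) | k. \<forall>i<d. k i \<in> PR n}"

lemma low_add: "p \<in> low n d \<Longrightarrow> q \<in> low n d \<Longrightarrow> p + q \<in> low n d"
proof -
  assume "p \<in> low n d" "q \<in> low n d"
  then obtain k l where "\<forall>i<d. k i \<in> PR n" "\<forall>i<d. l i \<in> PR n" "p = (\<Sum>i<d. k i * var n ^ i)" "q = (\<Sum>i<d. l i * var n ^ i)"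
    unfolding low_def by blast
  then have "p + q = (\<Sum>i<d. (k i + l i) * var n ^ i)" "\<forall>i<d. k i + l i \<in> PR n"
    by (simp_all add: sum.distrib distrib_right)
  then show ?thesis unfolding low_def by (intro CollectI exI[of _ "\<lambda>i. k i + l i"]) simp
qed

lemma low_scale: "c \<in> PR n \<Longrightarrow> p \<in> low n d \<Longrightarrow> c * p \<in> low n d"
proof -
  assume c: "c \<in> PR n" and "p \<in> low n d"
  then obtain k where "\<forall>i<d. k i \<in> PR n" "p = (\<Sum>i<d. k i * var n ^ i)" unfolding low_def by blast
  then show ?thesis unfolding low_def using c
    by (intro CollectI exI[of _ "\<lambda>i. c * k i"]) (simp add: sum_distrib_left mult.assoc)
qed

lemma low_Suc: "p \<in> low n d \<Longrightarrow> c \<in> PR n \<Longrightarrow> c * var n ^ d + p \<in> low n (Suc d)"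
proof -
  assume "p \<in> low n d" and c: "c \<in> PR n"
  then obtain k where k: "\<forall>i<d. k i \<in> PR n" "p = (\<Sum>i<d. k i * var n ^ i)" unfolding low_def by blast
  let ?k = "\<lambda>i. if i < d then k i else c"
  have "(\<Sum>i<Suc d. ?k i * var n ^ i) = c * var n ^ d + p" unfolding k(2) by (simp add: add.commute)
  then show ?thesis unfolding low_def using k(1) c by (intro CollectI exI[of _ ?k]) simp
qed

lemma low_mono: "d \<le> e \<Longrightarrow> low n d \<subseteq> low n e"
proof (induction rule: dec_induct)
  case (step e)
  have "p \<in> low n (Suc e)" if "p \<in> low n e" for p using low_Suc[OF that, of 0] by simp
  then show ?case using step by blast
qed simp

lemma low_var: "p \<in> low n d \<Longrightarrow> var n * p \<in> low n (Suc d)"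
proof -
  assume "p \<in> low n d"
  then obtain k where k: "\<forall>i<d. k i \<in> PR n" "p = (\<Sum>i<d. k i * var n ^ i)" unfolding low_def by blast
  let ?k = "\<lambda>i. case i of 0 \<Rightarrow> 0 | Suc j \<Rightarrow> k j"
  have "(\<Sum>i<Suc d. ?k i * var n ^ i) = var n * p"
    unfolding k(2) sum.lessThan_Suc_shift by (simp add: sum_distrib_left mult.left_commute)
  then show ?thesis unfolding low_def using k(1) by (intro CollectI exI[of _ ?k]) (auto split: nat.split)
qed

lemma low_0: "0 \<in> low n d"
  unfolding low_def by (intro CollectI exI[of _ "\<lambda>_. 0"]) simp

definition tdeg :: "nat \<Rightarrow> nat \<Rightarrow> 'k::field \<Rightarrow> 'k mpoly \<Rightarrow> bool" where
  "tdeg n d a K \<longleftrightarrow> K - cst a * var n ^ d \<in> low n d"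

lemma tdeg_low: "tdeg n d a K \<Longrightarrow> K \<in> low n (Suc d)"
  unfolding tdeg_def using low_Suc[of "K - cst a * var n ^ d" n d "cst a"] by simp

lemma tdeg_var: "tdeg n d a K \<Longrightarrow> tdeg n (Suc d) a (var n * K)"
  unfolding tdeg_def using low_var[of "K - cst a * var n ^ d" n d] by (simp add: algebra_simps)

lemma tdeg_add: "tdeg n d a K \<Longrightarrow> p \<in> low n d \<Longrightarrow> tdeg n d a (K + p)"
  unfolding tdeg_def using low_add[of "K - cst a * var n ^ d" n d p] by (simp add: algebra_simps)

lemma mlike_tdeg:
  assumes "tdeg n d a K" "a \<noteq> 0" "0 < d" shows "mlike n K"
proof -
  obtain k where k: "\<forall>i<d. k i \<in> PR n" "K - cst a * var n ^ d = (\<Sum>i<d. k i * var n ^ i)"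
    using assms(1) unfolding tdeg_def low_def by blast
  have "K = cst a * var n ^ d + (\<Sum>i<d. k i * var n ^ i)" unfolding k(2)[symmetric] by simp
  then show ?thesis unfolding mlike_def using assms(2,3) k(1) by (intro exI[of _ a] exI[of _ d] exI[of _ k] conjI)
qed

text \<open>Replacing the variable by x + t leaves the leading term in t unchanged: in the Horner
  step the multiple by t raises the degree, while the multiple by x and the constant remain below
  it.\<close>

lemma tdeg_pe:
  assumes x: "x \<in> PR n" and F: "F \<noteq> 0"
  shows "tdeg n (degree F) (lead_coeff F) (pe F (x + var n))"
  using F
proof (induction F)
  case (pCons a F)
  show ?case
  proof (cases "F = 0")
    case True
    then show ?thesis by (simp add: tdeg_def low_0)
  next
    case False
    note IH = pCons(2)[OF False]
    have "x * pe F (x + var n) \<in> low n (Suc (degree F))" by (rule low_scale[OF x tdeg_low[OF IH]])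
    moreover have "cst a \<in> low n (Suc (degree F))"
      using low_Suc[OF low_0, of "cst a" n 0] low_mono[of 1 "Suc (degree F)" n] by auto
    ultimately have "tdeg n (Suc (degree F)) (lead_coeff F) (var n * pe F (x + var n) + (x * pe F (x + var n) + cst a))"
      by (intro tdeg_add tdeg_var[OF IH] low_add)
    then show ?thesis using False by (simp add: algebra_simps)
  qed
qed simp

section \<open>Linear correspondences\<close>

lemma fr_class_Fr: "explicit_corr n X Y t \<Longrightarrow> fr_class n X Y t \<in> Fr n X Y"
  unfolding Fr_def by blast

context
  fixes n :: nat and X Y :: "'k::field sch"
begin

abbreviation "FG \<equiv> free_Abelian_group (Fr n X Y)"

lemma additivity_carrier: "additivity_rel n X Y \<subseteq> carrier FG"
proof
  fix x assume "x \<in> additivity_rel n X Y"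
  then obtain t Z Z' where x: "x = frag_of (fr_class n X Y t) - frag_of (fr_class n X Y (cut_support Y t Z Z')) - frag_of (fr_class n X Y (cut_support Y t Z' Z))"
    "explicit_corr n X Y t" "explicit_corr n X Y (cut_support Y t Z Z')" "explicit_corr n X Y (cut_support Y t Z' Z)"
    unfolding additivity_rel_def by blast
  have "Poly_Mapping.keys x \<subseteq> {fr_class n X Y t, fr_class n X Y (cut_support Y t Z Z'), fr_class n X Y (cut_support Y t Z' Z)}"
    unfolding x(1) by (rule order_trans[OF keys_diff]) (use keys_diff in fastforce)
  then show "x \<in> carrier FG" using fr_class_Fr[OF x(2)] fr_class_Fr[OF x(3)] fr_class_Fr[OF x(4)] by auto
qed

lemma ZF_rel_subgroup: "subgroup (ZF_rel n X Y) FG"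
  unfolding ZF_rel_def by (rule group.generate_is_subgroup[OF group_free_Abelian_group additivity_carrier])

lemma ZF_comm_group: "comm_group (ZF n X Y)"
  unfolding ZF_def by (rule comm_group.abelian_FactGroup[OF abelian_free_Abelian_group ZF_rel_subgroup])

lemma zf_class_hom: "zf_class n X Y \<in> hom FG (ZF n X Y)"
proof -
  have "ZF_rel n X Y \<lhd> FG" using comm_group.normal_iff_subgroup[OF abelian_free_Abelian_group] ZF_rel_subgroup by blast
  from normal.r_coset_hom_Mod[OF this] show ?thesis unfolding ZF_def zf_class_def[abs_def] .
qed

lemma zf_class_closed: "x \<in> carrier FG \<Longrightarrow> zf_class n X Y x \<in> carrier (ZF n X Y)"
  by (rule hom_in_carrier[OF zf_class_hom])

lemma zf_class_add: "x \<in> carrier FG \<Longrightarrow> y \<in> carrier FG \<Longrightarrow> zf_class n X Y (x + y) = zf_class n X Y x \<otimes>\<^bsub>ZF n X Y\<^esub> zf_class n X Y y"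
  using hom_mult[OF zf_class_hom] by simp

lemma zf_class_diff:
  assumes "x \<in> carrier FG" "y \<in> carrier FG"
  shows "zf_class n X Y (x - y) = zf_class n X Y x \<otimes>\<^bsub>ZF n X Y\<^esub> inv\<^bsub>ZF n X Y\<^esub> zf_class n X Y y"
proof -
  interpret Z: comm_group "ZF n X Y" by (rule ZF_comm_group)
  have xy: "x - y \<in> carrier FG" using assms keys_diff[of x y] by auto
  have "zf_class n X Y (x - y) \<otimes>\<^bsub>ZF n X Y\<^esub> zf_class n X Y y = zf_class n X Y x"
    using zf_class_add[OF xy assms(2)] by simp
  then show ?thesis using Z.inv_solve_right[of "zf_class n X Y (x - y)" "zf_class n X Y x" "zf_class n X Y y"] zf_class_closed assms xy by simp
qed

lemma zf_class_cut:
  assumes t: "explicit_corr n X Y t" "explicit_corr n X Y (cut_support Y t Z Z')" "explicit_corr n X Y (cut_support Y t Z' Z)"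
    and Z: "closedin (tspace (aff t)) Z" "closedin (tspace (aff t)) Z'" "Z \<inter> Z' = {}" "supp t = Z \<union> Z'"
  shows "zf_class n X Y (frag_of (fr_class n X Y t)) =
    zf_class n X Y (frag_of (fr_class n X Y (cut_support Y t Z Z'))) \<otimes>\<^bsub>ZF n X Y\<^esub> zf_class n X Y (frag_of (fr_class n X Y (cut_support Y t Z' Z)))"
proof -
  interpret Z: comm_group "ZF n X Y" by (rule ZF_comm_group)
  let ?a = "frag_of (fr_class n X Y t)" and ?b = "frag_of (fr_class n X Y (cut_support Y t Z Z'))" and ?c = "frag_of (fr_class n X Y (cut_support Y t Z' Z))"
  have "?a - ?b - ?c \<in> additivity_rel n X Y" unfolding additivity_rel_def using t Z by blast
  then have r: "?a - ?b - ?c \<in> ZF_rel n X Y" unfolding ZF_rel_def by (rule generate.incl)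
  have c: "?a \<in> carrier FG" "?b \<in> carrier FG" "?c \<in> carrier FG" using fr_class_Fr t by simp_all
  have rc: "?a - ?b - ?c \<in> carrier FG" by (rule subgroup.mem_carrier[OF ZF_rel_subgroup r])
  have bc: "?b + ?c \<in> carrier FG" using c keys_add[of ?b ?c] by auto
  have "zf_class n X Y (?a - ?b - ?c) = \<one>\<^bsub>ZF n X Y\<^esub>"
    unfolding zf_class_def ZF_def one_FactGroup by (rule group.coset_join2[OF group_free_Abelian_group rc ZF_rel_subgroup r])
  moreover have "zf_class n X Y ?a = zf_class n X Y (?a - ?b - ?c) \<otimes>\<^bsub>ZF n X Y\<^esub> zf_class n X Y (?b + ?c)"
    using zf_class_add[OF rc bc] by simp
  ultimately show ?thesis using zf_class_add[OF c(2,3)] zf_class_closed[OF bc] by simp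
qed

end

text \<open>The relation does not say where \<open>\<epsilon>\<close> lies, but each composite class
  comes with an explicit representative, so the defining sum is in the free group. Hence the
  generators of \<open>homotopy_rel\<close> are elements of \<open>ZF\<close>.\<close>

lemma zf_comp_closed:
  assumes "zf_comp m n X Y W \<beta> \<alpha> \<epsilon>" shows "\<epsilon> \<in> carrier (ZF (n + m) X W)"
proof -
  obtain y x E where E: "\<forall>b \<in> Poly_Mapping.keys y. \<forall>a \<in> Poly_Mapping.keys x. fr_comp m n X Y W b a (E b a)"
    "\<epsilon> = zf_class (n + m) X W (frag_extend (\<lambda>b. frag_extend (\<lambda>a. frag_of (E b a)) x) y)"
    using assms unfolding zf_comp_def by (elim exE conjE)
  have "E b a \<in> Fr (n + m) X W" if "b \<in> Poly_Mapping.keys y" "a \<in> Poly_Mapping.keys x" for a b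
  proof -
    have "fr_comp m n X Y W b a (E b a)" using E(1) that by blast
    then obtain t'' where t: "explicit_corr (n + m) X W t''" "E b a = fr_class (n + m) X W t''"
      unfolding fr_comp_def by (elim exE conjE)
    show ?thesis unfolding t(2) by (rule fr_class_Fr[OF t(1)])
  qed
  then have "Poly_Mapping.keys (frag_extend (\<lambda>a. frag_of (E b a)) x) \<subseteq> Fr (n + m) X W" if "b \<in> Poly_Mapping.keys y" for b
    by (intro order_trans[OF keys_frag_extend]) (use that in auto)
  then have "Poly_Mapping.keys (frag_extend (\<lambda>b. frag_extend (\<lambda>a. frag_of (E b a)) x) y) \<subseteq> Fr (n + m) X W"
    by (intro order_trans[OF keys_frag_extend]) auto
  then show ?thesis unfolding E(2) by (intro zf_class_closed) simp
qed

lemma homotopy_rel_subgroup: "subgroup (homotopy_rel n X Y) (ZF n X Y)"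
proof -
  interpret Z: comm_group "ZF n X Y" by (rule ZF_comm_group)
  show ?thesis unfolding homotopy_rel_def
  proof (rule Z.generate_is_subgroup, rule subsetI, elim CollectE exE conjE)
    fix u d0 d1 Q \<pi> c i0 i1 e
    assume "u = d0 \<otimes>\<^bsub>ZF n X Y\<^esub> inv\<^bsub>ZF n X Y\<^esub> d1"
      "zf_comp n 0 X Q Y e (zf_morphism X Q i0) d0" "zf_comp n 0 X Q Y e (zf_morphism X Q i1) d1"
    then show "u \<in> carrier (ZF n X Y)" using zf_comp_closed[of n 0 X Q Y] by simp
  qed
qed

text \<open>A single correspondence over the product with the line is a homotopy between its two
  restrictions. On basis elements the bilinear extension of composition reduces to one
  composite.\<close>

lemma homotopy_relI:
  assumes "is_affine_space X Q \<pi> [c]" "is_const_section X Q \<pi> c 0 i0" "is_const_section X Q \<pi> c 1 i1"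
    and T: "explicit_corr n Q Y T"
    and t: "fr_comp n 0 X Q Y (fr_class n Q Y T) (fr_class 0 X Q (graph_corr X i0)) a0"
      "fr_comp n 0 X Q Y (fr_class n Q Y T) (fr_class 0 X Q (graph_corr X i1)) a1"
    and i: "explicit_corr 0 X Q (graph_corr X i0)" "explicit_corr 0 X Q (graph_corr X i1)"
  shows "zf_class n X Y (frag_of a0) \<otimes>\<^bsub>ZF n X Y\<^esub> inv\<^bsub>ZF n X Y\<^esub> zf_class n X Y (frag_of a1) \<in> homotopy_rel n X Y"
proof -
  have "zf_comp n 0 X Q Y (zf_class n Q Y (frag_of (fr_class n Q Y T))) (zf_morphism X Q j) (zf_class n X Y (frag_of a))"
    if "fr_comp n 0 X Q Y (fr_class n Q Y T) (fr_class 0 X Q (graph_corr X j)) a" "explicit_corr 0 X Q (graph_corr X j)" for j a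
    unfolding zf_comp_def zf_morphism_def
    by (rule exI[of _ "frag_of (fr_class n Q Y T)"], rule exI[of _ "frag_of (fr_class 0 X Q (graph_corr X j))"], rule exI[of _ "\<lambda>_ _. a"])
      (use that fr_class_Fr[OF T] fr_class_Fr[OF that(2)] in simp)
  note z = this[OF t(1) i(1)] this[OF t(2) i(2)]
  have c: "zf_class n Q Y (frag_of (fr_class n Q Y T)) \<in> carrier (ZF n Q Y)"
    by (rule zf_class_closed) (use fr_class_Fr[OF T] in simp)
  show ?thesis
    unfolding homotopy_rel_def
    by (intro generate.incl CollectI exI conjI, rule refl, rule assms(1), rule assms(2), rule assms(3), rule c, rule z(1), rule z(2))
qed

lemma zfbar_class_eqI:
  assumes "a \<in> carrier (ZF n X Y)" "b \<in> carrier (ZF n X Y)" "a \<otimes>\<^bsub>ZF n X Y\<^esub> inv\<^bsub>ZF n X Y\<^esub> b \<in> homotopy_rel n X Y"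
  shows "zfbar_class n X Y a = zfbar_class n X Y b"
proof -
  interpret Z: comm_group "ZF n X Y" by (rule ZF_comm_group)
  note s = homotopy_rel_subgroup[of n X Y]
  have "homotopy_rel n X Y #>\<^bsub>ZF n X Y\<^esub> (a \<otimes>\<^bsub>ZF n X Y\<^esub> inv\<^bsub>ZF n X Y\<^esub> b) = homotopy_rel n X Y"
    by (rule Z.coset_join2[OF _ s assms(3)]) (use assms in simp)
  then show ?thesis unfolding zfbar_class_def by (rule Z.coset_mult_inv1[OF _ assms(1,2) subgroup.subset[OF s]])
qed

section \<open>The correspondences\<close>

lemma targ_morphism:
  assumes u: "u \<in> PR m" and y: "y \<in> PR m" and E: "\<And>P. P \<in> DD m u \<Longrightarrow> pe E y \<notin> P"
  shows "morphism (Aff m (DD m u)) (Aff 1 (DD 1 (pe E (var 0)))) (sm m (DD m u) 1 (\<lambda>_. y))"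
proof (rule sm_DD[OF DD_open[OF u] y])
  show "pe E (var 0) \<in> PR 1" by (rule pe_PR) simp
  show "ev (polyring m) (\<lambda>_. y) (pe E (var 0)) \<notin> P" if "P \<in> DD m u" for P
    using E[OF that] by (simp add: ev_pe[where q = "\<lambda>_. y", OF y] pev_var[where q = "\<lambda>_. y", OF y])
qed

text \<open>To be read with \<open>a\<close> the class of \<open>c1\<close>, \<open>b\<close> of
  \<open>cb'\<close>, \<open>s\<close> of \<open>s0\<close> and \<open>u\<close> of \<sigma>. The
  class of \<open>c0\<close> is b + s; the relation from \<open>c0\<close> to \<open>c1\<close>,
  reversed, plus the relation from \<open>s0\<close> to \<sigma> leaves a - b - u.\<close>

lemma (in comm_group) homotopy_cancel:
  assumes "a \<in> carrier G" "b \<in> carrier G" "s \<in> carrier G" "u \<in> carrier G"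
  shows "inv ((b \<otimes> s) \<otimes> inv a) \<otimes> (s \<otimes> inv u) = a \<otimes> inv b \<otimes> inv u"
proof -
  have "inv ((b \<otimes> s) \<otimes> inv a) = a \<otimes> inv b \<otimes> inv s"
    using assms by (simp add: inv_mult_group m_ac)
  moreover have "inv s \<otimes> (s \<otimes> inv u) = inv u"
    using assms by (simp add: m_assoc[symmetric])
  ultimately show ?thesis using assms by (simp add: m_assoc)
qed

declare One_nat_def [simp del]

locale coprime_pair =
  fixes F G A B :: "'k::field poly"
  assumes F0: "F \<noteq> 0" and G0: "G \<noteq> 0" and bezout: "A * F + B * G = 1"
begin

definition f :: "'k mpoly" where "f = pe F (var 0)"
text \<open>The argument \<open>n\<close> is the index of the fibre coordinate: 1 over U, and 2 over
  the product of U with the line, where \<open>var 1\<close> is the homotopy parameter.\<close>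

definition y :: "nat \<Rightarrow> 'k mpoly" where "y n = var 0 + var n"
definition fy :: "nat \<Rightarrow> 'k mpoly" where "fy n = pe F (y n)"
definition gy :: "nat \<Rightarrow> 'k mpoly" where "gy n = pe G (y n)"

text \<open>\<open>L = g (1 + y f)\<close> has no common zero with \<open>f\<close>, vanishes where \<open>g\<close> does, and has larger degree than \<open>f\<close>.\<close>

definition L :: "'k poly" where "L = G * pCons 1 F"
definition ly :: "nat \<Rightarrow> 'k mpoly" where "ly n = pe L (y n)"

text \<open>The cofactor of the fibre coordinate in \<open>H\<theta>\<close> at parameter 0. It is
  f(x) where the fibre coordinate vanishes.\<close>

definition K :: "nat \<Rightarrow> 'k mpoly" where "K n = fy n + var n * ly n"
definition H1 :: "nat \<Rightarrow> 'k mpoly" where "H1 n = var n * (var n * ly n) + fy n"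
definition H\<theta> :: "'k mpoly" where "H\<theta> = var 2 * (var 2 * ly 2) + (var 2 * (1 - var 1) + var 1) * fy 2"
text \<open>Data of the second homotopy: as the parameter runs from 0 to 1, the target
  \<open>y'\<close> moves from x + t to x and the framing t C from t K to t f(x). Modulo t one has
  y' = x and C = f(x) at every parameter, so t = 0 stays apart from the zeros of f(y') and of
  C.\<close>

definition y' :: "'k mpoly" where "y' = var 0 + (1 - var 1) * var 2"
definition C :: "'k mpoly" where "C = var 1 * f + (1 - var 1) * K 2"

lemma f_PR: "0 < n \<Longrightarrow> f \<in> PR n"
  unfolding f_def by (rule pe_PR) simp

lemma y_PR: "0 < n \<Longrightarrow> y n \<in> PR (Suc n)" and fy_PR: "0 < n \<Longrightarrow> fy n \<in> PR (Suc n)"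
  and gy_PR: "0 < n \<Longrightarrow> gy n \<in> PR (Suc n)" and ly_PR: "0 < n \<Longrightarrow> ly n \<in> PR (Suc n)"
  unfolding y_def fy_def gy_def ly_def by (simp_all add: pe_PR)

lemma K_PR: "0 < n \<Longrightarrow> K n \<in> PR (Suc n)" and H1_PR: "0 < n \<Longrightarrow> H1 n \<in> PR (Suc n)"
  unfolding K_def H1_def by (simp_all add: fy_PR ly_PR)

lemma PR_3: "f \<in> PR 3" "y' \<in> PR 3" "C \<in> PR 3" "H\<theta> \<in> PR 3" "fy 2 \<in> PR 3" "y 2 \<in> PR 3" "K 2 \<in> PR 3" "pe F y' \<in> PR 3"
proof -
  show *: "f \<in> PR 3" "fy 2 \<in> PR 3" "y 2 \<in> PR 3" "K 2 \<in> PR 3"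
    using f_PR[of 3] fy_PR[of 2] y_PR[of 2] K_PR[of 2] by simp_all
  show "y' \<in> PR 3" unfolding y'_def by simp
  then show "pe F y' \<in> PR 3" by (rule pe_PR)
  show "C \<in> PR 3" unfolding C_def using * by simp
  show "H\<theta> \<in> PR 3" unfolding H\<theta>_def using * ly_PR[of 2] by simp
qed

lemma ly_eq: "ly n = gy n * (1 + y n * fy n)"
  unfolding ly_def gy_def fy_def L_def pe_mult pe_pCons by simp

section \<open>Degrees in the fibre coordinate and finiteness of the supports\<close>

lemma L0: "L \<noteq> 0" and L_degree: "degree F < degree L"
  unfolding L_def using F0 G0 by (auto simp: degree_mult_eq simp del: mult_pCons_right)

lemma ly_tdeg: "0 < n \<Longrightarrow> tdeg n (degree L) (lead_coeff L) (ly n)"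
  unfolding ly_def y_def by (rule tdeg_pe[OF _ L0]) simp

text \<open>The factor 1 + y f in L makes deg L exceed deg f, even when g is constant. Adding
  multiples of f(y) of small degree therefore cannot affect the leading term of t L(y).\<close>

lemma fy_low: "0 < n \<Longrightarrow> fy n \<in> low n (degree L)"
proof -
  assume "0 < n"
  then have "fy n \<in> low n (Suc (degree F))" unfolding fy_def y_def by (intro tdeg_low[OF tdeg_pe[OF _ F0]]) simp
  then show ?thesis using low_mono[of "Suc (degree F)" "degree L" n] L_degree by auto
qed

lemma mlike_K: "0 < n \<Longrightarrow> mlike n (K n)"
proof -
  assume n: "0 < n"
  have "fy n \<in> low n (Suc (degree L))" using fy_low[OF n] low_mono[of "degree L" "Suc (degree L)" n] by auto
  then have "tdeg n (Suc (degree L)) (lead_coeff L) (K n)"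
    unfolding K_def add.commute[of "fy n"] by (rule tdeg_add[OF tdeg_var[OF ly_tdeg[OF n]]])
  then show ?thesis by (rule mlike_tdeg) (use L0 in simp_all)
qed

lemma mlike_var: "mlike n (var n)"
  by (rule mlike_tdeg[of n 1 1]) (simp_all add: tdeg_def low_0)

lemma mlike_H1: "0 < n \<Longrightarrow> mlike n (H1 n)"
proof -
  assume n: "0 < n"
  have "fy n \<in> low n (Suc (Suc (degree L)))" using fy_low[OF n] low_mono[of "degree L" "Suc (Suc (degree L))" n] by auto
  then have "tdeg n (Suc (Suc (degree L))) (lead_coeff L) (H1 n)"
    unfolding H1_def by (rule tdeg_add[OF tdeg_var[OF tdeg_var[OF ly_tdeg[OF n]]]])
  then show ?thesis by (rule mlike_tdeg) (use L0 in simp_all)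
qed

text \<open>The parameter occurs only in t (1 - \<theta>) f(y) and \<theta> f(y), of degree at most
  deg L in t, while t^2 L(y) has degree deg L + 2 with the scalar leading coefficient of L.\<close>

lemma mlike_H\<theta>: "mlike 2 H\<theta>"
proof -
  have f: "fy 2 \<in> low 2 (degree L)" by (rule fy_low) simp
  have "(1 - var 1) * (var 2 * fy 2) \<in> low 2 (Suc (degree L))" by (rule low_scale[OF _ low_var[OF f]]) simp
  moreover have "var 1 * fy 2 \<in> low 2 (Suc (degree L))"
    using low_scale[OF _ f, of "var 1"] low_mono[of "degree L" "Suc (degree L)" 2] by auto
  ultimately have "(1 - var 1) * (var 2 * fy 2) + var 1 * fy 2 \<in> low 2 (Suc (degree L))" by (rule low_add)
  then have "(1 - var 1) * (var 2 * fy 2) + var 1 * fy 2 \<in> low 2 (Suc (Suc (degree L)))"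
    using low_mono[of "Suc (degree L)" "Suc (Suc (degree L))" 2] by auto
  then have "tdeg 2 (Suc (Suc (degree L))) (lead_coeff L) (var 2 * (var 2 * ly 2) + ((1 - var 1) * (var 2 * fy 2) + var 1 * fy 2))"
    by (rule tdeg_add[OF tdeg_var[OF tdeg_var[OF ly_tdeg]], rotated]) simp
  moreover have "var 2 * (var 2 * ly 2) + ((1 - var 1) * (var 2 * fy 2) + var 1 * fy 2) = H\<theta>" unfolding H\<theta>_def by (simp add: algebra_simps)
  ultimately have "tdeg 2 (Suc (Suc (degree L))) (lead_coeff L) H\<theta>" by simp
  then show ?thesis by (rule mlike_tdeg) (use L0 in simp_all)
qed

section \<open>Common zeros at primes where f is invertible\<close>

context
  fixes n :: nat and P :: "'k mpoly set"
  assumes n: "0 < n" and P: "primeideal P (polyring (Suc n))" "f \<notin> P"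
begin

private lemma PR: "fy n \<in> PR (Suc n)" "gy n \<in> PR (Suc n)" "ly n \<in> PR (Suc n)" "y n \<in> PR (Suc n)" "K n \<in> PR (Suc n)" "f \<in> PR (Suc n)"
  using fy_PR gy_PR ly_PR y_PR K_PR f_PR n by simp_all

text \<open>Modulo the fibre coordinate y is x, and f(x) is outside \<open>P\<close>.\<close>

lemma var_fy: "var n \<in> P \<Longrightarrow> fy n \<notin> P"
proof -
  assume t: "var n \<in> P"
  have "y n - var 0 = var n" by (simp add: y_def)
  then have "pe F (y n) \<in> P \<longleftrightarrow> pe F (var 0) \<in> P" using t PR(4) by (intro pe_cong[OF P(1)]) simp_all
  then show ?thesis using P(2) unfolding fy_def f_def by simp
qed

text \<open>The Bezout identity of the locale, evaluated at y, writes 1 as a combination of f(y) and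
  g(y).\<close>

lemma fy_gy: "fy n \<in> P \<Longrightarrow> gy n \<notin> P"
proof
  assume fg: "fy n \<in> P" "gy n \<in> P"
  have c: "pe A (y n) \<in> PR (Suc n)" "pe B (y n) \<in> PR (Suc n)" using pe_PR[OF PR(4)] by simp_all
  have "pe A (y n) * fy n + pe B (y n) * gy n \<in> P"
    using prime_mult_iff[OF P(1) c(1) PR(1)] prime_mult_iff[OF P(1) c(2) PR(2)] fg by (intro prime_add[OF P(1)]) simp_all
  moreover have "pe A (y n) * fy n + pe B (y n) * gy n = 1"
    unfolding fy_def gy_def pe_mult[symmetric] pe_add[symmetric] bezout by simp
  ultimately show False using prime_one[OF P(1)] by simp
qed

text \<open>A zero of L(y) is a zero of g(y) or of 1 + y f(y). Where f(y) = 0, the former is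
  excluded by coprimality and the latter is 1.\<close>

lemma ly_fy: "ly n \<in> P \<Longrightarrow> fy n \<notin> P"
proof
  assume l: "ly n \<in> P" and f: "fy n \<in> P"
  then have "1 + y n * fy n \<in> P"
    using prime_mult_iff[OF P(1) PR(2), of "1 + y n * fy n"] PR fy_gy[OF f] unfolding ly_eq by simp
  moreover have "y n * fy n \<in> P" using prime_mult_iff[OF P(1) PR(4,1)] f by simp
  ultimately show False using prime_add_iff[OF P(1), of "y n * fy n" 1] prime_one[OF P(1)] by (simp add: add.commute)
qed

lemma gy_ly: "gy n \<in> P \<Longrightarrow> ly n \<in> P"
  using prime_mult_iff[OF P(1) PR(2), of "1 + y n * fy n"] PR unfolding ly_eq by simp

lemma vl: "var n * ly n \<in> P \<longleftrightarrow> var n \<in> P \<or> ly n \<in> P"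
  by (rule prime_mult_iff[OF P(1) _ PR(3)]) simp

text \<open>Where f(y) = 0, a zero of K is a zero of t L(y); \<open>var_fy\<close> excludes t = 0
  and \<open>ly_fy\<close> excludes L(y) = 0. With \<open>K_ly\<close> it gives all that is needed
  on the zeros of K.\<close>

lemma K_fy: "K n \<in> P \<Longrightarrow> fy n \<notin> P"
  using prime_add_iff[OF P(1), of "fy n" "var n * ly n"] vl ly_fy var_fy unfolding K_def by blast

lemma K_ly: "K n \<in> P \<Longrightarrow> var n \<notin> P \<and> ly n \<notin> P"
  using prime_add_iff[OF P(1), of "var n * ly n" "fy n"] vl K_fy unfolding K_def by (auto simp: add.commute)

lemma K_gy: "K n \<in> P \<Longrightarrow> gy n \<notin> P"
  using gy_ly K_ly by blast

lemma H1_fy: "H1 n \<in> P \<Longrightarrow> fy n \<notin> P"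
  using prime_add_iff[OF P(1), of "fy n" "var n * (var n * ly n)"] prime_mult_iff[OF P(1), of "var n" "var n * ly n"] vl ly_fy var_fy PR(3)
  unfolding H1_def by (auto simp: add.commute)

text \<open>Where g(y) = 0, also L(y) = 0, and the value of \<open>H1\<close> is f(y), which cannot
  vanish at a zero of \<open>H1\<close>.\<close>

lemma H1_gy: "H1 n \<in> P \<Longrightarrow> gy n \<notin> P"
  using prime_add_iff[OF P(1), of "var n * (var n * ly n)" "fy n"] prime_mult_iff[OF P(1), of "var n" "var n * ly n"] vl gy_ly H1_fy PR(3)
  unfolding H1_def by auto

lemma K_var: "var n \<in> P \<Longrightarrow> K n \<notin> P"
  using K_ly by blast

end

lemma H\<theta>_fy:
  assumes P: "primeideal P (polyring 3)" "f \<notin> P" and H: "H\<theta> \<in> P" shows "fy 2 \<notin> P"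
proof
  assume f: "fy 2 \<in> P"
  have P': "primeideal P (polyring (Suc 2))" using P(1) by simp
  note ly = ly_PR[of 2, simplified]
  have "(var 2 * (1 - var 1) + var 1) * fy 2 \<in> P"
    using prime_mult_iff[OF P(1), of "var 2 * (1 - var 1) + var 1" "fy 2"] PR_3 f by simp
  then have "var 2 * (var 2 * ly 2) \<in> P"
    using prime_add_iff[OF P(1), of "(var 2 * (1 - var 1) + var 1) * fy 2" "var 2 * (var 2 * ly 2)"] H unfolding H\<theta>_def by (simp add: add.commute)
  then have "var 2 \<in> P \<or> ly 2 \<in> P"
    using prime_mult_iff[OF P(1), of "var 2" "var 2 * ly 2"] prime_mult_iff[OF P(1), of "var 2" "ly 2"] ly by auto
  then show False using var_fy[OF _ P' P(2)] ly_fy[OF _ P' P(2)] f by auto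
qed

section \<open>Admissibility of the polynomial data\<close>

lemma ok_a: "std_ok 1 f (H1 1) (fy 1 * gy 1) (H1 1) (y 1)"
  unfolding std_ok_def using f_PR[of 1] mlike_H1[of 1] fy_PR[of 1] gy_PR[of 1] H1_PR[of 1] y_PR[of 1] H1_fy[of 1] H1_gy[of 1]
  by (simp add: prime_mult_iff[OF _ fy_PR[of 1] gy_PR[of 1]] del: One_nat_def)

text \<open>Besides f(y) g(y) = 0, which has to be removed for the target to be V, the locus t = 0
  is removed, because the framing t K vanishes there in addition to the support K = 0.\<close>

lemma ok_b: "std_ok 1 f (K 1) (fy 1 * (gy 1 * var 1)) (var 1 * K 1) (y 1)"
  unfolding std_ok_def using f_PR[of 1] mlike_K[of 1] fy_PR[of 1] gy_PR[of 1] K_PR[of 1] y_PR[of 1] K_fy[of 1] K_gy[of 1] K_ly[of 1]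
  by (simp add: prime_mult_iff[where m = "Suc 1"] del: One_nat_def)

text \<open>The same correspondence with the larger neighbourhood that arises over U, when the zero
  set t = 0 is cut off from t K.\<close>

lemma ok_b': "std_ok 1 f (K 1) (fy 1 * var 1) (var 1 * K 1) (y 1)"
  unfolding std_ok_def using f_PR[of 1] mlike_K[of 1] fy_PR[of 1] K_PR[of 1] y_PR[of 1] K_fy[of 1] K_ly[of 1]
  by (simp add: prime_mult_iff[where m = "Suc 1"] del: One_nat_def)

lemma ok_\<theta>: "std_ok (Suc 1) f H\<theta> (fy 2) H\<theta> (y 2)"
  unfolding std_ok_def Suc_1 using PR_3 f_PR[of 2] mlike_H\<theta> H\<theta>_fy by simp

text \<open>The support is t = 0. The removed set consists of the other zeros C = 0 of the framing
  and of f(y') = 0, where y' would leave U; both are disjoint from t = 0 since f(y') and C reduce to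
  f(x) modulo t.\<close>

lemma ok_2: "std_ok (Suc 1) f (var 2) (pe F y' * C) (var 2 * C) y'"
proof -
  have "(var 2 \<in> P \<longrightarrow> pe F y' * C \<notin> P) \<and> (pe F y' * C \<notin> P \<longrightarrow> (var 2 * C \<in> P) = (var 2 \<in> P))"
    if P: "primeideal P (polyring 3)" "f \<notin> P" for P
  proof -
    note pm = prime_mult_iff[OF P(1)]
    have c: "pe F y' * C \<in> P \<longleftrightarrow> pe F y' \<in> P \<or> C \<in> P" by (rule pm) (use PR_3 in simp_all)
    moreover have "pe F y' \<notin> P" "C \<notin> P" if t: "var 2 \<in> P"
    proof -
      have "y' - var 0 \<in> P" using pm[of "1 - var 1" "var 2"] t unfolding y'_def by simp
      then have "pe F y' \<in> P \<longleftrightarrow> pe F (var 0) \<in> P" using PR_3 by (intro pe_cong[OF P(1)]) simp_all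
      then show "pe F y' \<notin> P" using P(2) by (simp add: f_def)
      have "y 2 - var 0 = var 2" by (simp add: y_def)
      then have fd: "fy 2 - f \<in> P" unfolding fy_def f_def using t PR_3 by (intro pe_diff[OF P(1)]) simp_all
      note ly = ly_PR[of 2, simplified]
      have "var 2 * ly 2 \<in> P" using pm[of "var 2" "ly 2"] t ly by simp
      then have "(1 - var 1) * (fy 2 - f + var 2 * ly 2) \<in> P"
        using pm[of "1 - var 1" "fy 2 - f + var 2 * ly 2"] prime_add[OF P(1) fd] PR_3 ly by simp
      from prime_add_iff[OF P(1) this, of f] have "(1 - var 1) * (fy 2 - f + var 2 * ly 2) + f \<notin> P" using P(2) by simp
      moreover have "C = (1 - var 1) * (fy 2 - f + var 2 * ly 2) + f" unfolding C_def K_def by (simp add: algebra_simps)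
      ultimately show "C \<notin> P" by simp
    qed
    moreover have "var 2 * C \<in> P \<longleftrightarrow> var 2 \<in> P \<or> C \<in> P" by (rule pm) (use PR_3 in simp_all)
    ultimately show ?thesis by blast
  qed
  then show ?thesis unfolding std_ok_def Suc_1 using PR_3 f_PR[of 2] mlike_var[of 2] by simp
qed

section \<open>Specialization at the ends of the two homotopies\<close>

lemmas subst_2 = subst_simps[where n = 1, unfolded Suc_1]

lemma subst_var: "csub 1 c 0 = var 0" "csub 1 c 1 = cst c" "csub 1 c 2 = var 1"
  by (simp_all add: csub_def)

lemma subst_f: "ev (polyring 2) (csub 1 c) f = f"
  using subst_base[OF f_PR[of 1], of c] unfolding Suc_1 by simp

lemma subst_pe: "ev (polyring 2) (csub 1 c) (pe E z) = pe E (ev (polyring 2) (csub 1 c) z)"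
  by (rule ev_pe[OF csub_PR[of 1, unfolded Suc_1]])

lemma subst_y: "ev (polyring 2) (csub 1 c) (y 2) = y 1" "ev (polyring 2) (csub 1 c) (fy 2) = fy 1" "ev (polyring 2) (csub 1 c) (ly 2) = ly 1"
  unfolding y_def fy_def ly_def subst_pe subst_2 subst_var by simp_all

lemma subst_K: "ev (polyring 2) (csub 1 c) (K 2) = K 1"
  unfolding K_def subst_2 subst_var subst_y ..

lemma subst_H\<theta>: "ev (polyring 2) (csub 1 0) H\<theta> = var 1 * K 1" "ev (polyring 2) (csub 1 1) H\<theta> = H1 1"
  unfolding H\<theta>_def K_def H1_def subst_2 subst_var subst_y by (simp_all add: algebra_simps)

lemma subst_C: "ev (polyring 2) (csub 1 0) C = K 1" "ev (polyring 2) (csub 1 1) C = f"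
    "ev (polyring 2) (csub 1 0) y' = y 1" "ev (polyring 2) (csub 1 1) y' = var 0"
  unfolding C_def y'_def subst_2 subst_var subst_K subst_f by (simp_all add: y_def)

abbreviation "X \<equiv> Aff 1 (DD 1 f)"
abbreviation "Q \<equiv> Aff 2 (DD 2 f)"

lemma target_X:
  assumes "w \<in> PR (Suc n)" "z \<in> PR (Suc n)" and "\<And>P. primeideal P (polyring (Suc n)) \<Longrightarrow> w \<notin> P \<Longrightarrow> pe F z \<notin> P"
  shows "morphism (Aff (Suc n) (DD (Suc n) (f * w))) X (sm (Suc n) (DD (Suc n) (f * w)) 1 (\<lambda>_. z))"
proof -
  have f: "f \<in> PR (Suc n)" by (rule f_PR) simp
  show ?thesis unfolding f_def[of]
    by (rule targ_morphism) (use assms f in \<open>simp_all add: f_def[symmetric] DD_mult\<close>, simp add: DD_iff)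
qed


text \<open>Each relation comes from one standard correspondence over \<open>Q\<close>, with data
  \<open>ok_\<theta>\<close> and \<open>ok_2\<close> respectively; its ends, together with their
  explicitness, are produced by substituting 0 and 1 in \<open>stdc_fr_comp\<close>.\<close>

lemma homotopies:
  shows "explicit_corr 1 X X (stdc 1 f (var 1 * K 1) (fy 1) (var 1 * K 1) (y 1))"
    and "explicit_corr 1 X X (stdc 1 f (H1 1) (fy 1) (H1 1) (y 1))"
    and "explicit_corr 1 X X (stdc 1 f (var 1) (fy 1 * K 1) (var 1 * K 1) (y 1))"
    and "explicit_corr 1 X X (stdc 1 f (var 1) (f * f) (var 1 * f) (var 0))"
    and "zf_class 1 X X (frag_of (fr_class 1 X X (stdc 1 f (var 1 * K 1) (fy 1) (var 1 * K 1) (y 1)))) \<otimes>\<^bsub>ZF 1 X X\<^esub>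
      inv\<^bsub>ZF 1 X X\<^esub> zf_class 1 X X (frag_of (fr_class 1 X X (stdc 1 f (H1 1) (fy 1) (H1 1) (y 1)))) \<in> homotopy_rel 1 X X"
    and "zf_class 1 X X (frag_of (fr_class 1 X X (stdc 1 f (var 1) (fy 1 * K 1) (var 1 * K 1) (y 1)))) \<otimes>\<^bsub>ZF 1 X X\<^esub>
      inv\<^bsub>ZF 1 X X\<^esub> zf_class 1 X X (frag_of (fr_class 1 X X (stdc 1 f (var 1) (f * f) (var 1 * f) (var 0)))) \<in> homotopy_rel 1 X X"
proof -
  have f1: "f \<in> PR 1" by (rule f_PR) simp
  note oX = DD_open[OF f1]
  have m\<theta>: "morphism (Aff (Suc (Suc 1)) (DD (Suc (Suc 1)) (f * fy 2))) X (sm (Suc (Suc 1)) (DD (Suc (Suc 1)) (f * fy 2)) 1 (\<lambda>_. y 2))"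
    by (rule target_X) (use PR_3 in \<open>simp_all add: fy_def\<close>)
  have m2: "morphism (Aff (Suc (Suc 1)) (DD (Suc (Suc 1)) (f * (pe F y' * C)))) X (sm (Suc (Suc 1)) (DD (Suc (Suc 1)) (f * (pe F y' * C))) 1 (\<lambda>_. y'))"
  proof (rule target_X)
    fix P :: "'k mpoly set" assume "primeideal P (polyring (Suc (Suc 1)))" "pe F y' * C \<notin> P"
    then show "pe F y' \<notin> P" using prime_mult_iff[of P "Suc (Suc 1)" "pe F y'" C] PR_3 by simp
  qed (use PR_3 in simp_all)
  have g: "explicit_corr 0 X Q (graph_corr X (csec 1 f c))" for c
    using explicit_graph_corr[OF kscheme_Aff[OF oX] Aff_lreduced[OF oX] csec_morphism[OF f1, of c]] unfolding Suc_1 .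
  note hr = homotopy_relI[OF affine_space_Aff[OF f1] const_section[OF f1, of 0] const_section[OF f1, of 1], unfolded Suc_1, OF _ _ _ g g]
  note c = stdc_fr_comp[OF ok_\<theta> f1 m\<theta> oX, unfolded Suc_1]
  note c0 = c[of 0, unfolded subst_H\<theta> subst_y] and c1 = c[of 1, unfolded subst_H\<theta> subst_y]
  show "explicit_corr 1 X X (stdc 1 f (var 1 * K 1) (fy 1) (var 1 * K 1) (y 1))" "explicit_corr 1 X X (stdc 1 f (H1 1) (fy 1) (H1 1) (y 1))"
    by (rule c0(1), rule c1(1))
  show "zf_class 1 X X (frag_of (fr_class 1 X X (stdc 1 f (var 1 * K 1) (fy 1) (var 1 * K 1) (y 1)))) \<otimes>\<^bsub>ZF 1 X X\<^esub>
      inv\<^bsub>ZF 1 X X\<^esub> zf_class 1 X X (frag_of (fr_class 1 X X (stdc 1 f (H1 1) (fy 1) (H1 1) (y 1)))) \<in> homotopy_rel 1 X X"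
    by (rule hr[OF stdc_explicit[OF ok_\<theta> m\<theta>, unfolded Suc_1] c0(2) c1(2)])
  note d = stdc_fr_comp[OF ok_2 f1 m2 oX, unfolded Suc_1 subst_2 subst_pe subst_var]
  note d0 = d[of 0, unfolded subst_C fy_def[symmetric]] and d1 = d[of 1, unfolded subst_C f_def[symmetric]]
  show "explicit_corr 1 X X (stdc 1 f (var 1) (fy 1 * K 1) (var 1 * K 1) (y 1))" "explicit_corr 1 X X (stdc 1 f (var 1) (f * f) (var 1 * f) (var 0))"
    by (rule d0(1), rule d1(1))
  show "zf_class 1 X X (frag_of (fr_class 1 X X (stdc 1 f (var 1) (fy 1 * K 1) (var 1 * K 1) (y 1)))) \<otimes>\<^bsub>ZF 1 X X\<^esub>
      inv\<^bsub>ZF 1 X X\<^esub> zf_class 1 X X (frag_of (fr_class 1 X X (stdc 1 f (var 1) (f * f) (var 1 * f) (var 0)))) \<in> homotopy_rel 1 X X"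
    by (rule hr[OF stdc_explicit[OF ok_2 m2, unfolded Suc_1] d0(2) d1(2)])
qed

text \<open>The removed polynomial \<open>f * f\<close> is what f(y') C becomes at parameter 1. It
  is invertible on U, so the neighbourhood is the full relative line, as in the model of
  \<sigma>.\<close>

lemma sigma_class: "zf_sigma X = zf_class 1 X X (frag_of (fr_class 1 X X (stdc 1 f (var 1) (f * f) (var 1 * f) (var 0))))"
proof -
  have f: "f \<in> PR 1" "f \<in> PR 2" using f_PR[of 1] f_PR[of 2] by simp_all
  have "DD 2 (f * (f * f)) = DD 2 f" using f by (simp add: DD_mult)
  from sigma_stdc[OF f(1) this] show ?thesis unfolding zf_sigma_def sigma_eq[OF f(1)] Suc_1 by simp
qed

section \<open>Correspondences into V and their images over U\<close>

context
  fixes V :: "'k mpoly set set"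
  assumes V: "openin (tspace (Spec (polyring 1))) V" "V \<subseteq> DD 1 f" "DD 1 f \<inter> DD 1 (pe G (var 0)) \<subseteq> V"
begin

abbreviation "XV \<equiv> Aff 1 V"
abbreviation "ca \<equiv> stdc 1 f (H1 1) (fy 1 * gy 1) (H1 1) (y 1)"
abbreviation "cb \<equiv> stdc 1 f (K 1) (fy 1 * (gy 1 * var 1)) (var 1 * K 1) (y 1)"
abbreviation "cb' \<equiv> stdc 1 f (K 1) (fy 1 * var 1) (var 1 * K 1) (y 1)"
abbreviation "c0 \<equiv> stdc 1 f (var 1 * K 1) (fy 1) (var 1 * K 1) (y 1)"
abbreviation "c1 \<equiv> stdc 1 f (H1 1) (fy 1) (H1 1) (y 1)"
abbreviation "s0 \<equiv> stdc 1 f (var 1) (fy 1 * K 1) (var 1 * K 1) (y 1)"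

private lemma PR2: "f \<in> PR 2" "fy 1 \<in> PR 2" "gy 1 \<in> PR 2" "K 1 \<in> PR 2" "H1 1 \<in> PR 2" "y 1 \<in> PR 2"
  using f_PR[of 2] fy_PR[of 1] gy_PR[of 1] K_PR[of 1] H1_PR[of 1] y_PR[of 1] by simp_all

text \<open>Where the removed polynomial \<open>w\<close> is invertible, f(y) g(y) is invertible, so
  y lands in the intersection of the basic open sets of f and g, which lies in V.\<close>

lemma target_V:
  assumes w: "w \<in> PR 2" and "\<And>P. primeideal P (polyring 2) \<Longrightarrow> w \<notin> P \<Longrightarrow> fy 1 \<notin> P \<and> gy 1 \<notin> P"
  shows "morphism (Aff 2 (DD 2 (f * w))) XV (sm 2 (DD 2 (f * w)) 1 (\<lambda>_. y 1))"
proof -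
  have v: "var 0 \<in> PR (1::nat)" by simp
  have u: "f * w \<in> PR 2" using PR2 w by simp
  have p: "pe (F * G) (y 1) \<notin> P" if P: "P \<in> DD 2 (f * w)" for P
  proof -
    have pr: "primeideal P (polyring 2)" "w \<notin> P" using P w PR2 by (simp_all add: DD_mult) (simp_all add: DD_iff)
    have "pe (F * G) (y 1) = fy 1 * gy 1" by (simp add: pe_mult fy_def gy_def)
    then show ?thesis using prime_mult_iff[OF pr(1), of "fy 1" "gy 1"] PR2 assms(2)[OF pr] by simp
  qed
  note m = targ_morphism[OF u PR2(6) p]
  have o: "pe (F * G) (var 0) \<in> PR 1" by (rule pe_PR[OF v])
  have "DD 1 (pe (F * G) (var 0)) \<subseteq> V"
    using V(3) unfolding pe_mult DD_mult[OF pe_PR[OF v] pe_PR[OF v]] f_def .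
  then show ?thesis using m unfolding mor_Aff_iff[OF V(1)] mor_Aff_iff[OF DD_open[OF o]] by blast
qed

lemma explicit_V: "explicit_corr 1 X XV ca" "explicit_corr 1 X XV cb"
proof -
  note pm = prime_mult_iff[where m = 2]
  have "morphism (Aff 2 (DD 2 (f * (fy 1 * gy 1)))) XV (sm 2 (DD 2 (f * (fy 1 * gy 1))) 1 (\<lambda>_. y 1))"
    by (rule target_V) (use PR2 in \<open>simp_all add: pm\<close>)
  then show "explicit_corr 1 X XV ca" by (intro stdc_explicit[OF ok_a, unfolded Suc_1])
  have "morphism (Aff 2 (DD 2 (f * (fy 1 * (gy 1 * var 1))))) XV (sm 2 (DD 2 (f * (fy 1 * (gy 1 * var 1)))) 1 (\<lambda>_. y 1))"
    by (rule target_V) (use PR2 in \<open>simp_all add: pm\<close>)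
  then show "explicit_corr 1 X XV cb" by (intro stdc_explicit[OF ok_b, unfolded Suc_1])
qed

lemma X_open_sub: "open_sub X V = XV"
  by (rule open_sub_Aff[OF V(2)])

lemma X_facts: "locally_ringed X" "openin (tspace X) V" "kscheme X" "kscheme XV" "lreduced XV" "pts X = DD 1 f"
proof -
  note oX = DD_open[OF f_PR[of 1, OF zero_less_one]]
  show "locally_ringed X" "openin (tspace X) V" "kscheme X" "kscheme XV" "lreduced XV" "pts X = DD 1 f"
    by (rule Aff_lr[OF oX], rule openin_Aff[OF oX V(1,2)], rule kscheme_Aff[OF oX], rule kscheme_Aff[OF V(1)], rule Aff_lreduced[OF V(1)], rule Aff_pts[OF oX])
qed

lemma explicit_X: "explicit_corr 1 X XV t \<Longrightarrow> explicit_corr 1 X X t"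
  using explicit_corr_open_sub[OF X_facts(1,2)] unfolding X_open_sub .

lemma class_X:
  assumes "fr_class 1 X XV s = fr_class 1 X XV t" shows "fr_class 1 X X s = fr_class 1 X X t"
  using fr_equiv_open_sub[OF X_facts(1,2), of 1 X] assms unfolding X_open_sub fr_class_eq_iff by blast

text \<open>By \<open>graph_composite\<close>, a standard correspondence into V composes with the
  inclusion to itself; the data stay the same and only the target changes to U.\<close>

lemma fr_comp_incl:
  assumes ok: "std_ok 1 f M w H z" and t: "explicit_corr 1 X XV (stdc 1 f M w H z)"
  shows "fr_comp 0 1 X XV X (fr_class 0 XV X (graph_corr XV (id_mor XV))) (fr_class 1 X XV (stdc 1 f M w H z)) (fr_class 1 X X (stdc 1 f M w H z))"
proof -
  let ?t = "stdc 1 f M w H z"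
  note o = okO[OF ok, unfolded Suc_1] and n = okN[OF ok, unfolded Suc_1]
  have i: "morphism XV X (id_mor XV)" using open_incl_morphism[OF X_facts(1,2)] unfolding X_open_sub .
  have co: "is_composite X XV X (graph_corr XV (id_mor XV)) ?t ?t"
  proof (rule graph_composite[OF X_facts(1,1,2), unfolded X_open_sub, OF t])
    show "kscheme (nbhd ?t)" "kscheme (aff ?t)" unfolding stdc_def fcorr.select_convs Suc_1 by (rule kscheme_Aff[OF o(2)], rule kscheme_Aff[OF o(1)])
    show "morphism (nbhd ?t) (aff ?t) (emap ?t)" unfolding stdc_def fcorr.select_convs Suc_1 by (rule Aff_sub_morphism[OF o(1,2) n(1)])
    show "supp ?t \<subseteq> fst (emap ?t) ` pts (nbhd ?t)"
      unfolding stdc_def fcorr.select_convs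
    proof
      fix p assume "p \<in> ZK 1 f M"
      then have p: "p \<in> pts (Aff (Suc 1) (DD (Suc 1) (f * w)))" using okN(2)[OF ok] unfolding Aff_pts[OF okO(2)[OF ok]] by blast
      show "p \<in> fst (id_mor (Aff (Suc 1) (DD (Suc 1) (f * w)))) ` pts (Aff (Suc 1) (DD (Suc 1) (f * w)))"
        by (rule image_eqI, rule id_mor_fst[OF p, symmetric], rule p)
    qed
  qed
  show ?thesis unfolding fr_comp_def
    by (rule exI[of _ "graph_corr XV (id_mor XV)"], rule exI[of _ ?t], rule exI[of _ ?t])
      (use co explicit_graph_corr[OF X_facts(4,5) i] t explicit_X[OF t] in simp)
qed

text \<open>Cutting t K at its two disjoint zero sets multiplies the removed polynomial f(y) by the
  equation of the other set. The piece at t = 0 thus has removed polynomial f(y) K, which is also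
  the value of f(y') C at parameter 0; so it is literally the start \<open>s0\<close> of the second
  homotopy.\<close>

lemma additivity:
  "zf_class 1 X X (frag_of (fr_class 1 X X c0)) =
     zf_class 1 X X (frag_of (fr_class 1 X X cb')) \<otimes>\<^bsub>ZF 1 X X\<^esub> zf_class 1 X X (frag_of (fr_class 1 X X s0))"
  and explicit_b': "explicit_corr 1 X X cb'"
proof -
  have "morphism (Aff (Suc 1) (DD (Suc 1) (f * (fy 1 * var 1)))) X (sm (Suc 1) (DD (Suc 1) (f * (fy 1 * var 1))) 1 (\<lambda>_. y 1))"
    by (rule target_X) (use PR2 in \<open>simp_all add: prime_mult_iff[where m = 2] fy_def[symmetric] del: One_nat_def\<close>)
  then show b: "explicit_corr 1 X X cb'" by (rule stdc_explicit[OF ok_b'])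
  have m: "mlike 1 (var 1 * K 1)" using mlike_subst[of 1 H\<theta> 0] mlike_H\<theta> unfolding Suc_1 subst_H\<theta> by simp
  have "fy 1 \<notin> P" if "primeideal P (polyring 2)" "f \<notin> P" "var 1 * K 1 \<in> P" for P
    using that prime_mult_iff[OF that(1), of "var 1" "K 1"] PR2 K_fy[of 1 P] var_fy[of 1 P] by auto
  then have ok: "std_ok 1 f (var 1 * K 1) (fy 1) (var 1 * K 1) (y 1)"
    unfolding std_ok_def Suc_1 using f_PR[of 1] m PR2 by simp
  have cut: "cut_support X c0 (ZK 1 f (K 1)) (ZK 1 f (var 1)) = cb'" "cut_support X c0 (ZK 1 f (var 1)) (ZK 1 f (K 1)) = s0"
    by (rule stdc_cut[OF ok], use PR2 in simp)+
  have e: "explicit_corr 1 X X (cut_support X c0 (ZK 1 f (K 1)) (ZK 1 f (var 1)))" "explicit_corr 1 X X (cut_support X c0 (ZK 1 f (var 1)) (ZK 1 f (K 1)))"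
    unfolding cut by (rule b, rule homotopies(3))
  have "closedin (tspace (aff cb')) (supp cb')" "closedin (tspace (aff s0)) (supp s0)"
    using b homotopies(3) unfolding explicit_corr_def by blast+
  then have cl: "closedin (tspace (aff c0)) (ZK 1 f (K 1))" "closedin (tspace (aff c0)) (ZK 1 f (var 1))" unfolding stdc_def fcorr.select_convs .
  have dis: "ZK 1 f (K 1) \<inter> ZK 1 f (var 1) = {}"
  proof -
    have "K 1 \<notin> p" if "p \<in> DD 2 f" "var 1 \<in> p" for p
      using that K_var[of 1 p] by (simp add: DD_iff)
    then show ?thesis unfolding Suc_1 by blast
  qed
  have un: "supp c0 = ZK 1 f (K 1) \<union> ZK 1 f (var 1)"
  proof -
    have "var 1 * K 1 \<in> p \<longleftrightarrow> var 1 \<in> p \<or> K 1 \<in> p" if "p \<in> DD 2 f" for p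
      using that prime_mult_iff[of p 2 "var 1" "K 1"] PR2 by (simp add: DD_iff)
    then show ?thesis unfolding stdc_def fcorr.select_convs Suc_1 by blast
  qed
  show "zf_class 1 X X (frag_of (fr_class 1 X X c0)) =
     zf_class 1 X X (frag_of (fr_class 1 X X cb')) \<otimes>\<^bsub>ZF 1 X X\<^esub> zf_class 1 X X (frag_of (fr_class 1 X X s0))"
    using zf_class_cut[OF homotopies(1) e cl dis un] unfolding cut .
qed

text \<open>The correspondences into V differ from those over U only by the additional removal of
  g(y) = 0, a locus that their supports avoid. Over U this is a refinement of the
  neighbourhood.\<close>

lemma refinements: "fr_class 1 X X ca = fr_class 1 X X c1" "fr_class 1 X X cb = fr_class 1 X X cb'"
proof -
  have ok1: "std_ok 1 f (H1 1) (fy 1) (H1 1) (y 1)"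
    unfolding std_ok_def using f_PR[of 1] mlike_H1[of 1] fy_PR[of 1] H1_PR[of 1] y_PR[of 1] H1_fy[of 1] by (simp del: One_nat_def)
  have "Defs.refines X X ca c1"
    by (rule stdc_refines[OF ok1]) (use PR2 in \<open>simp_all add: DD_mult\<close>, blast)
  then show "fr_class 1 X X ca = fr_class 1 X X c1"
    by (intro fr_class_eqI refines_equiv explicit_X explicit_V homotopies)
  have "Defs.refines X X cb cb'"
    by (rule stdc_refines[OF ok_b']) (use PR2 in \<open>simp_all add: DD_mult\<close>, blast)
  then show "fr_class 1 X X cb = fr_class 1 X X cb'"
    by (intro fr_class_eqI refines_equiv explicit_X explicit_V explicit_b')
qed

lemma inverse_up_to_homotopy:
  "\<exists>r \<in> carrier (ZF 1 X XV). \<exists>e \<in> carrier (ZF 1 X X).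
     zf_comp 0 1 X XV X (zf_morphism XV X (id_mor XV)) r e \<and> zfbar_class 1 X X e = zfbar_class 1 X X (zf_sigma X)"
proof -
  let ?A = "fr_class 1 X XV ca" and ?B = "fr_class 1 X XV cb"
  let ?a = "fr_class 1 X X ca" and ?b = "fr_class 1 X X cb"
  let ?x = "frag_of ?A - frag_of ?B" and ?z = "\<lambda>t. zf_class 1 X X (frag_of (fr_class 1 X X t))"
  let ?e = "zf_class 1 X X (frag_of ?a - frag_of ?b)"
  interpret Z: comm_group "ZF 1 X X" by (rule ZF_comm_group)
  have x: "?x \<in> carrier (free_Abelian_group (Fr 1 X XV))"
    using keys_diff[of "frag_of ?A" "frag_of ?B"] fr_class_Fr[OF explicit_V(1)] fr_class_Fr[OF explicit_V(2)] by auto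
  have ab: "frag_of ?a \<in> carrier (free_Abelian_group (Fr 1 X X))" "frag_of ?b \<in> carrier (free_Abelian_group (Fr 1 X X))"
    using fr_class_Fr[OF explicit_X[OF explicit_V(1)]] fr_class_Fr[OF explicit_X[OF explicit_V(2)]] by simp_all
  have ec: "?e \<in> carrier (ZF 1 X X)"
    unfolding zf_class_diff[OF ab] by (intro Z.m_closed Z.inv_closed zf_class_closed ab)
  have i: "morphism XV X (id_mor XV)" using open_incl_morphism[OF X_facts(1,2)] unfolding X_open_sub .
  have comp: "zf_comp 0 1 X XV X (zf_morphism XV X (id_mor XV)) (zf_class 1 X XV ?x) ?e"
  proof -
    \<comment> \<open>The composite is chosen by cases on the class. Should the two classes coincide
      over V, then by \<open>class_X\<close> so do their images over U, and the case distinction is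
      consistent.\<close>
    let ?E = "\<lambda>_ c. if c = ?A then ?a else ?b" and ?y = "fr_class 0 XV X (graph_corr XV (id_mor XV))"
    have eb: "?E d ?B = ?b" for d using class_X[of ca cb] by auto
    have "fr_comp 0 1 X XV X ?y c (?E d c)" if "c \<in> Poly_Mapping.keys ?x" for c d
    proof -
      have "c = ?A \<or> c = ?B" using that keys_diff[of "frag_of ?A" "frag_of ?B"] by auto
      then show ?thesis using fr_comp_incl[OF ok_a explicit_V(1)] fr_comp_incl[OF ok_b explicit_V(2)] eb by auto
    qed
    moreover have "frag_extend (\<lambda>b. frag_extend (\<lambda>a. frag_of (?E b a)) ?x) (frag_of ?y) = frag_of ?a - frag_of ?b"
      unfolding frag_extend_of frag_extend_diff eb by simp
    moreover have "?y \<in> Fr 0 XV X" by (rule fr_class_Fr[OF explicit_graph_corr[OF X_facts(4,5) i]])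
    ultimately show ?thesis unfolding zf_comp_def zf_morphism_def
      by (intro exI[of _ "frag_of ?y"] exI[of _ ?x] exI[of _ ?E] conjI) (use x in simp_all)
  qed
  have "zfbar_class 1 X X ?e = zfbar_class 1 X X (zf_sigma X)"
  proof (rule zfbar_class_eqI[OF ec])
    let ?s = "stdc 1 f (var 1) (f * f) (var 1 * f) (var 0)"
    have c: "?z t \<in> carrier (ZF 1 X X)" if "explicit_corr 1 X X t" for t
      by (rule zf_class_closed) (use fr_class_Fr[OF that] in simp)
    note cc = c[OF homotopies(1)] c[OF homotopies(2)] c[OF homotopies(3)] c[OF homotopies(4)] c[OF explicit_b']
    show "zf_sigma X \<in> carrier (ZF 1 X X)" unfolding sigma_class by (rule cc(4))
    have e: "?e = ?z c1 \<otimes>\<^bsub>ZF 1 X X\<^esub> inv\<^bsub>ZF 1 X X\<^esub> ?z cb'"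
      using zf_class_diff[OF ab] unfolding refinements .
    let ?h1 = "?z c0 \<otimes>\<^bsub>ZF 1 X X\<^esub> inv\<^bsub>ZF 1 X X\<^esub> ?z c1" and ?h2 = "?z s0 \<otimes>\<^bsub>ZF 1 X X\<^esub> inv\<^bsub>ZF 1 X X\<^esub> ?z ?s"
    interpret S: subgroup "homotopy_rel 1 X X" "ZF 1 X X" by (rule homotopy_rel_subgroup)
    \<comment> \<open>The first homotopy is used backwards, from \<open>c1\<close> to
      \<open>c0\<close>; after splitting \<open>c0\<close> by additivity the class of
      \<open>s0\<close> cancels against the second homotopy.\<close>
    have "inv\<^bsub>ZF 1 X X\<^esub> ?h1 \<otimes>\<^bsub>ZF 1 X X\<^esub> ?h2 \<in> homotopy_rel 1 X X"
      by (intro S.m_closed S.m_inv_closed homotopies)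
    moreover have "inv\<^bsub>ZF 1 X X\<^esub> ?h1 \<otimes>\<^bsub>ZF 1 X X\<^esub> ?h2 = ?z c1 \<otimes>\<^bsub>ZF 1 X X\<^esub> inv\<^bsub>ZF 1 X X\<^esub> ?z cb' \<otimes>\<^bsub>ZF 1 X X\<^esub> inv\<^bsub>ZF 1 X X\<^esub> ?z ?s"
      unfolding additivity by (rule Z.homotopy_cancel[OF cc(2,5,3,4)])
    ultimately show "?e \<otimes>\<^bsub>ZF 1 X X\<^esub> inv\<^bsub>ZF 1 X X\<^esub> zf_sigma X \<in> homotopy_rel 1 X X" unfolding e sigma_class by simp
  qed
  then show ?thesis using comp ec zf_class_closed[OF x] by blast
qed

end

end

theorem theorem3p2:
  fixes U V :: "'k::field mpoly set set"
  assumes "openin (tspace (affine_line :: 'k sch)) U"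
    and "openin (tspace (open_sub (affine_line :: 'k sch) U)) V"
    and "V \<noteq> {}"
  defines "XU \<equiv> open_sub (affine_line :: 'k sch) U"
  defines "XV \<equiv> open_sub XU V"
  defines "i \<equiv> id_mor XV"
  shows "\<exists>r \<in> carrier (ZF 1 XU XV). \<exists>e \<in> carrier (ZF 1 XU XU).
           zf_comp 0 1 XU XV XU (zf_morphism XV XU i) r e \<and>
           zfbar_class 1 XU XU e = zfbar_class 1 XU XU (zf_sigma XU)"
proof -
  have U: "openin (tspace (Spec (polyring 1))) U" using assms(1) by (simp only: affine_line_def)
  have V: "openin (tspace (Spec (polyring 1))) V" "V \<subseteq> U"
    using assms(2) openin_open_subtopology[OF U] unfolding affine_line_def open_sub_simps by blast+
  obtain F where F: "U = DD 1 (pe F (var 0))" using open_affine_line[OF U] by blast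
  obtain G where G: "V = DD 1 (pe G (var 0))" using open_affine_line[OF V(1)] by blast
  \<comment> \<open>The basic open set of 0 is empty, so the equations of the non-empty sets U and V
    are non-zero.\<close>
  have "P \<notin> DD 1 (pe 0 (var 0))" for P :: "'k mpoly set" using prime_zero[of P 1] by (auto simp: DD_iff)
  then have z: "DD 1 (pe 0 (var 0)) = ({} :: 'k mpoly set set)" by blast
  have "U \<noteq> {}" "V \<noteq> {}" using assms(3) V(2) by blast+
  then have FG: "F \<noteq> 0" "G \<noteq> 0" unfolding F G using z by blast+
  obtain H A B where H: "H \<noteq> 0" "A * F + B * H = 1" "DD 1 (pe F (var 0)) \<inter> DD 1 (pe H (var 0)) \<subseteq> DD 1 (pe G (var 0))"
    by (rule coprime_part[OF FG])
  \<comment> \<open>The parameter \<open>G\<close> of the locale is instantiated with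
    \<open>H\<close>, the part of the equation of V that is prime to \<open>F\<close>, and not with
    the equation itself.\<close>
  interpret coprime_pair F H A B by unfold_locales (rule FG(1), rule H(1), rule H(2))
  have XU: "XU = X" unfolding XU_def affine_line_def F f_def ..
  have XV: "XV = Aff 1 V" unfolding XV_def XU by (rule open_sub_Aff) (use V(2) F f_def in simp)
  have "V \<subseteq> DD 1 f" "DD 1 f \<inter> DD 1 (pe H (var 0)) \<subseteq> V" using V(2) H(3) unfolding F G f_def by blast+
  from inverse_up_to_homotopy[OF V(1) this] show ?thesis unfolding i_def XV XU .
qed

end
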